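(* Let $n\ge 2$, $p>1$, and let $A$ satisfy: (i) $A\in C([0,+\infty))$; (ii) $\delta\le A\le L$ for positive constants $\delta,L$; (iii) $t\mapsto t^{p-1}A(t)$ is strictly increasing for $t>0$. Let $B_1$ be the open unit ball centered at the origin, let $f\in L^1_{loc}(\mathbb{R}^n\setminus B_1)$, and let $u\in C^1(\mathbb{R}^n\setminus B_1)$ be a bounded weak solution of $-\mathrm{div}(|\nabla u|^{p-2}A(|\nabla u|)\nabla u)=f$ in $\mathbb{R}^n\setminus \overline{B_1}$. Consider the decay condition $$(\mathrm{D})\qquad |f(x)|\le C_f|x|^{-(p+\epsilon)}\ \text{ for all } |x| \text{ sufficiently large, for some positive constants } C_f,\epsilon.$$ Then: (a) for $p>1$, the limit $\lim_{|x|\to\infty}u(x)$ exists provided $f$ satisfies (D). (In this case, if $u$ is assumed only bounded from above (respectively, from below) instead of bounded, then either $u$ converges at infinity or $\lim_{|x|\to+\infty}u(x)=-\infty$ (respectively, $+\infty$).) (b) for $1<p<n$, the limit of $u$ at infinity exists if $f\in L^r(\mathbb{R}^n\setminus B_1)$ for some $r<n/p$, and $f\in L^{\frac{n}{p-\theta}}(\mathbb{R}^n\setminus B_1)$ for some $\theta\in(0,1)$ with $$\lim_{R\to+\infty}R^{\theta}\,\|f\|_{L^{\frac{n}{p-\theta}}(\mathbb{R}^n\setminus B_R(0))}=0.$$ (c) for $p>n$, if $f$ satisfies (D), there are positive constants $C,\beta$ such that $\big|\lim_{|x|\to\infty}u-u(x)\big|<C|x|^{-\beta}$ for all $|x|$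 large. Moreover, for $p\ge n$ these results also hold for unbounded weak solutions $u\in C^1(\mathbb{R}^n\setminus B_1)$ provided $\lim_{|x|\to\infty}\frac{|u(x)|}{|x|^{\alpha}}=0$ with $\alpha=\frac{p-n}{p-1}$ if $p>n$, or $\lim_{|x|\to\infty}\frac{|u(x)|}{\log|x|}=0$ if $p=n$.
   Context: A function $u\in W^{1,p}_{loc}(\Omega)$ is a weak solution of $-\mathrm{div}(|\nabla u|^{p-2}A(|\nabla u|)\nabla u)=f$ in an open set $\Omega$ if $\int_\Omega |\nabla u|^{p-2}A(|\nabla u|)\nabla u\cdot\nabla\eta\,dx=\int_\Omega f\eta\,dx$ for all $\eta\in C_0^\infty(\Omega)$. $B_R(0)$ denotes the open ball of radius $R$ centered at the origin. *)

theory Defs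
  imports "HOL-Analysis.Analysis"
begin

fun Ck_on :: "nat \<Rightarrow> 'a::euclidean_space set \<Rightarrow> ('a \<Rightarrow> real) \<Rightarrow> bool" where
  "Ck_on 0 S g = continuous_on S g"
| "Ck_on (Suc k) S g =
     ((\<forall>x\<in>S. g differentiable (at x)) \<and>
      (\<forall>v. Ck_on k S (\<lambda>x. frechet_derivative g (at x) v)))"

definition smooth_on :: "'a::euclidean_space set \<Rightarrow> ('a \<Rightarrow> real) \<Rightarrow> bool" where
  "smooth_on S g \<longleftrightarrow> (\<forall>k. Ck_on k S g)"

definition tsupport :: "('a::euclidean_space \<Rightarrow> real) \<Rightarrow> 'a set" where
  "tsupport g = closure {x. g x \<noteq> 0}"

text \<open>Test functions C_0^infinity(Omega), extended by zero to the whole space.\<close>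
definition test_fun :: "'a::euclidean_space set \<Rightarrow> ('a \<Rightarrow> real) \<Rightarrow> bool" where
  "test_fun \<Omega> \<eta> \<longleftrightarrow> smooth_on UNIV \<eta> \<and> compact (tsupport \<eta>) \<and> tsupport \<eta> \<subseteq> \<Omega>"

definition grad :: "('a::euclidean_space \<Rightarrow> real) \<Rightarrow> 'a \<Rightarrow> 'a" where
  "grad g x = (\<Sum>b\<in>Basis. frechet_derivative g (at x) b *\<^sub>R b)"

definition C1_grad_on :: "'a::euclidean_space set \<Rightarrow> ('a \<Rightarrow> real) \<Rightarrow> ('a \<Rightarrow> 'a) \<Rightarrow> bool" where
  "C1_grad_on S u G \<longleftrightarrow> continuous_on S G \<and>
     (\<forall>x\<in>S. (u has_derivative (\<lambda>h. G x \<bullet> h)) (at x within S))"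

definition loc_integrable_on :: "'a::euclidean_space set \<Rightarrow> ('a \<Rightarrow> real) \<Rightarrow> bool" where
  "loc_integrable_on S f \<longleftrightarrow> (\<forall>K. compact K \<and> K \<subseteq> S \<longrightarrow> set_integrable lebesgue K f)"

text \<open>Weak solution of -div(|Du|^(p-2) A(|Du|) Du) = f in Omega, Du = G.
  (0 powr a = 0, so the flux vanishes where G vanishes.)\<close>
definition weak_solution ::
  "real \<Rightarrow> (real \<Rightarrow> real) \<Rightarrow> ('a::euclidean_space \<Rightarrow> 'a) \<Rightarrow> ('a \<Rightarrow> real) \<Rightarrow> 'a set \<Rightarrow> bool" where
  "weak_solution p A G f \<Omega> \<longleftrightarrow>
    (\<forall>\<eta>. test_fun \<Omega> \<eta> \<longrightarrow>
       integral\<^sup>L (lebesgue_on \<Omega>)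
          (\<lambda>x. (norm (G x) powr (p - 2) * A (norm (G x))) * (G x \<bullet> grad \<eta> x))
     = integral\<^sup>L (lebesgue_on \<Omega>) (\<lambda>x. f x * \<eta> x))"

definition Lp_on :: "real \<Rightarrow> 'a::euclidean_space set \<Rightarrow> ('a \<Rightarrow> real) \<Rightarrow> bool" where
  "Lp_on q S f \<longleftrightarrow> f \<in> borel_measurable (lebesgue_on S) \<and>
     integrable (lebesgue_on S) (\<lambda>x. \<bar>f x\<bar> powr q)"

definition Lp_norm_on :: "real \<Rightarrow> 'a::euclidean_space set \<Rightarrow> ('a \<Rightarrow> real) \<Rightarrow> real" where
  "Lp_norm_on q S f = (integral\<^sup>L (lebesgue_on S) (\<lambda>x. \<bar>f x\<bar> powr q)) powr (1 / q)"

definition decay_D :: "real \<Rightarrow> ('a::euclidean_space \<Rightarrow> real) \<Rightarrow> bool" where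
  "decay_D p f \<longleftrightarrow> (\<exists>Cf \<epsilon>. Cf > 0 \<and> \<epsilon> > 0 \<and>
     (\<exists>R. \<forall>x. norm x \<ge> R \<longrightarrow> \<bar>f x\<bar> \<le> Cf * norm x powr (-(p + \<epsilon>))))"

end

(* For a positive solution u with right-hand side f, testing the equation with zeta^p (u - k)_+^(p+1)
   and with zeta^p (u + kappa)^(1-p) gives De Giorgi's and Moser's estimates; the only Sobolev-type
   inequality needed is the Faber-Krahn inequality, which follows from
   int |w(x + h) - w(x)| dx <= |h| int |grad w| by averaging over h.  They yield the expansion of
   positivity, and maximizing u(x) (t - |x - x0|)^s over a ball turns it into a Harnack inequality
   on the spheres |x| = R, with an error term controlled by f that tends to 0 as R -> infinity.

   Let m = liminf u be finite.  Harnack's inequality for u - m + eps on spheres through points where u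
   is close to m shows that u <= m + C eps on a sequence of spheres, and a maximum principle on the
   annuli between them carries this over to all large x, so that u -> m.  Under the decay condition
   (D) the maximum principle comes from radial barriers v whose flux is
   (c |x|^(-n) + k |x|^(-q)) x; for p >= n the term with c > 0 absorbs unbounded solutions of small
   growth, and c -> 0.  In case (b) it comes from Stampacchia's level-set method with one exponent on
   either side of n/p.  For p > n the barrier controls u outside a sphere by its values on the
   sphere, so that Harnack's inequality makes the oscillation contract geometrically. *)
theory Submission
  imports Defs
begin

section \<open>Integral inequalities for compactly supported C^1 functions\<close>

subsection \<open>Compactly supported continuously differentiable functions\<close>

text \<open>As u is C^1 and truncations occur only with exponents above one, every test function is
  C^1 with a classical gradient, and the argument stays clear of Sobolev spaces; this is why (u -
  k)_+^(p+1) replaces the usual (u - k)_+. The interior estimates see the equation only through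
  growth and coercivity of the flux and through a bound B N |{\<eta> \<noteq> 0}|^e for the
  right-hand side tested with |\<eta>| \<le> B. At scale R its size is N R^\<gamma>, to be compared
  with u^(p-1); both (D) and the weighted norm condition imply that this tends to 0 when N is taken
  over |x| > R/3. The flux does not involve u and is odd, so constants may be added and signs
  reversed: Harnack's inequality applies to the distance of u from any one-sided bound. It controls
  u only on spheres that meet a point where u is small, and nothing bounds the gaps between such
  spheres; hence the maximum principle must have an error independent of the width of the annulus.
  Strict monotonicity of t^(p-1) A(t) enters through the comparison principle and the inversion of
  the radial flux.\<close>

definition C1c :: "'a::euclidean_space set \<Rightarrow> ('a \<Rightarrow> real) \<Rightarrow> ('a \<Rightarrow> 'a) \<Rightarrow> bool" where
  "C1c S \<eta> D \<longleftrightarrow> (\<exists>K. compact K \<and> K \<subseteq> S \<and> (\<forall>x. x \<notin> K \<longrightarrow> \<eta> x = 0)) \<and>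
     continuous_on UNIV D \<and> (\<forall>x. (\<eta> has_derivative (\<lambda>h. D x \<bullet> h)) (at x))"

lemma inner_has_derivative_unique:
  assumes "(w has_derivative (\<lambda>h. a \<bullet> h)) (at x)" "(w has_derivative (\<lambda>h. b \<bullet> h)) (at x)"
  shows "a = b"
proof -
  have "(\<lambda>h. a \<bullet> h) = (\<lambda>h. b \<bullet> h)"
    using has_derivative_unique assms by blast
  then show ?thesis
    by (metis inner_commute vector_eq_rdot fun_cong)
qed

lemma C1c_deriv_zero:
  assumes "C1c S w D" "compact K" "\<And>x. x \<notin> K \<Longrightarrow> w x = 0" "x \<notin> K"
  shows "D x = 0"
proof -
  have o: "open (-K)" using assms(2) by (simp add: compact_imp_closed open_Compl)
  have "(w has_derivative (\<lambda>h. 0 \<bullet> h)) (at x)"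
    by (rule has_derivative_transform_within_open[of "\<lambda>_. 0" _ _ UNIV "-K", OF _ o]) (use assms in auto)
  then show ?thesis
    using assms(1) inner_has_derivative_unique unfolding C1c_def by blast
qed

lemma C1c_continuous:
  assumes "C1c S w D" shows "continuous_on UNIV w" "continuous_on UNIV D"
  using assms unfolding C1c_def
  by (auto intro!: continuous_at_imp_continuous_on has_derivative_continuous)

lemma C1c_mono: "C1c S w D \<Longrightarrow> S \<subseteq> T \<Longrightarrow> C1c T w D"
  unfolding C1c_def by blast

text \<open>The solution is controlled only on \<open>S\<close>, so test functions built from it are
  set to 0 outside. Where \<open>w\<close> vanishes, on \<open>S - K\<close>, its gradient vanishes
  as well; both extensions are therefore 0 on the open set \<open>-K\<close>, which together with
  \<open>S\<close> covers the space.\<close>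

lemma C1c_glue:
  assumes S: "open S" and K: "compact K" "K \<subseteq> S"
    and z: "\<And>x. x \<in> S \<Longrightarrow> x \<notin> K \<Longrightarrow> w x = 0"
    and d: "\<And>x. x \<in> S \<Longrightarrow> (w has_derivative (\<lambda>h. D x \<bullet> h)) (at x)"
    and c: "continuous_on S D"
  shows "C1c S (\<lambda>x. if x \<in> S then w x else 0) (\<lambda>x. if x \<in> S then D x else 0)"
    (is "C1c S ?w ?D")
proof -
  have oK: "open (-K)" using K by (simp add: compact_imp_closed open_Compl)
  have D0: "D x = 0" if "x \<in> S" "x \<notin> K" for x
  proof -
    have "(w has_derivative (\<lambda>h. 0 \<bullet> h)) (at x)"
      by (rule has_derivative_transform_within_open[of "\<lambda>_. 0" _ _ UNIV "S - K"])
        (use that S K z in \<open>auto intro: open_Diff compact_imp_closed\<close>)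
    then show ?thesis using d[OF that(1)] inner_has_derivative_unique by blast
  qed
  have 1: "(?w has_derivative (\<lambda>h. ?D x \<bullet> h)) (at x)" for x
  proof (cases "x \<in> S")
    case True
    then show ?thesis
      using has_derivative_transform_within_open[OF d[OF True] S True, of ?w] by auto
  next
    case False
    then have "x \<in> -K" using K by auto
    have "(?w has_derivative (\<lambda>h. 0 \<bullet> h)) (at x)"
      by (rule has_derivative_transform_within_open[OF _ oK \<open>x \<in> -K\<close>, of "\<lambda>_. 0"])
        (use z in auto)
    then show ?thesis using False by simp
  qed
  have "continuous_on (S \<union> -K) ?D"
  proof (rule continuous_on_open_Un[OF S oK])
    show "continuous_on S ?D" using c by (rule continuous_on_eq) auto
    show "continuous_on (-K) ?D"
      by (rule continuous_on_eq[OF continuous_on_const[of _ 0]]) (use D0 in auto)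
  qed
  moreover have "S \<union> -K = UNIV" using K by auto
  ultimately show ?thesis
    unfolding C1c_def using 1 K z by auto
qed

lemma integrable_continuous_compact_support:
  fixes f :: "'a::euclidean_space \<Rightarrow> 'b::{banach, second_countable_topology}"
  assumes "continuous_on K f" "compact K" "\<And>x. x \<notin> K \<Longrightarrow> f x = 0"
  shows "integrable lborel f"
proof -
  have "integrable lborel (\<lambda>x. indicator K x *\<^sub>R f x)"
    using borel_integrable_compact[OF assms(2,1)] by simp
  moreover have "(\<lambda>x. indicator K x *\<^sub>R f x) = f"
    using assms(3) by (auto simp: indicator_def fun_eq_iff)
  ultimately show ?thesis by simp
qed

subsection \<open>Translation estimate and the Faber--Krahn inequality\<close>

text \<open>The fundamental theorem of calculus along a segment, phrased with the extended
  nonnegative integral: Tonelli's theorem then applies to it without integrability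
  conditions.\<close>

lemma segment_ineq:
  fixes w :: "'a::euclidean_space \<Rightarrow> real"
  assumes d: "\<And>t. t \<in> {0..1} \<Longrightarrow> (w has_derivative (\<lambda>k. D (x + t *\<^sub>R h) \<bullet> k)) (at (x + t *\<^sub>R h))"
    and c: "continuous_on {0..1} (\<lambda>t::real. D (x + t *\<^sub>R h))"
  shows "ennreal \<bar>w (x + h) - w x\<bar>
    \<le> (\<integral>\<^sup>+t. ennreal (norm h * norm (D (x + t *\<^sub>R h))) * indicator {0..1} t \<partial>lborel)"
proof -
  let ?g = "\<lambda>t. D (x + t *\<^sub>R h) \<bullet> h"
  let ?F = "\<lambda>t::real. w (x + t *\<^sub>R h)"
  have "((\<lambda>t. w (x + t *\<^sub>R h)) has_vector_derivative ?g t) (at t within {0..1})"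
    if "0 \<le> t" "t \<le> 1" for t
  proof -
    have "((\<lambda>t. w (x + t *\<^sub>R h)) has_derivative (\<lambda>s. D (x + t *\<^sub>R h) \<bullet> (s *\<^sub>R h))) (at t within {0..1})"
    proof (rule has_derivative_compose[of "\<lambda>t. x + t *\<^sub>R h" "\<lambda>s. s *\<^sub>R h" t "{0..1}" w])
      show "((\<lambda>t. x + t *\<^sub>R h) has_derivative (\<lambda>s. s *\<^sub>R h)) (at t within {0..1})"
        by (auto intro!: derivative_eq_intros)
      show "(w has_derivative (\<bullet>) (D (x + t *\<^sub>R h))) (at (x + t *\<^sub>R h))"
        using d that by auto
    qed
    then show ?thesis
      unfolding has_vector_derivative_def by (simp add: mult.commute)
  qed
  moreover have "continuous_on {0..1} ?g" using c by (intro continuous_intros)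
  ultimately have H: "has_bochner_integral lborel (\<lambda>t. indicator {0..1} t *\<^sub>R ?g t) (?F 1 - ?F 0)"
    by (intro has_bochner_integral_FTC_Icc) auto
  have I: "integrable lborel (\<lambda>t. indicator {0..1} t *\<^sub>R ?g t)"
    and E: "(\<integral>t. indicator {0..1} t *\<^sub>R ?g t \<partial>lborel) = ?F 1 - ?F 0"
    using H unfolding has_bochner_integral_iff by blast+
  have "ennreal (norm (?F 1 - ?F 0)) \<le> (\<integral>\<^sup>+t. ennreal (norm (indicator {0..1} t *\<^sub>R ?g t)) \<partial>lborel)"
    unfolding E[symmetric] by (rule integral_norm_bound_ennreal[OF I])
  also have "\<dots> \<le> (\<integral>\<^sup>+t. ennreal (norm h * norm (D (x + t *\<^sub>R h))) * indicator {0..1} t \<partial>lborel)"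
  proof (rule nn_integral_mono)
    fix t :: real
    show "ennreal (norm (indicator {0..1} t *\<^sub>R ?g t))
      \<le> ennreal (norm h * norm (D (x + t *\<^sub>R h))) * indicator {0..1} t"
    proof (cases "t \<in> {0..1}")
      case True
      then show ?thesis
        using Cauchy_Schwarz_ineq2[of "D (x + t *\<^sub>R h)" h]
        by (simp add: mult.commute ennreal_leI)
    next
      case False
      then show ?thesis by simp
    qed
  qed
  finally show ?thesis by simp
qed

lemma nn_integral_lborel_translate:
  fixes f :: "'a::euclidean_space \<Rightarrow> ennreal"
  assumes [measurable]: "f \<in> borel_measurable borel"
  shows "(\<integral>\<^sup>+x. f (x + a) \<partial>lborel) = (\<integral>\<^sup>+x. f x \<partial>lborel)"
proof -
  have "(\<integral>\<^sup>+x. f x \<partial>lborel) = (\<integral>\<^sup>+x. f x \<partial>(distr lborel borel ((+) a)))"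
    by (simp add: lborel_distr_plus)
  also have "\<dots> = (\<integral>\<^sup>+x. f (a + x) \<partial>lborel)"
    by (subst nn_integral_distr) auto
  finally show ?thesis by (simp add: add.commute)
qed

lemma nn_integral_lborel_affine:
  fixes f :: "'a::euclidean_space \<Rightarrow> ennreal"
  assumes [measurable]: "f \<in> borel_measurable borel" and c: "c \<noteq> 0"
  shows "(\<integral>\<^sup>+x. f x \<partial>lborel) = \<bar>c\<bar> ^ DIM('a) * (\<integral>\<^sup>+x. f (t + c *\<^sub>R x) \<partial>lborel)"
  by (subst lborel_affine[OF c, of t])
    (simp add: nn_integral_density nn_integral_distr nn_integral_cmult ennreal_power)

lemma translation_estimate:
  fixes w :: "'a::euclidean_space \<Rightarrow> real"
  assumes "C1c UNIV w D"
  shows "(\<integral>\<^sup>+x. ennreal \<bar>w (x + h) - w x\<bar> \<partial>lborel)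
    \<le> ennreal (norm h) * (\<integral>\<^sup>+x. ennreal (norm (D x)) \<partial>lborel)"
proof -
  have Dc: "continuous_on UNIV D" using C1c_continuous[OF assms] by simp
  then have [measurable]: "D \<in> borel_measurable borel" by (rule borel_measurable_continuous_onI)
  have "(\<integral>\<^sup>+x. ennreal \<bar>w (x + h) - w x\<bar> \<partial>lborel)
    \<le> (\<integral>\<^sup>+x. (\<integral>\<^sup>+t. ennreal (norm h * norm (D (x + t *\<^sub>R h))) * indicator {0..1::real} t \<partial>lborel) \<partial>lborel)"
  proof (rule nn_integral_mono, rule segment_ineq)
    fix x :: 'a
    show "(w has_derivative (\<bullet>) (D (x + t *\<^sub>R h))) (at (x + t *\<^sub>R h))" for t :: real
      using assms unfolding C1c_def by auto
    show "continuous_on {0..1} (\<lambda>t::real. D (x + t *\<^sub>R h))"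
      by (intro continuous_on_compose2[OF Dc] continuous_intros) auto
  qed
  also have "\<dots> = (\<integral>\<^sup>+t. (\<integral>\<^sup>+x. ennreal (norm h * norm (D (x + t *\<^sub>R h))) * indicator {0..1::real} t \<partial>lborel) \<partial>lborel)"
    by (rule lborel_pair.Fubini') measurable
  also have "\<dots> = (\<integral>\<^sup>+t. (\<integral>\<^sup>+x. ennreal (norm h * norm (D x)) \<partial>lborel) * indicator {0..1::real} t \<partial>lborel)"
    by (subst nn_integral_multc, measurable)
      (subst nn_integral_lborel_translate[of "\<lambda>x. ennreal (norm h * norm (D x))"], auto)
  also have "\<dots> = (\<integral>\<^sup>+x. ennreal (norm h * norm (D x)) \<partial>lborel)"
    by (subst nn_integral_cmult) auto
  also have "\<dots> = ennreal (norm h) * (\<integral>\<^sup>+x. ennreal (norm (D x)) \<partial>lborel)"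
    by (simp add: ennreal_mult nn_integral_cmult)
  finally show ?thesis .
qed

definition ubvol :: "'a::euclidean_space itself \<Rightarrow> real" where
  "ubvol _ = measure lborel (ball (0::'a) 1)"

lemma ubvol_pos: "ubvol TYPE('a::euclidean_space) > 0"
  unfolding ubvol_def by (rule content_ball_pos) simp

lemma measure_ball:
  "r \<ge> 0 \<Longrightarrow> measure lborel (ball (c::'a::euclidean_space) r) = r ^ DIM('a) * ubvol TYPE('a)"
  unfolding ubvol_def by (rule content_ball_conv_unit_ball)

lemma emeasure_ball_eq:
  "emeasure lborel (ball (c::'a::euclidean_space) r) = ennreal (measure lborel (ball c r))"
  by (intro emeasure_eq_ennreal_measure) (use emeasure_lborel_ball_finite[of c r] in auto)

lemma measure_open_pos:
  fixes A :: "'a::euclidean_space set"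
  assumes "open A" "A \<noteq> {}" "emeasure lborel A < \<infinity>"
  shows "measure lborel A > 0"
proof -
  obtain x e where "e > 0" "ball x e \<subseteq> A"
    using assms by (meson ex_in_conv openE)
  then have "0 < measure lborel (ball x e)" "measure lborel (ball x e) \<le> measure lborel A"
    using assms by (auto intro!: content_ball_pos measure_mono_fmeasurable fmeasurableI)
  then show ?thesis by linarith
qed

text \<open>Averaging the translation estimate over a ball of twice the measure of the support:
  at least half of the translates of a point of the support leave the support.\<close>

lemma Faber_Krahn:
  fixes w :: "'a::euclidean_space \<Rightarrow> real"
  assumes w: "C1c UNIV w D"
  defines "A \<equiv> {x. w x \<noteq> 0}"
  shows "(\<integral>x. \<bar>w x\<bar> \<partial>lborel) \<le> 2 * (2 / ubvol TYPE('a)) powr (1 / DIM('a))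
     * measure lborel A powr (1 / DIM('a)) * (\<integral>x. norm (D x) \<partial>lborel)"
proof -
  obtain K where K: "compact K" "\<And>x. x \<notin> K \<Longrightarrow> w x = 0" using w unfolding C1c_def by blast
  note wc = C1c_continuous(1)[OF w] and Dc = C1c_continuous(2)[OF w]
  have [measurable]: "w \<in> borel_measurable borel" "D \<in> borel_measurable borel"
    using wc Dc by (auto intro: borel_measurable_continuous_onI)
  have oA: "open A"
    using wc unfolding A_def
    by (intro open_Collect_neq continuous_intros) auto
  have [measurable]: "A \<in> sets borel" using oA by auto
  have bA: "bounded A" "A \<subseteq> K" using K bounded_subset[of K A] compact_imp_bounded unfolding A_def by blast+
  have fA: "emeasure lborel A < \<infinity>" using emeasure_bounded_finite[OF bA(1)] .
  have eA: "emeasure lborel A = ennreal (measure lborel A)"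
    using fA by (intro emeasure_eq_ennreal_measure) auto
  define m where "m = measure lborel A"
  have m0: "m \<ge> 0" unfolding m_def by simp
  have intw: "integrable lborel (\<lambda>x. \<bar>w x\<bar>)"
    by (rule integrable_continuous_compact_support[of K])
      (use K continuous_on_subset[OF wc] in \<open>auto intro!: continuous_intros\<close>)
  have intD: "integrable lborel (\<lambda>x. norm (D x))"
    by (rule integrable_continuous_compact_support[of K])
      (use K continuous_on_subset[OF Dc] C1c_deriv_zero[OF w K] in \<open>auto intro!: continuous_intros\<close>)
  show ?thesis
  proof (cases "m = 0")
    case True
    then have "A = {}" using measure_open_pos[OF oA _ fA] m_def by fastforce
    then have "w x = 0" for x unfolding A_def by auto
    then show ?thesis by simp
  next
    case False
    then have mp: "m > 0" using m0 by simp
    define \<rho> where "\<rho> = (2 * m / ubvol TYPE('a)) powr (1 / DIM('a))"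
    let ?B = "ball (0::'a) \<rho>"
    have \<rho>: "\<rho> > 0" unfolding \<rho>_def using mp ubvol_pos[where 'a='a] by simp
    have [measurable]: "?B \<in> sets borel" by simp
    have "\<rho> ^ DIM('a) = 2 * m / ubvol TYPE('a)"
      unfolding \<rho>_def using mp ubvol_pos[where 'a='a]
      by (simp add: powr_realpow[symmetric] powr_powr)
    then have mB: "measure lborel ?B = 2 * m"
      using measure_ball[of \<rho> "0::'a"] \<rho> ubvol_pos[where 'a='a] by simp
    then have eB: "emeasure lborel ?B = ennreal (2 * m)" using emeasure_ball_eq by metis
    let ?D = "\<integral>\<^sup>+x. ennreal (norm (D x)) \<partial>lborel"
    let ?W = "\<integral>\<^sup>+x. ennreal \<bar>w x\<bar> \<partial>lborel"
    have "ennreal m * ?W = (\<integral>\<^sup>+x. ennreal \<bar>w x\<bar> * ennreal m \<partial>lborel)"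
      by (subst nn_integral_multc) (auto simp: mult.commute)
    also have "\<dots> \<le> (\<integral>\<^sup>+x. (\<integral>\<^sup>+h. ennreal \<bar>w (x + h) - w x\<bar> * indicator ?B h \<partial>lborel) \<partial>lborel)"
    proof (rule nn_integral_mono)
      fix x :: 'a
      have e1: "emeasure lborel ((\<lambda>h. x + h) -` A) = ennreal m"
      proof -
        have "emeasure lborel A = emeasure (distr lborel borel ((+) x)) A"
          by (simp add: lborel_distr_plus)
        also have "\<dots> = emeasure lborel ((\<lambda>h. x + h) -` A)"
          by (subst emeasure_distr) auto
        finally show ?thesis using eA m_def by simp
      qed
      have [measurable]: "(\<lambda>h. x + h) -` A \<in> sets borel"
        by (rule measurable_sets_borel[of _ borel]) auto
      have "ennreal m = ennreal (2 * m) - ennreal m"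
        using mp by (subst ennreal_minus) auto
      also have "\<dots> \<le> emeasure lborel (?B - (\<lambda>h. x + h) -` A)"
      proof -
        have "emeasure lborel ?B \<le> emeasure lborel (?B - (\<lambda>h. x + h) -` A) + emeasure lborel ((\<lambda>h. x + h) -` A)"
          by (rule order_trans[OF emeasure_mono[of _ "(?B - (\<lambda>h. x + h) -` A) \<union> ((\<lambda>h. x + h) -` A)"] emeasure_subadditive]) auto
        then show ?thesis unfolding eB e1
          by (simp add: add.commute ennreal_minus_le_iff)
      qed
      also have "\<dots> = (\<integral>\<^sup>+h. indicator (?B - (\<lambda>h. x + h) -` A) h \<partial>lborel)" by simp
      finally have "ennreal \<bar>w x\<bar> * ennreal m \<le> ennreal \<bar>w x\<bar> * (\<integral>\<^sup>+h. indicator (?B - (\<lambda>h. x + h) -` A) h \<partial>lborel)"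
        by (rule mult_left_mono) simp
      also have "\<dots> = (\<integral>\<^sup>+h. ennreal \<bar>w x\<bar> * indicator (?B - (\<lambda>h. x + h) -` A) h \<partial>lborel)"
        by (subst nn_integral_cmult, measurable)
      also have "\<dots> \<le> (\<integral>\<^sup>+h. ennreal \<bar>w (x + h) - w x\<bar> * indicator ?B h \<partial>lborel)"
        by (intro nn_integral_mono) (auto simp: indicator_def A_def)
      finally show "ennreal \<bar>w x\<bar> * ennreal m \<le> (\<integral>\<^sup>+h. ennreal \<bar>w (x + h) - w x\<bar> * indicator ?B h \<partial>lborel)" .
    qed
    also have "\<dots> = (\<integral>\<^sup>+h. (\<integral>\<^sup>+x. ennreal \<bar>w (x + h) - w x\<bar> * indicator ?B h \<partial>lborel) \<partial>lborel)"
      by (rule lborel_pair.Fubini') measurable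
    also have "\<dots> = (\<integral>\<^sup>+h. (\<integral>\<^sup>+x. ennreal \<bar>w (x + h) - w x\<bar> \<partial>lborel) * indicator ?B h \<partial>lborel)"
      by (subst nn_integral_multc) auto
    also have "\<dots> \<le> (\<integral>\<^sup>+h. (ennreal \<rho> * ?D) * indicator ?B h \<partial>lborel)"
    proof (rule nn_integral_mono)
      fix h :: 'a
      have "(\<integral>\<^sup>+x. ennreal \<bar>w (x + h) - w x\<bar> \<partial>lborel) \<le> ennreal \<rho> * ?D" if "h \<in> ?B"
        using translation_estimate[OF w, of h] that
        by (elim order_trans) (auto intro!: mult_right_mono ennreal_leI)
      then show "(\<integral>\<^sup>+x. ennreal \<bar>w (x + h) - w x\<bar> \<partial>lborel) * indicator ?B h \<le> ennreal \<rho> * ?D * indicator ?B h"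
        by (auto simp: indicator_def)
    qed
    also have "\<dots> = ennreal \<rho> * ?D * ennreal (2 * m)"
      by (subst nn_integral_cmult_indicator) (auto simp: eB)
    finally have main: "ennreal m * ?W \<le> ennreal \<rho> * ?D * ennreal (2 * m)" .
    have "?W = ennreal (\<integral>x. \<bar>w x\<bar> \<partial>lborel)" using intw by (intro nn_integral_eq_integral) auto
    moreover have "?D = ennreal (\<integral>x. norm (D x) \<partial>lborel)" using intD by (intro nn_integral_eq_integral) auto
    ultimately have "ennreal (m * (\<integral>x. \<bar>w x\<bar> \<partial>lborel)) \<le> ennreal (\<rho> * (\<integral>x. norm (D x) \<partial>lborel) * (2 * m))"
      using main mp \<rho> by (simp add: ennreal_mult)
    then have "m * (\<integral>x. \<bar>w x\<bar> \<partial>lborel) \<le> \<rho> * (\<integral>x. norm (D x) \<partial>lborel) * (2 * m)"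
      using mp \<rho> by (subst (asm) ennreal_le_iff) auto
    then have "(\<integral>x. \<bar>w x\<bar> \<partial>lborel) \<le> 2 * \<rho> * (\<integral>x. norm (D x) \<partial>lborel)"
      using mp by (simp add: mult.commute mult.left_commute)
    moreover have "\<rho> = (2 / ubvol TYPE('a)) powr (1 / DIM('a)) * m powr (1 / DIM('a))"
      unfolding \<rho>_def using mp ubvol_pos[where 'a='a]
      by (simp add: powr_mult[symmetric])
    ultimately show ?thesis unfolding m_def by (simp add: mult.assoc)
  qed
qed

subsection \<open>A Poincare inequality on balls\<close>

lemma nn_integral_lborel_shrink:
  fixes g :: "'a::euclidean_space \<Rightarrow> ennreal"
  assumes [measurable]: "g \<in> borel_measurable borel" and c: "c \<ge> 1/2"
  shows "(\<integral>\<^sup>+y. g (a + c *\<^sub>R y) \<partial>lborel) \<le> 2 ^ DIM('a) * (\<integral>\<^sup>+y. g y \<partial>lborel)"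
proof -
  let ?I = "\<integral>\<^sup>+y. g (a + c *\<^sub>R y) \<partial>lborel"
  have "(1::ennreal) \<le> ennreal (2 ^ DIM('a) * \<bar>c\<bar> ^ DIM('a))"
    using c one_le_power[of "2 * \<bar>c\<bar>" "DIM('a)"] by (simp add: power_mult_distrib)
  then have "1 * ?I \<le> ennreal (2 ^ DIM('a) * \<bar>c\<bar> ^ DIM('a)) * ?I"
    by (intro mult_right_mono) auto
  also have "\<dots> = 2 ^ DIM('a) * (\<bar>c\<bar> ^ DIM('a) * ?I)"
    by (simp add: ennreal_mult ennreal_power[symmetric] mult.assoc)
  also have "(\<bar>c\<bar> ^ DIM('a) * ?I) = (\<integral>\<^sup>+y. g y \<partial>lborel)"
    using nn_integral_lborel_affine[of g c a] c by (simp add: ennreal_power)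
  finally show ?thesis by simp
qed

text \<open>Integrating the segment inequality over all pairs from \<open>P\<close> and
  \<open>Q\<close> leaves, for each t, a double integral of |D| at x + t(y - x). One substitutes for
  the endpoint whose coefficient is at least 1/2, that is y for t \<ge> 1/2 and x otherwise, so that
  the Jacobian costs at most 2^n. Two sets take the place of a mean value because \<open>w\<close>
  will be a logarithm that is nonpositive on one set and large on the other.\<close>

lemma Poincare_two_sets:
  fixes w :: "'a::euclidean_space \<Rightarrow> real"
  assumes d: "\<And>x. x \<in> ball x0 r \<Longrightarrow> (w has_derivative (\<lambda>h. D x \<bullet> h)) (at x)"
    and c: "continuous_on (ball x0 r) D"
    and P: "P \<in> sets borel" "P \<subseteq> ball x0 r" "\<And>x. x \<in> P \<Longrightarrow> w x \<ge> s"
    and Q: "Q \<in> sets borel" "Q \<subseteq> ball x0 r" "\<And>x. x \<in> Q \<Longrightarrow> w x \<le> 0"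
    and s: "s > 0" and r: "r > 0"
  shows "ennreal s * emeasure lborel P * emeasure lborel Q \<le>
     ennreal (2 * r) * 2 ^ DIM('a) * emeasure lborel (ball x0 r)
       * (\<integral>\<^sup>+x. ennreal (norm (D x)) * indicator (ball x0 r) x \<partial>lborel)"
proof -
  let ?B = "ball x0 r"
  define g where "g = (\<lambda>x. ennreal (norm (indicator ?B x *\<^sub>R D x)))"
  have [measurable]: "?B \<in> sets borel" by simp
  have [measurable]: "(\<lambda>x. indicator ?B x *\<^sub>R D x) \<in> borel_measurable borel"
    by (rule borel_measurable_continuous_on_indicator[OF _ c]) auto
  have gm[measurable]: "g \<in> borel_measurable borel" unfolding g_def by measurable
  have gB: "g x = ennreal (norm (D x)) * indicator ?B x" for x
    unfolding g_def by (auto simp: indicator_def)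
  note [measurable] = P(1) Q(1)
  let ?J = "\<lambda>t. \<integral>\<^sup>+x. (\<integral>\<^sup>+y. g (x + t *\<^sub>R (y - x)) * indicator ?B x * indicator ?B y \<partial>lborel) \<partial>lborel"
  let ?I = "\<integral>\<^sup>+x. g x \<partial>lborel"
  have J: "?J t \<le> 2 ^ DIM('a) * emeasure lborel ?B * ?I" if t: "t \<in> {0..1}" for t :: real
  proof -
    have one: "(\<integral>\<^sup>+x. (\<integral>\<^sup>+y. g (a *\<^sub>R x + b *\<^sub>R y) * indicator ?B x * indicator ?B y \<partial>lborel) \<partial>lborel)
      \<le> 2 ^ DIM('a) * emeasure lborel ?B * ?I" if b: "b \<ge> 1/2" for a b :: real
    proof -
      have "(\<integral>\<^sup>+x. (\<integral>\<^sup>+y. g (a *\<^sub>R x + b *\<^sub>R y) * indicator ?B x * indicator ?B y \<partial>lborel) \<partial>lborel)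
        \<le> (\<integral>\<^sup>+x. (2 ^ DIM('a) * ?I) * indicator ?B x \<partial>lborel)"
      proof (rule nn_integral_mono)
        fix x :: 'a
        have "(\<integral>\<^sup>+y. g (a *\<^sub>R x + b *\<^sub>R y) * indicator ?B x * indicator ?B y \<partial>lborel)
          \<le> (\<integral>\<^sup>+y. g (a *\<^sub>R x + b *\<^sub>R y) * indicator ?B x \<partial>lborel)"
          by (intro nn_integral_mono) (auto simp: indicator_def)
        also have "\<dots> = (\<integral>\<^sup>+y. g (a *\<^sub>R x + b *\<^sub>R y) \<partial>lborel) * indicator ?B x"
          by (subst nn_integral_multc) auto
        also have "\<dots> \<le> (2 ^ DIM('a) * ?I) * indicator ?B x"
          by (intro mult_right_mono nn_integral_lborel_shrink b) auto
        finally show "(\<integral>\<^sup>+y. g (a *\<^sub>R x + b *\<^sub>R y) * indicator ?B x * indicator ?B y \<partial>lborel)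
          \<le> (2 ^ DIM('a) * ?I) * indicator ?B x" .
      qed
      also have "\<dots> = 2 ^ DIM('a) * emeasure lborel ?B * ?I"
        by (subst nn_integral_cmult_indicator) (auto simp: mult_ac)
      finally show ?thesis .
    qed
    show ?thesis
    proof (cases "t \<ge> 1/2")
      case True
      have "x + t *\<^sub>R (y - x) = (1 - t) *\<^sub>R x + t *\<^sub>R y" for x y :: 'a
        by (simp add: algebra_simps)
      then show ?thesis using one[OF True, of "1 - t"] by simp
    next
      case False
      then have F: "1 - t \<ge> 1/2" by simp
      have "?J t = (\<integral>\<^sup>+y. (\<integral>\<^sup>+x. g (x + t *\<^sub>R (y - x)) * indicator ?B x * indicator ?B y \<partial>lborel) \<partial>lborel)"
        by (rule lborel_pair.Fubini') measurable
      also have "\<dots> = (\<integral>\<^sup>+y. (\<integral>\<^sup>+x. g (t *\<^sub>R y + (1 - t) *\<^sub>R x) * indicator ?B y * indicator ?B x \<partial>lborel) \<partial>lborel)"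
        by (simp add: algebra_simps)
      also have "\<dots> \<le> 2 ^ DIM('a) * emeasure lborel ?B * ?I" by (rule one[OF F])
      finally show ?thesis .
    qed
  qed
  have "ennreal s * emeasure lborel P * emeasure lborel Q
    = (\<integral>\<^sup>+x. (\<integral>\<^sup>+y. ennreal s * indicator P x * indicator Q y \<partial>lborel) \<partial>lborel)"
    by (simp add: nn_integral_cmult nn_integral_multc)
  also have "\<dots> \<le> (\<integral>\<^sup>+x. (\<integral>\<^sup>+y. (\<integral>\<^sup>+t. ennreal (2 * r) * (g (x + t *\<^sub>R (y - x)) * indicator ?B x * indicator ?B y * indicator {0..1::real} t) \<partial>lborel) \<partial>lborel) \<partial>lborel)"
  proof (intro nn_integral_mono)
    fix x y :: 'a
    let ?R = "\<integral>\<^sup>+t. ennreal (2 * r) * (g (x + t *\<^sub>R (y - x)) * indicator ?B x * indicator ?B y * indicator {0..1::real} t) \<partial>lborel"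
    show "ennreal s * indicator P x * indicator Q y \<le> ?R"
    proof (cases "x \<in> P \<and> y \<in> Q")
      case False then show ?thesis by (auto simp: indicator_def)
    next
      case True
      then have xy: "x \<in> ?B" "y \<in> ?B" using P Q by auto
      have seg: "x + t *\<^sub>R (y - x) \<in> ?B" if "t \<in> {0..1}" for t :: real
      proof -
        have "(1 - t) *\<^sub>R x + t *\<^sub>R y \<in> ?B"
          using xy that convex_ball[of x0 r] unfolding convex_alt by auto
        then show ?thesis by (simp add: algebra_simps)
      qed
      have "ennreal s \<le> ennreal \<bar>w (x + (y - x)) - w x\<bar>"
        using True P(3)[of x] Q(3)[of y] s by (intro ennreal_leI) auto
      also have "\<dots> \<le> (\<integral>\<^sup>+t. ennreal (norm (y - x) * norm (D (x + t *\<^sub>R (y - x)))) * indicator {0..1} t \<partial>lborel)"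
        by (rule segment_ineq)
          (use d seg c in \<open>auto intro!: continuous_on_compose2[of ?B D] continuous_intros\<close>)
      also have "\<dots> \<le> ?R"
      proof (rule nn_integral_mono)
        fix t :: real
        have "norm (y - x) \<le> 2 * r"
          using xy norm_triangle_ineq4[of "y - x0" "x - x0"] by (simp add: dist_norm norm_minus_commute)
        then have "norm (y - x) * norm (D (x + t *\<^sub>R (y - x))) \<le> 2 * r * norm (D (x + t *\<^sub>R (y - x)))"
          by (rule mult_right_mono) simp
        then have "ennreal (norm (y - x) * norm (D (x + t *\<^sub>R (y - x)))) \<le> ennreal (2 * r) * ennreal (norm (D (x + t *\<^sub>R (y - x))))"
          using r by (simp add: ennreal_mult[symmetric] ennreal_leI)
        then show "ennreal (norm (y - x) * norm (D (x + t *\<^sub>R (y - x)))) * indicator {0..1} t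
          \<le> ennreal (2 * r) * (g (x + t *\<^sub>R (y - x)) * indicator ?B x * indicator ?B y * indicator {0..1::real} t)"
          using xy seg[of t] unfolding gB by (auto simp: indicator_def)
      qed
      finally show ?thesis using True by simp
    qed
  qed
  also have "\<dots> = (\<integral>\<^sup>+x. (\<integral>\<^sup>+t. (\<integral>\<^sup>+y. ennreal (2 * r) * (g (x + t *\<^sub>R (y - x)) * indicator ?B x * indicator ?B y * indicator {0..1::real} t) \<partial>lborel) \<partial>lborel) \<partial>lborel)"
    by (intro nn_integral_cong, rule lborel_pair.Fubini') measurable
  also have "\<dots> = (\<integral>\<^sup>+t. (\<integral>\<^sup>+x. (\<integral>\<^sup>+y. ennreal (2 * r) * (g (x + t *\<^sub>R (y - x)) * indicator ?B x * indicator ?B y * indicator {0..1::real} t) \<partial>lborel) \<partial>lborel) \<partial>lborel)"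
    by (rule lborel_pair.Fubini') measurable
  also have "\<dots> = (\<integral>\<^sup>+t. ennreal (2 * r) * ?J t * indicator {0..1::real} t \<partial>lborel)"
  proof (rule nn_integral_cong)
    fix t :: real
    show "(\<integral>\<^sup>+x. (\<integral>\<^sup>+y. ennreal (2 * r) * (g (x + t *\<^sub>R (y - x)) * indicator ?B x * indicator ?B y * indicator {0..1::real} t) \<partial>lborel) \<partial>lborel)
      = ennreal (2 * r) * ?J t * indicator {0..1::real} t"
      by (cases "t \<in> {0..1}") (simp_all add: nn_integral_cmult)
  qed
  also have "\<dots> \<le> (\<integral>\<^sup>+t. ennreal (2 * r) * (2 ^ DIM('a) * emeasure lborel ?B * ?I) * indicator {0..1::real} t \<partial>lborel)"
    using J by (intro nn_integral_mono) (auto simp: indicator_def intro!: mult_left_mono)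
  also have "\<dots> = ennreal (2 * r) * (2 ^ DIM('a) * emeasure lborel ?B * ?I)"
    by (subst nn_integral_cmult_indicator) auto
  finally show ?thesis unfolding gB by (simp add: mult.assoc)
qed

section \<open>Interior estimates: De Giorgi, Moser and Harnack\<close>

subsection \<open>De Giorgi's energy estimate\<close>

text \<open>Whichever of \<open>T\<close> and \<open>\<tau> * X\<close> is the larger one dominates
  the product; the constants are not optimal, but no dual exponent appears.\<close>

lemma young_crude:
  fixes X T \<tau> p :: real
  assumes "X \<ge> 0" "T \<ge> 0" "\<tau> > 0" "p > 1"
  shows "X powr (p - 1) * T \<le> \<tau> * X powr p + \<tau> powr (1 - p) * T powr p"
proof (cases "T \<le> \<tau> * X")
  case True
  have "X powr (p - 1) * T \<le> X powr (p - 1) * (\<tau> * X)"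
    using True by (intro mult_left_mono) auto
  also have "\<dots> = \<tau> * X powr p"
    using assms by (cases "X = 0") (auto simp: powr_diff)
  finally show ?thesis by (smt (verit) powr_ge_zero mult_nonneg_nonneg)
next
  case False
  then have "X \<le> T / \<tau>" using assms by (simp add: field_simps)
  then have "X powr (p - 1) * T \<le> (T / \<tau>) powr (p - 1) * T"
    using assms by (intro mult_right_mono powr_mono2) auto
  also have "\<dots> = \<tau> powr (1 - p) * T powr p"
    using assms by (cases "T = 0") (auto simp: powr_diff powr_divide field_simps)
  finally show ?thesis using assms by (smt (verit) powr_ge_zero mult_nonneg_nonneg)
qed

text \<open>The threshold \<open>T\<close> separates small values, bounded by \<open>T\<close>, from
  large ones, absorbed by the p-th power. With \<open>T\<close> adapted to the scale at hand this
  takes the place of Hoelder's inequality, both for gradients and for right-hand sides in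
  L^s.\<close>

lemma le_powr_split:
  fixes a T p :: real
  assumes "a \<ge> 0" "T > 0" "p > 1"
  shows "a \<le> T powr (1 - p) * a powr p + T"
proof (cases "a \<le> T")
  case True then show ?thesis by (simp add: add_increasing)
next
  case False
  then have "a > 0" using assms by simp
  have "1 \<le> (a / T) powr (p - 1)" using False assms by (intro ge_one_powr_ge_zero) auto
  then have "a * 1 \<le> a * (a / T) powr (p - 1)" using \<open>a > 0\<close> by (intro mult_left_mono) auto
  also have "\<dots> = T powr (1 - p) * a powr p"
    using \<open>a > 0\<close> assms by (auto simp: powr_diff powr_divide field_simps)
  finally show ?thesis using assms by simp
qed

text \<open>Exponents larger than one smooth out the corner of the positive part at 0, so that
  truncations of a C^1 function remain C^1.\<close>

lemma pos_part_powr_deriv: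
  fixes q t :: real
  assumes "q > 1"
  shows "((\<lambda>t. max 0 t powr q) has_real_derivative q * max 0 t powr (q - 1)) (at t)"
proof -
  consider "t > 0" | "t < 0" | "t = 0" by linarith
  then show ?thesis
  proof cases
    case 1
    have "((\<lambda>t. t powr q) has_real_derivative q * t powr (q - 1)) (at t)"
      using 1 by (auto intro!: derivative_eq_intros simp: powr_diff)
    then have "((\<lambda>t. max 0 t powr q) has_real_derivative q * t powr (q - 1)) (at t)"
      by (rule has_field_derivative_transform_within_open[of _ _ _ "{0<..}"]) (use 1 in auto)
    then show ?thesis using 1 by simp
  next
    case 2
    have "((\<lambda>t. 0) has_real_derivative 0) (at t)" by simp
    then have "((\<lambda>t. max 0 t powr q) has_real_derivative 0) (at t)"
      by (rule has_field_derivative_transform_within_open[of _ _ _ "{..<0}"]) (use 2 assms in auto)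
    then show ?thesis using 2 assms by simp
  next
    case 3
    have "((\<lambda>h. max 0 h powr (q - 1)) \<longlongrightarrow> max 0 0 powr (q - 1)) (at (0::real))"
      by (intro tendsto_intros tendsto_powr'[THEN tendsto_eq_rhs]) (use assms in \<open>auto intro: tendsto_intros eventuallyI\<close>)
    then have "((\<lambda>h. max 0 h powr (q - 1)) \<longlongrightarrow> 0) (at (0::real))" using assms by simp
    then have "((\<lambda>h. max 0 h powr q / h) \<longlongrightarrow> 0) (at (0::real))"
      by (rule Lim_transform_within[of _ _ _ _ 1]) (auto simp: powr_diff max_def)
    then show ?thesis using 3 assms unfolding DERIV_def by simp
  qed
qed

text \<open>The right-hand side of the equation enters only through the bound \<open>N\<close> and the exponent \<open>e\<close>;
  for a right-hand side in \<open>L\<^sup>q\<close> one may take \<open>e = 1 - 1 / q\<close>.\<close>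

definition DGsol ::
  "real \<Rightarrow> real \<Rightarrow> real \<Rightarrow> real \<Rightarrow> real \<Rightarrow> 'a::euclidean_space set \<Rightarrow> ('a \<Rightarrow> real) \<Rightarrow> ('a \<Rightarrow> 'a) \<Rightarrow> ('a \<Rightarrow> 'a) \<Rightarrow> bool" where
  "DGsol p \<delta> L e N S u G F \<longleftrightarrow> open S \<and> 0 \<le> N \<and> continuous_on S G \<and> continuous_on S F \<and>
    (\<forall>x\<in>S. (u has_derivative (\<lambda>h. G x \<bullet> h)) (at x)) \<and>
    (\<forall>x\<in>S. norm (F x) \<le> L * norm (G x) powr (p - 1) \<and> \<delta> * norm (G x) powr p \<le> F x \<bullet> G x) \<and>
    (\<forall>\<eta> D B. C1c S \<eta> D \<longrightarrow> (\<forall>x. \<bar>\<eta> x\<bar> \<le> B) \<longrightarrow>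
       \<bar>\<integral>x. F x \<bullet> D x \<partial>lborel\<bar> \<le> B * N * measure lborel {x. \<eta> x \<noteq> 0} powr e)"

lemma DGsolD:
  assumes "DGsol p \<delta> L e N S u G F"
  shows "open S" "0 \<le> N" "continuous_on S G" "continuous_on S F"
    "\<And>x. x \<in> S \<Longrightarrow> (u has_derivative (\<lambda>h. G x \<bullet> h)) (at x)"
    "\<And>x. x \<in> S \<Longrightarrow> norm (F x) \<le> L * norm (G x) powr (p - 1)"
    "\<And>x. x \<in> S \<Longrightarrow> \<delta> * norm (G x) powr p \<le> F x \<bullet> G x"
    "\<And>\<eta> D B. C1c S \<eta> D \<Longrightarrow> (\<And>x. \<bar>\<eta> x\<bar> \<le> B) \<Longrightarrow>
       \<bar>\<integral>x. F x \<bullet> D x \<partial>lborel\<bar> \<le> B * N * measure lborel {x. \<eta> x \<noteq> 0} powr e"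
    "continuous_on S u"
  using assms unfolding DGsol_def
  by (auto intro!: continuous_at_imp_continuous_on has_derivative_continuous)

text \<open>The bound on the right-hand side is two-sided, so the class is closed under reflection;
  upper bounds proved for \<open>c - u\<close> become lower bounds for \<open>u\<close>.\<close>

lemma DGsol_uminus:
  assumes "DGsol p \<delta> L e N S u G F"
  shows "DGsol p \<delta> L e N S (\<lambda>x. c - u x) (\<lambda>x. - G x) (\<lambda>x. - F x)"
  using assms unfolding DGsol_def
  by (auto intro!: continuous_intros derivative_eq_intros)

lemma DGsol_add:
  assumes "DGsol p \<delta> L e N S u G F"
  shows "DGsol p \<delta> L e N S (\<lambda>x. u x + c) G F"
  using assms unfolding DGsol_def
  by (auto intro!: continuous_intros derivative_eq_intros)

lemma C1c_integrable_flux: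
  fixes F D :: "'a::euclidean_space \<Rightarrow> 'a"
  assumes "C1c S \<eta> D" "continuous_on S F"
  shows "integrable lborel (\<lambda>x. F x \<bullet> D x)"
proof -
  obtain K where K: "compact K" "K \<subseteq> S" "\<And>x. x \<notin> K \<Longrightarrow> \<eta> x = 0" using assms unfolding C1c_def by blast
  show ?thesis
    by (rule integrable_continuous_compact_support[of K])
      (use K C1c_deriv_zero[OF assms(1) K(1,3)] continuous_on_subset[OF assms(2)]
         continuous_on_subset[OF C1c_continuous(2)[OF assms(1)]] in \<open>auto intro!: continuous_intros\<close>)
qed

text \<open>The Faber-Krahn constant times the bound for the L^1 norm of the gradient of
  \<open>W\<close> in \<open>energy_step\<close>; the inner fraction is the constant
  \<open>C1\<close> there, with \<open>\<tau> = \<delta> / L\<close>.\<close>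

definition energy_const :: "'a::euclidean_space itself \<Rightarrow> real \<Rightarrow> real \<Rightarrow> real \<Rightarrow> real" where
  "energy_const _ p \<delta> L = 2 * (2 / ubvol TYPE('a)) powr (1 / DIM('a)) * (3 + 2 * ((1 + L * (\<delta> / L) powr (1 - p)) / \<delta>))"

lemma energy_const_pos: "L > 0 \<Longrightarrow> \<delta> > 0 \<Longrightarrow> energy_const TYPE('a::euclidean_space) p \<delta> L > 0"
  unfolding energy_const_def using ubvol_pos[where 'a='a]
  by (intro mult_pos_pos add_pos_nonneg divide_nonneg_pos) (auto intro!: add_nonneg_nonneg)

text \<open>Testing with \<zeta> v^(p+1), where v = (u - k)_+, bounds the integral of X = \<zeta>
  v^p |G|^p, in which v G is half the gradient of v^2; so Faber-Krahn is applied to \<zeta> v^2. The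
  number \<open>T\<close> majorizes the contributions of the cut-off and of the right-hand side at
  once, and it is also the threshold that converts the p-th power of v|G| into the first power. A
  Chebyshev argument on \<open>A'\<close> ends the proof. The condition on \<open>K\<close> admits
  either a true cut-off or \<zeta> = 1 when u \<le> k near the boundary.\<close>

lemma energy_step:
  fixes u \<zeta> :: "'a::euclidean_space \<Rightarrow> real"
  assumes p: "p > 1" and \<delta>: "\<delta> > 0" and L: "L > 0"
    and sol: "DGsol p \<delta> L e N S u G F"
    and \<zeta>d: "\<And>x. x \<in> S \<Longrightarrow> (\<zeta> has_derivative (\<lambda>h. Z x \<bullet> h)) (at x)" and Zc: "continuous_on S Z"
    and \<zeta>01: "\<And>x. x \<in> S \<Longrightarrow> 0 \<le> \<zeta> x \<and> \<zeta> x \<le> 1"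
    and Z: "\<And>x. x \<in> S \<Longrightarrow> norm (Z x) \<le> \<Lambda> * \<zeta> x powr ((p - 1) / p)" and \<Lambda>: "\<Lambda> \<ge> 0"
    and K: "compact K" "K \<subseteq> S" "\<And>x. x \<in> S \<Longrightarrow> x \<notin> K \<Longrightarrow> \<zeta> x = 0 \<or> u x \<le> k"
    and H: "H > 0" "\<And>x. x \<in> S \<Longrightarrow> \<zeta> x > 0 \<Longrightarrow> u x - k \<le> H"
  defines "a \<equiv> measure lborel {x\<in>S. \<zeta> x > 0 \<and> u x > k}"
  assumes T: "T > 0" "T \<ge> \<Lambda> * H\<^sup>2" "T powr p \<ge> N * H powr (p + 1) * a powr (e - 1)"
    and A': "A' \<in> sets borel" "\<And>x. x \<in> A' \<Longrightarrow> x \<in> S \<and> \<zeta> x \<ge> z0 \<and> u x \<ge> k + d"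
      and zd: "z0 > 0" "d > 0"
  shows "measure lborel A' * (z0 * d\<^sup>2) \<le> energy_const TYPE('a) p \<delta> L * a powr (1 / DIM('a)) * a * T"
proof -
  note S = DGsolD(1)[OF sol] and N0 = DGsolD(2)[OF sol] and Gc = DGsolD(3)[OF sol]
    and Fc = DGsolD(4)[OF sol] and ud = DGsolD(5)[OF sol] and uc = DGsolD(9)[OF sol]
  have \<zeta>c: "continuous_on S \<zeta>"
    using \<zeta>d by (auto intro!: continuous_at_imp_continuous_on has_derivative_continuous)
  define A where "A = {x\<in>S. \<zeta> x > 0 \<and> u x > k}"
  define v where "v = (\<lambda>x. max 0 (u x - k))"
  have v0: "v x \<ge> 0" for x unfolding v_def by simp
  have vH: "v x \<le> H" if "x \<in> S" "\<zeta> x > 0" for x using H(2)[OF that] H(1) unfolding v_def by simp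
  have vc: "continuous_on S v" unfolding v_def using uc by (intro continuous_intros)
  have oA: "open A"
  proof -
    have "A = (S \<inter> (\<lambda>x. min (\<zeta> x) (u x - k)) -` {0<..})" unfolding A_def by auto
    moreover have "open \<dots>"
      using \<zeta>c uc S by (intro continuous_open_preimage continuous_intros) auto
    ultimately show ?thesis by simp
  qed
  have [measurable]: "A \<in> sets borel" using oA by simp
  have AK: "A \<subseteq> K" using K(3) \<zeta>01 unfolding A_def by force
  have bA: "bounded A" using AK K(1) bounded_subset compact_imp_bounded by blast
  have fA: "emeasure lborel A < \<infinity>" using emeasure_bounded_finite[OF bA] .
  have aA: "a = measure lborel A" unfolding a_def A_def by simp
  have notA: "\<zeta> x = 0 \<or> v x = 0" if "x \<in> S" "x \<notin> A" for x
    using that \<zeta>01[of x] unfolding A_def v_def by force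
  have onA: "\<zeta> x > 0" "v x > 0" if "x \<in> A" for x using that unfolding A_def v_def by auto
  have supp: "{x. (if x \<in> S then \<zeta> x * v x powr q else 0) \<noteq> 0} = A" for q
  proof (intro set_eqI iffI)
    fix x assume "x \<in> {x. (if x \<in> S then \<zeta> x * v x powr q else 0) \<noteq> 0}"
    then have "x \<in> S" "\<zeta> x \<noteq> 0" "v x \<noteq> 0" by (auto split: if_splits)
    then show "x \<in> A" using notA by blast
  next
    fix x assume x: "x \<in> A"
    then have "x \<in> S" unfolding A_def by simp
    then show "x \<in> {x. (if x \<in> S then \<zeta> x * v x powr q else 0) \<noteq> 0}" using onA[OF x] by simp
  qed
  have vd: "((\<lambda>x. v x powr q) has_derivative (\<lambda>h. (q * v x powr (q - 1)) * (G x \<bullet> h))) (at x)"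
    if "x \<in> S" "q > 1" for x q
  proof -
    have "((\<lambda>x. u x - k) has_derivative (\<lambda>h. G x \<bullet> h)) (at x)"
      using ud[OF that(1)] by (auto intro!: derivative_eq_intros)
    from has_derivative_compose[OF this, of "\<lambda>t. max 0 t powr q" "\<lambda>h. (q * v x powr (q - 1)) * h"]
    show ?thesis using pos_part_powr_deriv[OF that(2), of "u x - k"]
      unfolding v_def has_field_derivative_def by simp
  qed
  have vpc: "continuous_on S (\<lambda>x. v x powr q)" if "q > 0" for q
    using vc v0 that by (intro continuous_on_powr' continuous_intros) auto
  have glue: "C1c S (\<lambda>x. if x \<in> S then \<zeta> x * v x powr q else 0)
     (\<lambda>x. if x \<in> S then v x powr q *\<^sub>R Z x + (q * \<zeta> x * v x powr (q - 1)) *\<^sub>R G x else 0)"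
    if "q > 1" for q
  proof (rule C1c_glue[OF S K(1,2)])
    show "\<zeta> x * v x powr q = 0" if "x \<in> S" "x \<notin> K" for x
      using K(3)[OF that] by (auto simp: v_def)
    show "((\<lambda>x. \<zeta> x * v x powr q) has_derivative
         (\<bullet>) (v x powr q *\<^sub>R Z x + (q * \<zeta> x * v x powr (q - 1)) *\<^sub>R G x)) (at x)" if "x \<in> S" for x
      using has_derivative_mult[OF \<zeta>d[OF that] vd[OF that \<open>q > 1\<close>]]
      by (rule has_derivative_eq_rhs) (auto simp: inner_add_left algebra_simps)
    show "continuous_on S (\<lambda>x. v x powr q *\<^sub>R Z x + (q * \<zeta> x * v x powr (q - 1)) *\<^sub>R G x)"
      using that Zc Gc \<zeta>c vpc[of q] vpc[of "q - 1"]
      by (intro continuous_on_add continuous_on_scaleR continuous_on_mult continuous_on_const) auto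
  qed
  show ?thesis
  \<comment> \<open>For a = 0 the third condition on \<open>T\<close> is void, since
    \<open>0 powr (e - 1)\<close> is 0; but then the super-level set is an open null set, hence
    empty.\<close>
  proof (cases "a = 0")
    case True
    then have "A = {}" using measure_open_pos[OF oA _ fA] aA by fastforce
    moreover have "A' \<subseteq> A" using A'(2) zd unfolding A_def by force
    ultimately show ?thesis using True by simp
  next
    case False
    then have ap: "a > 0" using aA by (simp add: less_le)
    \<comment> \<open>With this choice the term \<open>L * \<tau> * X\<close> produced by Young's
      inequality equals \<open>\<delta> * X\<close>; of the \<open>(p + 1) * \<delta> * X\<close>
      gained by coercivity, \<open>p * \<delta> * X\<close> is left.\<close>
    define \<tau> where "\<tau> = \<delta> / L"
    have \<tau>: "\<tau> > 0" unfolding \<tau>_def using \<delta> L by simp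
    define C1 where "C1 = (1 + L * \<tau> powr (1 - p)) / \<delta>"
    define X where "X = (\<lambda>x. if x \<in> S then \<zeta> x * v x powr p * norm (G x) powr p else 0)"
    define W where "W = (\<lambda>x. if x \<in> S then \<zeta> x * v x powr 2 else 0)"
    define DW where "DW = (\<lambda>x. if x \<in> S then v x powr 2 *\<^sub>R Z x + (2 * \<zeta> x * v x powr (2 - 1)) *\<^sub>R G x else 0)"
    define \<eta> where "\<eta> = (\<lambda>x. if x \<in> S then \<zeta> x * v x powr (p + 1) else 0)"
    define D where "D = (\<lambda>x. if x \<in> S then v x powr (p + 1) *\<^sub>R Z x + ((p + 1) * \<zeta> x * v x powr (p + 1 - 1)) *\<^sub>R G x else 0)"
    have C\<eta>: "C1c S \<eta> D" unfolding \<eta>_def D_def using p by (intro glue) auto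
    have CW: "C1c S W DW" unfolding W_def DW_def by (intro glue) auto
    have X0: "X x = 0" if "x \<notin> A" for x
      using notA[of x] that p unfolding X_def by auto
    have Xn: "X x \<ge> 0" for x using \<zeta>01 unfolding X_def by auto
    have Xi: "integrable lborel X"
    proof (rule integrable_continuous_compact_support[OF _ K(1)])
      have "continuous_on S (\<lambda>x. \<zeta> x * v x powr p * norm (G x) powr p)"
      proof (intro continuous_on_mult)
        show "continuous_on S (\<lambda>x. norm (G x) powr p)"
          using p Gc by (intro continuous_on_powr' continuous_intros) auto
      qed (use p \<zeta>c vpc[of p] in auto)
      then have "continuous_on S X" by (rule continuous_on_eq) (auto simp: X_def)
      then show "continuous_on K X" using K(2) by (rule continuous_on_subset)
      show "X x = 0" if "x \<notin> K" for x using X0 AK that by blast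
    qed
    have Ai: "integrable lborel (indicator A :: 'a \<Rightarrow> real)" using fA by simp
    have DFi: "integrable lborel (\<lambda>x. F x \<bullet> D x)" by (rule C1c_integrable_flux[OF C\<eta> Fc])
    have \<zeta>p: "\<zeta> x powr ((p - 1) / p) \<le> 1" if "x \<in> S" for x
      using \<zeta>01[OF that] p by (intro powr_le1) auto
    have pt: "\<delta> * X x \<le> F x \<bullet> D x + (L * \<tau> powr (1 - p) * T powr p) * indicator A x" for x
    proof (cases "x \<in> A")
      case False
      have "D x = 0"
      proof (cases "x \<in> S")
        case True
        from notA[OF this False] show ?thesis
        proof
          assume z: "\<zeta> x = 0"
          then have "norm (Z x) \<le> 0" using Z[OF True] p by simp
          then show ?thesis using z unfolding D_def by simp
        qed (use p in \<open>simp add: D_def\<close>)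
      qed (simp add: D_def)
      then show ?thesis using X0[OF False] False by simp
    next
      case True
      then have xS: "x \<in> S" unfolding A_def by simp
      note pos = onA[OF True]
      let ?g = "norm (G x)"
      let ?Y = "\<zeta> x powr (1/p) * v x * ?g"
      have Y0: "?Y \<ge> 0" using pos by simp
      have Yp: "?Y powr p = X x"
        using pos p xS by (simp add: X_def powr_mult powr_powr)
      have "F x \<bullet> D x = v x powr (p + 1) * (F x \<bullet> Z x) + (p + 1) * \<zeta> x * v x powr p * (F x \<bullet> G x)"
        using xS unfolding D_def by (simp add: inner_add_right)
      moreover have "(p + 1) * \<zeta> x * v x powr p * (F x \<bullet> G x) \<ge> (p + 1) * \<delta> * X x"
      proof -
        have "(p + 1) * \<zeta> x * v x powr p * (\<delta> * ?g powr p) \<le> (p + 1) * \<zeta> x * v x powr p * (F x \<bullet> G x)"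
          using DGsolD(7)[OF sol xS] pos p by (intro mult_left_mono) auto
        then show ?thesis using xS unfolding X_def by (simp add: mult_ac)
      qed
      moreover have "v x powr (p + 1) * (F x \<bullet> Z x) \<ge> - (L * (?Y powr (p - 1) * T))"
      proof -
        have "\<bar>F x \<bullet> Z x\<bar> \<le> norm (F x) * norm (Z x)" by (rule Cauchy_Schwarz_ineq2)
        also have "\<dots> \<le> (L * ?g powr (p - 1)) * (\<Lambda> * \<zeta> x powr ((p - 1) / p))"
          using DGsolD(6)[OF sol xS] Z[OF xS] L by (intro mult_mono) auto
        finally have "v x powr (p + 1) * \<bar>F x \<bullet> Z x\<bar> \<le> v x powr (p + 1) * ((L * ?g powr (p - 1)) * (\<Lambda> * \<zeta> x powr ((p - 1) / p)))"
          by (intro mult_left_mono) auto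
        also have "\<dots> = L * (?Y powr (p - 1) * (\<Lambda> * (v x)\<^sup>2))"
        proof -
          have "v x powr (p + 1) = v x powr (p - 1) * v x powr 2"
            by (simp add: powr_add[symmetric] add.commute)
          then have "v x powr (p + 1) = v x powr (p - 1) * (v x)\<^sup>2"
            using pos by (simp add: powr_numeral)
          moreover have "?Y powr (p - 1) = \<zeta> x powr ((p - 1) / p) * v x powr (p - 1) * ?g powr (p - 1)"
            using pos by (simp add: powr_mult powr_powr)
          ultimately show ?thesis by simp
        qed
        also have "\<dots> \<le> L * (?Y powr (p - 1) * T)"
        proof -
          have "\<Lambda> * (v x)\<^sup>2 \<le> \<Lambda> * H\<^sup>2"
            using vH[OF xS pos(1)] v0 \<Lambda> by (intro mult_left_mono power_mono) auto
          then have "\<Lambda> * (v x)\<^sup>2 \<le> T" using T(2) by simp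
          then show ?thesis using L by (intro mult_left_mono) auto
        qed
        finally have "v x powr (p + 1) * \<bar>F x \<bullet> Z x\<bar> \<le> L * (?Y powr (p - 1) * T)" .
        moreover have "v x powr (p + 1) * (F x \<bullet> Z x) \<ge> - (v x powr (p + 1) * \<bar>F x \<bullet> Z x\<bar>)"
          by (simp add: abs_if mult_nonneg_nonpos)
        ultimately show ?thesis by linarith
      qed
      moreover have "L * (?Y powr (p - 1) * T) \<le> L * (\<tau> * X x + \<tau> powr (1 - p) * T powr p)"
        using young_crude[OF Y0, of T \<tau> p] T \<tau> p L Yp by (intro mult_left_mono) auto
      moreover have "L * (\<tau> * X x) = \<delta> * X x" unfolding \<tau>_def using L by simp
      moreover have "p * \<delta> * X x \<ge> 1 * \<delta> * X x" using p \<delta> Xn[of x] by (intro mult_right_mono) auto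
      ultimately have "F x \<bullet> D x \<ge> \<delta> * X x - L * (\<tau> powr (1 - p) * T powr p)"
        by (simp add: algebra_simps)
      then show ?thesis using True by simp
    qed
    have Xint: "(\<integral>x. X x \<partial>lborel) \<le> C1 * T powr p * a"
    proof -
      have "\<delta> * (\<integral>x. X x \<partial>lborel) = (\<integral>x. \<delta> * X x \<partial>lborel)" by simp
      also have "\<dots> \<le> (\<integral>x. F x \<bullet> D x + (L * \<tau> powr (1 - p) * T powr p) * indicator A x \<partial>lborel)"
        using Xi DFi Ai pt by (intro integral_mono) auto
      also have "\<dots> = (\<integral>x. F x \<bullet> D x \<partial>lborel) + (L * \<tau> powr (1 - p) * T powr p) * a"
        using DFi Ai by (subst Bochner_Integration.integral_add) (auto simp: aA)
      also have "(\<integral>x. F x \<bullet> D x \<partial>lborel) \<le> H powr (p + 1) * N * a powr e"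
      proof -
        have "\<bar>\<eta> x\<bar> \<le> H powr (p + 1)" for x
        proof (cases "x \<in> S \<and> \<zeta> x > 0")
          case True
          have "\<zeta> x * v x powr (p + 1) \<le> 1 * H powr (p + 1)"
            using \<zeta>01[of x] vH[of x] True p v0 by (intro mult_mono powr_mono2) auto
          then show ?thesis using True unfolding \<eta>_def by (simp add: abs_mult)
        next
          case False
          then show ?thesis using \<zeta>01[of x] unfolding \<eta>_def by force
        qed
        from DGsolD(8)[OF sol C\<eta> this] have "(\<integral>x. F x \<bullet> D x \<partial>lborel) \<le> H powr (p + 1) * N * measure lborel {x. \<eta> x \<noteq> 0} powr e"
          by simp
        moreover have "{x. \<eta> x \<noteq> 0} = A" unfolding \<eta>_def by (rule supp)
        ultimately show ?thesis using aA by simp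
      qed
      also have "H powr (p + 1) * N * a powr e = (N * H powr (p + 1) * a powr (e - 1)) * a"
        using ap by (simp add: powr_diff)
      also have "\<dots> \<le> T powr p * a" using T(3) ap by (intro mult_right_mono) auto
      finally have "\<delta> * (\<integral>x. X x \<partial>lborel) \<le> (1 + L * \<tau> powr (1 - p)) * T powr p * a"
        by (simp add: algebra_simps)
      then show ?thesis unfolding C1_def using \<delta> by (simp add: field_simps)
    qed
    have DWpt: "norm (DW x) \<le> 3 * T * indicator A x + 2 * T powr (1 - p) * X x" for x
    proof (cases "x \<in> A")
      case False
      have "DW x = 0"
      proof (cases "x \<in> S")
        case True
        from notA[OF this False] show ?thesis
        proof
          assume z: "\<zeta> x = 0"
          then have "norm (Z x) \<le> 0" using Z[OF True] p by simp
          then show ?thesis using z unfolding DW_def by simp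
        qed (simp add: DW_def)
      qed (simp add: DW_def)
      then show ?thesis using X0[OF False] False by simp
    next
      case True
      then have xS: "x \<in> S" unfolding A_def by simp
      note pos = onA[OF True]
      have "norm (DW x) \<le> (v x)\<^sup>2 * norm (Z x) + 2 * \<zeta> x * v x * norm (G x)"
        using norm_triangle_ineq[of "v x powr 2 *\<^sub>R Z x" "(2 * \<zeta> x * v x powr (2 - 1)) *\<^sub>R G x"] xS pos
        unfolding DW_def by (simp add: powr_numeral)
      also have "(v x)\<^sup>2 * norm (Z x) \<le> H\<^sup>2 * (\<Lambda> * 1)"
        using vH[OF xS pos(1)] v0 Z[OF xS] \<Lambda> mult_left_mono[OF \<zeta>p[OF xS] \<Lambda>]
        by (intro mult_mono power_mono) auto
      also have "\<dots> \<le> T" using T(2) by (simp add: mult.commute)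
      also have "2 * \<zeta> x * v x * norm (G x) \<le> 2 * \<zeta> x * (T powr (1 - p) * (v x * norm (G x)) powr p + T)"
        using le_powr_split[of "v x * norm (G x)" T p] T p pos
        by (simp add: mult.assoc)
      also have "\<dots> = 2 * T powr (1 - p) * X x + 2 * T * \<zeta> x"
        using xS pos unfolding X_def by (simp add: powr_mult algebra_simps)
      also have "2 * T * \<zeta> x \<le> 2 * T * 1" using \<zeta>01[OF xS] T by (intro mult_left_mono) auto
      finally show ?thesis using True by simp
    qed
    have DWint: "(\<integral>x. norm (DW x) \<partial>lborel) \<le> (3 + 2 * C1) * T * a"
    proof -
      have "(\<integral>x. norm (DW x) \<partial>lborel) \<le> (\<integral>x. 3 * T * indicator A x + 2 * T powr (1 - p) * X x \<partial>lborel)"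
      proof (rule integral_mono)
        have "C1c UNIV W DW" using C1c_mono[OF CW] by auto
        show "integrable lborel (\<lambda>x. norm (DW x))"
        proof (rule integrable_continuous_compact_support[OF _ K(1)])
          show "continuous_on K (\<lambda>x. norm (DW x))"
            using continuous_on_subset[OF C1c_continuous(2)[OF CW]] by (auto intro!: continuous_intros)
          show "norm (DW x) = 0" if "x \<notin> K" for x
          proof -
            have "x \<notin> A" using AK that by blast
            then show ?thesis using DWpt[of x] X0[of x] by simp
          qed
        qed
      qed (use Xi Ai DWpt in auto)
      also have "\<dots> = 3 * T * a + 2 * T powr (1 - p) * (\<integral>x. X x \<partial>lborel)"
        using Xi Ai by (subst Bochner_Integration.integral_add) (auto simp: aA)
      also have "2 * T powr (1 - p) * (\<integral>x. X x \<partial>lborel) \<le> 2 * T powr (1 - p) * (C1 * T powr p * a)"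
        using Xint by (intro mult_left_mono) auto
      also have "\<dots> = 2 * C1 * T * a" using T by (simp add: powr_diff)
      finally show ?thesis by (simp add: algebra_simps)
    qed
    have "{x. W x \<noteq> 0} = A" unfolding W_def by (rule supp)
    then have "(\<integral>x. \<bar>W x\<bar> \<partial>lborel) \<le> 2 * (2 / ubvol TYPE('a)) powr (1 / DIM('a)) * a powr (1 / DIM('a)) * (\<integral>x. norm (DW x) \<partial>lborel)"
      using Faber_Krahn[of W DW] C1c_mono[OF CW, of UNIV] aA by simp
    also have "\<dots> \<le> 2 * (2 / ubvol TYPE('a)) powr (1 / DIM('a)) * a powr (1 / DIM('a)) * ((3 + 2 * C1) * T * a)"
      using DWint by (intro mult_left_mono) auto
    also have "\<dots> = energy_const TYPE('a) p \<delta> L * a powr (1 / DIM('a)) * a * T"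
      unfolding energy_const_def C1_def \<tau>_def by (simp add: mult_ac)
    finally have fin: "(\<integral>x. \<bar>W x\<bar> \<partial>lborel) \<le> energy_const TYPE('a) p \<delta> L * a powr (1 / DIM('a)) * a * T" .
    have A'A: "A' \<subseteq> A" using A'(2) zd unfolding A_def by force
    then have fA': "emeasure lborel A' < \<infinity>"
      using fA emeasure_mono[of A' A lborel] by (simp add: order_le_less_trans)
    have "measure lborel A' * (z0 * d\<^sup>2) = (\<integral>x. (z0 * d\<^sup>2) * indicator A' x \<partial>lborel)" 
      using A'(1) by simp
    also have "\<dots> \<le> (\<integral>x. \<bar>W x\<bar> \<partial>lborel)"
    proof (rule integral_mono)
      show "integrable lborel (\<lambda>x. (z0 * d\<^sup>2) * indicator A' x)" using A'(1) fA' by simp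
      show "integrable lborel (\<lambda>x. \<bar>W x\<bar>)"
      proof (rule integrable_continuous_compact_support[OF _ K(1)])
        show "continuous_on K (\<lambda>x. \<bar>W x\<bar>)"
          using continuous_on_subset[OF C1c_continuous(1)[OF CW]] by (auto intro!: continuous_intros)
        show "\<bar>W x\<bar> = 0" if "x \<notin> K" for x
          using \<open>{x. W x \<noteq> 0} = A\<close> AK that by auto
      qed
      show "(z0 * d\<^sup>2) * indicator A' x \<le> \<bar>W x\<bar>" for x
      proof (cases "x \<in> A'")
        case True
        then have h: "x \<in> S" "\<zeta> x \<ge> z0" "u x \<ge> k + d" using A'(2) by auto
        then have "v x \<ge> d" using zd unfolding v_def by simp
        then have "z0 * d\<^sup>2 \<le> \<zeta> x * (v x)\<^sup>2" using h zd by (intro mult_mono power_mono) auto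
        then show ?thesis using True h zd \<open>v x \<ge> d\<close> unfolding W_def by (simp add: powr_numeral)
      qed simp
    qed
    finally show ?thesis using fin by linarith
  qed
qed

subsection \<open>Cut-off functions\<close>

text \<open>The exponent \<open>p\<close> makes the gradient of the cut-off \<open>\<zeta>\<close> comparable to \<open>\<zeta> powr ((p - 1) / p)\<close>,
  as needed in the energy estimate.\<close>

definition cut :: "real \<Rightarrow> 'a::euclidean_space \<Rightarrow> real \<Rightarrow> 'a \<Rightarrow> real" where
  "cut p x0 \<rho> x = max 0 (1 - (norm (x - x0))\<^sup>2 / \<rho>\<^sup>2) powr p"

definition dcut :: "real \<Rightarrow> 'a::euclidean_space \<Rightarrow> real \<Rightarrow> 'a \<Rightarrow> 'a" where
  "dcut p x0 \<rho> x = (p * max 0 (1 - (norm (x - x0))\<^sup>2 / \<rho>\<^sup>2) powr (p - 1) * (- 2 / \<rho>\<^sup>2)) *\<^sub>R (x - x0)"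

lemma cut_has_derivative:
  assumes "p > 1"
  shows "(cut p x0 \<rho> has_derivative (\<lambda>h. dcut p x0 \<rho> x \<bullet> h)) (at x)"
proof -
  have 1: "((\<lambda>x. 1 - (norm (x - x0))\<^sup>2 / \<rho>\<^sup>2) has_derivative (\<lambda>h. - (2 * ((x - x0) \<bullet> h) / \<rho>\<^sup>2))) (at x)"
    unfolding power2_norm_eq_inner divide_inverse
    by (auto intro!: derivative_eq_intros simp: inner_commute algebra_simps)
  show ?thesis
    unfolding cut_def
    by (rule has_derivative_eq_rhs[OF has_derivative_compose[OF 1
          pos_part_powr_deriv[OF assms, unfolded has_field_derivative_def]]])
      (auto simp: dcut_def fun_eq_iff)
qed

lemma dcut_continuous:
  assumes "p > 1" shows "continuous_on UNIV (dcut p x0 \<rho>)"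
proof -
  have "continuous_on UNIV (\<lambda>x. max 0 (1 - (norm (x - x0))\<^sup>2 / \<rho>\<^sup>2) powr (p - 1))"
    using assms unfolding divide_inverse by (intro continuous_on_powr' continuous_intros) auto
  then show ?thesis unfolding dcut_def
    by (intro continuous_on_scaleR continuous_on_mult continuous_on_const continuous_on_diff continuous_on_id)
qed

lemma cut_bounds: "p > 0 \<Longrightarrow> 0 \<le> cut p x0 \<rho> x \<and> cut p x0 \<rho> x \<le> 1"
  unfolding cut_def by (auto intro!: powr_le1)

lemma cut_pos_iff:
  assumes "\<rho> > 0" shows "cut p x0 \<rho> x > 0 \<longleftrightarrow> x \<in> ball x0 \<rho>"
proof -
  have *: "max 0 t powr p > 0 \<longleftrightarrow> t > 0" for t :: real by (auto simp: max_def)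
  have "x \<in> ball x0 \<rho> \<longleftrightarrow> norm (x - x0) < \<rho>" by (simp add: dist_norm norm_minus_commute)
  also have "\<dots> \<longleftrightarrow> (norm (x - x0))\<^sup>2 < \<rho>\<^sup>2" using assms by (metis norm_ge_zero less_eq_real_def power2_less_imp_less power_strict_mono zero_less_numeral)
  also have "\<dots> \<longleftrightarrow> 1 - (norm (x - x0))\<^sup>2 / \<rho>\<^sup>2 > 0" using assms by (simp add: field_simps)
  also have "\<dots> \<longleftrightarrow> cut p x0 \<rho> x > 0" unfolding cut_def by (simp only: *)
  finally show ?thesis by simp
qed

lemma dcut_bound:
  assumes "p > 1" "\<rho> > 0"
  shows "norm (dcut p x0 \<rho> x) \<le> (2 * p / \<rho>) * cut p x0 \<rho> x powr ((p - 1) / p)"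
proof (cases "x \<in> ball x0 \<rho>")
  case True
  define s where "s = max 0 (1 - (norm (x - x0))\<^sup>2 / \<rho>\<^sup>2)"
  have n: "norm (x - x0) \<le> \<rho>" using True by (simp add: dist_norm norm_minus_commute)
  have "norm (dcut p x0 \<rho> x) = (2 * p / \<rho>\<^sup>2 * s powr (p - 1)) * norm (x - x0)"
    unfolding dcut_def s_def[symmetric] using assms by (simp add: abs_mult)
  also have "\<dots> \<le> (2 * p / \<rho>\<^sup>2 * s powr (p - 1)) * \<rho>"
    using n assms by (intro mult_left_mono) auto
  also have "\<dots> = (2 * p / \<rho>) * s powr (p - 1)"
    using assms by (simp add: power2_eq_square)
  also have "s powr (p - 1) = cut p x0 \<rho> x powr ((p - 1) / p)"
    unfolding cut_def s_def[symmetric] using assms by (simp add: powr_powr)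
  finally show ?thesis .
next
  case False
  then have "\<not> cut p x0 \<rho> x > 0" using cut_pos_iff assms by blast
  then have "max 0 (1 - (norm (x - x0))\<^sup>2 / \<rho>\<^sup>2) = 0" unfolding cut_def by (auto simp: max_def split: if_splits)
  then show ?thesis unfolding dcut_def cut_def by simp
qed

lemma cut_lower:
  assumes "x \<in> ball x0 \<rho>'" "0 < \<rho>'" "\<rho>' \<le> \<rho>" "p > 0"
  shows "cut p x0 \<rho> x \<ge> (1 - \<rho>'\<^sup>2 / \<rho>\<^sup>2) powr p"
proof -
  have "norm (x - x0) \<le> \<rho>'" using assms by (simp add: dist_norm norm_minus_commute)
  then have "(norm (x - x0))\<^sup>2 / \<rho>\<^sup>2 \<le> \<rho>'\<^sup>2 / \<rho>\<^sup>2" using assms by (intro divide_right_mono power_mono) auto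
  moreover have "\<rho>'\<^sup>2 / \<rho>\<^sup>2 \<le> 1" using assms by (simp add: power_mono)
  ultimately show ?thesis unfolding cut_def using assms by (intro powr_mono2) auto
qed

lemma open_superlevel:
  fixes u :: "'a::topological_space \<Rightarrow> real"
  assumes "open B" "continuous_on B u"
  shows "open {x\<in>B. u x > k}"
proof -
  have "{x\<in>B. u x > k} = B \<inter> u -` {k<..}" by auto
  then show ?thesis using assms by (simp add: continuous_open_preimage)
qed

lemma measure_ball_mono:
  fixes x0 :: "'a::euclidean_space"
  assumes "E \<in> sets borel" "E \<subseteq> ball x0 r"
  shows "measure lborel E \<le> measure lborel (ball x0 r)" "emeasure lborel E < \<infinity>"
proof -
  have "emeasure lborel E \<le> emeasure lborel (ball x0 r)" using assms by (intro emeasure_mono) auto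
  then show f: "emeasure lborel E < \<infinity>"
    using emeasure_lborel_ball_finite[of x0 r] by (simp add: order_le_less_trans)
  show "measure lborel E \<le> measure lborel (ball x0 r)"
    using assms emeasure_lborel_ball_finite[of x0 r] by (intro measure_mono_fmeasurable) (auto simp: fmeasurable_def)
qed

text \<open>The threshold \<open>\<nu>\<close> is the value for which
  \<open>C * \<nu> powr \<alpha> = b powr (- 1 / \<alpha>)\<close>: then the bound \<nu>
  b^(-j/\<alpha>) reproduces itself under the recursion, the superlinear power beating the growing
  factor b^j.\<close>

lemma fast_geometric_decay:
  fixes y :: "nat \<Rightarrow> real"
  assumes C: "C > 0" "b > 1" "\<alpha> > 0" and y: "\<And>j. y j \<ge> 0"
    and step: "\<And>j. y (Suc j) \<le> C * b powr j * y j powr (1 + \<alpha>)"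
    and y0: "y 0 \<le> C powr (- 1 / \<alpha>) * b powr (- 1 / \<alpha>\<^sup>2)"
  shows "y \<longlonglongrightarrow> 0"
proof -
  define \<nu> where "\<nu> = C powr (- 1 / \<alpha>) * b powr (- 1 / \<alpha>\<^sup>2)"
  have \<nu>: "\<nu> > 0" unfolding \<nu>_def using C by simp
  have C\<nu>: "C * \<nu> powr \<alpha> = b powr (- 1 / \<alpha>)"
  proof -
    have "- 1 / \<alpha> * \<alpha> = - 1" "- 1 / \<alpha>\<^sup>2 * \<alpha> = - 1 / \<alpha>" using C by (auto simp: power2_eq_square)
    then have "\<nu> powr \<alpha> = C powr (- 1) * b powr (- 1 / \<alpha>)"
      unfolding \<nu>_def using C by (simp add: powr_mult powr_powr)
    then show ?thesis using C by (simp add: powr_minus)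
  qed
  have claim: "y j \<le> \<nu> * b powr (- real j / \<alpha>)" for j
  proof (induction j)
    case 0 then show ?case using y0 C unfolding \<nu>_def by simp
  next
    case (Suc j)
    have "y (Suc j) \<le> C * b powr j * y j powr (1 + \<alpha>)" by (rule step)
    also have "\<dots> \<le> C * b powr j * (\<nu> * b powr (- real j / \<alpha>)) powr (1 + \<alpha>)"
      using Suc y C by (intro mult_left_mono powr_mono2) auto
    also have "\<dots> = (C * \<nu> powr \<alpha>) * \<nu> * (b powr j * b powr ((- real j / \<alpha>) * (1 + \<alpha>)))"
    proof -
      have "(\<nu> * b powr z) powr (1 + \<alpha>) = \<nu> * \<nu> powr \<alpha> * b powr (z * (1 + \<alpha>))" for z
        using \<nu> C by (simp add: powr_mult powr_powr powr_add[of \<nu>])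
      then show ?thesis by simp
    qed
    also have "\<dots> = \<nu> * b powr (- 1 / \<alpha> + (j + (- real j / \<alpha>) * (1 + \<alpha>)))"
      unfolding C\<nu> powr_add by (simp only: mult_ac)
    also have "- 1 / \<alpha> + (j + (- real j / \<alpha>) * (1 + \<alpha>)) = - real (Suc j) / \<alpha>"
      using C by (simp add: field_simps)
    finally show ?case .
  qed
  have "(\<lambda>j. \<nu> * (b powr (- 1 / \<alpha>)) ^ j) \<longlonglongrightarrow> \<nu> * 0"
    using C by (intro tendsto_mult tendsto_const LIMSEQ_power_zero) (simp add: powr_less_one)
  moreover have "(\<lambda>j. \<nu> * (b powr (- 1 / \<alpha>)) ^ j) = (\<lambda>j. \<nu> * b powr (- real j / \<alpha>))"
    using C by (simp add: powr_realpow[symmetric] powr_powr)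
  ultimately have "(\<lambda>j. \<nu> * b powr (- real j / \<alpha>)) \<longlonglongrightarrow> 0" by (simp only: mult_zero_right)
  then show ?thesis
    by (rule tendsto_sandwich[rotated 2, OF tendsto_const]) (use y claim in auto)
qed

text \<open>For \<open>e = 1 - 1 / q\<close> the lower bound on \<open>e\<close> is the condition q
  > n/p, under which each iteration step gains a positive power of the measure. The argument
  \<open>TA\<close> makes the ambient space, hence n and \<omega>, part of the locale.\<close>

locale DG_exponents =
  fixes TA :: "'a::euclidean_space itself" and p \<delta> L e n \<omega> :: real
  assumes p: "p > 1" and \<delta>: "\<delta> > 0" and L: "L > 0"
    and e: "0 \<le> e" "e \<le> 1" "e > 1 - p / DIM('a)"
    and n_def: "n = real DIM('a)" and \<omega>_def: "\<omega> = ubvol TYPE('a)"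
begin

text \<open>The scaling exponent: in a ball of radius r the bound \<open>N\<close> acts as
  \<open>N * r powr \<gamma>\<close>, which has the dimension of u^(p-1).\<close>

definition "\<gamma> = p - n + n * e"

lemma n_pos: "n > 0" unfolding n_def by simp

lemma \<gamma>_pos: "\<gamma> > 0"
proof -
  have "n * e > n * (1 - p / n)" using e(3) n_pos unfolding n_def[symmetric] by (intro mult_strict_left_mono) auto
  then show ?thesis using n_pos unfolding \<gamma>_def by (simp add: algebra_simps)
qed

lemma \<omega>_pos: "\<omega> > 0" unfolding \<omega>_def by (rule ubvol_pos)

lemma mball: "r > 0 \<Longrightarrow> measure lborel (ball (x::'a) r) = r powr n * \<omega>"
  by (simp add: measure_ball n_def \<omega>_def powr_realpow)

text \<open>\<open>energy_step\<close> is iterated over radii decreasing from r to r/2 and levels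
  increasing from \<open>k0\<close> to \<open>k0 + H / 2\<close>. After division by r^n the measures
  of the super-level sets satisfy a superlinear recursion with constants free of r and H; the
  condition \<open>N * r powr \<gamma> \<le> H powr (p - 1)\<close> is what removes \<open>N\<close>
  from it.\<close>

lemma de_giorgi:
  obtains \<nu> where "\<nu> > 0" "\<And>N S (u::'a \<Rightarrow> real) G F x0 r k0 H x.
    \<lbrakk>DGsol p \<delta> L e N S u G F; cball x0 r \<subseteq> S; r > 0; H > 0; \<forall>x\<in>ball x0 r. u x \<le> k0 + H;
     N * r powr \<gamma> \<le> H powr (p - 1);
     measure lborel {x\<in>ball x0 r. u x > k0} \<le> \<nu> * measure lborel (ball x0 r);
     x \<in> ball x0 (r / 2)\<rbrakk> \<Longrightarrow> u x \<le> k0 + H / 2"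
proof -
  \<comment> \<open>This equals \<gamma>/(np): 1/n is the gain from Faber-Krahn, and (1 - e)/p is
    what the right-hand side costs.\<close>
  define \<alpha> where "\<alpha> = 1 / n - (1 - e) / p"
  have \<alpha>: "\<alpha> > 0"
  proof -
    have "(1 - e) / p < (p / n) / p" using e p unfolding n_def by (intro divide_strict_right_mono) auto
    then show ?thesis unfolding \<alpha>_def using p by simp
  qed
  define E where "E = energy_const TYPE('a) p \<delta> L"
  have E: "E > 0" unfolding E_def by (rule energy_const_pos[OF L \<delta>])
  define C where "C = E * 4 powr (p + 2) * (4 * p * \<omega> powr ((1 - e) / p) + 1)"
  define b where "b = (2::real) powr (p + 2)"
  have C: "C > 0" unfolding C_def using E p by (intro mult_pos_pos add_nonneg_pos) auto
  have b: "b > 1" unfolding b_def using p by simp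
  define \<nu>' where "\<nu>' = C powr (- 1 / \<alpha>) * b powr (- 1 / \<alpha>\<^sup>2)"
  have \<nu>': "\<nu>' > 0" unfolding \<nu>'_def using C b by simp
  show thesis
  \<comment> \<open>The sequence \<open>y\<close> is normalized by r^n, the hypothesis by the volume
    \<omega> r^n of the ball.\<close>
  proof (rule that[of "\<nu>' / \<omega>"])
    show "\<nu>' / \<omega> > 0" using \<nu>' \<omega>_pos by simp
    fix N S and u :: "'a \<Rightarrow> real" and G F x0 r k0 H x
    assume sol: "DGsol p \<delta> L e N S u G F" and cb: "cball x0 r \<subseteq> S" and r: "r > 0" and H: "H > 0"
      and uH: "\<forall>x\<in>ball x0 r. u x \<le> k0 + H" and N: "N * r powr \<gamma> \<le> H powr (p - 1)"
      and small: "measure lborel {x\<in>ball x0 r. u x > k0} \<le> \<nu>' / \<omega> * measure lborel (ball x0 r)"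
      and x: "x \<in> ball x0 (r / 2)"
    note uc = DGsolD(9)[OF sol] and N0 = DGsolD(2)[OF sol]
    define q where "q = (\<lambda>j::nat. (1/2::real) ^ j)"
    define \<rho> where "\<rho> = (\<lambda>j. r / 2 * (1 + q j))"
    define k where "k = (\<lambda>j. k0 + H / 2 * (1 - q j))"
    define A where "A = (\<lambda>j. {x\<in>ball x0 (\<rho> j). u x > k j})"
    define y where "y = (\<lambda>j. measure lborel (A j) / r powr n)"
    have q: "0 < q j" "q j \<le> 1" "q (Suc j) = q j / 2" for j
      unfolding q_def by (auto simp: power_le_one)
    have \<rho>b: "0 < \<rho> j" "\<rho> j \<le> r" "r / 2 \<le> \<rho> j" "\<rho> (Suc j) \<le> \<rho> j" for j
    proof -
      show "0 < \<rho> j" using r q[of j] unfolding \<rho>_def by (intro mult_pos_pos add_pos_pos) auto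
      show "r / 2 \<le> \<rho> j" using r q[of j] unfolding \<rho>_def by (simp add: field_simps)
      have "r / 2 * (1 + q j) \<le> r / 2 * 2" using q[of j] r by (intro mult_left_mono) auto
      then show "\<rho> j \<le> r" unfolding \<rho>_def by simp
      show "\<rho> (Suc j) \<le> \<rho> j" using r q[of j] unfolding \<rho>_def by (intro mult_left_mono) auto
    qed
    have bS: "ball x0 (\<rho> j) \<subseteq> ball x0 r" "ball x0 (\<rho> j) \<subseteq> S" for j
      using \<rho>b[of j] cb by auto
    have Ao: "open (A j)" for j
      unfolding A_def by (intro open_superlevel continuous_on_subset[OF uc] open_ball bS(2))
    have Am[measurable]: "A j \<in> sets borel" for j using Ao by simp
    have Ab: "A j \<subseteq> ball x0 r" for j using bS(1) unfolding A_def by blast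
    have y0: "y j \<ge> 0" for j unfolding y_def by simp
    have y\<omega>: "y j \<le> \<omega>" for j
      unfolding y_def using measure_ball_mono(1)[OF Am Ab, of j] mball[OF r, of x0] r by (simp add: field_simps)
    have step: "y (Suc j) \<le> C * b powr j * y j powr (1 + \<alpha>)" for j
    proof (cases "y j = 0")
      case True
      then have "A j = {}"
        using measure_open_pos[OF Ao _ measure_ball_mono(2)[OF Am Ab], of j] r unfolding y_def by auto
      moreover have "A (Suc j) \<subseteq> A j"
      proof -
        have "k j \<le> k (Suc j)" using H q[of j] unfolding k_def by simp
        then show ?thesis using \<rho>b(4)[of j] unfolding A_def by force
      qed
      ultimately show ?thesis unfolding y_def by simp
    next
      case False
      then have yp: "y j > 0" using y0[of j] by simp
      define Y where "Y = y j"
      \<comment> \<open>The two summands answer the two lower bounds required of \<open>T\<close>: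
        the cut-off constant 2p/\<rho> is at most 4p/r, and N \<le> H^(p-1) r^(-\<gamma>) turns the
        contribution of the right-hand side into (H^2/r)^p Y^(e-1).\<close>
      define T where "T = H\<^sup>2 / r * (4 * p + Y powr ((e - 1) / p))"
      have T0: "T > 0" unfolding T_def using H r p by (intro mult_pos_pos add_pos_nonneg divide_pos_pos) auto
      have a: "measure lborel (A j) = r powr n * Y" unfolding Y_def y_def using r by simp
      have Aeq: "{x\<in>S. cut p x0 (\<rho> j) x > 0 \<and> u x > k j} = A j"
        using bS(2)[of j] cut_pos_iff[OF \<rho>b(1)[of j]] unfolding A_def by blast
      have z0: "(1 - (\<rho> (Suc j))\<^sup>2 / (\<rho> j)\<^sup>2) \<ge> q j / 4"
      proof -
        define t where "t = \<rho> (Suc j) / \<rho> j"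
        have t: "0 < t" "t \<le> 1" using \<rho>b[of j] \<rho>b(1)[of "Suc j"] unfolding t_def by auto
        have "1 - t = (q j / 2) / (1 + q j)"
        proof -
          have "t = (1 + q j / 2) / (1 + q j)" using r unfolding t_def \<rho>_def q(3) by simp
          moreover have "1 + q j \<noteq> 0" using q[of j] by linarith
          ultimately show ?thesis by (simp add: field_simps)
        qed
        also have "\<dots> \<ge> (q j / 2) / 2" using q[of j] by (intro divide_left_mono) auto
        finally have "1 - t \<ge> q j / 4" by simp
        moreover have "t\<^sup>2 \<le> t" using t by (simp add: power2_eq_square mult_le_one mult_left_le)
        ultimately have "1 - t\<^sup>2 \<ge> q j / 4" by linarith
        then show ?thesis unfolding t_def by (simp add: power_divide)
      qed
      have "measure lborel (A (Suc j)) * ((q j / 4) powr p * (H * q j / 4)\<^sup>2)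
        \<le> energy_const TYPE('a) p \<delta> L * measure lborel {x\<in>S. cut p x0 (\<rho> j) x > 0 \<and> u x > k j} powr (1 / DIM('a))
            * measure lborel {x\<in>S. cut p x0 (\<rho> j) x > 0 \<and> u x > k j} * T"
      proof (rule energy_step[OF p \<delta> L sol cut_has_derivative[OF p]])
        show "continuous_on S (dcut p x0 (\<rho> j))"
          using dcut_continuous[OF p] by (rule continuous_on_subset) auto
        show "0 \<le> cut p x0 (\<rho> j) x \<and> cut p x0 (\<rho> j) x \<le> 1" for x using cut_bounds[of p x0 "\<rho> j" x] p by simp
        show "norm (dcut p x0 (\<rho> j) x) \<le> (2 * p / \<rho> j) * cut p x0 (\<rho> j) x powr ((p - 1) / p)" for x
          using dcut_bound[OF p \<rho>b(1)] .
        show "0 \<le> 2 * p / \<rho> j" using p \<rho>b(1)[of j] by simp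
        show "compact (cball x0 (\<rho> j))" "cball x0 (\<rho> j) \<subseteq> S" using \<rho>b(2)[of j] cb by auto
        show "cut p x0 (\<rho> j) x = 0 \<or> u x \<le> k j" if "x \<notin> cball x0 (\<rho> j)" for x
          using cut_pos_iff[OF \<rho>b(1)[of j], of p x0 x] that cut_bounds[of p x0 "\<rho> j" x] p by (auto simp: less_le)
        show "H > 0" by fact
        show "u x - k j \<le> H" if "0 < cut p x0 (\<rho> j) x" for x
        proof -
          have "x \<in> ball x0 r" using that cut_pos_iff[OF \<rho>b(1)] bS(1) by blast
          moreover have "k j \<ge> k0" using H q[of j] unfolding k_def by simp
          ultimately show ?thesis using uH[rule_format, of x] by linarith
        qed
        show "T > 0" by fact
        show "2 * p / \<rho> j * H\<^sup>2 \<le> T"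
        proof -
          have "2 * p / \<rho> j \<le> 2 * p / (r / 2)" using \<rho>b(3)[of j] r p by (intro divide_left_mono) auto
          then have "2 * p / \<rho> j * H\<^sup>2 \<le> 4 * p / r * H\<^sup>2" by (intro mult_right_mono) auto
          also have "\<dots> = H\<^sup>2 / r * (4 * p)" by simp
          also have "\<dots> \<le> T" unfolding T_def using r by (intro mult_left_mono) auto
          finally show ?thesis .
        qed
        show "N * H powr (p + 1) * measure lborel {x\<in>S. cut p x0 (\<rho> j) x > 0 \<and> u x > k j} powr (e - 1) \<le> T powr p"
        proof -
          have "N \<le> H powr (p - 1) * r powr (- \<gamma>)"
            using N r by (simp add: powr_minus field_simps)
          then have "N * H powr (p + 1) * (r powr n * Y) powr (e - 1)
             \<le> H powr (p - 1) * r powr (- \<gamma>) * H powr (p + 1) * (r powr n * Y) powr (e - 1)"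
            by (intro mult_right_mono) auto
          also have "\<dots> = (H powr (p - 1) * H powr (p + 1)) * (r powr (- \<gamma>) * r powr (n * (e - 1))) * Y powr (e - 1)"
            using r yp unfolding Y_def by (simp add: powr_mult powr_powr)
          also have "\<dots> = H powr (2 * p) * r powr (- p) * Y powr (e - 1)"
            unfolding powr_add[symmetric] \<gamma>_def by (simp add: algebra_simps)
          also have "\<dots> = (H\<^sup>2 / r * Y powr ((e - 1) / p)) powr p"
          proof -
            have "H\<^sup>2 powr p = H powr (2 * p)" using H by (simp add: powr_powr powr_numeral[symmetric] del: powr_numeral)
            moreover have "(Y powr ((e - 1) / p)) powr p = Y powr (e - 1)" using p by (simp add: powr_powr)
            ultimately show ?thesis
              using H r p by (simp add: powr_mult powr_divide powr_minus_divide)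
          qed
          also have "\<dots> \<le> T powr p"
            unfolding T_def using H r p by (intro powr_mono2 mult_left_mono) auto
          finally show ?thesis unfolding Aeq a .
        qed
        show "A (Suc j) \<in> sets borel" by simp
        show "x \<in> S \<and> cut p x0 (\<rho> j) x \<ge> (q j / 4) powr p \<and> u x \<ge> k j + H * q j / 4" if "x \<in> A (Suc j)" for x
        proof -
          have xb: "x \<in> ball x0 (\<rho> (Suc j))" and ux: "u x > k (Suc j)" using that unfolding A_def by auto
          have "(q j / 4) powr p \<le> (1 - (\<rho> (Suc j))\<^sup>2 / (\<rho> j)\<^sup>2) powr p"
            using z0 q[of j] p by (intro powr_mono2) auto
          also have "\<dots> \<le> cut p x0 (\<rho> j) x" using xb \<rho>b p by (intro cut_lower) auto
          finally have "cut p x0 (\<rho> j) x \<ge> (q j / 4) powr p" .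
          moreover have "k (Suc j) = k j + H * q j / 4" unfolding k_def q(3) by (simp add: field_simps)
          ultimately show ?thesis using ux xb bS(2)[of "Suc j"] by auto
        qed
        show "(q j / 4) powr p > 0" "H * q j / 4 > 0" using q[of j] H by auto
      qed
      then have "r powr n * y (Suc j) * ((q j / 4) powr p * (H * q j / 4)\<^sup>2)
          \<le> E * (r powr n * Y) powr (1 / n) * (r powr n * Y) * T"
        unfolding Aeq a E_def n_def[symmetric] using r by (simp add: y_def)
      also have "(r powr n * Y) powr (1 / n) = r * Y powr (1 / n)"
        using r n_pos yp by (simp add: powr_mult powr_powr)
      finally have "r powr n * (y (Suc j) * ((q j / 4) powr p * (q j / 4)\<^sup>2) * H\<^sup>2)
          \<le> r powr n * ((E * Y powr (1 / n) * Y * (4 * p + Y powr ((e - 1) / p))) * H\<^sup>2)"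
        unfolding T_def using r by (simp add: power_mult_distrib power_divide mult_ac)
      then have "y (Suc j) * ((q j / 4) powr p * (q j / 4)\<^sup>2)
          \<le> E * Y powr (1 / n) * Y * (4 * p + Y powr ((e - 1) / p))"
        using r H by simp
      also have "\<dots> = E * (Y powr (1 + \<alpha>) * (4 * p * Y powr ((1 - e) / p) + 1))"
      proof -
        have "Y powr (1 / n) * Y = Y powr (1 + \<alpha>) * Y powr ((1 - e) / p)"
          using yp unfolding Y_def \<alpha>_def by (simp add: powr_add[symmetric] powr_mult_base mult.commute[of _ "y j"])
        moreover have "Y powr ((1 - e) / p) * Y powr ((e - 1) / p) = 1"
          using yp unfolding Y_def by (simp add: powr_add[symmetric] diff_divide_distrib)
        ultimately show ?thesis by (simp add: algebra_simps)
      qed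
      \<comment> \<open>The cut-off term carries the excess power \<open>(1 - e) / p\<close> of Y;
        since \<open>Y \<le> \<omega>\<close>, it is reduced to the common power
        \<open>1 + \<alpha>\<close>.\<close>
      also have "\<dots> \<le> E * (Y powr (1 + \<alpha>) * (4 * p * \<omega> powr ((1 - e) / p) + 1))"
        using E p e yp y\<omega>[of j] unfolding Y_def
        by (intro mult_left_mono add_right_mono powr_mono2) auto
      finally have *: "y (Suc j) * ((q j / 4) powr p * (q j / 4)\<^sup>2)
        \<le> E * (Y powr (1 + \<alpha>) * (4 * p * \<omega> powr ((1 - e) / p) + 1))" .
      have "(q j / 4) powr p * (q j / 4)\<^sup>2 = (q j / 4) powr (p + 2)"
        using q[of j] by (simp add: powr_add powr_numeral)
      also have "\<dots> = 1 / (b powr j * 4 powr (p + 2))"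
      proof -
        have qj: "q j = 2 powr (- real j)" unfolding q_def by (simp add: powr_minus powr_realpow field_simps power_one_over)
        have "q j powr (p + 2) = 2 powr (- ((p + 2) * real j))" unfolding qj powr_powr by (simp add: algebra_simps)
        also have "\<dots> = 1 / b powr j" unfolding b_def powr_powr by (rule powr_minus_divide)
        finally show ?thesis using q[of j] by (simp add: powr_divide)
      qed
      finally have "y (Suc j) / (b powr j * 4 powr (p + 2)) \<le> E * (Y powr (1 + \<alpha>) * (4 * p * \<omega> powr ((1 - e) / p) + 1))"
        using * by simp
      then have "y (Suc j) \<le> E * (Y powr (1 + \<alpha>) * (4 * p * \<omega> powr ((1 - e) / p) + 1)) * (b powr j * 4 powr (p + 2))"
        using b by (subst (asm) pos_divide_le_eq) auto
      then show ?thesis unfolding C_def Y_def by (simp add: mult_ac)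
    qed
    have init: "y 0 \<le> \<nu>'"
    proof -
      have "A 0 = {x\<in>ball x0 r. u x > k0}" unfolding A_def \<rho>_def k_def q_def by simp
      then have "measure lborel (A 0) \<le> \<nu>' * r powr n" using small mball[OF r, of x0] \<omega>_pos by simp
      then show ?thesis unfolding y_def using r by (simp add: field_simps)
    qed
    have lim: "y \<longlonglongrightarrow> 0"
      by (rule fast_geometric_decay[OF C b \<alpha> y0 step]) (use init in \<open>simp add: \<nu>'_def\<close>)
    \<comment> \<open>\<open>U\<close> lies in every \<open>A j\<close>, so it is an open null set
      and hence empty: the bound holds at every point, not only almost everywhere.\<close>
    define U where "U = {x\<in>ball x0 (r/2). u x > k0 + H / 2}"
    have oU: "open U"
      unfolding U_def using uc cb r by (intro open_superlevel) (auto intro!: continuous_on_subset[OF uc])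
    have UA: "U \<subseteq> A j" for j
    proof -
      have "k j \<le> k0 + H / 2" using H q[of j] unfolding k_def by (simp add: algebra_simps)
      moreover have "ball x0 (r/2) \<subseteq> ball x0 (\<rho> j)" using \<rho>b(3)[of j] by auto
      ultimately show ?thesis unfolding U_def A_def by force
    qed
    have "measure lborel U / r powr n \<le> y j" for j
      unfolding y_def using UA[of j] oU measure_ball_mono(2)[OF Am Ab, of j]
      by (intro divide_right_mono measure_mono_fmeasurable) (auto simp: fmeasurable_def)
    then have "measure lborel U / r powr n \<le> 0"
      using lim by (intro LIMSEQ_le_const[OF lim]) auto
    then have "measure lborel U \<le> 0" using r by (simp add: field_simps)
    then have "U = {}"
      using measure_open_pos[OF oU] measure_ball_mono(2)[of U x0 r] oU UA[of 0] Ab[of 0] by force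
    then show "u x \<le> k0 + H / 2" using x unfolding U_def by force
  qed
qed

end

subsection \<open>Logarithmic estimate and expansion of positivity\<close>

context DG_exponents
begin

text \<open>Testing with \<zeta> (u + \<kappa>)^(1-p) produces a coercive term that controls \<zeta>
  |grad log(u + \<kappa>)|^p. The shift \<kappa> keeps the test function below \<kappa>^(1-p), and
  the condition on \<open>N\<close> gives the right-hand side the same order r^(n-p) as the cut-off
  term. Splitting at the threshold 1/r passes from the p-th to the first power.\<close>

lemma log_estimate:
  obtains C where "C > 0" "\<And>N S (u::'a \<Rightarrow> real) G F x0 r \<kappa>.
    \<lbrakk>DGsol p \<delta> L e N S u G F; cball x0 (2 * r) \<subseteq> S; r > 0; \<kappa> > 0; \<forall>x\<in>S. u x \<ge> 0;
     N * r powr \<gamma> \<le> \<kappa> powr (p - 1)\<rbrakk> \<Longrightarrow>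
     (\<integral>\<^sup>+x. ennreal (norm (G x) / (u x + \<kappa>)) * indicator (ball x0 r) x \<partial>lborel) \<le> ennreal (C * r powr n / r)"
proof -
  \<comment> \<open>\<open>L * \<tau>\<close> is half of the coercivity constant
    \<open>(p - 1) * \<delta>\<close>, so half of the good term survives as
    \<open>c0\<close>.\<close>
  define \<tau> where "\<tau> = (p - 1) * \<delta> / (2 * L)"
  have \<tau>: "\<tau> > 0" unfolding \<tau>_def using p \<delta> L by simp
  define V where "V = 2 powr n * \<omega>"
  have V: "V > 0" unfolding V_def using \<omega>_pos by simp
  define C0 where "C0 = 2 / ((p - 1) * \<delta>) * (V powr e + L * \<tau> powr (1 - p) * p powr p * V)"
  have C0: "C0 \<ge> 0" unfolding C0_def using p \<delta> L V by (intro mult_nonneg_nonneg) auto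
  show thesis
  proof (rule that[of "2 * (C0 + \<omega>)"])
    show "2 * (C0 + \<omega>) > 0" using C0 \<omega>_pos by simp
    fix N S and u :: "'a \<Rightarrow> real" and G F x0 r \<kappa>
    assume sol: "DGsol p \<delta> L e N S u G F" and cb: "cball x0 (2 * r) \<subseteq> S" and r: "r > 0" and \<kappa>: "\<kappa> > 0"
      and u0': "\<forall>x\<in>S. u x \<ge> 0" and N: "N * r powr \<gamma> \<le> \<kappa> powr (p - 1)"
    have u0: "\<And>x. x \<in> S \<Longrightarrow> u x \<ge> 0" using u0' by blast
    note S = DGsolD(1)[OF sol] and uc = DGsolD(9)[OF sol] and Gc = DGsolD(3)[OF sol] and ud = DGsolD(5)[OF sol]
    let ?B = "ball x0 (2 * r)"
    let ?\<zeta> = "cut p x0 (2 * r)" and ?Z = "dcut p x0 (2 * r)"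
    have r2: "2 * r > 0" using r by simp
    have BS: "?B \<subseteq> S" using cb by auto
    have \<zeta>01: "0 \<le> ?\<zeta> x" "?\<zeta> x \<le> 1" for x using cut_bounds[of p x0 "2 * r" x] p by auto
    have \<zeta>c: "continuous_on UNIV ?\<zeta>"
      using cut_has_derivative[OF p] by (auto intro!: continuous_at_imp_continuous_on has_derivative_continuous)
    have Zc: "continuous_on UNIV ?Z" by (rule dcut_continuous[OF p])
    have \<zeta>0: "?\<zeta> x = 0" if "x \<notin> ?B" for x
      using cut_pos_iff[OF r2, of p x0 x] that \<zeta>01(1)[of x] by linarith
    have \<zeta>pos: "?\<zeta> x > 0" if "x \<in> ?B" for x using cut_pos_iff[OF r2, of p x0 x] that by blast
    have Zb: "norm (?Z x) \<le> p / r * ?\<zeta> x powr ((p - 1) / p)" for x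
      using dcut_bound[OF p r2, of x0 x] by simp
    have Z0: "?Z x = 0" if "x \<notin> ?B" for x using Zb[of x] \<zeta>0[OF that] p by simp
    have uk: "u x + \<kappa> > 0" if "x \<in> S" for x using u0[OF that] \<kappa> by simp
    define \<eta> where "\<eta> = (\<lambda>x. if x \<in> S then ?\<zeta> x * (u x + \<kappa>) powr (1 - p) else 0)"
    define D where "D = (\<lambda>x. if x \<in> S then (u x + \<kappa>) powr (1 - p) *\<^sub>R ?Z x + ((1 - p) * ?\<zeta> x * (u x + \<kappa>) powr (- p)) *\<^sub>R G x else 0)"
    have upc: "continuous_on S (\<lambda>x. (u x + \<kappa>) powr q)" for q
      using uc uk by (intro continuous_on_powr continuous_intros) (auto simp: less_le)
    have C\<eta>: "C1c S \<eta> D" unfolding \<eta>_def D_def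
    proof (rule C1c_glue[OF S compact_cball cb])
      show "?\<zeta> x * (u x + \<kappa>) powr (1 - p) = 0" if "x \<in> S" "x \<notin> cball x0 (2 * r)" for x
        using \<zeta>0[of x] that by auto
      show "((\<lambda>x. ?\<zeta> x * (u x + \<kappa>) powr (1 - p)) has_derivative
        (\<bullet>) ((u x + \<kappa>) powr (1 - p) *\<^sub>R ?Z x + ((1 - p) * ?\<zeta> x * (u x + \<kappa>) powr (- p)) *\<^sub>R G x)) (at x)" if "x \<in> S" for x
      proof -
        have d1: "((\<lambda>x. u x + \<kappa>) has_derivative (\<lambda>h. G x \<bullet> h)) (at x)"
          using ud[OF that] by (auto intro!: derivative_eq_intros)
        have d2: "((\<lambda>t. t powr (1 - p)) has_real_derivative (1 - p) * (u x + \<kappa>) powr (- p)) (at (u x + \<kappa>))"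
          using has_real_derivative_powr[OF uk[OF that], of "1 - p"] by simp
        show ?thesis
          by (rule has_derivative_eq_rhs[OF has_derivative_mult[OF cut_has_derivative[OF p]
              has_derivative_compose[OF d1 d2[unfolded has_field_derivative_def]]]])
            (auto simp: fun_eq_iff inner_add_left algebra_simps)
      qed
      show "continuous_on S (\<lambda>x. (u x + \<kappa>) powr (1 - p) *\<^sub>R ?Z x + ((1 - p) * ?\<zeta> x * (u x + \<kappa>) powr (- p)) *\<^sub>R G x)"
        using upc Gc continuous_on_subset[OF Zc] continuous_on_subset[OF \<zeta>c]
        by (intro continuous_on_add continuous_on_scaleR continuous_on_mult continuous_on_const) auto
    qed
    define Y where "Y = (\<lambda>x. ?\<zeta> x powr (1 / p) * (norm (G x) / (u x + \<kappa>)))"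
    have Y0: "Y x \<ge> 0" if "x \<in> S" for x unfolding Y_def using uk[OF that] by auto
    define Yp where "Yp = (\<lambda>x. if x \<in> S then ?\<zeta> x * (norm (G x) powr p * (u x + \<kappa>) powr (- p)) else 0)"
    have YYp: "Y x powr p = Yp x" if "x \<in> S" for x
      using uk[OF that] \<zeta>01(1)[of x] that p unfolding Y_def Yp_def
      by (simp add: powr_mult powr_divide powr_powr powr_minus_divide)
    have Ypi: "integrable lborel Yp"
    proof (rule integrable_continuous_compact_support[OF _ compact_cball[of x0 "2 * r"]])
      have "continuous_on S (\<lambda>x. norm (G x) powr p)"
        using p Gc by (intro continuous_on_powr' continuous_intros) auto
      then have "continuous_on S (\<lambda>x. ?\<zeta> x * (norm (G x) powr p * (u x + \<kappa>) powr (- p)))"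
        using upc continuous_on_subset[OF \<zeta>c] by (intro continuous_on_mult) auto
      then have "continuous_on S Yp" by (rule continuous_on_eq) (auto simp: Yp_def)
      then show "continuous_on (cball x0 (2 * r)) Yp" using cb by (rule continuous_on_subset)
      show "Yp x = 0" if "x \<notin> cball x0 (2 * r)" for x using \<zeta>0[of x] that unfolding Yp_def by auto
    qed
    have Bi: "integrable lborel (indicator ?B :: 'a \<Rightarrow> real)"
      using emeasure_lborel_ball_finite[of x0 "2 * r"] by simp
    have DFi: "integrable lborel (\<lambda>x. F x \<bullet> D x)" by (rule C1c_integrable_flux[OF C\<eta> DGsolD(4)[OF sol]])
    define c0 where "c0 = (p - 1) * \<delta> / 2"
    have c0: "c0 > 0" unfolding c0_def using p \<delta> by simp
    define M where "M = L * \<tau> powr (1 - p) * (p / r) powr p"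
    have M0: "M \<ge> 0" unfolding M_def using L by simp
    have pt: "c0 * Yp x \<le> - (F x \<bullet> D x) + M * indicator ?B x" for x
    proof (cases "x \<in> ?B")
      case False
      then show ?thesis using \<zeta>0[OF False] Z0[OF False] unfolding D_def Yp_def by simp
    next
      case True
      then have xS: "x \<in> S" using BS by blast
      let ?w = "u x + \<kappa>"
      have w: "?w > 0" by (rule uk[OF xS])
      have "F x \<bullet> D x = ?w powr (1 - p) * (F x \<bullet> ?Z x) - (p - 1) * ?\<zeta> x * ?w powr (- p) * (F x \<bullet> G x)"
        using xS unfolding D_def by (simp add: inner_add_right algebra_simps)
      moreover have "(p - 1) * ?\<zeta> x * ?w powr (- p) * (F x \<bullet> G x) \<ge> 2 * c0 * Yp x"
      proof -
        have "(p - 1) * ?\<zeta> x * ?w powr (- p) * (\<delta> * norm (G x) powr p) \<le> (p - 1) * ?\<zeta> x * ?w powr (- p) * (F x \<bullet> G x)"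
          using DGsolD(7)[OF sol xS] \<zeta>01(1)[of x] p by (intro mult_left_mono) auto
        moreover have "2 * c0 = (p - 1) * \<delta>" unfolding c0_def by simp
        ultimately show ?thesis using xS unfolding Yp_def by (simp only: mult_ac if_True)
      qed
      moreover have "?w powr (1 - p) * (F x \<bullet> ?Z x) \<le> c0 * Yp x + M"
      proof -
        have "F x \<bullet> ?Z x \<le> norm (F x) * norm (?Z x)" by (rule norm_cauchy_schwarz)
        also have "\<dots> \<le> (L * norm (G x) powr (p - 1)) * (p / r * ?\<zeta> x powr ((p - 1) / p))"
          using DGsolD(6)[OF sol xS] Zb[of x] L by (intro mult_mono) auto
        finally have "?w powr (1 - p) * (F x \<bullet> ?Z x) \<le> ?w powr (1 - p) * ((L * norm (G x) powr (p - 1)) * (p / r * ?\<zeta> x powr ((p - 1) / p)))"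
          by (rule mult_left_mono) simp
        also have "\<dots> = L * (Y x powr (p - 1) * (p / r))"
        proof -
          have "?w powr (1 - p) = 1 / (?w powr (p - 1))"
            using powr_minus_divide[of ?w "p - 1"] by simp
          then have "Y x powr (p - 1) = ?\<zeta> x powr ((p - 1) / p) * norm (G x) powr (p - 1) * ?w powr (1 - p)"
            using w \<zeta>01(1)[of x] unfolding Y_def
            by (simp add: powr_mult powr_divide powr_powr)
          then show ?thesis by simp
        qed
        also have "\<dots> \<le> L * (\<tau> * Y x powr p + \<tau> powr (1 - p) * (p / r) powr p)"
          using young_crude[OF Y0[OF xS], of "p / r" \<tau> p] \<tau> p r L by (intro mult_left_mono) auto
        also have "\<dots> = c0 * Yp x + M"
          unfolding YYp[OF xS] c0_def M_def \<tau>_def using L by (simp add: field_simps)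
        finally show ?thesis .
      qed
      ultimately show ?thesis using True by simp
    qed
    have mB: "measure lborel ?B = V * r powr n"
      using mball[OF r2, of x0] r unfolding V_def by (simp add: powr_mult)
    have Ypint: "(\<integral>x. Yp x \<partial>lborel) \<le> C0 * r powr (n - p)"
    proof -
      have "c0 * (\<integral>x. Yp x \<partial>lborel) = (\<integral>x. c0 * Yp x \<partial>lborel)" by simp
      also have "\<dots> \<le> (\<integral>x. - (F x \<bullet> D x) + M * indicator ?B x \<partial>lborel)"
        using Ypi DFi Bi pt by (intro integral_mono) auto
      also have "\<dots> = - (\<integral>x. F x \<bullet> D x \<partial>lborel) + M * measure lborel ?B"
        using DFi Bi by (subst Bochner_Integration.integral_add) auto
      also have "- (\<integral>x. F x \<bullet> D x \<partial>lborel) \<le> \<kappa> powr (1 - p) * N * (V * r powr n) powr e"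
      proof -
        have "\<bar>\<eta> x\<bar> \<le> \<kappa> powr (1 - p)" for x
        proof (cases "x \<in> S")
          case True
          have "?\<zeta> x * (u x + \<kappa>) powr (1 - p) \<le> 1 * \<kappa> powr (1 - p)"
            using \<zeta>01[of x] u0[OF True] \<kappa> p by (intro mult_mono powr_mono2') auto
          then show ?thesis using True \<zeta>01[of x] unfolding \<eta>_def by (simp add: abs_mult)
        qed (simp add: \<eta>_def)
        from DGsolD(8)[OF sol C\<eta> this]
        have "- (\<integral>x. F x \<bullet> D x \<partial>lborel) \<le> \<kappa> powr (1 - p) * N * measure lborel {x. \<eta> x \<noteq> 0} powr e" by simp
        moreover have "{x. \<eta> x \<noteq> 0} = ?B"
        proof (intro set_eqI iffI)
          fix x assume "x \<in> {x. \<eta> x \<noteq> 0}"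
          then show "x \<in> ?B" using \<zeta>0[of x] unfolding \<eta>_def by (auto split: if_splits)
        next
          fix x assume "x \<in> ?B"
          then show "x \<in> {x. \<eta> x \<noteq> 0}" using \<zeta>pos[of x] BS uk[of x] unfolding \<eta>_def by auto
        qed
        ultimately show ?thesis using mB by simp
      qed
      also have "\<kappa> powr (1 - p) * N \<le> r powr (- \<gamma>)"
      proof -
        have "N \<le> \<kappa> powr (p - 1) * r powr (- \<gamma>)" using N r by (simp add: powr_minus field_simps)
        then have "\<kappa> powr (1 - p) * N \<le> \<kappa> powr (1 - p) * (\<kappa> powr (p - 1) * r powr (- \<gamma>))"
          by (rule mult_left_mono) simp
        also have "\<dots> = r powr (- \<gamma>)" using \<kappa> by (simp add: mult.assoc[symmetric] powr_add[symmetric])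
        finally show ?thesis .
      qed
      also have "r powr (- \<gamma>) * (V * r powr n) powr e = V powr e * r powr (n - p)"
        using V r unfolding \<gamma>_def by (simp add: powr_mult powr_powr powr_add[symmetric] algebra_simps)
      also have "M * measure lborel ?B = L * \<tau> powr (1 - p) * p powr p * V * r powr (n - p)"
        unfolding M_def mB using r p by (simp add: powr_divide powr_diff)
      finally have "c0 * (\<integral>x. Yp x \<partial>lborel) \<le> (V powr e + L * \<tau> powr (1 - p) * p powr p * V) * r powr (n - p)"
        by (simp add: algebra_simps mult_right_mono)
      then have "(\<integral>x. Yp x \<partial>lborel) \<le> (V powr e + L * \<tau> powr (1 - p) * p powr p * V) * r powr (n - p) / c0"
        using c0 by (simp add: field_simps)
      also have "\<dots> = C0 * r powr (n - p)" unfolding C0_def c0_def by simp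
      finally show ?thesis .
    qed
    let ?b = "ball x0 r"
    have bB: "?b \<subseteq> ?B" using r by auto
    have pt2: "ennreal (norm (G x) / (u x + \<kappa>)) * indicator ?b x
      \<le> ennreal (2 * (r powr (p - 1) * Yp x + indicator ?b x / r))" for x
    proof (cases "x \<in> ?b")
      case False
      then show ?thesis by simp
    next
      case True
      then have xS: "x \<in> S" using bB BS by blast
      have "(3 / 4) powr p \<le> ?\<zeta> x"
        using cut_lower[OF True r, of "2 * r" p] p r by (simp add: power2_eq_square)
      then have "((3 / 4) powr p) powr (1 / p) \<le> ?\<zeta> x powr (1 / p)" using p by (intro powr_mono2) auto
      then have z: "3 / 4 \<le> ?\<zeta> x powr (1 / p)" using p by (simp add: powr_powr)
      have g0: "norm (G x) / (u x + \<kappa>) \<ge> 0" using uk[OF xS] by simp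
      have "1/2 * (norm (G x) / (u x + \<kappa>)) \<le> ?\<zeta> x powr (1 / p) * (norm (G x) / (u x + \<kappa>))"
        using z g0 by (intro mult_right_mono) auto
      then have "norm (G x) / (u x + \<kappa>) \<le> 2 * Y x" unfolding Y_def by linarith
      also have "Y x \<le> (1 / r) powr (1 - p) * Y x powr p + 1 / r"
        using le_powr_split[OF Y0[OF xS], of "1 / r" p] r p by simp
      also have "(1 / r) powr (1 - p) = r powr (p - 1)"
        using r powr_minus_divide[of r "1 - p"] by (simp add: powr_divide)
      finally show ?thesis using True YYp[OF xS] g0 by (simp add: ennreal_leI)
    qed
    have bi: "integrable lborel (indicator ?b :: 'a \<Rightarrow> real)"
      using emeasure_lborel_ball_finite[of x0 r] by simp
    have Yp0: "Yp x \<ge> 0" for x using \<zeta>01(1)[of x] unfolding Yp_def by simp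
    have "(\<integral>\<^sup>+x. ennreal (norm (G x) / (u x + \<kappa>)) * indicator ?b x \<partial>lborel)
      \<le> (\<integral>\<^sup>+x. ennreal (2 * (r powr (p - 1) * Yp x + indicator ?b x / r)) \<partial>lborel)"
      by (rule nn_integral_mono) (rule pt2)
    also have "\<dots> = ennreal (\<integral>x. 2 * (r powr (p - 1) * Yp x + indicator ?b x / r) \<partial>lborel)"
      using Ypi bi r Yp0 by (intro nn_integral_eq_integral) (auto intro!: AE_I2 add_nonneg_nonneg)
    also have "(\<integral>x. 2 * (r powr (p - 1) * Yp x + indicator ?b x / r) \<partial>lborel)
       = 2 * (r powr (p - 1) * (\<integral>x. Yp x \<partial>lborel) + measure lborel ?b / r)"
      using Ypi bi by simp
    also have "ennreal \<dots> \<le> ennreal (2 * (r powr (p - 1) * (C0 * r powr (n - p)) + measure lborel ?b / r))"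
      using Ypint by (intro ennreal_leI) (simp add: mult_left_mono)
    also have "r powr (p - 1) * (C0 * r powr (n - p)) = C0 * (r powr n / r)"
      using r by (simp add: powr_diff)
    also have "2 * (C0 * (r powr n / r) + measure lborel ?b / r) = 2 * (C0 + \<omega>) * r powr n / r"
      unfolding mball[OF r] by (simp add: field_simps add_divide_distrib)
    finally show "(\<integral>\<^sup>+x. ennreal (norm (G x) / (u x + \<kappa>)) * indicator ?b x \<partial>lborel) \<le> ennreal (2 * (C0 + \<omega>) * r powr n / r)" .
  qed
qed

text \<open>The function ln((a + \<kappa>)/(u + \<kappa>)) is nonpositive where u \<ge> a, a set of
  relative measure at least \<mu>, and it is at least s where u < H. The two-set Poincare inequality
  and the logarithmic estimate bound the relative measure of the second set by a constant over \<mu>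
  s, so for large s it is small enough for De Giorgi's lemma applied to -u.\<close>

lemma expansion_of_positivity:
  assumes \<mu>: "\<mu> > 0"
  obtains c where "0 < c" "c < 1" "\<And>N S (u::'a \<Rightarrow> real) G F x0 r a x.
    \<lbrakk>DGsol p \<delta> L e N S u G F; cball x0 (2 * r) \<subseteq> S; r > 0; \<forall>x\<in>S. u x \<ge> 0; a > 0;
     \<mu> * measure lborel (ball x0 r) \<le> measure lborel {x\<in>ball x0 r. u x \<ge> a};
     N * r powr \<gamma> \<le> c * a powr (p - 1); x \<in> ball x0 (r / 2)\<rbrakk> \<Longrightarrow> u x \<ge> c * a"
proof -
  obtain \<nu> where \<nu>: "\<nu> > 0" and dg: "\<And>N S (u::'a \<Rightarrow> real) G F x0 r k0 H x.
    \<lbrakk>DGsol p \<delta> L e N S u G F; cball x0 r \<subseteq> S; r > 0; H > 0; \<forall>x\<in>ball x0 r. u x \<le> k0 + H;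
     N * r powr \<gamma> \<le> H powr (p - 1);
     measure lborel {x\<in>ball x0 r. u x > k0} \<le> \<nu> * measure lborel (ball x0 r);
     x \<in> ball x0 (r / 2)\<rbrakk> \<Longrightarrow> u x \<le> k0 + H / 2"
    by (rule de_giorgi) (rule that)
  obtain C where C: "C > 0" and log: "\<And>N S (u::'a \<Rightarrow> real) G F x0 r \<kappa>.
    \<lbrakk>DGsol p \<delta> L e N S u G F; cball x0 (2 * r) \<subseteq> S; r > 0; \<kappa> > 0; \<forall>x\<in>S. u x \<ge> 0;
     N * r powr \<gamma> \<le> \<kappa> powr (p - 1)\<rbrakk> \<Longrightarrow>
     (\<integral>\<^sup>+x. ennreal (norm (G x) / (u x + \<kappa>)) * indicator (ball x0 r) x \<partial>lborel) \<le> ennreal (C * r powr n / r)"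
    by (rule log_estimate) (rule that)
  \<comment> \<open>Makes the relative measure of {u < H} at most \<nu>;
    \<open>t = exp (- s)\<close> is the corresponding ratio of u + \<kappa> to a + \<kappa>. Of the
    two bounds on \<open>c\<close> below, the first controls the right-hand side through \<kappa>,
    the second comes from the final estimate u \<ge> H/2 \<ge> ta/4.\<close>
  define s where "s = 2 * 2 ^ DIM('a) * C / (\<omega> * \<mu> * \<nu>)"
  have s: "s > 0" unfolding s_def using C \<omega>_pos \<mu> \<nu> by simp
  define t where "t = exp (- s)"
  have t: "0 < t" "t < 1" unfolding t_def using s by auto
  define c where "c = min ((t / 2) powr (p - 1)) (t / 4)"
  have c: "c > 0" "c < 1" "c \<le> (t / 2) powr (p - 1)" "c \<le> t / 4"
    unfolding c_def using t by (auto simp: min_less_iff_disj)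
  show thesis
  proof (rule that[OF c(1,2)])
    fix N S and u :: "'a \<Rightarrow> real" and G F x0 r a x
    assume sol: "DGsol p \<delta> L e N S u G F" and cb: "cball x0 (2 * r) \<subseteq> S" and r: "r > 0"
      and u0': "\<forall>x\<in>S. u x \<ge> 0" and a: "a > 0"
      and big: "\<mu> * measure lborel (ball x0 r) \<le> measure lborel {x\<in>ball x0 r. u x \<ge> a}"
      and N: "N * r powr \<gamma> \<le> c * a powr (p - 1)" and x: "x \<in> ball x0 (r / 2)"
    have u0: "\<And>x. x \<in> S \<Longrightarrow> u x \<ge> 0" using u0' by blast
    note uc = DGsolD(9)[OF sol] and ud = DGsolD(5)[OF sol]
    let ?B = "ball x0 r"
    have cr: "cball x0 r \<subseteq> cball x0 (2 * r)" using r by (intro subset_cball) simp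
    then have cbr: "cball x0 r \<subseteq> S" using cb by blast
    then have BS: "?B \<subseteq> S" using ball_subset_cball[of x0 r] by blast
    \<comment> \<open>Small enough for \<open>H = t * (a + \<kappa>) - \<kappa>\<close> to stay
      above \<open>t / 2 * a\<close>, yet comparable to a, so that the hypothesis on
      \<open>N\<close> suffices for the logarithmic estimate.\<close>
    define \<kappa> where "\<kappa> = t / 2 * a"
    define H where "H = t * (a + \<kappa>) - \<kappa>"
    have \<kappa>: "\<kappa> > 0" unfolding \<kappa>_def using t a by simp
    have H: "H \<ge> t / 2 * a"
    proof -
      have "H = t / 2 * a + t * \<kappa>" unfolding H_def \<kappa>_def by (simp add: algebra_simps)
      then show ?thesis using t \<kappa> by simp
    qed
    have ta: "t / 2 * a > 0" using t a by simp
    have Hp: "H > 0" using H ta by linarith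
    have "N * r powr \<gamma> \<le> (t / 2) powr (p - 1) * a powr (p - 1)"
      using N c(3) by (meson mult_right_mono order_trans powr_ge_zero)
    then have N1: "N * r powr \<gamma> \<le> \<kappa> powr (p - 1)" unfolding \<kappa>_def using t a by (simp only: powr_mult)
    also have "\<dots> \<le> H powr (p - 1)" using H p \<kappa> unfolding \<kappa>_def[symmetric] by (intro powr_mono2) auto
    finally have N2: "N * r powr \<gamma> \<le> H powr (p - 1)" .
    define l where "l = (\<lambda>x. ln (a + \<kappa>) - ln (u x + \<kappa>))"
    define D where "D = (\<lambda>x. (- 1 / (u x + \<kappa>)) *\<^sub>R G x)"
    have uk: "u x + \<kappa> > 0" if "x \<in> S" for x using u0[OF that] \<kappa> by simp
    define P where "P = {x\<in>?B. u x < H}"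
    define Q where "Q = {x\<in>?B. u x \<ge> a}"
    have ucB: "continuous_on ?B u" using uc BS by (rule continuous_on_subset)
    have Pm[measurable]: "P \<in> sets borel"
    proof -
      have "P = {x\<in>?B. - u x > - H}" unfolding P_def by auto
      moreover have "open \<dots>" using ucB by (intro open_superlevel continuous_intros) auto
      ultimately show ?thesis by simp
    qed
    have Qm[measurable]: "Q \<in> sets borel"
    proof -
      have "Q = ?B - {x\<in>?B. - u x > - a}" unfolding Q_def by auto
      moreover have "open {x\<in>?B. - u x > - a}" using ucB by (intro open_superlevel continuous_intros) auto
      ultimately show ?thesis by simp
    qed
    have PQB: "P \<subseteq> ?B" "Q \<subseteq> ?B" unfolding P_def Q_def by auto
    have "ennreal s * emeasure lborel P * emeasure lborel Q \<le>
       ennreal (2 * r) * 2 ^ DIM('a) * emeasure lborel ?B * (\<integral>\<^sup>+x. ennreal (norm (D x)) * indicator ?B x \<partial>lborel)"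
    proof (rule Poincare_two_sets[of x0 r l D, OF _ _ Pm PQB(1) _ Qm PQB(2) _ s r])
      show "(l has_derivative (\<bullet>) (D x)) (at x)" if "x \<in> ?B" for x
      proof -
        have xS: "x \<in> S" using that BS by blast
        have d1: "((\<lambda>x. u x + \<kappa>) has_derivative (\<lambda>h. G x \<bullet> h)) (at x)"
          using ud[OF xS] by (auto intro!: derivative_eq_intros)
        show ?thesis unfolding l_def D_def
          by (rule derivative_eq_intros d1 uk[OF xS] refl)+ (auto simp: fun_eq_iff field_simps)
      qed
      show "continuous_on ?B D"
      proof -
        have "u x + \<kappa> \<noteq> 0" if "x \<in> ?B" for x using uk[of x] that BS by auto
        then show ?thesis
          unfolding D_def using ucB continuous_on_subset[OF DGsolD(3)[OF sol] BS]
          by (intro continuous_intros) auto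
      qed
      show "s \<le> l x" if "x \<in> P" for x
      proof -
        have "u x + \<kappa> \<le> t * (a + \<kappa>)" using that unfolding P_def H_def by simp
        moreover have "u x + \<kappa> > 0" using that uk BS unfolding P_def by auto
        ultimately have "ln (u x + \<kappa>) \<le> ln (t * (a + \<kappa>))" by simp
        also have "\<dots> = - s + ln (a + \<kappa>)" using t a \<kappa> unfolding t_def by (simp add: ln_mult)
        finally show ?thesis unfolding l_def by simp
      qed
      show "l x \<le> 0" if "x \<in> Q" for x
        using that a \<kappa> unfolding Q_def l_def by simp
    qed
    also have "(\<integral>\<^sup>+x. ennreal (norm (D x)) * indicator ?B x \<partial>lborel)
       = (\<integral>\<^sup>+x. ennreal (norm (G x) / (u x + \<kappa>)) * indicator ?B x \<partial>lborel)"
    proof (rule nn_integral_cong)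
      fix x
      show "ennreal (norm (D x)) * indicator ?B x = ennreal (norm (G x) / (u x + \<kappa>)) * indicator ?B x"
      proof (cases "x \<in> ?B")
        case True
        then have "u x + \<kappa> > 0" using uk BS by blast
        then have "norm (D x) = norm (G x) / (u x + \<kappa>)" unfolding D_def by simp
        then show ?thesis by simp
      qed simp
    qed
    also have "\<dots> \<le> ennreal (C * r powr n / r)" by (rule log[OF sol cb r \<kappa> u0' N1])
    finally have "ennreal s * emeasure lborel P * emeasure lborel Q \<le>
       ennreal (2 * r) * 2 ^ DIM('a) * emeasure lborel ?B * ennreal (C * r powr n / r)"
      by (simp add: mult_left_mono)
    note * = this
    have e1: "emeasure lborel P = ennreal (measure lborel P)" and e2: "emeasure lborel Q = ennreal (measure lborel Q)"
      using measure_ball_mono(2)[OF Pm PQB(1)] measure_ball_mono(2)[OF Qm PQB(2)]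
      by (auto intro!: emeasure_eq_ennreal_measure)
    have "ennreal (s * measure lborel P * measure lborel Q)
       \<le> ennreal (2 * r * 2 ^ DIM('a) * measure lborel ?B * (C * r powr n / r))"
    proof -
      define W where "W = C * r powr n / r"
      have W: "W \<ge> 0" unfolding W_def using C r by simp
      have "(2::ennreal) ^ DIM('a) = ennreal (2 ^ DIM('a))" by (simp add: ennreal_power[symmetric])
      then have "ennreal (2 * r) * 2 ^ DIM('a) * ennreal (measure lborel ?B) * ennreal W
        = ennreal (2 * r * 2 ^ DIM('a) * measure lborel ?B * W)"
        using r W by (simp only: ennreal_mult' mult_nonneg_nonneg measure_nonneg zero_le_power zero_le_numeral
            less_imp_le mult.assoc)
      then show ?thesis
        using * s unfolding emeasure_ball_eq e1 e2 W_def[symmetric] by (simp add: ennreal_mult)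
    qed
    then have "s * measure lborel P * measure lborel Q
       \<le> 2 * r * 2 ^ DIM('a) * measure lborel ?B * (C * r powr n / r)"
      using r C by (subst (asm) ennreal_le_iff) auto
    also have "\<dots> = (2 * 2 ^ DIM('a) * C) * r powr n * measure lborel ?B" using r by simp
    also have "\<dots> = s * (\<mu> * \<nu>) * (\<omega> * r powr n) * measure lborel ?B"
      unfolding s_def using \<omega>_pos \<mu> \<nu> by simp
    also have "\<omega> * r powr n = measure lborel ?B" using mball[OF r, of x0] by simp
    finally have PQ: "s * measure lborel P * measure lborel Q \<le> s * (\<mu> * \<nu>) * measure lborel ?B * measure lborel ?B" .
    have mB: "measure lborel ?B > 0" using mball[OF r, of x0] \<omega>_pos r by simp
    have "s * measure lborel P * (\<mu> * measure lborel ?B) \<le> s * measure lborel P * measure lborel Q"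
      using big s unfolding Q_def by (intro mult_left_mono) auto
    with PQ have "(s * \<mu> * measure lborel ?B) * measure lborel P \<le> (s * \<mu> * measure lborel ?B) * (\<nu> * measure lborel ?B)"
      by (simp add: mult_ac)
    then have Psmall: "measure lborel P \<le> \<nu> * measure lborel ?B"
      using s \<mu> mB by simp
    have "0 - u x \<le> - H + H / 2"
    proof (rule dg[OF DGsol_uminus[OF sol, of 0] cbr r Hp _ N2 _ x])
      show "\<forall>x\<in>?B. 0 - u x \<le> - H + H" using u0 BS by auto
      have "{x\<in>?B. 0 - u x > - H} = P" unfolding P_def by auto
      then show "measure lborel {x\<in>?B. 0 - u x > - H} \<le> \<nu> * measure lborel ?B" using Psmall by simp
    qed
    then have "u x \<ge> H / 2" by simp
    also have "H / 2 \<ge> t / 4 * a" using H by (simp add: mult.commute)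
    finally have "t / 4 * a \<le> u x" .
    moreover have "c * a \<le> t / 4 * a" using c(4) a by (intro mult_right_mono) auto
    ultimately show "c * a \<le> u x" by linarith
  qed
qed

end

subsection \<open>Harnack inequality\<close>

context DG_exponents
begin

text \<open>The ball of radius \<rho> fills the fraction 4^(-n) of the one of radius 4\<rho>, so
  positivity expands to radius 2\<rho>. The loss \<open>c\<close> does not depend on \<rho>;
  repeated doubling therefore costs a fixed power of the ratio of the radii.\<close>

lemma doubling:
  obtains c where "0 < c" "c < 1" "\<And>N S (u::'a \<Rightarrow> real) G F y \<rho> a x.
    \<lbrakk>DGsol p \<delta> L e N S u G F; cball y (8 * \<rho>) \<subseteq> S; \<rho> > 0; \<forall>x\<in>S. u x \<ge> 0; a > 0;
     \<forall>x\<in>ball y \<rho>. u x \<ge> a; N * (4 * \<rho>) powr \<gamma> \<le> c * a powr (p - 1); x \<in> ball y (2 * \<rho>)\<rbrakk> \<Longrightarrow> u x \<ge> c * a"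
proof -
  define \<mu> where "\<mu> = 4 powr (- n)"
  have \<mu>: "\<mu> > 0" unfolding \<mu>_def by simp
  obtain c where c: "0 < c" "c < 1" and E: "\<And>N S (u::'a \<Rightarrow> real) G F x0 r a x.
    \<lbrakk>DGsol p \<delta> L e N S u G F; cball x0 (2 * r) \<subseteq> S; r > 0; \<forall>x\<in>S. u x \<ge> 0; a > 0;
     \<mu> * measure lborel (ball x0 r) \<le> measure lborel {x\<in>ball x0 r. u x \<ge> a};
     N * r powr \<gamma> \<le> c * a powr (p - 1); x \<in> ball x0 (r / 2)\<rbrakk> \<Longrightarrow> u x \<ge> c * a"
    by (rule expansion_of_positivity[OF \<mu>]) (rule that)
  show thesis
  proof (rule that[OF c])
    fix N S and u :: "'a \<Rightarrow> real" and G F y \<rho> a x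
    assume sol: "DGsol p \<delta> L e N S u G F" and cb: "cball y (8 * \<rho>) \<subseteq> S" and \<rho>: "\<rho> > 0"
      and u0: "\<forall>x\<in>S. u x \<ge> 0" and a: "a > 0" and ua: "\<forall>x\<in>ball y \<rho>. u x \<ge> a"
      and N: "N * (4 * \<rho>) powr \<gamma> \<le> c * a powr (p - 1)" and x: "x \<in> ball y (2 * \<rho>)"
    let ?Q = "{x\<in>ball y (4 * \<rho>). u x \<ge> a}"
    have BS: "ball y (4 * \<rho>) \<subseteq> S"
    proof -
      have "ball y (4 * \<rho>) \<subseteq> cball y (8 * \<rho>)" using \<rho> by auto
      then show ?thesis using cb by blast
    qed
    have Qm: "?Q \<in> sets borel"
    proof -
      have "?Q = ball y (4 * \<rho>) - {x\<in>ball y (4 * \<rho>). - u x > - a}" by auto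
      moreover have "open {x\<in>ball y (4 * \<rho>). - u x > - a}"
        using continuous_on_subset[OF DGsolD(9)[OF sol] BS]
        by (intro open_superlevel continuous_intros) auto
      ultimately show ?thesis by simp
    qed
    have "ball y \<rho> \<subseteq> ?Q" using ua \<rho> by auto
    moreover have "emeasure lborel ?Q < \<infinity>" by (rule measure_ball_mono(2)[OF Qm]) auto
    ultimately have "measure lborel (ball y \<rho>) \<le> measure lborel ?Q"
      using Qm by (intro measure_mono_fmeasurable) (auto simp: fmeasurable_def)
    moreover have "\<mu> * measure lborel (ball y (4 * \<rho>)) = measure lborel (ball y \<rho>)"
      using mball[of \<rho> y] mball[of "4 * \<rho>" y] \<rho> unfolding \<mu>_def
      by (simp add: powr_mult powr_minus)
    ultimately have "\<mu> * measure lborel (ball y (4 * \<rho>)) \<le> measure lborel ?Q" by simp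
    then show "u x \<ge> c * a"
      using E[OF sol, of y "4 * \<rho>" a x] cb \<rho> u0 a N x by simp
  qed
qed

text \<open>At the maximum point y of the weighted function, with d = t - |y - x0|, the value of u
  is at least (t/d)^s u(x0). Spreading it from a radius of order d to the radius 2t by doublings
  loses a multiple of (d/t)^s, because s is fitted to the loss per doubling; gain and loss
  cancel.\<close>

lemma harnack_ball:
  obtains c where "0 < c" "c < 1" "\<And>N S (u::'a \<Rightarrow> real) G F x0 t x.
    \<lbrakk>DGsol p \<delta> L e N S u G F; cball x0 (20 * t) \<subseteq> S; t > 0; \<forall>x\<in>S. u x \<ge> 0;
     N * t powr \<gamma> \<le> c * u x0 powr (p - 1); x \<in> ball x0 t\<rbrakk> \<Longrightarrow> u x \<ge> c * u x0"
proof -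
  obtain \<nu> where \<nu>: "\<nu> > 0" and dg: "\<And>N S (u::'a \<Rightarrow> real) G F x0 r k0 H x.
    \<lbrakk>DGsol p \<delta> L e N S u G F; cball x0 r \<subseteq> S; r > 0; H > 0; \<forall>x\<in>ball x0 r. u x \<le> k0 + H;
     N * r powr \<gamma> \<le> H powr (p - 1);
     measure lborel {x\<in>ball x0 r. u x > k0} \<le> \<nu> * measure lborel (ball x0 r);
     x \<in> ball x0 (r / 2)\<rbrakk> \<Longrightarrow> u x \<le> k0 + H / 2"
    by (rule de_giorgi) (rule that)
  obtain c1 where c1: "0 < c1" "c1 < 1" and EP: "\<And>N S (u::'a \<Rightarrow> real) G F x0 r a x.
    \<lbrakk>DGsol p \<delta> L e N S u G F; cball x0 (2 * r) \<subseteq> S; r > 0; \<forall>x\<in>S. u x \<ge> 0; a > 0;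
     \<nu> * measure lborel (ball x0 r) \<le> measure lborel {x\<in>ball x0 r. u x \<ge> a};
     N * r powr \<gamma> \<le> c1 * a powr (p - 1); x \<in> ball x0 (r / 2)\<rbrakk> \<Longrightarrow> u x \<ge> c1 * a"
    by (rule expansion_of_positivity[OF \<nu>]) (rule that)
  obtain c2 where c2: "0 < c2" "c2 < 1" and D: "\<And>N S (u::'a \<Rightarrow> real) G F y \<rho> a x.
    \<lbrakk>DGsol p \<delta> L e N S u G F; cball y (8 * \<rho>) \<subseteq> S; \<rho> > 0; \<forall>x\<in>S. u x \<ge> 0; a > 0;
     \<forall>x\<in>ball y \<rho>. u x \<ge> a; N * (4 * \<rho>) powr \<gamma> \<le> c2 * a powr (p - 1); x \<in> ball y (2 * \<rho>)\<rbrakk> \<Longrightarrow> u x \<ge> c2 * a"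
    by (rule doubling) (rule that)
  define s where "s = - ln c2 / ln 2"
  have s: "s > 0" unfolding s_def using c2 by (simp add: divide_neg_pos)
  have c2s: "c2 = 2 powr (- s)" unfolding s_def powr_def using c2 by simp
  \<comment> \<open>Within distance \<open>\<tau> * d\<close> of y the weight falls by a factor no
    smaller than 4/5, so u \<le> 5U/4 there.\<close>
  define \<tau> where "\<tau> = 1 - (4/5 :: real) powr (1 / s)"
  have \<tau>: "0 < \<tau>" "\<tau> < 1" unfolding \<tau>_def using s powr_less_mono2[of "1 / s" "4 / 5" 1] by auto
  have \<tau>s: "(1 - \<tau>) powr s = 4 / 5"
    unfolding \<tau>_def using s by (simp add: powr_powr)
  \<comment> \<open>The start is the bound \<open>c1 * (U / 2)\<close> on radius \<rho>/2 with
    \<rho> = \<tau> d. The fewest doublings k that reach radius 2t satisfy 2^k \<le> 8t/\<rho>, and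
    they cost at most the factor (\<rho>/(8t))^s.\<close>
  define c3 where "c3 = c1 / 2 * (\<tau> / 8) powr s"
  have c3: "0 < c3" "c3 \<le> 1 / 2"
  proof -
    show "0 < c3" unfolding c3_def using c1 \<tau> by simp
    have "c1 / 2 * (\<tau> / 8) powr s \<le> 1 / 2 * 1" using c1 \<tau> s by (intro mult_mono powr_le1) auto
    then show "c3 \<le> 1 / 2" unfolding c3_def by simp
  qed
  define c where "c = min c3 (c1 * c2 * c3 powr (p - 1) / 16 powr \<gamma>)"
  have c: "0 < c" "c \<le> c3" "c \<le> c1 * c2 * c3 powr (p - 1) / 16 powr \<gamma>" "c < 1"
    unfolding c_def using c1 c2 c3 by (auto simp: min_less_iff_disj)
  show thesis
  proof (rule that[OF c(1,4)])
    fix N S and u :: "'a \<Rightarrow> real" and G F x0 t x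
    assume sol: "DGsol p \<delta> L e N S u G F" and cb: "cball x0 (20 * t) \<subseteq> S" and t: "t > 0"
      and u0: "\<forall>x\<in>S. u x \<ge> 0" and N: "N * t powr \<gamma> \<le> c * u x0 powr (p - 1)" and x: "x \<in> ball x0 t"
    note uc = DGsolD(9)[OF sol] and N0 = DGsolD(2)[OF sol]
    have xS: "x \<in> S" "x0 \<in> S" using x cb t by (auto simp: subset_eq dist_commute)
    show "u x \<ge> c * u x0"
    proof (cases "u x0 = 0")
      case True then show ?thesis using u0 xS by simp
    next
      case False
      then have up: "u x0 > 0" using u0 xS by (simp add: less_le)
      have small: "N * r powr \<gamma> \<le> c1 * c2 * a powr (p - 1)"
        if "0 < r" "r \<le> 16 * t" "a \<ge> c3 * u x0" for r a
      proof -
        have "N * r powr \<gamma> \<le> N * (16 * t) powr \<gamma>"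
          using that N0 \<gamma>_pos by (intro mult_left_mono powr_mono2) auto
        also have "\<dots> = 16 powr \<gamma> * (N * t powr \<gamma>)" using t by (simp add: powr_mult)
        also have "\<dots> \<le> 16 powr \<gamma> * (c * u x0 powr (p - 1))" using N by (intro mult_left_mono) auto
        also have "\<dots> \<le> 16 powr \<gamma> * (c1 * c2 * c3 powr (p - 1) / 16 powr \<gamma> * u x0 powr (p - 1))"
          using c(3) by (intro mult_left_mono mult_right_mono) auto
        also have "\<dots> = c1 * c2 * (c3 * u x0) powr (p - 1)" using c3 up by (simp add: powr_mult)
        also have "\<dots> \<le> c1 * c2 * a powr (p - 1)"
          using that c1 c2 c3 up p by (intro mult_left_mono powr_mono2) auto
        finally show ?thesis .
      qed
      text \<open>Maximizing \<open>u\<close> against a power of the distance to the boundary yields a point \<open>y\<close> where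
        \<open>u\<close> is large and controls its values on a comparable ball.\<close>
      define g where "g = (\<lambda>z. u z * (t - norm (z - x0)) powr s)"
      have cbt: "cball x0 t \<subseteq> S" using cb t by (auto simp: subset_eq)
      have gc: "continuous_on (cball x0 t) g"
        unfolding g_def using continuous_on_subset[OF uc cbt] s
        by (intro continuous_intros continuous_on_powr') (auto simp: dist_norm norm_minus_commute)
      obtain y where y: "y \<in> cball x0 t" and ymax: "\<And>z. z \<in> cball x0 t \<Longrightarrow> g z \<le> g y"
        using continuous_attains_sup[OF compact_cball _ gc] t by fastforce
      define d where "d = t - norm (y - x0)"
      define U where "U = u y"
      have "g x0 > 0" unfolding g_def using up t by simp
      then have gy: "g y > 0" using ymax[of x0] t by force
      have dle: "d \<le> t" unfolding d_def by simp
      have "d \<ge> 0" using y unfolding d_def by (simp add: dist_norm norm_minus_commute)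
      moreover have "d \<noteq> 0" using gy unfolding g_def d_def by auto
      ultimately have d: "d > 0" by simp
      have U: "U > 0" using gy unfolding g_def U_def by (simp add: zero_less_mult_iff)
      have Ud: "U * d powr s \<ge> u x0 * t powr s" using ymax[of x0] t unfolding g_def U_def d_def by simp
      have UU: "U \<ge> u x0"
      proof -
        have "u x0 * t powr s \<le> U * t powr s"
          using Ud mult_left_mono[OF powr_mono2[of s d t], of U] s d dle U by linarith
        then show ?thesis using t by simp
      qed
      define \<rho> where "\<rho> = \<tau> * d"
      have \<rho>: "\<rho> > 0" "\<rho> \<le> t" unfolding \<rho>_def using \<tau> d dle by (auto intro: mult_le_one order_trans[OF mult_left_le_one_le])
      have ny: "norm (y - x0) \<le> t" using y by (simp add: dist_norm norm_minus_commute)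
      \<comment> \<open>Doubling at radius \<open>R k < 2 * t\<close> uses a ball of radius below
        16t about y; together with |y - x0| \<le> t this is where the factor 20 of the hypothesis is
        spent.\<close>
      have yb: "cball y (r) \<subseteq> S" if "r \<le> 16 * t" for r
      proof
        fix z assume "z \<in> cball y r"
        then have "dist x0 z \<le> dist x0 y + r" using dist_triangle[of x0 z y] by (simp add: dist_commute)
        then show "z \<in> S" using cb that ny t by (auto simp: subset_eq dist_norm norm_minus_commute)
      qed
      have uU: "u z \<le> U / 2 + 3 / 4 * U" if z: "z \<in> ball y \<rho>" for z
      proof -
        have "norm (z - y) < \<tau> * d" using z unfolding \<rho>_def by (simp add: dist_norm norm_minus_commute)
        moreover have "norm (z - x0) \<le> norm (z - y) + norm (y - x0)"
          using norm_triangle_ineq[of "z - y" "y - x0"] by simp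
        ultimately have dz: "t - norm (z - x0) \<ge> (1 - \<tau>) * d" unfolding d_def by (simp add: algebra_simps)
        then have "norm (z - x0) \<le> t" using \<tau> d by (smt (verit) mult_pos_pos)
        then have zt: "z \<in> cball x0 t" by (simp add: dist_norm norm_minus_commute)
        have uz: "u z \<ge> 0" using u0 zt cbt by blast
        have "u z * ((1 - \<tau>) * d) powr s \<le> g z"
          unfolding g_def using dz \<tau> d s uz by (intro mult_left_mono powr_mono2) auto
        also have "\<dots> \<le> U * d powr s" using ymax[OF zt] unfolding g_def U_def d_def by simp
        finally have "u z * (1 - \<tau>) powr s \<le> U" using \<tau> d by (simp add: powr_mult)
        then show ?thesis unfolding \<tau>s by simp
      qed
      \<comment> \<open>Otherwise De Giorgi's lemma with level U/2 and height 3U/4 would give u(y)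
        \<le> 7U/8 < U.\<close>
      have big: "\<nu> * measure lborel (ball y \<rho>) \<le> measure lborel {z\<in>ball y \<rho>. u z \<ge> U / 2}"
      proof (rule ccontr)
        assume "\<not> ?thesis"
        then have lt: "measure lborel {z\<in>ball y \<rho>. u z \<ge> U / 2} \<le> \<nu> * measure lborel (ball y \<rho>)" by simp
        have bS: "ball y \<rho> \<subseteq> S" using yb[of \<rho>] \<rho> ball_subset_cball[of y \<rho>] t by (auto simp: subset_eq)
        have ub: "continuous_on (ball y \<rho>) u" using uc bS by (rule continuous_on_subset)
        have "{z\<in>ball y \<rho>. u z \<ge> U / 2} = ball y \<rho> - {z\<in>ball y \<rho>. - u z > - (U / 2)}" by auto
        moreover have "open {z\<in>ball y \<rho>. - u z > - (U / 2)}"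
          using ub by (intro open_superlevel continuous_intros) auto
        ultimately have m: "{z\<in>ball y \<rho>. u z \<ge> U / 2} \<in> sets borel" by simp
        have fm: "emeasure lborel {z\<in>ball y \<rho>. u z \<ge> U / 2} < \<infinity>" by (rule measure_ball_mono(2)[OF m]) auto
        have "open {z\<in>ball y \<rho>. u z > U / 2}" using ub by (intro open_superlevel) auto
        then have "measure lborel {z\<in>ball y \<rho>. u z > U / 2} \<le> measure lborel {z\<in>ball y \<rho>. u z \<ge> U / 2}"
          using m fm by (intro measure_mono_fmeasurable) (auto simp: fmeasurable_def)
        with lt have lt': "measure lborel {z\<in>ball y \<rho>. u z > U / 2} \<le> \<nu> * measure lborel (ball y \<rho>)" by linarith
        have "u y \<le> U / 2 + (3 / 4 * U) / 2"
        proof (rule dg[OF sol _ \<rho>(1) _ _ _ lt'])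
          show "cball y \<rho> \<subseteq> S" using yb \<rho> t by simp
          have "3 / 4 * U \<ge> c3 * u x0" using UU c3 up U by (intro mult_mono) auto
          then have "N * \<rho> powr \<gamma> \<le> c1 * c2 * (3 / 4 * U) powr (p - 1)" using small[of \<rho> "3 / 4 * U"] \<rho> t by simp
          also have "\<dots> \<le> 1 * (3 / 4 * U) powr (p - 1)"
            using c1 c2 by (intro mult_right_mono mult_le_one) auto
          finally show "N * \<rho> powr \<gamma> \<le> (3 / 4 * U) powr (p - 1)" by simp
        qed (use uU U \<rho> in auto)
        then show False using U unfolding U_def by simp
      qed
      have start: "\<forall>z\<in>ball y (\<rho> / 2). u z \<ge> c1 * (U / 2)"
      proof
        fix z assume z: "z \<in> ball y (\<rho> / 2)"
        have "U / 2 \<ge> c3 * u x0" using mult_mono[OF c3(2) UU] U c3 up by simp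
        then have "N * \<rho> powr \<gamma> \<le> c1 * c2 * (U / 2) powr (p - 1)" using small[of \<rho> "U / 2"] \<rho> t by simp
        also have "\<dots> \<le> c1 * 1 * (U / 2) powr (p - 1)"
          using c1 c2 by (intro mult_right_mono mult_left_mono) auto
        finally have "N * \<rho> powr \<gamma> \<le> c1 * (U / 2) powr (p - 1)" by simp
        then show "u z \<ge> c1 * (U / 2)"
          using EP[OF sol _ \<rho>(1) u0 _ big _ z] yb[of "2 * \<rho>"] \<rho> t U by simp
      qed
      define a where "a = (\<lambda>k::nat. c2 ^ k * (c1 * (U / 2)))"
      define R where "R = (\<lambda>k::nat. 2 ^ k * (\<rho> / 2))"
      have low: "a k \<ge> c3 * u x0" if "k = 0 \<or> R (k - 1) < 2 * t" for k
      proof -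
        have k2: "2 ^ k \<le> 8 * t / \<rho>"
        proof (cases "k = 0")
          case True then show ?thesis using \<rho> t by (simp add: field_simps)
        next
          case False
          then have "(2::real) ^ k = 2 * 2 ^ (k - 1)" by (cases k) auto
          then show ?thesis using that False \<rho> unfolding R_def by (simp add: field_simps)
        qed
        have "(\<tau> / 8) powr s * (d / t) powr s = (8 * t / \<rho>) powr (- s)"
        proof -
          have "(\<tau> / 8) powr s * (d / t) powr s = (\<rho> / (8 * t)) powr s"
          proof -
            have e: "\<rho> / (8 * t) = (\<tau> / 8) * (d / t)" unfolding \<rho>_def using t by simp
            show ?thesis unfolding e powr_mult ..
          qed
          also have "\<rho> / (8 * t) = inverse (8 * t / \<rho>)" by simp
          also have "\<dots> powr s = (8 * t / \<rho>) powr (- s)"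
            by (simp only: inverse_powr powr_minus)
          finally show ?thesis .
        qed
        also have "\<dots> \<le> (2 ^ k) powr (- s)" using k2 s by (intro powr_mono2') auto
        also have "\<dots> = c2 ^ k"
          unfolding c2s by (simp add: powr_realpow[symmetric] powr_powr mult.commute)
        finally have k3: "(\<tau> / 8) powr s * (d / t) powr s \<le> c2 ^ k" .
        have "u x0 \<le> U * (d / t) powr s" using Ud t d by (simp add: powr_divide field_simps)
        then have "c3 * u x0 \<le> c3 * (U * (d / t) powr s)" using c3 by (intro mult_left_mono) auto
        also have "\<dots> = ((\<tau> / 8) powr s * (d / t) powr s) * (c1 * (U / 2))" unfolding c3_def by simp
        also have "\<dots> \<le> a k" unfolding a_def using k3 c1 U by (intro mult_right_mono) auto
        finally show ?thesis .
      qed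
      have iter: "\<forall>z\<in>ball y (R k). u z \<ge> a k" if "k = 0 \<or> R (k - 1) < 2 * t" for k
        using that
      proof (induction k)
        case 0
        then show ?case using start unfolding R_def a_def by simp
      next
        case (Suc k)
        then have Rk: "R k < 2 * t" by simp
        have Rpos: "R j > 0" for j unfolding R_def using \<rho> by simp
        have "k = 0 \<or> R (k - 1) < 2 * t"
        proof (cases k)
          case (Suc j)
          have "R j \<le> R k" unfolding R_def Suc using \<rho> by simp
          then show ?thesis using Rk Suc by simp
        qed simp
        note IH = Suc.IH[OF this] and lk = low[OF this]
        have ak: "a k > 0" using lk c3 up by (smt (verit) mult_pos_pos)
        have N4: "N * (4 * R k) powr \<gamma> \<le> c1 * c2 * a k powr (p - 1)"
          using small[of "4 * R k" "a k"] Rk Rpos[of k] lk t by simp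
        also have "\<dots> \<le> 1 * c2 * a k powr (p - 1)" using c1 c2 by (intro mult_right_mono) auto
        finally have N5: "N * (4 * R k) powr \<gamma> \<le> c2 * a k powr (p - 1)" by simp
        show ?case
        proof
          fix z assume "z \<in> ball y (R (Suc k))"
          then have "z \<in> ball y (2 * R k)" unfolding R_def by simp
          from D[OF sol yb Rpos u0 ak IH N5 this] Rk have "u z \<ge> c2 * a k" by simp
          then show "u z \<ge> a (Suc k)" unfolding a_def by (simp add: mult.assoc)
        qed
      qed
      \<comment> \<open>The least such k is taken, because \<open>low\<close> requires that the
        preceding radius is below 2t; radius 2t about y covers the ball of radius t about
        x0.\<close>
      have "\<exists>k. R k \<ge> 2 * t"
      proof -
        obtain k where "4 * t / \<rho> < 2 ^ k" using real_arch_pow[of 2 "4 * t / \<rho>"] by auto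
        then have "R k \<ge> 2 * t" unfolding R_def using \<rho> by (simp add: field_simps)
        then show ?thesis ..
      qed
      then obtain k where k: "R k \<ge> 2 * t" and kmin: "\<And>j. j < k \<Longrightarrow> R j < 2 * t"
        using LeastI_ex[of "\<lambda>k. R k \<ge> 2 * t"] not_less_Least[of _ "\<lambda>k. R k \<ge> 2 * t"] by (metis not_le)
      have kk: "k = 0 \<or> R (k - 1) < 2 * t" using kmin[of "k - 1"] by (cases k) auto
      have "dist y x < 2 * t"
        using x ny dist_triangle[of y x x0] by (simp add: dist_norm norm_minus_commute)
      then have "x \<in> ball y (R k)" using k by simp
      then have "u x \<ge> a k" using iter[OF kk] by blast
      also have "a k \<ge> c3 * u x0" by (rule low[OF kk])
      also have "c3 * u x0 \<ge> c * u x0" using c(2) up by (intro mult_right_mono) auto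
      finally show ?thesis by simp
    qed
  qed
qed

end

subsection \<open>Chains of balls on spheres\<close>

text \<open>Two points of a sphere lie on a common great circle. If they are parallel, the second
  direction is any vector orthogonal to the first, and its existence is where dimension at least 2
  enters; in dimension one the sphere is disconnected.\<close>

lemma sphere_planar_angle:
  fixes x y :: "'a::euclidean_space"
  assumes "DIM('a) \<ge> 2" "norm x = R" "norm y = R" "R > 0"
  obtains e1 e2 :: 'a and \<theta> where "norm e1 = 1" "norm e2 = 1" "x = R *\<^sub>R e1"
    "y = R *\<^sub>R (cos \<theta> *\<^sub>R e1 + sin \<theta> *\<^sub>R e2)" "0 \<le> \<theta>" "\<theta> \<le> 2 * pi" "e1 \<bullet> e2 = 0"
proof -
  define e1 where "e1 = (1 / R) *\<^sub>R x"
  define w where "w = (1 / R) *\<^sub>R y"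
  have e1: "norm e1 = 1" "e1 \<bullet> e1 = 1" and w: "norm w = 1" "w \<bullet> w = 1"
    using assms unfolding e1_def w_def by (auto simp: dot_square_norm power2_eq_square)
  define a where "a = w \<bullet> e1"
  define v where "v = w - a *\<^sub>R e1"
  have ve: "v \<bullet> e1 = 0" unfolding v_def a_def using e1 by (simp add: inner_diff_left)
  have "\<exists>e2. norm e2 = 1 \<and> e1 \<bullet> e2 = 0 \<and> v = norm v *\<^sub>R e2"
  proof (cases "v = 0")
    case True
    obtain z where "z \<noteq> 0" "orthogonal e1 z"
      using orthogonal_to_vector_exists[OF assms(1), of e1] by blast
    then show ?thesis using True
      by (intro exI[of _ "(1 / norm z) *\<^sub>R z"]) (auto simp: orthogonal_def)
  next
    case False
    then show ?thesis using ve by (intro exI[of _ "(1 / norm v) *\<^sub>R v"]) (auto simp: inner_commute)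
  qed
  then obtain e2 where e2: "norm e2 = 1" "e1 \<bullet> e2 = 0" "v = norm v *\<^sub>R e2" by blast
  have "a\<^sup>2 + (norm v)\<^sup>2 = 1"
  proof -
    have "w \<bullet> w = (a *\<^sub>R e1 + v) \<bullet> (a *\<^sub>R e1 + v)" unfolding v_def by simp
    also have "\<dots> = a\<^sup>2 + (norm v)\<^sup>2"
      using e1 ve by (simp add: inner_add_left inner_add_right inner_commute power2_eq_square power2_norm_eq_inner[unfolded power2_eq_square])
    finally show ?thesis using w by simp
  qed
  then obtain \<theta> where \<theta>: "0 \<le> \<theta>" "\<theta> < 2 * pi" "a = cos \<theta>" "norm v = sin \<theta>"
    using sincos_total_2pi by metis
  have "w = cos \<theta> *\<^sub>R e1 + sin \<theta> *\<^sub>R e2" using e2(3) \<theta> unfolding v_def by (metis add.commute diff_add_cancel)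
  moreover have "x = R *\<^sub>R e1" "y = R *\<^sub>R w" unfolding e1_def w_def using assms by auto
  ultimately show thesis using that[of e1 e2 \<theta>] e1 e2 \<theta> by auto
qed

lemma sphere_chain:
  fixes x y :: "'a::euclidean_space"
  assumes "DIM('a) \<ge> 2" "norm x = R" "norm y = R" "R > 0"
  obtains z :: "nat \<Rightarrow> 'a" where "z 0 = x" "z 1000 = y" "\<And>i. norm (z i) = R" "\<And>i. dist (z i) (z (Suc i)) < R / 40"
proof -
  obtain e1 e2 :: 'a and \<theta> where e: "norm e1 = 1" "norm e2 = 1" "x = R *\<^sub>R e1"
    "y = R *\<^sub>R (cos \<theta> *\<^sub>R e1 + sin \<theta> *\<^sub>R e2)" "0 \<le> \<theta>" "\<theta> \<le> 2 * pi" "e1 \<bullet> e2 = 0"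
    using sphere_planar_angle[OF assms] .
  \<comment> \<open>The arc of angle at most 2 pi < 8 is cut into 1000 steps; cosine and sine change
    by at most h < 1/100 per step, so the chords are shorter than R/40.\<close>
  define h where "h = \<theta> / 1000"
  have h: "0 \<le> h" "h < 1 / 100"
    unfolding h_def using e pi_less_4 by auto
  define z where "z = (\<lambda>i::nat. R *\<^sub>R (cos (i * h) *\<^sub>R e1 + sin (i * h) *\<^sub>R e2))"
  show thesis
  proof
    show "z 0 = x" unfolding z_def using e by simp
    show "z 1000 = y" unfolding z_def h_def using e by simp
    fix i :: nat
    have "e1 \<bullet> e1 = 1" "e2 \<bullet> e2 = 1" using e by (auto simp: dot_square_norm)
    then have "(norm (cos (i * h) *\<^sub>R e1 + sin (i * h) *\<^sub>R e2))\<^sup>2 = (cos (i * h))\<^sup>2 + (sin (i * h))\<^sup>2"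
      using e unfolding power2_norm_eq_inner
      by (simp add: inner_add_left inner_add_right inner_commute power2_eq_square)
    then have "norm (cos (i * h) *\<^sub>R e1 + sin (i * h) *\<^sub>R e2) = 1"
      by (metis sin_cos_squared_add2 norm_ge_zero power2_eq_1_iff abs_norm_cancel abs_1 abs_minus)
    then show "norm (z i) = R" unfolding z_def using assms by simp
    have c: "\<bar>cos (i * h) - cos (Suc i * h)\<bar> \<le> h" and s: "\<bar>sin (i * h) - sin (Suc i * h)\<bar> \<le> h"
    proof -
      have "\<bar>f a - f b\<bar> \<le> \<bar>a - b\<bar>" if "\<And>x. (f has_real_derivative f' x) (at x)" "\<And>x. \<bar>f' x\<bar> \<le> 1" for f f' :: "real \<Rightarrow> real" and a b
        using field_differentiable_bound[of UNIV f f' 1 a b] that by (auto simp: has_field_derivative_at_within)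
      from this[of cos "\<lambda>x. - sin x"] this[of sin cos]
      have "\<bar>cos (i * h) - cos (Suc i * h)\<bar> \<le> \<bar>i * h - Suc i * h\<bar>" "\<bar>sin (i * h) - sin (Suc i * h)\<bar> \<le> \<bar>i * h - Suc i * h\<bar>"
        by (auto intro!: derivative_eq_intros simp: abs_sin_le_one abs_cos_le_one)
      moreover have "\<bar>i * h - Suc i * h\<bar> = h" using h by (simp add: algebra_simps)
      ultimately show "\<bar>cos (i * h) - cos (Suc i * h)\<bar> \<le> h" "\<bar>sin (i * h) - sin (Suc i * h)\<bar> \<le> h" by auto
    qed
    have "z i - z (Suc i) = R *\<^sub>R ((cos (i * h) - cos (Suc i * h)) *\<^sub>R e1 + (sin (i * h) - sin (Suc i * h)) *\<^sub>R e2)"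
      unfolding z_def by (simp add: algebra_simps)
    then have "dist (z i) (z (Suc i)) = R * norm ((cos (i * h) - cos (Suc i * h)) *\<^sub>R e1 + (sin (i * h) - sin (Suc i * h)) *\<^sub>R e2)"
      using assms by (simp add: dist_norm)
    also have "\<dots> \<le> R * (h + h)"
      using assms e c s by (intro mult_left_mono order_trans[OF norm_triangle_ineq] add_mono) auto
    also have "\<dots> < R / 40" using h assms by (simp add: field_simps)
    finally show "dist (z i) (z (Suc i)) < R / 40" .
  qed
qed

context DG_exponents
begin

text \<open>If the right-hand side dominates u(x), the error term alone bounds u(x). Otherwise the
  ball version is applied along a chain of balls of radius R/40, whose 20-fold enlargements of
  radius R/2 stay in |x| > R/3. The constant \<open>c'\<close> is so small that the right-hand side
  remains negligible at every link, where u may have dropped to c^1000 u(x).\<close>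

lemma harnack_sphere:
  assumes dim: "DIM('a) \<ge> 2"
  obtains C where "C \<ge> 1" "\<And>N (u::'a \<Rightarrow> real) G F R x y.
    \<lbrakk>DGsol p \<delta> L e N {x. norm x > R / 3} u G F; R > 0; \<forall>x. norm x > R / 3 \<longrightarrow> u x \<ge> 0;
     norm x = R; norm y = R\<rbrakk> \<Longrightarrow> u x \<le> C * (u y + (N * R powr \<gamma>) powr (1 / (p - 1)))"
proof -
  obtain c where c: "0 < c" "c < 1" and H: "\<And>N S (u::'a \<Rightarrow> real) G F x0 t x.
    \<lbrakk>DGsol p \<delta> L e N S u G F; cball x0 (20 * t) \<subseteq> S; t > 0; \<forall>x\<in>S. u x \<ge> 0;
     N * t powr \<gamma> \<le> c * u x0 powr (p - 1); x \<in> ball x0 t\<rbrakk> \<Longrightarrow> u x \<ge> c * u x0"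
    by (rule harnack_ball) (rule that)
  define c' where "c' = c * (c ^ 1000) powr (p - 1)"
  have c': "c' > 0" unfolding c'_def using c by simp
  define C where "C = max (1 / c ^ 1000) ((1 / c') powr (1 / (p - 1)))"
  have cm1: "c ^ 1000 \<le> 1" using c by (simp add: power_le_one)
  have C: "C \<ge> 1 / c ^ 1000" "C \<ge> (1 / c') powr (1 / (p - 1))" unfolding C_def by auto
  have C1: "C \<ge> 1" using C(1) cm1 c by (smt (verit) le_divide_eq_1_pos zero_less_power)
  show thesis
  proof (rule that[OF C1])
    fix N and u :: "'a \<Rightarrow> real" and G F R and x y :: 'a
    assume sol: "DGsol p \<delta> L e N {x. norm x > R / 3} u G F" and R: "R > 0"
      and u0: "\<forall>x. norm x > R / 3 \<longrightarrow> u x \<ge> 0" and x: "norm x = R" and y: "norm y = R"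
    let ?\<kappa> = "(N * R powr \<gamma>) powr (1 / (p - 1))"
    have N0: "N \<ge> 0" using DGsolD(2)[OF sol] .
    have ux: "u x \<ge> 0" and uy: "u y \<ge> 0" using u0 x y R by auto
    show "u x \<le> C * (u y + ?\<kappa>)"
    proof (cases "N * R powr \<gamma> \<le> c' * u x powr (p - 1)")
      case False
      then have "u x powr (p - 1) \<le> 1 / c' * (N * R powr \<gamma>)" using c' by (simp add: field_simps)
      then have "(u x powr (p - 1)) powr (1 / (p - 1)) \<le> (1 / c' * (N * R powr \<gamma>)) powr (1 / (p - 1))"
        using p by (intro powr_mono2) auto
      moreover have "(u x powr (p - 1)) powr (1 / (p - 1)) = u x" using p ux by (simp add: powr_powr)
      moreover have "(1 / c' * (N * R powr \<gamma>)) powr (1 / (p - 1)) = (1 / c') powr (1 / (p - 1)) * ?\<kappa>"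
        using c' N0 by (subst powr_mult) auto
      ultimately have "u x \<le> (1 / c') powr (1 / (p - 1)) * ?\<kappa>" by simp
      also have "\<dots> \<le> C * ?\<kappa>" using C(2) by (rule mult_right_mono) simp
      also have "\<dots> \<le> C * (u y + ?\<kappa>)" using C1 uy by (intro mult_left_mono) auto
      finally show ?thesis .
    next
      case True
      obtain z :: "nat \<Rightarrow> 'a" where z: "z 0 = x" "z 1000 = y" "\<And>i. norm (z i) = R"
        "\<And>i. dist (z i) (z (Suc i)) < R / 40"
        using sphere_chain[OF dim x y R] by blast
      have step: "i \<le> 1000 \<Longrightarrow> u (z i) \<ge> c ^ i * u x" for i
      proof (induction i)
        case 0 then show ?case using z by simp
      next
        case (Suc i)
        then have IH: "u (z i) \<ge> c ^ i * u x" by simp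
        have "u (z (Suc i)) \<ge> c * u (z i)"
        proof (rule H[OF sol])
          show "cball (z i) (20 * (R / 40)) \<subseteq> {x. norm x > R / 3}"
          proof
            fix v assume "v \<in> cball (z i) (20 * (R / 40))"
            then have "norm (z i - v) \<le> R / 2" by (simp add: dist_norm)
            then show "v \<in> {x. norm x > R / 3}"
              using norm_triangle_sub[of "z i" v] z(3)[of i] R by simp
          qed
          show "R / 40 > 0" using R by simp
          show "\<forall>x\<in>{x. norm x > R / 3}. u x \<ge> 0" using u0 by simp
          have "c ^ 1000 \<le> c ^ i" using Suc.prems c by (intro power_decreasing) auto
          then have ui: "c ^ 1000 * u x \<le> u (z i)" using IH mult_right_mono[OF _ ux] by (meson order_trans)
          have "N * (R / 40) powr \<gamma> \<le> N * R powr \<gamma>"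
            using N0 R \<gamma>_pos by (intro mult_left_mono powr_mono2) auto
          also have "\<dots> \<le> c' * u x powr (p - 1)" by (rule True)
          also have "\<dots> = c * (c ^ 1000 * u x) powr (p - 1)"
            unfolding c'_def using c ux by (simp add: powr_mult)
          also have "\<dots> \<le> c * u (z i) powr (p - 1)"
            using ui c ux p by (intro mult_left_mono powr_mono2) auto
          finally show "N * (R / 40) powr \<gamma> \<le> c * u (z i) powr (p - 1)" .
          show "z (Suc i) \<in> ball (z i) (R / 40)" using z(4)[of i] by simp
        qed
        moreover have "c * (c ^ i * u x) \<le> c * u (z i)" using IH c by (intro mult_left_mono) auto
        ultimately show ?case by simp
      qed
      from step[of 1000] have "c ^ 1000 * u x \<le> u y" using z by simp
      then have "u x \<le> 1 / c ^ 1000 * u y" using c by (simp add: field_simps)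
      also have "\<dots> \<le> C * u y" using C(1) uy by (rule mult_right_mono)
      also have "\<dots> \<le> C * (u y + ?\<kappa>)" using C1 by (intro mult_left_mono) auto
      finally show ?thesis .
    qed
  qed
qed

end

section \<open>Passage from smooth to C^1 test functions\<close>

subsection \<open>Mollification\<close>

lemma bochner_norm_bound:
  fixes f :: "'a \<Rightarrow> 'b::{banach, second_countable_topology}"
  assumes "integrable M f" "integrable M g" "\<And>x. norm (f x) \<le> g x"
  shows "norm (\<integral>x. f x \<partial>M) \<le> (\<integral>x. g x \<partial>M)"
  by (rule order_trans[OF integral_norm_bound integral_mono]) (use assms in auto)

text \<open>The flat function exp(-1/t), with powers of 1/t in front so that the linear span of the
  family is closed under differentiation.\<close>

definition flat_exp :: "nat \<Rightarrow> real \<Rightarrow> real" where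
  "flat_exp m t = (if t > 0 then inverse t ^ m * exp (- inverse t) else 0)"

lemma flat_exp_tendsto_0: "(flat_exp m \<longlongrightarrow> 0) (at 0)"
proof (rule filterlim_split_at)
  have "eventually (\<lambda>t::real. t < 0) (at_left 0)" by (simp add: eventually_at_filter)
  then show "(flat_exp m \<longlongrightarrow> 0) (at_left 0)"
    by (intro tendsto_eventually) (auto elim!: eventually_mono simp: flat_exp_def)
  have "((\<lambda>t::real. inverse t ^ m / exp (inverse t)) \<longlongrightarrow> 0) (at_right 0)"
    by (rule filterlim_compose[OF tendsto_power_div_exp_0 filterlim_inverse_at_top_right])
  moreover have "eventually (\<lambda>t::real. t > 0) (at_right 0)" by (simp add: eventually_at_filter)
  then have "eventually (\<lambda>t::real. inverse t ^ m / exp (inverse t) = flat_exp m t) (at_right 0)"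
    by (rule eventually_mono) (auto simp: flat_exp_def exp_minus divide_inverse)
  ultimately show "(flat_exp m \<longlongrightarrow> 0) (at_right 0)" by (rule Lim_transform_eventually)
qed

lemma flat_exp_deriv:
  "(flat_exp m has_real_derivative - real m * flat_exp (Suc m) t + flat_exp (Suc (Suc m)) t) (at t)"
proof -
  consider "t > 0" | "t < 0" | "t = 0" by linarith
  then show ?thesis
  proof cases
    case 1
    have "((\<lambda>t. inverse t ^ m * exp (- inverse t)) has_real_derivative
       - real m * (inverse t ^ Suc m * exp (- inverse t)) + inverse t ^ Suc (Suc m) * exp (- inverse t)) (at t)"
    proof -
      let ?s = "inverse t"
      have "((\<lambda>s. s ^ m * exp (- s)) has_real_derivative real m * ?s ^ (m - 1) * exp (- ?s) - ?s ^ m * exp (- ?s)) (at ?s)"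
        by (auto intro!: derivative_eq_intros)
      moreover have "(inverse has_real_derivative - (?s * ?s)) (at t)"
        using 1 by (auto intro!: derivative_eq_intros)
      ultimately have "((\<lambda>t. inverse t ^ m * exp (- inverse t)) has_real_derivative
         (real m * ?s ^ (m - 1) * exp (- ?s) - ?s ^ m * exp (- ?s)) * (- (?s * ?s))) (at t)"
        by (rule DERIV_chain2)
      moreover have "(real m * ?s ^ (m - 1) * exp (- ?s) - ?s ^ m * exp (- ?s)) * (- (?s * ?s))
        = - real m * (?s ^ Suc m * exp (- ?s)) + ?s ^ Suc (Suc m) * exp (- ?s)"
        by (cases m) (simp_all add: algebra_simps)
      ultimately show ?thesis by simp
    qed
    then have "(flat_exp m has_real_derivative
       - real m * (inverse t ^ Suc m * exp (- inverse t)) + inverse t ^ Suc (Suc m) * exp (- inverse t)) (at t)"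
      by (rule has_field_derivative_transform_within_open[of _ _ _ "{0<..}"]) (use 1 in \<open>auto simp: flat_exp_def\<close>)
    then show ?thesis using 1 by (simp add: flat_exp_def)
  next
    case 2
    have "((\<lambda>t. 0) has_real_derivative 0) (at t)" by simp
    then have "(flat_exp m has_real_derivative 0) (at t)"
      by (rule has_field_derivative_transform_within_open[of _ _ _ "{..<0}"]) (use 2 in \<open>auto simp: flat_exp_def\<close>)
    then show ?thesis using 2 by (simp add: flat_exp_def)
  next
    case 3
    have "((\<lambda>h. flat_exp m h / h) \<longlongrightarrow> 0) (at (0::real))"
      by (rule Lim_transform_within[OF flat_exp_tendsto_0[of "Suc m"], of 1])
        (auto simp: flat_exp_def divide_inverse)
    then show ?thesis using 3 unfolding DERIV_def by (simp add: flat_exp_def)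
  qed
qed

text \<open>A class of functions that contains a bump function and is closed under partial derivatives.\<close>

inductive smoothcl :: "real \<Rightarrow> ('a::euclidean_space \<Rightarrow> real) \<Rightarrow> bool" for r where
  const: "smoothcl r (\<lambda>x. c)"
| lin: "smoothcl r (\<lambda>x. x \<bullet> v)"
| bump: "smoothcl r (\<lambda>x. flat_exp m (r\<^sup>2 - x \<bullet> x))"
| add: "smoothcl r f \<Longrightarrow> smoothcl r g \<Longrightarrow> smoothcl r (\<lambda>x. f x + g x)"
| mult: "smoothcl r f \<Longrightarrow> smoothcl r g \<Longrightarrow> smoothcl r (\<lambda>x. f x * g x)"

lemma smoothcl_derivative:
  assumes "smoothcl r g"
  shows "\<exists>D. (\<forall>x. (g has_derivative D x) (at x)) \<and> (\<forall>v. smoothcl r (\<lambda>x. D x v))"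
  using assms
proof induction
  case (const c)
  show ?case by (rule exI[of _ "\<lambda>x h. 0"]) (auto intro: smoothcl.const)
next
  case (lin v)
  show ?case
    by (rule exI[of _ "\<lambda>x h. h \<bullet> v"]) (auto intro: smoothcl.const intro!: derivative_eq_intros)
next
  case (bump m)
  have d: "((\<lambda>x. r\<^sup>2 - x \<bullet> x) has_derivative (\<lambda>h. - 2 * (x \<bullet> h))) (at x)" for x :: 'a
    by (auto intro!: derivative_eq_intros simp: inner_commute)
  have "((\<lambda>x. flat_exp m (r\<^sup>2 - x \<bullet> x)) has_derivative
     (\<lambda>h. (- real m * flat_exp (Suc m) (r\<^sup>2 - x \<bullet> x) + flat_exp (Suc (Suc m)) (r\<^sup>2 - x \<bullet> x)) * (- 2 * (x \<bullet> h)))) (at x)" for x :: 'a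
    by (rule has_derivative_compose[OF d flat_exp_deriv[unfolded has_field_derivative_def]])
  moreover have "smoothcl r (\<lambda>x. (- real m * flat_exp (Suc m) (r\<^sup>2 - x \<bullet> x) + flat_exp (Suc (Suc m)) (r\<^sup>2 - x \<bullet> x)) * (- 2 * (x \<bullet> v)))" for v :: 'a
    by (intro smoothcl.intros)
  ultimately show ?case
    by (intro exI[of _ "\<lambda>x h. (- real m * flat_exp (Suc m) (r\<^sup>2 - x \<bullet> x) + flat_exp (Suc (Suc m)) (r\<^sup>2 - x \<bullet> x)) * (- 2 * (x \<bullet> h))"])
      auto
next
  case (add f g)
  then obtain Df Dg where D: "\<forall>x. (f has_derivative Df x) (at x)" "\<forall>v. smoothcl r (\<lambda>x. Df x v)"
    "\<forall>x. (g has_derivative Dg x) (at x)" "\<forall>v. smoothcl r (\<lambda>x. Dg x v)" by blast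
  show ?case
    by (rule exI[of _ "\<lambda>x h. Df x h + Dg x h"]) (use D in \<open>auto intro: smoothcl.add has_derivative_add\<close>)
next
  case (mult f g)
  then obtain Df Dg where D: "\<forall>x. (f has_derivative Df x) (at x)" "\<forall>v. smoothcl r (\<lambda>x. Df x v)"
    "\<forall>x. (g has_derivative Dg x) (at x)" "\<forall>v. smoothcl r (\<lambda>x. Dg x v)" by blast
  show ?case
    by (rule exI[of _ "\<lambda>x h. f x * Dg x h + Df x h * g x"])
      (use D mult.hyps in \<open>auto intro!: smoothcl.add smoothcl.mult has_derivative_mult\<close>)
qed

lemma smoothcl_gradient:
  fixes g :: "'a::euclidean_space \<Rightarrow> real"
  assumes "smoothcl r g"
  obtains D where "\<And>x. (g has_derivative (\<lambda>h. D x \<bullet> h)) (at x)" "continuous_on UNIV D"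
    "\<And>v. smoothcl r (\<lambda>x. D x \<bullet> v)"
proof -
  obtain D' where D': "\<And>x. (g has_derivative D' x) (at x)" "\<And>v. smoothcl r (\<lambda>x. D' x v)"
    using smoothcl_derivative[OF assms] by blast
  define D where "D = (\<lambda>x. \<Sum>b\<in>Basis. D' x b *\<^sub>R b)"
  have D: "D' x = (\<lambda>h. D x \<bullet> h)" for x
  proof
    fix h
    have l: "linear (D' x)" using D'(1) has_derivative_linear by blast
    have "D' x h = D' x (\<Sum>b\<in>Basis. (h \<bullet> b) *\<^sub>R b)" by (simp add: euclidean_representation)
    also have "\<dots> = (\<Sum>b\<in>Basis. (h \<bullet> b) * D' x b)"
      using l by (simp add: linear_sum linear_scale)
    also have "\<dots> = D x \<bullet> h"
      unfolding D_def by (simp add: inner_sum_left inner_commute[of h] mult.commute)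
    finally show "D' x h = D x \<bullet> h" .
  qed
  have "continuous_on UNIV (\<lambda>x. D' x b)" for b
  proof -
    obtain E where E: "\<forall>x. ((\<lambda>x. D' x b) has_derivative E x) (at x)"
      using smoothcl_derivative[OF D'(2)[of b]] by blast
    show ?thesis
      by (intro continuous_at_imp_continuous_on ballI has_derivative_continuous[OF E[rule_format]])
  qed
  then have "continuous_on UNIV D" unfolding D_def by (intro continuous_intros)
  then show thesis using that[of D] D' D by auto
qed

definition convol :: "('a::euclidean_space \<Rightarrow> real) \<Rightarrow> ('a \<Rightarrow> real) \<Rightarrow> 'a \<Rightarrow> real" where
  "convol \<phi> g x = (\<integral>y. \<phi> y * g (x - y) \<partial>lborel)"

lemma lborel_reflect: "lborel = distr lborel borel (\<lambda>y::'a::euclidean_space. x - y)"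
  using lborel_affine[of "-1" x] by (simp add: density_1)

lemma convol_commute:
  assumes "continuous_on UNIV \<phi>" "continuous_on UNIV g"
  shows "convol \<phi> g x = convol g \<phi> x"
proof -
  have [measurable]: "\<phi> \<in> borel_measurable borel" "g \<in> borel_measurable borel"
    using assms by (auto intro: borel_measurable_continuous_onI)
  have "convol \<phi> g x = (\<integral>y. \<phi> y * g (x - y) \<partial>(distr lborel borel (\<lambda>y. x - y)))"
    unfolding convol_def using lborel_reflect[of x] by simp
  also have "\<dots> = (\<integral>y. \<phi> (x - y) * g (x - (x - y)) \<partial>lborel)"
    by (subst integral_distr) auto
  finally show ?thesis unfolding convol_def by (simp add: mult.commute)
qed

lemma compact_support_uniformly_continuous:
  fixes D :: "'a::euclidean_space \<Rightarrow> 'b::real_normed_vector"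
  assumes c: "continuous_on UNIV D" and K: "compact K" "\<And>x. x \<notin> K \<Longrightarrow> D x = 0" and e: "e > 0"
  obtains d where "d > 0" "\<And>x y. dist x y < d \<Longrightarrow> dist (D x) (D y) < e"
proof -
  let ?K = "{x + y |x y. x \<in> K \<and> y \<in> cball 0 (1::real)}"
  have cK: "compact ?K" by (rule compact_sums[OF K(1) compact_cball])
  have near: "y \<in> ?K" if "x \<in> K" "dist x y < 1" for x y
  proof -
    show ?thesis using that
      by (intro CollectI exI[of _ x] exI[of _ "y - x"]) (auto simp: dist_norm norm_minus_commute)
  qed
  have "uniformly_continuous_on ?K D"
    using compact_uniformly_continuous[OF continuous_on_subset[OF c] cK] by simp
  then have "\<exists>d>0. \<forall>x\<in>?K. \<forall>y\<in>?K. dist y x < d \<longrightarrow> dist (D y) (D x) < e"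
    using e unfolding uniformly_continuous_on_def by simp
  then obtain d where d: "d > 0" "\<forall>x\<in>?K. \<forall>y\<in>?K. dist y x < d \<longrightarrow> dist (D y) (D x) < e"
    by (elim exE conjE)
  show thesis
  proof (rule that[of "min d 1"])
    show "min d 1 > 0" using d by simp
    fix x y :: 'a assume xy: "dist x y < min d 1"
    show "dist (D x) (D y) < e"
    proof (cases "x \<in> K \<or> y \<in> K")
      case True
      then have "x \<in> ?K \<and> y \<in> ?K"
      proof
        assume "x \<in> K" then show ?thesis using near[of x x] near[of x y] xy by simp
      next
        assume "y \<in> K" then show ?thesis using near[of y y] near[of y x] xy by (simp add: dist_commute)
      qed
      then show ?thesis using d(2)[rule_format, of y x] xy by simp
    next
      case False
      then show ?thesis using K(2) e by simp
    qed
  qed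
qed

text \<open>The remainder is uniform in x thanks to the compact support. Convolutions can then be
  differentiated, and integrals of gradients evaluated, without dominated convergence.\<close>

lemma C1c_taylor:
  fixes g :: "'a::euclidean_space \<Rightarrow> real"
  assumes g: "C1c UNIV g D" and e: "e > 0"
  obtains d where "d > 0" "\<And>x h. norm h < d \<Longrightarrow> \<bar>g (x + h) - g x - D x \<bullet> h\<bar> \<le> norm h * e"
proof -
  note Dc = C1c_continuous(2)[OF g]
  obtain K where K: "compact K" "\<And>x. x \<notin> K \<Longrightarrow> g x = 0" using g unfolding C1c_def by blast
  obtain d where d: "d > 0" and du: "\<And>x y. dist x y < d \<Longrightarrow> dist (D x) (D y) < e"
    using compact_support_uniformly_continuous[OF Dc K(1) C1c_deriv_zero[OF g K] e] by blast
  show thesis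
  proof (rule that[OF d])
    fix x h :: 'a assume h: "norm h < d"
    have "norm (g (x + h) - g x - D x \<bullet> ((x + h) - x)) \<le> norm ((x + h) - x) * e"
    proof (rule differentiable_bound_linearization[of x "x + h" "ball x d" g "\<lambda>x h. D x \<bullet> h" x e])
      fix t :: real assume t: "t \<in> {0..1}"
      have "norm (t *\<^sub>R h) \<le> norm h" using t by (simp add: mult_left_le_one_le)
      then show "x + t *\<^sub>R (x + h - x) \<in> ball x d" using h by (simp add: dist_norm)
    next
      fix w assume w: "w \<in> ball x d"
      show "(g has_derivative (\<bullet>) (D w)) (at w within ball x d)"
        using g has_derivative_at_withinI unfolding C1c_def by blast
      have "onorm ((\<bullet>) (D w) - (\<bullet>) (D x)) \<le> norm (D w - D x)"
        by (rule onorm_le) (simp add: inner_diff_left[symmetric] Cauchy_Schwarz_ineq2)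
      also have "\<dots> \<le> e" using du[of w x] w by (simp add: dist_norm norm_minus_commute)
      finally show "onorm ((\<bullet>) (D w) - (\<bullet>) (D x)) \<le> e" .
    qed (use d in auto)
    then show "\<bar>g (x + h) - g x - D x \<bullet> h\<bar> \<le> norm h * e" by simp
  qed
qed

lemma continuous_nonneg_integral_0:
  fixes g :: "'a::euclidean_space \<Rightarrow> real"
  assumes S: "open S" "continuous_on S g" and g: "\<And>x. g x \<ge> 0" "integrable lborel g" "(\<integral>x. g x \<partial>lborel) \<le> 0"
    and x: "x \<in> S"
  shows "g x = 0"
proof (rule ccontr)
  assume "g x \<noteq> 0"
  then have gx: "g x > 0" using g(1)[of x] by simp
  let ?E = "{x\<in>S. g x > 0}"
  have o: "open ?E" by (rule open_superlevel[OF S])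
  obtain e where e: "e > 0" "ball x e \<subseteq> ?E" using o x gx by (auto elim: openE)
  have "(\<integral>x. g x \<partial>lborel) = 0" using g(1,3) by (simp add: antisym)
  then have "AE x in lborel. g x = 0"
    using integral_nonneg_eq_0_iff_AE[OF g(2)] g(1) by simp
  then have "AE y in lborel. y \<notin> ball x e" by (rule eventually_mono) (use e in auto)
  then have "emeasure lborel (ball x e) = 0"
    by (subst (asm) AE_iff_measurable[OF _ refl]) (auto simp: ball_def)
  then have "measure lborel (ball x e) = 0" by (simp add: measure_def)
  then show False using content_ball_pos[OF e(1), of x] by simp
qed

lemma convol_deriv:
  fixes \<phi> g :: "'a::euclidean_space \<Rightarrow> real"
  assumes \<phi>: "continuous_on UNIV \<phi>" "compact K1" "\<And>x. x \<notin> K1 \<Longrightarrow> \<phi> x = 0"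
    and g: "C1c UNIV g D"
  shows "(convol \<phi> g has_derivative (\<lambda>h. (\<integral>y. \<phi> y *\<^sub>R D (x - y) \<partial>lborel) \<bullet> h)) (at x)"
proof -
  note gc = C1c_continuous(1)[OF g] and Dc = C1c_continuous(2)[OF g]
  obtain K where K: "compact K" "\<And>x. x \<notin> K \<Longrightarrow> g x = 0" using g unfolding C1c_def by blast
  note D0 = C1c_deriv_zero[OF g K]
  have gd: "(g has_derivative (\<lambda>h. D x \<bullet> h)) (at x)" for x using g unfolding C1c_def by blast
  have i\<phi>: "integrable lborel (\<lambda>y. \<bar>\<phi> y\<bar>)"
    by (rule integrable_continuous_compact_support[OF _ \<phi>(2)])
      (use \<phi> continuous_on_subset[OF \<phi>(1)] in \<open>auto intro!: continuous_intros\<close>)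
  have ig: "integrable lborel (\<lambda>y. \<phi> y * g (x - y))" for x
    by (rule integrable_continuous_compact_support[OF _ \<phi>(2)])
      (use \<phi> continuous_on_subset[OF \<phi>(1)] in \<open>auto intro!: continuous_intros continuous_on_compose2[OF gc]\<close>)
  have iD: "integrable lborel (\<lambda>y. \<phi> y *\<^sub>R D (x - y))" for x
    by (rule integrable_continuous_compact_support[OF _ \<phi>(2)])
      (use \<phi> continuous_on_subset[OF \<phi>(1)] in \<open>auto intro!: continuous_intros continuous_on_compose2[OF Dc]\<close>)
  define I where "I = (\<integral>y. \<bar>\<phi> y\<bar> \<partial>lborel)"
  have I: "I \<ge> 0" unfolding I_def by simp
  define V where "V = (\<integral>y. \<phi> y *\<^sub>R D (x - y) \<partial>lborel)"
  have "(convol \<phi> g has_derivative (\<lambda>h. V \<bullet> h)) (at x)"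
    unfolding has_derivative_at_alt
  proof (intro conjI allI impI)
    show "bounded_linear ((\<bullet>) V)" by (rule bounded_linear_inner_right)
    fix e :: real assume e: "e > 0"
    define e' where "e' = e / (I + 1)"
    have e': "e' > 0" "I * e' \<le> e" unfolding e'_def using e I by (auto simp: field_simps)
    obtain d where d: "d > 0" and du: "\<And>x h. norm h < d \<Longrightarrow> \<bar>g (x + h) - g x - D x \<bullet> h\<bar> \<le> norm h * e'"
      by (rule C1c_taylor[OF g e'(1)]) (rule that)
    show "\<exists>d>0. \<forall>y. norm (y - x) < d \<longrightarrow> norm (convol \<phi> g y - convol \<phi> g x - V \<bullet> (y - x)) \<le> e * norm (y - x)"
    proof (intro exI[of _ d] conjI allI impI d)
      fix z assume z: "norm (z - x) < d"
      have pt: "\<bar>g (z - y) - g (x - y) - D (x - y) \<bullet> (z - x)\<bar> \<le> norm (z - x) * e'" for y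
        using du[OF z, of "x - y"] by (simp add: algebra_simps)
      have "convol \<phi> g z - convol \<phi> g x - V \<bullet> (z - x)
        = (\<integral>y. \<phi> y * g (z - y) - \<phi> y * g (x - y) - (\<phi> y *\<^sub>R D (x - y)) \<bullet> (z - x) \<partial>lborel)"
        unfolding convol_def V_def using ig iD
        by (simp add: Bochner_Integration.integral_diff del: inner_scaleR_left)
      also have "\<dots> = (\<integral>y. \<phi> y * (g (z - y) - g (x - y) - D (x - y) \<bullet> (z - x)) \<partial>lborel)"
        by (simp add: algebra_simps)
      finally have eq: "convol \<phi> g z - convol \<phi> g x - V \<bullet> (z - x)
        = (\<integral>y. \<phi> y * (g (z - y) - g (x - y) - D (x - y) \<bullet> (z - x)) \<partial>lborel)" .
      have "norm (convol \<phi> g z - convol \<phi> g x - V \<bullet> (z - x))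
        \<le> (\<integral>y. \<bar>\<phi> y\<bar> * (norm (z - x) * e') \<partial>lborel)"
        unfolding eq
      proof (rule bochner_norm_bound)
        have "integrable lborel (\<lambda>y. \<phi> y * g (z - y) - \<phi> y * g (x - y) - (\<phi> y *\<^sub>R D (x - y)) \<bullet> (z - x))"
          using ig iD by (intro Bochner_Integration.integrable_diff integrable_inner_left) auto
        then show "integrable lborel (\<lambda>y. \<phi> y * (g (z - y) - g (x - y) - D (x - y) \<bullet> (z - x)))"
          by (simp add: algebra_simps)
        show "integrable lborel (\<lambda>y. \<bar>\<phi> y\<bar> * (norm (z - x) * e'))" using i\<phi> by simp
        show "norm (\<phi> y * (g (z - y) - g (x - y) - D (x - y) \<bullet> (z - x))) \<le> \<bar>\<phi> y\<bar> * (norm (z - x) * e')" for y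
          using pt[of y] by (simp add: abs_mult mult_left_mono)
      qed
      also have "\<dots> = (I * e') * norm (z - x)" unfolding I_def by simp
      also have "\<dots> \<le> e * norm (z - x)" using e'(2) by (rule mult_right_mono) simp
      finally show "norm (convol \<phi> g z - convol \<phi> g x - V \<bullet> (z - x)) \<le> e * norm (z - x)" .
    qed
  qed
  then show ?thesis unfolding V_def .
qed

lemma grad_eqI: "(g has_derivative (\<lambda>h. a \<bullet> h)) (at x) \<Longrightarrow> grad g x = a"
  unfolding grad_def by (simp add: frechet_derivative_at[symmetric] euclidean_representation)

text \<open>Each derivative falls on the smooth factor \<open>g\<close> and stays in the class
  generated by the bump, with the same support; this is what the induction on \<open>k\<close> runs
  over.\<close>

lemma convol_smooth:
  fixes \<phi> g :: "'a::euclidean_space \<Rightarrow> real"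
  assumes \<phi>: "continuous_on UNIV \<phi>" "compact K1" "\<And>x. x \<notin> K1 \<Longrightarrow> \<phi> x = 0"
    and g: "smoothcl r g" "\<And>x. x \<notin> cball 0 r \<Longrightarrow> g x = 0"
  shows "Ck_on k UNIV (convol \<phi> g)"
  using g
proof (induction k arbitrary: g)
  case 0
  obtain D where D: "\<And>x. (g has_derivative (\<lambda>h. D x \<bullet> h)) (at x)" "continuous_on UNIV D"
    "\<And>v. smoothcl r (\<lambda>x. D x \<bullet> v)"
    by (rule smoothcl_gradient[OF 0(1)]) (rule that)
  have "C1c UNIV g D" unfolding C1c_def using D 0(2) by (intro conjI exI[of _ "cball 0 r"]) auto
  from convol_deriv[OF \<phi> this] show ?case
    by (auto intro!: continuous_at_imp_continuous_on has_derivative_continuous)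
next
  case (Suc k)
  obtain D where D: "\<And>x. (g has_derivative (\<lambda>h. D x \<bullet> h)) (at x)" "continuous_on UNIV D"
    "\<And>v. smoothcl r (\<lambda>x. D x \<bullet> v)"
    by (rule smoothcl_gradient[OF Suc.prems(1)]) (rule that)
  have C: "C1c UNIV g D" unfolding C1c_def using D Suc.prems(2) by (intro conjI exI[of _ "cball 0 r"]) auto
  note d = convol_deriv[OF \<phi> C]
  have D0: "D x = 0" if "x \<notin> cball 0 r" for x
    using C1c_deriv_zero[OF C compact_cball Suc.prems(2) that] by simp
  have eq: "(\<lambda>x. frechet_derivative (convol \<phi> g) (at x) v) = convol \<phi> (\<lambda>x. D x \<bullet> v)" for v
  proof
    fix x
    have i: "integrable lborel (\<lambda>y. \<phi> y *\<^sub>R D (x - y))"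
      by (rule integrable_continuous_compact_support[OF _ \<phi>(2)])
        (use \<phi> continuous_on_subset[OF \<phi>(1)] in \<open>auto intro!: continuous_intros continuous_on_compose2[OF D(2)]\<close>)
    have "frechet_derivative (convol \<phi> g) (at x) v = (\<integral>y. \<phi> y *\<^sub>R D (x - y) \<partial>lborel) \<bullet> v"
      using frechet_derivative_at[OF d[of x]] by metis
    also have "\<dots> = (\<integral>y. (\<phi> y *\<^sub>R D (x - y)) \<bullet> v \<partial>lborel)"
      by (rule integral_inner_left[symmetric]) (rule i)
    finally show "frechet_derivative (convol \<phi> g) (at x) v = convol \<phi> (\<lambda>x. D x \<bullet> v) x"
      unfolding convol_def by simp
  qed
  have "Ck_on k UNIV (convol \<phi> (\<lambda>x. D x \<bullet> v))" for v
    by (rule Suc.IH[OF D(3)]) (use D0 in simp)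
  then show ?case using d unfolding Ck_on.simps eq by (auto simp: differentiable_def)
qed

text \<open>The convolution is used in both orders: differentiating the bump shows smoothness,
  differentiating \<eta> shows that the gradient is an average of \<open>D\<close> and hence
  uniformly close to it. All approximations are supported in one compact \<open>K\<close> inside
  \<open>S\<close>, so that the weak formulation passes to the limit with integrability on
  \<open>K\<close> alone.\<close>

lemma mollify:
  fixes \<eta> :: "'a::euclidean_space \<Rightarrow> real"
  assumes S: "open S" and \<eta>: "C1c S \<eta> D"
  obtains K where "compact K" "K \<subseteq> S" "\<And>x. x \<notin> K \<Longrightarrow> \<eta> x = 0"
    "\<And>\<epsilon>. \<epsilon> > 0 \<Longrightarrow> \<exists>\<phi> V. test_fun S \<phi> \<and> C1c S \<phi> V \<and> (\<forall>x. x \<notin> K \<longrightarrow> \<phi> x = 0) \<and>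
       (\<forall>x. \<bar>\<phi> x - \<eta> x\<bar> \<le> \<epsilon>) \<and> (\<forall>x. norm (V x - D x) \<le> \<epsilon>)"
proof -
  note \<eta>c = C1c_continuous(1)[OF \<eta>] and Dc = C1c_continuous(2)[OF \<eta>]
  have \<eta>U: "C1c UNIV \<eta> D" using C1c_mono[OF \<eta>] by simp
  obtain K0 where K0: "compact K0" "K0 \<subseteq> S" "\<And>x. x \<notin> K0 \<Longrightarrow> \<eta> x = 0" using \<eta> unfolding C1c_def by blast
  note D0 = C1c_deriv_zero[OF \<eta> K0(1,3)]
  obtain d0 where d0: "d0 > 0" "(\<Union>x\<in>K0. cball x d0) \<subseteq> S"
    using compact_subset_open_imp_cball_epsilon_subset[OF K0(1) S K0(2)] .
  define K where "K = {x + y |x y. x \<in> K0 \<and> y \<in> cball 0 d0}"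
  have cK: "compact K" unfolding K_def by (rule compact_sums[OF K0(1) compact_cball])
  have KS: "K \<subseteq> S"
  proof
    fix z assume "z \<in> K"
    then obtain x y where "z = x + y" "x \<in> K0" "y \<in> cball 0 d0" unfolding K_def by blast
    then have "z \<in> cball x d0" by (simp add: dist_norm)
    then show "z \<in> S" using d0(2) \<open>x \<in> K0\<close> by blast
  qed
  have K0K: "K0 \<subseteq> K"
  proof
    fix x assume "x \<in> K0"
    then show "x \<in> K" unfolding K_def using d0 by (intro CollectI exI[of _ x] exI[of _ 0]) auto
  qed
  show thesis
  proof (rule that[OF cK KS])
    show "\<eta> x = 0" if "x \<notin> K" for x using K0(3) K0K that by blast
    fix \<epsilon> :: real assume \<epsilon>: "\<epsilon> > 0"
    obtain d1 where d1: "d1 > 0" "\<And>x y. dist x y < d1 \<Longrightarrow> dist (\<eta> x) (\<eta> y) < \<epsilon>"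
      using compact_support_uniformly_continuous[OF \<eta>c K0(1,3) \<epsilon>] by blast
    obtain d2 where d2: "d2 > 0" "\<And>x y. dist x y < d2 \<Longrightarrow> dist (D x) (D y) < \<epsilon>"
      using compact_support_uniformly_continuous[OF Dc K0(1) D0 \<epsilon>] by blast
    define r where "r = min d0 (min d1 d2) / 2"
    have r: "r > 0" "r < d0" "r < d1" "r < d2" unfolding r_def using d0 d1 d2 by (auto simp: min_def)
    define b where "b = (\<lambda>x::'a. flat_exp 0 (r\<^sup>2 - x \<bullet> x))"
    have b0: "b x \<ge> 0" for x unfolding b_def flat_exp_def by simp
    have bz: "b x = 0" if "x \<notin> cball 0 r" for x
    proof -
      have "norm x > r" using that by simp
      then have "r\<^sup>2 < (norm x)\<^sup>2" using r by (intro power_strict_mono) auto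
      then show ?thesis unfolding b_def flat_exp_def by (simp add: dot_square_norm)
    qed
    have sb: "smoothcl r b" unfolding b_def by (rule smoothcl.bump)
    obtain Db where Db: "\<And>x. (b has_derivative (\<lambda>h. Db x \<bullet> h)) (at x)" "continuous_on UNIV Db"
      "\<And>v. smoothcl r (\<lambda>x. Db x \<bullet> v)"
      by (rule smoothcl_gradient[OF sb]) (rule that)
    have bc: "continuous_on UNIV b"
      using Db(1) by (auto intro!: continuous_at_imp_continuous_on has_derivative_continuous)
    have bi: "integrable lborel b"
      by (rule integrable_continuous_compact_support[OF _ compact_cball[of 0 r]])
        (use bz continuous_on_subset[OF bc] in auto)
    define I where "I = (\<integral>x. b x \<partial>lborel)"
    have I: "I > 0"
    proof (rule ccontr)
      assume "\<not> I > 0"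
      then have "b 0 = 0"
        using continuous_nonneg_integral_0[OF open_UNIV bc b0 bi, of 0] unfolding I_def by simp
      then show False unfolding b_def flat_exp_def using r by simp
    qed
    define \<rho> where "\<rho> = (\<lambda>x. inverse I * b x)"
    have \<rho>s: "smoothcl r \<rho>" unfolding \<rho>_def by (intro smoothcl.mult smoothcl.const sb)
    have \<rho>0: "\<rho> x \<ge> 0" for x unfolding \<rho>_def using b0 I by simp
    have \<rho>z: "\<rho> x = 0" if "x \<notin> cball 0 r" for x unfolding \<rho>_def using bz that by simp
    have \<rho>c: "continuous_on UNIV \<rho>" unfolding \<rho>_def using bc by (intro continuous_intros)
    have \<rho>i: "integrable lborel \<rho>" unfolding \<rho>_def using bi by simp
    have \<rho>1: "(\<integral>x. \<rho> x \<partial>lborel) = 1" unfolding \<rho>_def using I by (simp add: I_def)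
    define \<phi> where "\<phi> = convol \<rho> \<eta>"
    define V where "V = (\<lambda>x. \<integral>y. \<rho> y *\<^sub>R D (x - y) \<partial>lborel)"
    have avg: "norm ((\<integral>y. \<rho> y *\<^sub>R g (x - y) \<partial>lborel) - g x) \<le> \<epsilon>"
      if gc: "continuous_on UNIV g" and du: "\<And>x y. dist x y \<le> r \<Longrightarrow> dist (g x) (g y) < \<epsilon>"
      for g :: "'a \<Rightarrow> 'b::euclidean_space" and x
    proof -
      have ig: "integrable lborel (\<lambda>y. \<rho> y *\<^sub>R g (x - y))"
        by (rule integrable_continuous_compact_support[OF _ compact_cball[of 0 r]])
          (use \<rho>z continuous_on_subset[OF \<rho>c] in \<open>auto intro!: continuous_intros continuous_on_compose2[OF gc]\<close>)
      have "(\<integral>y. \<rho> y *\<^sub>R g (x - y) \<partial>lborel) - g x = (\<integral>y. \<rho> y *\<^sub>R g (x - y) \<partial>lborel) - (\<integral>y. \<rho> y *\<^sub>R g x \<partial>lborel)"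
        using \<rho>i \<rho>1 by simp
      also have "\<dots> = (\<integral>y. \<rho> y *\<^sub>R g (x - y) - \<rho> y *\<^sub>R g x \<partial>lborel)"
        using ig \<rho>i by (intro Bochner_Integration.integral_diff[symmetric]) auto
      finally have eq: "(\<integral>y. \<rho> y *\<^sub>R g (x - y) \<partial>lborel) - g x = (\<integral>y. \<rho> y *\<^sub>R g (x - y) - \<rho> y *\<^sub>R g x \<partial>lborel)" .
      have "norm (\<integral>y. \<rho> y *\<^sub>R g (x - y) - \<rho> y *\<^sub>R g x \<partial>lborel) \<le> (\<integral>y. \<rho> y * \<epsilon> \<partial>lborel)"
      proof (rule bochner_norm_bound)
        show "integrable lborel (\<lambda>y. \<rho> y *\<^sub>R g (x - y) - \<rho> y *\<^sub>R g x)"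
          using ig \<rho>i by (intro Bochner_Integration.integrable_diff) auto
        show "integrable lborel (\<lambda>y. \<rho> y * \<epsilon>)" using \<rho>i by simp
        show "norm (\<rho> y *\<^sub>R g (x - y) - \<rho> y *\<^sub>R g x) \<le> \<rho> y * \<epsilon>" for y
        proof (cases "y \<in> cball 0 r")
          case True
          then have "norm (g (x - y) - g x) \<le> \<epsilon>" using du[of "x - y" x] by (simp add: dist_norm)
          then have "\<rho> y * norm (g (x - y) - g x) \<le> \<rho> y * \<epsilon>" using \<rho>0[of y] by (intro mult_left_mono)
          then show ?thesis using \<rho>0[of y] by (simp add: scaleR_diff_right[symmetric])
        next
          case False
          then show ?thesis using \<rho>z by simp
        qed
      qed
      also have "\<dots> = \<epsilon>" using \<rho>1 by simp
      finally show ?thesis unfolding eq .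
    qed
    have \<phi>eq: "\<phi> = convol \<eta> \<rho>" unfolding \<phi>_def using convol_commute[OF \<rho>c \<eta>c] by auto
    have \<phi>smooth: "smooth_on UNIV \<phi>"
      unfolding smooth_on_def \<phi>eq
      using convol_smooth[OF \<eta>c K0(1,3) \<rho>s \<rho>z] by blast
    have \<phi>d: "(\<phi> has_derivative (\<lambda>h. V x \<bullet> h)) (at x)" for x
      unfolding \<phi>_def V_def by (rule convol_deriv[OF \<rho>c compact_cball \<rho>z \<eta>U])
    have \<phi>z: "\<phi> x = 0" if "x \<notin> K" for x
    proof -
      have z: "\<rho> y * \<eta> (x - y) = 0" for y
      proof (cases "y \<in> cball 0 r")
        case True
        have "x - y \<notin> K0"
        proof
          assume "x - y \<in> K0"
          then have "x \<in> K" unfolding K_def using True r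
            by (intro CollectI exI[of _ "x - y"] exI[of _ y]) auto
          then show False using that by simp
        qed
        then show ?thesis using K0(3) by simp
      qed (use \<rho>z in simp)
      show ?thesis unfolding \<phi>_def convol_def by (simp only: z) simp
    qed
    have supp: "tsupport \<phi> \<subseteq> K"
      unfolding tsupport_def using \<phi>z cK by (intro closure_minimal compact_imp_closed) auto
    have test: "test_fun S \<phi>" unfolding test_fun_def
      using \<phi>smooth supp KS cK compact_Int_closed[OF cK, of "tsupport \<phi>"]
      by (auto simp: tsupport_def Int_absorb1 inf.absorb_iff2)
    have Vc: "continuous_on UNIV V"
    proof -
      have "continuous_on UNIV (\<lambda>x. V x \<bullet> b)" for b
      proof -
        have "Ck_on 1 UNIV \<phi>" using \<phi>smooth unfolding smooth_on_def by blast
        then have "continuous_on UNIV (\<lambda>x. frechet_derivative \<phi> (at x) b)" by simp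
        moreover have "frechet_derivative \<phi> (at x) b = V x \<bullet> b" for x
          using frechet_derivative_at[OF \<phi>d[of x]] by metis
        ultimately show ?thesis by simp
      qed
      then show ?thesis by (simp add: continuous_on_componentwise[of UNIV V])
    qed
    show "\<exists>\<phi> V. test_fun S \<phi> \<and> C1c S \<phi> V \<and> (\<forall>x. x \<notin> K \<longrightarrow> \<phi> x = 0) \<and>
       (\<forall>x. \<bar>\<phi> x - \<eta> x\<bar> \<le> \<epsilon>) \<and> (\<forall>x. norm (V x - D x) \<le> \<epsilon>)"
    proof (intro exI conjI allI impI)
      show "test_fun S \<phi>" by (rule test)
      show "C1c S \<phi> V" unfolding C1c_def using \<phi>d Vc \<phi>z cK KS by blast
      show "\<phi> x = 0" if "x \<notin> K" for x using \<phi>z[OF that] .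
      show "\<bar>\<phi> x - \<eta> x\<bar> \<le> \<epsilon>" for x
        using avg[OF \<eta>c, of x] d1(2) r unfolding \<phi>_def convol_def by fastforce
      show "norm (V x - D x) \<le> \<epsilon>" for x
        using avg[OF Dc, of x] d2(2) r unfolding V_def by fastforce
    qed
  qed
qed

subsection \<open>Weak solutions tested with continuously differentiable functions\<close>

definition flux :: "real \<Rightarrow> (real \<Rightarrow> real) \<Rightarrow> 'a::euclidean_space \<Rightarrow> 'a" where
  "flux p A \<xi> = (norm \<xi> powr (p - 2) * A (norm \<xi>)) *\<^sub>R \<xi>"

lemma norm_flux: "A (norm \<xi>) \<ge> 0 \<Longrightarrow> norm (flux p A \<xi>) = norm \<xi> powr (p - 1) * A (norm \<xi>)"
  using powr_mult_base[of "norm \<xi>" "p - 2"] unfolding flux_def by (simp add: abs_mult mult_ac)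

lemma flux_inner: "flux p A \<xi> \<bullet> \<xi> = norm \<xi> powr p * A (norm \<xi>)"
  unfolding flux_def
  by (cases "\<xi> = 0") (auto simp: dot_square_norm powr_diff powr_numeral)

text \<open>For p < 2 the factor |\<xi>|^(p-2) is singular at 0; continuity there comes from |flux|
  \<le> L |\<xi>|^(p-1) with p > 1.\<close>

lemma continuous_flux:
  fixes \<xi> :: "'a::euclidean_space"
  assumes p: "p > 1" and A: "continuous_on {0..} A" and L: "\<And>t. t \<ge> 0 \<Longrightarrow> 0 \<le> A t \<and> A t \<le> L"
  shows "isCont (flux p A) (\<xi>::'a)"
proof (cases "\<xi> = 0")
  case True
  have "((\<lambda>x::'a. norm x powr (p - 1) * L) \<longlongrightarrow> norm (0::'a) powr (p - 1) * L) (at 0)"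
    using p by (intro tendsto_intros tendsto_powr') auto
  then have lim: "((\<lambda>x::'a. norm x powr (p - 1) * L) \<longlongrightarrow> 0) (at 0)" using p by simp
  have "(flux p A \<longlongrightarrow> 0) (at (0::'a))"
  proof (rule Lim_null_comparison[OF _ lim])
    show "\<forall>\<^sub>F x in at (0::'a). norm (flux p A x) \<le> norm x powr (p - 1) * L"
      using L by (intro always_eventually allI) (simp add: norm_flux mult_left_mono)
  qed
  then show ?thesis unfolding isCont_def True by (simp add: flux_def)
next
  case False
  have "continuous_on (UNIV - {0::'a}) (\<lambda>x. A (norm x))"
    by (rule continuous_on_compose2[OF A]) (auto intro!: continuous_intros)
  then have "continuous_on (UNIV - {0::'a}) (flux p A)"
    unfolding flux_def by (intro continuous_intros) auto
  then show ?thesis using False by (simp add: continuous_on_eq_continuous_at open_delete)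
qed

text \<open>Replacing \<eta> by a test function that is \<epsilon>-close in C^1 and supported in
  \<open>K\<close> costs at most \<epsilon> times the L^1 norms of the flux and of \<open>f\<close>
  over \<open>K\<close>. The right-hand side is integrated over \<open>lebesgue\<close> because
  \<open>f\<close> is only Lebesgue measurable; for the Borel left-hand side both measures
  agree.\<close>

lemma weak_solution_C1c:
  fixes G :: "'a::euclidean_space \<Rightarrow> 'a"
  assumes p: "p > 1" and A: "continuous_on {0..} A" and L: "\<And>t. t \<ge> 0 \<Longrightarrow> 0 \<le> A t \<and> A t \<le> L"
    and S: "open S" and G: "continuous_on S G"
    and f: "\<And>K. compact K \<Longrightarrow> K \<subseteq> S \<Longrightarrow> set_integrable lebesgue K f"
    and weak: "weak_solution p A G f S" and \<eta>: "C1c S \<eta> D"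
  shows "(\<integral>x. flux p A (G x) \<bullet> D x \<partial>lborel) = (\<integral>x. f x * \<eta> x \<partial>lebesgue)"
proof -
  define F where "F = (\<lambda>x. flux p A (G x))"
  have Fc: "continuous_on S F"
    unfolding F_def
    by (rule continuous_on_compose2[OF _ G, of UNIV])
      (auto intro!: continuous_at_imp_continuous_on continuous_flux[OF p A L])
  have test: "(\<integral>x. F x \<bullet> V x \<partial>lborel) = (\<integral>x. f x * \<phi> x \<partial>lebesgue)"
    if t: "test_fun S \<phi>" and C: "C1c S \<phi> V" for \<phi> V
  proof -
    obtain K where K: "compact K" "K \<subseteq> S" "\<And>x. x \<notin> K \<Longrightarrow> \<phi> x = 0" using C unfolding C1c_def by blast
    have V0: "V x = 0" if "x \<notin> S" for x using C1c_deriv_zero[OF C K(1,3)] K(2) that by blast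
    have gr: "grad \<phi> x = V x" for x using C unfolding C1c_def by (intro grad_eqI) auto
    have Sm: "S \<inter> space lebesgue \<in> sets lebesgue" using S by simp
    have "integral\<^sup>L (lebesgue_on S) (\<lambda>x. (norm (G x) powr (p - 2) * A (norm (G x))) * (G x \<bullet> grad \<phi> x))
      = integral\<^sup>L lebesgue (\<lambda>x. indicator S x *\<^sub>R ((norm (G x) powr (p - 2) * A (norm (G x))) * (G x \<bullet> grad \<phi> x)))"
      by (rule integral_restrict_space[OF Sm])
    also have "(\<lambda>x. indicator S x *\<^sub>R ((norm (G x) powr (p - 2) * A (norm (G x))) * (G x \<bullet> grad \<phi> x)))
       = (\<lambda>x. F x \<bullet> V x)"
      using V0 unfolding gr F_def flux_def by (auto simp: indicator_def fun_eq_iff)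
    also have "integral\<^sup>L lebesgue (\<lambda>x. F x \<bullet> V x) = (\<integral>x. F x \<bullet> V x \<partial>lborel)"
      using borel_measurable_integrable[OF C1c_integrable_flux[OF C Fc]] by (intro integral_completion) simp
    finally have 1: "integral\<^sup>L (lebesgue_on S) (\<lambda>x. (norm (G x) powr (p - 2) * A (norm (G x))) * (G x \<bullet> grad \<phi> x))
       = (\<integral>x. F x \<bullet> V x \<partial>lborel)" .
    have "integral\<^sup>L (lebesgue_on S) (\<lambda>x. f x * \<phi> x) = integral\<^sup>L lebesgue (\<lambda>x. indicator S x *\<^sub>R (f x * \<phi> x))"
      by (rule integral_restrict_space[OF Sm])
    also have "(\<lambda>x. indicator S x *\<^sub>R (f x * \<phi> x)) = (\<lambda>x. f x * \<phi> x)"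
      using K(2,3) by (auto simp: indicator_def fun_eq_iff)
    finally have 2: "integral\<^sup>L (lebesgue_on S) (\<lambda>x. f x * \<phi> x) = (\<integral>x. f x * \<phi> x \<partial>lebesgue)" .
    have "integral\<^sup>L (lebesgue_on S) (\<lambda>x. (norm (G x) powr (p - 2) * A (norm (G x))) * (G x \<bullet> grad \<phi> x))
       = integral\<^sup>L (lebesgue_on S) (\<lambda>x. f x * \<phi> x)"
      using weak[unfolded weak_solution_def, rule_format, OF t] .
    then show ?thesis unfolding 1 2 .
  qed
  obtain K where K: "compact K" "K \<subseteq> S" "\<And>x. x \<notin> K \<Longrightarrow> \<eta> x = 0" and
    mol: "\<And>\<epsilon>. \<epsilon> > 0 \<Longrightarrow> \<exists>\<phi> V. test_fun S \<phi> \<and> C1c S \<phi> V \<and> (\<forall>x. x \<notin> K \<longrightarrow> \<phi> x = 0) \<and>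
       (\<forall>x. \<bar>\<phi> x - \<eta> x\<bar> \<le> \<epsilon>) \<and> (\<forall>x. norm (V x - D x) \<le> \<epsilon>)"
    by (rule mollify[OF S \<eta>]) (rule that)
  have fK: "integrable lebesgue (\<lambda>x. indicator K x *\<^sub>R f x)"
    using f[OF K(1,2)] unfolding set_integrable_def .
  have FK: "integrable lborel (\<lambda>x. indicator K x *\<^sub>R F x)"
    using borel_integrable_compact[OF K(1) continuous_on_subset[OF Fc K(2)]] by simp
  define IF where "IF = (\<integral>x. norm (indicator K x *\<^sub>R F x) \<partial>lborel)"
  define If where "If = (\<integral>x. \<bar>indicator K x *\<^sub>R f x\<bar> \<partial>lebesgue)"
  have fint: "integrable lebesgue (\<lambda>x. f x * \<phi> x)"
    if z: "\<And>x. x \<notin> K \<Longrightarrow> \<phi> x = 0" and c: "continuous_on UNIV \<phi>" for \<phi>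
  proof -
    obtain B where B: "\<And>x. x \<in> K \<Longrightarrow> \<bar>\<phi> x\<bar> \<le> B"
      using compact_imp_bounded[OF compact_continuous_image[OF continuous_on_subset[OF c] K(1)]]
      unfolding bounded_iff by auto
    have m: "\<phi> \<in> borel_measurable lebesgue"
      using borel_measurable_continuous_onI[OF c] by (simp add: measurable_completion)
    have "integrable lebesgue (\<lambda>x. \<phi> x * (indicator K x *\<^sub>R f x))"
    proof (rule Bochner_Integration.integrable_bound[of lebesgue "\<lambda>x. B * (indicator K x *\<^sub>R f x)"])
      show "integrable lebesgue (\<lambda>x. B * (indicator K x *\<^sub>R f x))" using fK by simp
      show "(\<lambda>x. \<phi> x * (indicator K x *\<^sub>R f x)) \<in> borel_measurable lebesgue"
        using m borel_measurable_integrable[OF fK] by (rule borel_measurable_times)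
      show "AE x in lebesgue. norm (\<phi> x * (indicator K x *\<^sub>R f x)) \<le> norm (B * (indicator K x *\<^sub>R f x))"
      proof (rule AE_I2)
        fix x show "norm (\<phi> x * (indicator K x *\<^sub>R f x)) \<le> norm (B * (indicator K x *\<^sub>R f x))"
          using B[of x] by (cases "x \<in> K") (auto simp: abs_mult intro!: mult_right_mono)
      qed
    qed
    moreover have "(\<lambda>x. \<phi> x * (indicator K x *\<^sub>R f x)) = (\<lambda>x. f x * \<phi> x)"
      using z by (auto simp: indicator_def fun_eq_iff)
    ultimately show ?thesis by simp
  qed
  have bound: "\<bar>(\<integral>x. F x \<bullet> D x \<partial>lborel) - (\<integral>x. f x * \<eta> x \<partial>lebesgue)\<bar> \<le> \<epsilon> * (IF + If)" if \<epsilon>: "\<epsilon> > 0" for \<epsilon>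
  proof -
    obtain \<phi> V where t: "test_fun S \<phi>" and C: "C1c S \<phi> V" and \<phi>z: "\<And>x. x \<notin> K \<Longrightarrow> \<phi> x = 0"
      and n1: "\<And>x. \<bar>\<phi> x - \<eta> x\<bar> \<le> \<epsilon>" and n2: "\<And>x. norm (V x - D x) \<le> \<epsilon>"
      using mol[OF \<epsilon>] by blast
    note Vz = C1c_deriv_zero[OF C K(1) \<phi>z] and Dz = C1c_deriv_zero[OF \<eta> K(1,3)]
    have "\<bar>(\<integral>x. F x \<bullet> D x \<partial>lborel) - (\<integral>x. F x \<bullet> V x \<partial>lborel)\<bar> = norm (\<integral>x. F x \<bullet> D x - F x \<bullet> V x \<partial>lborel)"
      using C1c_integrable_flux[OF C Fc] C1c_integrable_flux[OF \<eta> Fc] by simp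
    also have "\<dots> \<le> (\<integral>x. \<epsilon> * norm (indicator K x *\<^sub>R F x) \<partial>lborel)"
    proof (rule bochner_norm_bound)
      show "integrable lborel (\<lambda>x. F x \<bullet> D x - F x \<bullet> V x)"
        using C1c_integrable_flux[OF C Fc] C1c_integrable_flux[OF \<eta> Fc] by simp
      show "integrable lborel (\<lambda>x. \<epsilon> * norm (indicator K x *\<^sub>R F x))"
        using integrable_norm[OF FK] by simp
      show "norm (F x \<bullet> D x - F x \<bullet> V x) \<le> \<epsilon> * norm (indicator K x *\<^sub>R F x)" for x
      proof (cases "x \<in> K")
        case True
        have "\<bar>F x \<bullet> (D x - V x)\<bar> \<le> norm (F x) * norm (D x - V x)" by (rule Cauchy_Schwarz_ineq2)
        also have "\<dots> \<le> norm (F x) * \<epsilon>"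
          using n2[of x] by (intro mult_left_mono) (auto simp: norm_minus_commute)
        finally show ?thesis using True by (simp add: inner_diff_right mult.commute)
      qed (use Vz Dz in simp)
    qed
    also have "\<dots> = \<epsilon> * IF" unfolding IF_def by simp
    finally have b1: "\<bar>(\<integral>x. F x \<bullet> D x \<partial>lborel) - (\<integral>x. F x \<bullet> V x \<partial>lborel)\<bar> \<le> \<epsilon> * IF" .
    note i1 = fint[OF K(3) C1c_continuous(1)[OF \<eta>]] and i2 = fint[OF \<phi>z C1c_continuous(1)[OF C]]
    have "\<bar>(\<integral>x. f x * \<phi> x \<partial>lebesgue) - (\<integral>x. f x * \<eta> x \<partial>lebesgue)\<bar> = norm (\<integral>x. f x * \<phi> x - f x * \<eta> x \<partial>lebesgue)"
      using i1 i2 by simp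
    also have "\<dots> \<le> (\<integral>x. \<epsilon> * \<bar>indicator K x *\<^sub>R f x\<bar> \<partial>lebesgue)"
    proof (rule bochner_norm_bound)
      show "integrable lebesgue (\<lambda>x. f x * \<phi> x - f x * \<eta> x)" using i1 i2 by simp
      show "integrable lebesgue (\<lambda>x. \<epsilon> * \<bar>indicator K x *\<^sub>R f x\<bar>)"
        using integrable_abs[OF fK] by simp
      show "norm (f x * \<phi> x - f x * \<eta> x) \<le> \<epsilon> * \<bar>indicator K x *\<^sub>R f x\<bar>" for x
      proof (cases "x \<in> K")
        case True
        have "\<bar>f x * (\<phi> x - \<eta> x)\<bar> \<le> \<bar>f x\<bar> * \<epsilon>"
          unfolding abs_mult using n1[of x] by (intro mult_left_mono) auto
        then show ?thesis using True by (simp add: right_diff_distrib mult.commute)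
      qed (use K \<phi>z in simp)
    qed
    also have "\<dots> = \<epsilon> * If" unfolding If_def by simp
    finally have b2: "\<bar>(\<integral>x. f x * \<phi> x \<partial>lebesgue) - (\<integral>x. f x * \<eta> x \<partial>lebesgue)\<bar> \<le> \<epsilon> * If" .
    show ?thesis using b1 b2 test[OF t C] by (simp add: algebra_simps abs_le_iff)
  qed
  have "IF + If \<ge> 0" unfolding IF_def If_def by (simp add: add_nonneg_nonneg)
  have "\<bar>(\<integral>x. F x \<bullet> D x \<partial>lborel) - (\<integral>x. f x * \<eta> x \<partial>lebesgue)\<bar> \<le> 0"
  proof (rule field_le_epsilon)
    fix e :: real assume e: "e > 0"
    have "\<bar>(\<integral>x. F x \<bullet> D x \<partial>lborel) - (\<integral>x. f x * \<eta> x \<partial>lebesgue)\<bar> \<le> e / (IF + If + 1) * (IF + If)"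
      using e \<open>IF + If \<ge> 0\<close> by (intro bound) simp
    also have "\<dots> \<le> e" using e \<open>IF + If \<ge> 0\<close> by (simp add: field_simps)
    finally show "\<bar>(\<integral>x. F x \<bullet> D x \<partial>lborel) - (\<integral>x. f x * \<eta> x \<partial>lebesgue)\<bar> \<le> 0 + e" by simp
  qed
  then show ?thesis unfolding F_def by simp
qed

lemma DGsol_of_weak_solution:
  fixes u :: "'a::euclidean_space \<Rightarrow> real" and G :: "'a \<Rightarrow> 'a"
  assumes p: "p > 1" and A: "continuous_on {0..} A" and \<delta>: "\<delta> > 0"
    and \<delta>L: "\<And>t. t \<ge> 0 \<Longrightarrow> \<delta> \<le> A t \<and> A t \<le> L"
    and S: "open S" and G: "continuous_on S G" and u: "\<And>x. x \<in> S \<Longrightarrow> (u has_derivative (\<lambda>h. G x \<bullet> h)) (at x)"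
    and f: "\<And>K. compact K \<Longrightarrow> K \<subseteq> S \<Longrightarrow> set_integrable lebesgue K f"
    and weak: "weak_solution p A G f S"
    and S': "open S'" "S' \<subseteq> S" and N: "N \<ge> 0"
    and fN: "\<And>E. open E \<Longrightarrow> bounded E \<Longrightarrow> E \<subseteq> S' \<Longrightarrow> (\<integral>x. indicator E x * \<bar>f x\<bar> \<partial>lebesgue) \<le> N * measure lborel E powr e"
  shows "DGsol p \<delta> L e N S' u G (\<lambda>x. flux p A (G x))"
  unfolding DGsol_def
proof (intro conjI ballI allI impI)
  have A0: "0 \<le> A t \<and> A t \<le> L" if "t \<ge> 0" for t using \<delta>L[OF that] \<delta> by auto
  show "open S'" "0 \<le> N" by fact+
  show "continuous_on S' G" using G S'(2) by (rule continuous_on_subset)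
  then show "continuous_on S' (\<lambda>x. flux p A (G x))"
    by (rule continuous_on_compose2[of UNIV "flux p A", rotated])
      (auto intro!: continuous_at_imp_continuous_on continuous_flux[OF p A A0])
  show "(u has_derivative (\<bullet>) (G x)) (at x)" if "x \<in> S'" for x using u S'(2) that by blast
  show "norm (flux p A (G x)) \<le> L * norm (G x) powr (p - 1)" for x
    using A0[of "norm (G x)"] by (subst norm_flux) (auto simp: mult.commute intro!: mult_right_mono)
  show "\<delta> * norm (G x) powr p \<le> flux p A (G x) \<bullet> G x" for x
    using \<delta>L[of "norm (G x)"] unfolding flux_inner by (auto simp: mult.commute intro!: mult_right_mono)
  fix \<eta> D B assume \<eta>: "C1c S' \<eta> D" and B: "\<forall>x. \<bar>\<eta> x\<bar> \<le> B"
  let ?E = "{x. \<eta> x \<noteq> 0}"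
  obtain K where K: "compact K" "K \<subseteq> S'" "\<And>x. x \<notin> K \<Longrightarrow> \<eta> x = 0" using \<eta> unfolding C1c_def by blast
  have oE: "open ?E" using C1c_continuous(1)[OF \<eta>] by (intro open_Collect_neq continuous_intros) auto
  have EK: "?E \<subseteq> K" using K(3) by blast
  have bE: "bounded ?E" using EK K(1) bounded_subset compact_imp_bounded by blast
  have "integrable lebesgue (\<lambda>x. indicator K x *\<^sub>R f x)"
    using f[OF K(1)] K(2) S'(2) unfolding set_integrable_def by blast
  then have fE: "integrable lebesgue (\<lambda>x. indicator ?E x *\<^sub>R (indicator K x *\<^sub>R f x))"
    by (rule integrable_mult_indicator[rotated]) (use oE in auto)
  have eqE: "(\<lambda>x. indicator ?E x * \<bar>f x\<bar>) = (\<lambda>x. \<bar>indicator ?E x *\<^sub>R (indicator K x *\<^sub>R f x)\<bar>)"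
    using EK by (auto simp: indicator_def fun_eq_iff)
  have fE': "integrable lebesgue (\<lambda>x. indicator ?E x * \<bar>f x\<bar>)"
    unfolding eqE by (rule integrable_abs[OF fE])
  have B0: "B \<ge> 0" using B[rule_format, of undefined] by simp
  have "\<bar>\<integral>x. flux p A (G x) \<bullet> D x \<partial>lborel\<bar> = \<bar>\<integral>x. f x * \<eta> x \<partial>lebesgue\<bar>"
    using weak_solution_C1c[OF p A A0 S G f weak C1c_mono[OF \<eta> S'(2)]] by simp
  also have "\<dots> \<le> (\<integral>x. B * (indicator ?E x * \<bar>f x\<bar>) \<partial>lebesgue)"
  \<comment> \<open>A non-integrable function has integral 0 by convention, which is within the
    bound since \<open>B \<ge> 0\<close>.\<close>
  proof (cases "integrable lebesgue (\<lambda>x. f x * \<eta> x)")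
    case True
    show ?thesis unfolding real_norm_def[symmetric]
    proof (rule bochner_norm_bound[OF True])
      show "integrable lebesgue (\<lambda>x. B * (indicator ?E x * norm (f x)))" using fE' by simp
      show "norm (f x * \<eta> x) \<le> B * (indicator ?E x * norm (f x))" for x
        using B[rule_format, of x] by (cases "\<eta> x = 0") (auto simp: abs_mult mult.commute intro!: mult_right_mono)
    qed
  next
    case False
    then show ?thesis using B0 by (simp add: not_integrable_integral_eq)
  qed
  also have "\<dots> = B * (\<integral>x. indicator ?E x * \<bar>f x\<bar> \<partial>lebesgue)" by simp
  also have "\<dots> \<le> B * (N * measure lborel ?E powr e)"
    using fN[OF oE bE] EK K(2) B0 by (intro mult_left_mono) auto
  finally show "\<bar>\<integral>x. flux p A (G x) \<bullet> D x \<partial>lborel\<bar> \<le> B * N * measure lborel ?E powr e" by (simp add: mult.assoc)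
qed

section \<open>Radial vector fields, comparison and maximum principles\<close>

subsection \<open>Integration by parts\<close>

lemma integral_lborel_translate:
  fixes \<phi> :: "'a::euclidean_space \<Rightarrow> real"
  assumes [measurable]: "\<phi> \<in> borel_measurable borel"
  shows "(\<integral>x. \<phi> (x + h) \<partial>lborel) = (\<integral>x. \<phi> x \<partial>lborel)"
proof -
  have "(\<integral>x. \<phi> x \<partial>lborel) = (\<integral>x. \<phi> x \<partial>(distr lborel borel ((+) h)))"
    by (simp add: lborel_distr_plus)
  also have "\<dots> = (\<integral>x. \<phi> (h + x) \<partial>lborel)" by (subst integral_distr) auto
  finally show ?thesis by (simp add: add.commute)
qed

lemma C1c_integrable:
  fixes \<phi> :: "'a::euclidean_space \<Rightarrow> real"
  assumes "C1c S \<phi> D"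
  shows "integrable lborel \<phi>" "integrable lborel D"
proof -
  obtain K where K: "compact K" "\<And>x. x \<notin> K \<Longrightarrow> \<phi> x = 0" using assms unfolding C1c_def by blast
  show "integrable lborel \<phi>" "integrable lborel D"
    using K C1c_deriv_zero[OF assms K] continuous_on_subset[OF C1c_continuous(1)[OF assms]]
      continuous_on_subset[OF C1c_continuous(2)[OF assms]]
    by (auto intro!: integrable_continuous_compact_support[of K])
qed

text \<open>By translation invariance \<phi>(x + h) - \<phi>(x) has integral 0, and the uniform
  Taylor estimate compares it with D x \<bullet> h up to o(|h|) on a fixed bounded set. Iterated
  integration is thereby avoided.\<close>

lemma C1c_integral_gradient:
  fixes \<phi> :: "'a::euclidean_space \<Rightarrow> real"
  assumes \<phi>: "C1c S \<phi> D"
  shows "(\<integral>x. D x \<bullet> b \<partial>lborel) = 0"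
proof -
  have U: "C1c UNIV \<phi> D" using C1c_mono[OF \<phi>] by simp
  obtain K where K: "compact K" "\<And>x. x \<notin> K \<Longrightarrow> \<phi> x = 0" using \<phi> unfolding C1c_def by blast
  let ?K = "{x + y |x y. x \<in> K \<and> y \<in> cball 0 (1::real)}"
  have cK: "compact ?K" by (rule compact_sums[OF K(1) compact_cball])
  note ic = C1c_continuous[OF \<phi>] and ii = C1c_integrable[OF \<phi>]
  have im: "\<phi> \<in> borel_measurable borel" using ic by (intro borel_measurable_continuous_onI) auto
  have Ki: "integrable lborel (indicator ?K :: 'a \<Rightarrow> real)"
    using cK emeasure_bounded_finite[OF compact_imp_bounded[OF cK]] by (simp add: borel_compact)
  define m where "m = measure lborel ?K"
  have it: "integrable lborel (\<lambda>x. \<phi> (x + h))" for h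
  proof -
    have "integrable (distr lborel borel ((+) h)) \<phi>" using ii by (simp add: lborel_distr_plus)
    then show ?thesis by (subst (asm) integrable_distr_eq) (auto simp: im add.commute)
  qed
  have "\<bar>\<integral>x. D x \<bullet> b \<partial>lborel\<bar> \<le> norm b * e * m" if e: "e > 0" for e
  proof -
    obtain d where d: "d > 0" "\<And>x h. norm h < d \<Longrightarrow> \<bar>\<phi> (x + h) - \<phi> x - D x \<bullet> h\<bar> \<le> norm h * e"
      by (rule C1c_taylor[OF U e]) (rule that)
    \<comment> \<open>The step h = s b is shorter than d, for the Taylor estimate, and shorter than
      1, so that the integrand is supported in the unit neighbourhood \<open>?K\<close>.\<close>
    define s where "s = min d 1 / (2 * (norm b + 1))"
    have s: "s > 0" unfolding s_def using d(1) by (simp add: add_nonneg_pos)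
    define h where "h = s *\<^sub>R b"
    have "norm h \<le> s * (norm b + 1)" unfolding h_def using s by simp
    also have "\<dots> = min d 1 / 2"
    proof -
      have "min d 1 / (2 * X) * X = min d 1 / 2" if "X \<noteq> 0" for X using that by simp
      moreover have "norm b + 1 \<noteq> 0" using norm_ge_zero[of b] by linarith
      ultimately show ?thesis unfolding s_def by blast
    qed
    finally have hd: "norm h < d" "norm h < 1" using d(1) by (auto simp: min_def split: if_splits)
    have "\<bar>\<integral>x. D x \<bullet> h \<partial>lborel\<bar> = norm (\<integral>x. \<phi> (x + h) - \<phi> x - D x \<bullet> h \<partial>lborel)"
      using it ii integral_lborel_translate[OF im, of h] by simp
    also have "\<dots> \<le> (\<integral>x. norm h * e * indicator ?K x \<partial>lborel)"
    proof (rule bochner_norm_bound)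
      show "integrable lborel (\<lambda>x. \<phi> (x + h) - \<phi> x - D x \<bullet> h)" using it ii by simp
      show "integrable lborel (\<lambda>x. norm h * e * indicator ?K x)" using Ki by simp
      show "norm (\<phi> (x + h) - \<phi> x - D x \<bullet> h) \<le> norm h * e * indicator ?K x" for x
      proof (cases "x \<in> ?K")
        case True then show ?thesis using d(2)[OF hd(1), of x] by simp
      next
        case False
        have "x \<notin> K"
        proof
          assume "x \<in> K"
          then have "x \<in> ?K" by (intro CollectI exI[of _ x] exI[of _ 0]) auto
          then show False using False by simp
        qed
        moreover have "x + h \<notin> K"
        proof
          assume "x + h \<in> K"
          then have "x \<in> ?K" using hd(2) by (intro CollectI exI[of _ "x + h"] exI[of _ "- h"]) auto
          then show False using False by simp
        qed
        ultimately show ?thesis using K(2) C1c_deriv_zero[OF \<phi> K] e by (simp add: less_imp_le)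
      qed
    qed
    also have "\<dots> = norm h * e * m" using Ki unfolding m_def by simp
    also have "norm h = s * norm b" unfolding h_def using s by simp
    also have "(\<integral>x. D x \<bullet> h \<partial>lborel) = s * (\<integral>x. D x \<bullet> b \<partial>lborel)" unfolding h_def by simp
    finally have "s * \<bar>\<integral>x. D x \<bullet> b \<partial>lborel\<bar> \<le> s * (norm b * e * m)" using s by (simp add: abs_mult)
    then show ?thesis using s by simp
  qed
  note bnd = this
  have "\<bar>\<integral>x. D x \<bullet> b \<partial>lborel\<bar> \<le> 0"
  proof (rule field_le_epsilon)
    fix e :: real assume e: "e > 0"
    have nm: "norm b * m \<ge> 0" unfolding m_def by simp
    have "\<bar>\<integral>x. D x \<bullet> b \<partial>lborel\<bar> \<le> norm b * (e / (norm b * m + 1)) * m"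
      using e nm by (intro bnd divide_pos_pos) auto
    also have "\<dots> \<le> e" using e nm by (simp add: field_simps)
    finally show "\<bar>\<integral>x. D x \<bullet> b \<partial>lborel\<bar> \<le> 0 + e" by simp
  qed
  then show ?thesis by simp
qed

text \<open>The field |x|^(-m) x has divergence (n - m) |x|^(-m); in particular it is divergence
  free for m = n. The formula results from summing, over the basis, the vanishing integrals of the
  b-th partial derivative of |x|^(-m) (x \<bullet> b) \<eta>.\<close>

lemma radial_power_divergence:
  fixes \<eta> :: "'a::euclidean_space \<Rightarrow> real" and m :: real
  assumes S: "open S" "0 \<notin> S" and \<eta>: "C1c S \<eta> D"
  shows "(\<integral>x. (norm x powr (- m) *\<^sub>R x) \<bullet> D x \<partial>lborel)
     = - (DIM('a) - m) * (\<integral>x. norm x powr (- m) * \<eta> x \<partial>lborel)"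
    and "integrable lborel (\<lambda>x. norm x powr (- m) * \<eta> x)"
    and "integrable lborel (\<lambda>x. (norm x powr (- m) *\<^sub>R x) \<bullet> D x)"
proof -
  obtain K where K: "compact K" "K \<subseteq> S" "\<And>x. x \<notin> K \<Longrightarrow> \<eta> x = 0" using \<eta> unfolding C1c_def by blast
  note D0 = C1c_deriv_zero[OF \<eta> K(1,3)]
  have nz: "x \<noteq> 0" if "x \<in> S" for x using S that by auto
  have pc: "continuous_on S (\<lambda>x::'a. norm x powr q)" for q
    using nz by (intro continuous_intros) auto
  note c\<eta> = continuous_on_subset[OF C1c_continuous(1)[OF \<eta>] subset_UNIV]
    and cD = continuous_on_subset[OF C1c_continuous(2)[OF \<eta>] subset_UNIV]
  show i1: "integrable lborel (\<lambda>x. norm x powr (- m) * \<eta> x)"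
    by (rule integrable_continuous_compact_support[OF _ K(1)])
      (use K(3) continuous_on_subset[OF pc K(2)] c\<eta> in \<open>auto intro!: continuous_on_mult\<close>)
  show i2: "integrable lborel (\<lambda>x. (norm x powr (- m) *\<^sub>R x) \<bullet> D x)"
    by (rule integrable_continuous_compact_support[OF _ K(1)])
      (use D0 continuous_on_subset[OF pc K(2)] cD in \<open>auto intro!: continuous_on_inner continuous_on_mult continuous_on_id\<close>)
  have pd: "((\<lambda>x::'a. norm x powr (- m)) has_derivative (\<lambda>h. (- m * norm x powr (- m - 2)) * (x \<bullet> h))) (at x)"
    if "x \<in> S" for x
  proof -
    have x0: "norm x > 0" using nz[OF that] by simp
    have 1: "(norm has_derivative (\<lambda>h. inverse (norm x) * (x \<bullet> h))) (at x)"
      using has_derivative_norm[of x] nz[OF that] by (simp add: sgn_div_norm inner_commute divide_inverse mult.commute)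
    have 2: "((\<lambda>t. t powr (- m)) has_real_derivative (- m) * norm x powr (- m - 1)) (at (norm x))"
      by (rule has_real_derivative_powr[OF x0])
    have 3: "norm x powr (- m - 1) * inverse (norm x) = norm x powr (- m - 2)"
    proof -
      have "inverse (norm x) = norm x powr (- 1)" using x0 by (simp add: powr_minus)
      then show ?thesis by (simp only: powr_add[symmetric]) (rule arg_cong[of _ _ "\<lambda>q. norm x powr q"], simp)
    qed
    show ?thesis
      by (rule has_derivative_eq_rhs[OF has_derivative_compose[OF 1 2[unfolded has_field_derivative_def]]])
        (simp add: 3[symmetric] fun_eq_iff mult.assoc)
  qed
  let ?D = "\<lambda>b x. if x \<in> S then (norm x powr (- m) * (x \<bullet> b)) *\<^sub>R D x + \<eta> x *\<^sub>R (norm x powr (- m) *\<^sub>R b + ((x \<bullet> b) * (- m * norm x powr (- m - 2))) *\<^sub>R x) else 0"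
  have "C1c S (\<lambda>x. if x \<in> S then (norm x powr (- m) * (x \<bullet> b)) * \<eta> x else 0) (?D b)" for b
  proof (rule C1c_glue[OF S(1) K(1,2)])
    show "norm x powr (- m) * (x \<bullet> b) * \<eta> x = 0" if "x \<notin> K" for x using K(3) that by simp
    show "((\<lambda>x. norm x powr (- m) * (x \<bullet> b) * \<eta> x) has_derivative
      (\<bullet>) ((norm x powr (- m) * (x \<bullet> b)) *\<^sub>R D x + \<eta> x *\<^sub>R (norm x powr (- m) *\<^sub>R b + ((x \<bullet> b) * (- m * norm x powr (- m - 2))) *\<^sub>R x))) (at x)"
      if "x \<in> S" for x
    proof -
      have l: "((\<lambda>x. x \<bullet> b) has_derivative (\<lambda>h. h \<bullet> b)) (at x)" by (auto intro!: derivative_eq_intros)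
      have e: "(\<eta> has_derivative (\<bullet>) (D x)) (at x)" using \<eta> unfolding C1c_def by blast
      show ?thesis
        by (rule has_derivative_eq_rhs[OF has_derivative_mult[OF has_derivative_mult[OF pd[OF that] l] e]])
          (auto simp: fun_eq_iff inner_add_left inner_commute algebra_simps)
    qed
    show "continuous_on S (\<lambda>x. (norm x powr (- m) * (x \<bullet> b)) *\<^sub>R D x + \<eta> x *\<^sub>R (norm x powr (- m) *\<^sub>R b + ((x \<bullet> b) * (- m * norm x powr (- m - 2))) *\<^sub>R x))"
      by (intro continuous_on_add continuous_on_scaleR continuous_on_mult continuous_on_inner continuous_on_id
          continuous_on_const pc c\<eta> cD)
  qed
  note C = this
  have z: "(\<integral>x. ?D b x \<bullet> b \<partial>lborel) = 0" and i: "integrable lborel (\<lambda>x. ?D b x \<bullet> b)" for b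
    using C1c_integral_gradient[OF C] C1c_integrable(2)[OF C] by auto
  have "0 = (\<Sum>b\<in>Basis. \<integral>x. ?D b x \<bullet> b \<partial>lborel)" using z by simp
  also have "\<dots> = (\<integral>x. (\<Sum>b\<in>Basis. ?D b x \<bullet> b) \<partial>lborel)"
    using i by (intro Bochner_Integration.integral_sum[symmetric]) auto
  also have "\<dots> = (\<integral>x. (norm x powr (- m) *\<^sub>R x) \<bullet> D x + (DIM('a) - m) * (norm x powr (- m) * \<eta> x) \<partial>lborel)"
  proof (rule Bochner_Integration.integral_cong[OF refl])
    fix x :: 'a
    show "(\<Sum>b\<in>Basis. ?D b x \<bullet> b) = (norm x powr (- m) *\<^sub>R x) \<bullet> D x + (DIM('a) - m) * (norm x powr (- m) * \<eta> x)"
    proof (cases "x \<in> S")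
      case False
      then have "x \<notin> K" using K(2) by blast
      then show ?thesis using False D0 K(3) by simp
    next
      case True
      have sq: "norm x powr (- m - 2) * (x \<bullet> x) = norm x powr (- m)"
      proof -
        have xx: "x \<bullet> x = norm x powr 2" using nz[OF True] by (simp add: dot_square_norm powr_numeral)
        show ?thesis unfolding xx powr_add[symmetric] by simp
      qed
      have "(\<Sum>b\<in>Basis. ?D b x \<bullet> b) = (\<Sum>b\<in>Basis. norm x powr (- m) * ((x \<bullet> b) * (D x \<bullet> b))
          + \<eta> x * norm x powr (- m) + \<eta> x * (- m * norm x powr (- m - 2)) * ((x \<bullet> b) * (x \<bullet> b)))"
        using True by (intro sum.cong refl) (auto simp: inner_add_left algebra_simps)
      also have "\<dots> = norm x powr (- m) * (x \<bullet> D x) + real DIM('a) * (\<eta> x * norm x powr (- m))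
          + \<eta> x * (- m * norm x powr (- m - 2)) * (x \<bullet> x)"
        unfolding euclidean_inner[of x "D x"] euclidean_inner[of x x]
        by (simp add: sum.distrib sum_subtractf sum_negf sum_distrib_left)
      also have "\<dots> = norm x powr (- m) * (x \<bullet> D x) + real DIM('a) * (\<eta> x * norm x powr (- m))
          - \<eta> x * m * norm x powr (- m)"
        unfolding sq[symmetric] by (simp add: mult_ac)
      finally show ?thesis by (simp add: algebra_simps)
    qed
  qed
  also have "\<dots> = (\<integral>x. (norm x powr (- m) *\<^sub>R x) \<bullet> D x \<partial>lborel) + (DIM('a) - m) * (\<integral>x. norm x powr (- m) * \<eta> x \<partial>lborel)"
    using i1 i2 by (subst Bochner_Integration.integral_add) auto
  finally show "(\<integral>x. (norm x powr (- m) *\<^sub>R x) \<bullet> D x \<partial>lborel)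
     = - (DIM('a) - m) * (\<integral>x. norm x powr (- m) * \<eta> x \<partial>lborel)" by (simp add: algebra_simps)
qed

subsection \<open>The radial flux function and its inverse\<close>

locale p_structure =
  fixes p \<delta> L :: real and A :: "real \<Rightarrow> real"
  assumes p: "p > 1" and \<delta>: "\<delta> > 0" and L: "L > 0"
    and A_cont: "continuous_on {0..} A"
    and A_bounds: "\<And>t. t \<ge> 0 \<Longrightarrow> \<delta> \<le> A t \<and> A t \<le> L"
    and A_mono: "strict_mono_on {0<..} (\<lambda>t. t powr (p - 1) * A t)"
begin

lemma A0: "t \<ge> 0 \<Longrightarrow> 0 \<le> A t \<and> A t \<le> L"
  using A_bounds[of t] \<delta> by auto

text \<open>The flux of a signed radial derivative: the odd extension is a bijection of the whole
  line, as needed for barriers whose prescribed flux is negative.\<close>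

definition rflux :: "real \<Rightarrow> real" where
  "rflux t = sgn t * (\<bar>t\<bar> powr (p - 1) * A \<bar>t\<bar>)"

lemma flux_scaleR_unit:
  fixes e :: "'a::euclidean_space"
  assumes "norm e = 1" shows "flux p A (t *\<^sub>R e) = rflux t *\<^sub>R e"
proof (cases "t = 0")
  case False
  have "\<bar>t\<bar> powr (p - 2) * t = sgn t * \<bar>t\<bar> powr (p - 1)"
    using powr_mult_base[of t "p - 2"] powr_mult_base[of "- t" "p - 2"] False
    by (cases "t > 0") (auto simp: mult.commute)
  then show ?thesis using assms unfolding flux_def rflux_def by (simp add: mult_ac)
qed (simp add: flux_def rflux_def)

text \<open>By Cauchy-Schwarz the expression is at least (\<phi>(a) - \<phi>(b))(a - b), where a, b
  are the norms and \<phi>(t) = t^(p-1) A(t). If it vanishes, the norms agree, both fluxes carry the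
  same positive factor, and the expression is that factor times |\<xi> - \<zeta>|^2.\<close>

lemma flux_monotone:
  fixes \<xi> \<zeta> :: "'a::euclidean_space"
  shows "(flux p A \<xi> - flux p A \<zeta>) \<bullet> (\<xi> - \<zeta>) \<ge> 0"
    and "(flux p A \<xi> - flux p A \<zeta>) \<bullet> (\<xi> - \<zeta>) = 0 \<Longrightarrow> \<xi> = \<zeta>"
proof -
  define \<phi> where "\<phi> = (\<lambda>t. t powr (p - 1) * A t)"
  have \<phi>0: "\<phi> 0 = 0" unfolding \<phi>_def by simp
  have \<phi>pos: "\<phi> t > 0" if "t > 0" for t
    using A_bounds[of t] \<delta> that unfolding \<phi>_def by (intro mult_pos_pos) auto
  have \<phi>m: "\<phi> s < \<phi> t" if "0 \<le> s" "s < t" for s t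
    using A_mono that \<phi>0 \<phi>pos[of t] unfolding \<phi>_def strict_mono_on_def by (cases "s = 0") auto
  let ?a = "norm \<xi>" and ?b = "norm \<zeta>"
  have n: "norm (flux p A v) = \<phi> (norm v)" for v :: 'a
    unfolding \<phi>_def using A0[of "norm v"] by (simp add: norm_flux)
  have d: "flux p A v \<bullet> v = \<phi> (norm v) * norm v" for v :: 'a
    unfolding \<phi>_def flux_inner by (cases "v = 0") (auto simp: powr_diff)
  have c1: "flux p A \<xi> \<bullet> \<zeta> \<le> \<phi> ?a * ?b" "flux p A \<zeta> \<bullet> \<xi> \<le> \<phi> ?b * ?a"
    using norm_cauchy_schwarz[of "flux p A \<xi>" \<zeta>] norm_cauchy_schwarz[of "flux p A \<zeta>" \<xi>] n by auto
  have eq: "(flux p A \<xi> - flux p A \<zeta>) \<bullet> (\<xi> - \<zeta>)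
     = \<phi> ?a * ?a + \<phi> ?b * ?b - flux p A \<xi> \<bullet> \<zeta> - flux p A \<zeta> \<bullet> \<xi>"
    by (simp add: inner_diff_left inner_diff_right d)
  have ge: "(flux p A \<xi> - flux p A \<zeta>) \<bullet> (\<xi> - \<zeta>) \<ge> (\<phi> ?a - \<phi> ?b) * (?a - ?b)"
    unfolding eq using c1 by (simp add: algebra_simps)
  have nn: "(\<phi> ?a - \<phi> ?b) * (?a - ?b) > 0" if "?a \<noteq> ?b"
    using \<phi>m[of ?a ?b] \<phi>m[of ?b ?a] that by (cases "?a < ?b") (auto simp: mult_neg_neg)
  then have "(\<phi> ?a - \<phi> ?b) * (?a - ?b) \<ge> 0" by (cases "?a = ?b") auto
  then show "(flux p A \<xi> - flux p A \<zeta>) \<bullet> (\<xi> - \<zeta>) \<ge> 0" using ge by linarith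
  assume z: "(flux p A \<xi> - flux p A \<zeta>) \<bullet> (\<xi> - \<zeta>) = 0"
  then have ab: "?a = ?b" using ge nn by force
  show "\<xi> = \<zeta>"
  proof (cases "\<xi> = 0")
    case True then show ?thesis using ab by simp
  next
    case False
    then have a: "?a > 0" by simp
    define c where "c = ?a powr (p - 2) * A ?a"
    have cp: "c > 0" unfolding c_def using a A_bounds[of ?a] \<delta> by (intro mult_pos_pos) auto
    have "flux p A \<xi> = c *\<^sub>R \<xi>" "flux p A \<zeta> = c *\<^sub>R \<zeta>" unfolding flux_def c_def ab by auto
    then have "c * ((\<xi> - \<zeta>) \<bullet> (\<xi> - \<zeta>)) = 0" using z by (simp add: scaleR_diff_right[symmetric])
    then show ?thesis using cp by simp
  qed
qed

lemma rflux_minus: "rflux (- t) = - rflux t"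
  unfolding rflux_def by (simp add: sgn_if)

lemma rflux_bounds:
  assumes "t \<ge> 0" shows "\<delta> * t powr (p - 1) \<le> rflux t" "rflux t \<le> L * t powr (p - 1)"
proof -
  have "t powr (p - 1) * \<delta> \<le> t powr (p - 1) * A t" "t powr (p - 1) * A t \<le> t powr (p - 1) * L"
    using A_bounds[OF assms] by (auto intro!: mult_left_mono)
  then show "\<delta> * t powr (p - 1) \<le> rflux t" "rflux t \<le> L * t powr (p - 1)"
    using assms by (auto simp: rflux_def sgn_if mult.commute)
qed

lemma rflux_strict_mono: "strict_mono rflux"
proof (rule strict_monoI)
  fix s t :: real assume st: "s < t"
  have 0: "rflux 0 = 0" by (simp add: rflux_def)
  have pos: "rflux t > 0" if "t > 0" for t
    using rflux_bounds(1)[of t] that \<delta> by (smt (verit) mult_pos_pos powr_gt_zero)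
  have pm: "rflux s < rflux t" if "0 < s" "s < t" for s t
    using A_mono that unfolding rflux_def strict_mono_on_def by auto
  consider "0 < s" | "s \<le> 0" "0 < t" | "t \<le> 0" using st by linarith
  then show "rflux s < rflux t"
  proof cases
    case 1 then show ?thesis using pm st by blast
  next
    case 2
    have "rflux s \<le> 0" using pos[of "- s"] rflux_minus[of s] 0 2 by (cases "s = 0") auto
    then show ?thesis using pos[OF 2(2)] by simp
  next
    case 3
    have "rflux (- t) < rflux (- s)"
      using pm[of "- t" "- s"] pos[of "- s"] 3 st 0 by (cases "t = 0") auto
    then show ?thesis by (simp add: rflux_minus)
  qed
qed

lemma isCont_rflux: "isCont rflux t"
proof -
  have "continuous_on {0..} (\<lambda>t. t powr (p - 1) * A t)"
    using p A_cont by (intro continuous_on_mult continuous_on_powr' continuous_intros) auto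
  then have c: "continuous_on {0..} rflux"
    by (rule continuous_on_eq) (auto simp: rflux_def sgn_if)
  have "continuous_on {..0} (\<lambda>t. - rflux (- t))"
    by (intro continuous_intros continuous_on_compose2[OF c]) auto
  then have c': "continuous_on {..0} rflux" by (rule continuous_on_eq) (simp add: rflux_minus)
  have "continuous_on ({..0} \<union> {0..}) rflux" by (rule continuous_on_closed_Un[OF _ _ c' c]) auto
  moreover have "{..0} \<union> {0..} = (UNIV :: real set)" by auto
  ultimately show ?thesis by (simp add: continuous_on_eq_continuous_at)
qed

lemma rflux_surj: "\<exists>t. rflux t = s"
proof -
  have pos: "\<exists>t\<ge>0. rflux t = s" if "s \<ge> 0" for s
  proof -
    define T where "T = (s / \<delta>) powr (1 / (p - 1))"
    have "\<delta> * T powr (p - 1) = s" unfolding T_def using p \<delta> that by (simp add: powr_powr)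
    moreover have "T \<ge> 0" unfolding T_def by simp
    ultimately have "s \<le> rflux T" using rflux_bounds(1)[of T] by simp
    moreover have "rflux 0 \<le> s" using that by (simp add: rflux_def)
    ultimately show ?thesis
      using IVT[of rflux 0 s T] isCont_rflux \<open>T \<ge> 0\<close> by blast
  qed
  show ?thesis
  proof (cases "s \<ge> 0")
    case True then show ?thesis using pos by blast
  next
    case False
    then obtain t where "rflux t = - s" using pos[of "- s"] by auto
    then have "rflux (- t) = s" by (simp add: rflux_minus)
    then show ?thesis ..
  qed
qed

definition irflux :: "real \<Rightarrow> real" where "irflux = inv rflux"

lemma rflux_irflux: "rflux (irflux s) = s"
  unfolding irflux_def using rflux_surj by (metis f_inv_into_f rangeI)

lemma irflux_rflux: "irflux (rflux t) = t"
  unfolding irflux_def using rflux_strict_mono by (simp add: strict_mono_imp_inj_on inv_f_f)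

lemma isCont_irflux: "isCont irflux s"
proof -
  have "isCont irflux (rflux (irflux s))"
    by (rule isCont_inverse_function[of 1]) (auto simp: irflux_rflux isCont_rflux)
  then show ?thesis by (simp add: rflux_irflux)
qed

lemma irflux_nonneg: "s \<ge> 0 \<Longrightarrow> irflux s \<ge> 0"
  using rflux_strict_mono rflux_irflux[of s] by (metis strict_mono_less_eq rflux_def sgn_0 mult_zero_left)

lemma irflux_minus: "irflux (- s) = - irflux s"
  by (metis irflux_rflux rflux_irflux rflux_minus)

lemma irflux_bounds:
  assumes "s \<ge> 0"
  shows "(s / L) powr (1 / (p - 1)) \<le> irflux s" "irflux s \<le> (s / \<delta>) powr (1 / (p - 1))"
proof -
  let ?t = "irflux s"
  have t: "?t \<ge> 0" using irflux_nonneg[OF assms] .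
  have tt: "(?t powr (p - 1)) powr (1 / (p - 1)) = ?t" using p t by (simp add: powr_powr)
  have "s / L \<le> ?t powr (p - 1)" using rflux_bounds(2)[OF t] L by (simp add: rflux_irflux field_simps)
  then show "(s / L) powr (1 / (p - 1)) \<le> ?t"
    using powr_mono2[of "1 / (p - 1)" "s / L" "?t powr (p - 1)"] p assms L tt by simp
  have "?t powr (p - 1) \<le> s / \<delta>" using rflux_bounds(1)[OF t] \<delta> by (simp add: rflux_irflux field_simps)
  then show "?t \<le> (s / \<delta>) powr (1 / (p - 1))"
    using powr_mono2[of "1 / (p - 1)" "?t powr (p - 1)" "s / \<delta>"] p tt by simp
qed

lemma irflux_abs: "\<bar>irflux s\<bar> \<le> (\<bar>s\<bar> / \<delta>) powr (1 / (p - 1))"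
  using irflux_bounds(2)[of s] irflux_nonneg[of s] irflux_bounds(2)[of "- s"] irflux_nonneg[of "- s"] irflux_minus[of s]
  by (cases "s \<ge> 0") auto

text \<open>Prescribing the radial flux \<open>h\<close> amounts to integrating \<open>irflux \<circ> h\<close>.\<close>

lemma radial_profile:
  assumes R: "R > 0" and h: "continuous_on {0<..} h"
  obtains V where "V R = 0" "\<And>r. r > R / 2 \<Longrightarrow> (V has_real_derivative irflux (h r)) (at r)"
proof -
  \<comment> \<open>Integration starts at R/2 so that R is an interior point and the derivative
    there is two-sided.\<close>
  define W where "W = (\<lambda>r. integral {R/2..r} (\<lambda>s. irflux (h s)))"
  have W: "(W has_real_derivative irflux (h r)) (at r)" if "r > R / 2" for r
  proof -
    have c: "continuous_on {R/2..r+1} (\<lambda>s. irflux (h s))"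
      by (rule continuous_on_compose2[of UNIV irflux])
        (use R in \<open>auto intro!: continuous_at_imp_continuous_on isCont_irflux continuous_on_subset[OF h]\<close>)
    have "(W has_real_derivative irflux (h r)) (at r within {R/2..r+1})"
      unfolding W_def by (rule integral_has_real_derivative[OF c]) (use that in auto)
    moreover have "at r within {R/2..r+1} = at r"
      using that by (intro at_within_interior) auto
    ultimately show ?thesis by simp
  qed
  show thesis
    by (rule that[of "\<lambda>r. W r - W R"]) (use W in \<open>auto intro!: derivative_eq_intros\<close>)
qed

lemma radial_gradient:
  fixes x :: "'a::euclidean_space"
  assumes "(V has_real_derivative irflux s) (at (norm x))" "x \<noteq> 0"
  shows "((\<lambda>x. V (norm x)) has_derivative (\<lambda>k. (irflux s / norm x) *\<^sub>R x \<bullet> k)) (at x)"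
    and "flux p A ((irflux s / norm x) *\<^sub>R x) = (s / norm x) *\<^sub>R x"
proof -
  have 1: "(norm has_derivative (\<lambda>h. inverse (norm x) * (x \<bullet> h))) (at x)"
    using has_derivative_norm[of x] assms(2) by (simp add: sgn_div_norm inner_commute divide_inverse mult.commute)
  show "((\<lambda>x. V (norm x)) has_derivative (\<lambda>k. (irflux s / norm x) *\<^sub>R x \<bullet> k)) (at x)"
    by (rule has_derivative_eq_rhs[OF has_derivative_compose[OF 1 assms(1)[unfolded has_field_derivative_def]]])
      (auto simp: fun_eq_iff divide_inverse)
  have "flux p A (irflux s *\<^sub>R ((1 / norm x) *\<^sub>R x)) = rflux (irflux s) *\<^sub>R ((1 / norm x) *\<^sub>R x)"
    by (rule flux_scaleR_unit) (use assms(2) in simp)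
  then show "flux p A ((irflux s / norm x) *\<^sub>R x) = (s / norm x) *\<^sub>R x" by (simp add: rflux_irflux)
qed

text \<open>The test function is the square of (u - v - k')_+. The extra \<epsilon> in k' makes it
  vanish near the boundary, where u and v are merely continuous. Monotonicity forces the gradients
  to agree wherever u - v > k', so the test function has gradient zero everywhere and, being 0 at
  the origin, vanishes.\<close>

lemma comparison:
  fixes u v :: "'a::euclidean_space \<Rightarrow> real"
  assumes R: "0 < R1" "R1 < R2"
    and uc: "continuous_on {x. R1 \<le> norm x \<and> norm x \<le> R2} u"
    and vc: "continuous_on {x. R1 \<le> norm x \<and> norm x \<le> R2} v"
    and ud: "\<And>x. R1 < norm x \<Longrightarrow> norm x < R2 \<Longrightarrow> (u has_derivative (\<lambda>h. G x \<bullet> h)) (at x)"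
    and vd: "\<And>x. R1 < norm x \<Longrightarrow> norm x < R2 \<Longrightarrow> (v has_derivative (\<lambda>h. H x \<bullet> h)) (at x)"
    and Gc: "continuous_on {x. R1 < norm x \<and> norm x < R2} G"
    and Hc: "continuous_on {x. R1 < norm x \<and> norm x < R2} H"
    and le: "\<And>\<eta> D. C1c {x. R1 < norm x \<and> norm x < R2} \<eta> D \<Longrightarrow> (\<And>x. \<eta> x \<ge> 0) \<Longrightarrow>
      (\<integral>x. flux p A (G x) \<bullet> D x \<partial>lborel) \<le> (\<integral>x. flux p A (H x) \<bullet> D x \<partial>lborel)"
    and bd: "\<And>x. norm x = R1 \<or> norm x = R2 \<Longrightarrow> u x \<le> v x + k"
    and x: "R1 \<le> norm x" "norm x \<le> R2"
  shows "u x \<le> v x + k"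
proof (rule field_le_epsilon)
  fix \<epsilon> :: real assume \<epsilon>: "\<epsilon> > 0"
  define k' where "k' = k + \<epsilon>"
  let ?S = "{x::'a. R1 < norm x \<and> norm x < R2}"
  let ?C = "{x::'a. R1 \<le> norm x \<and> norm x \<le> R2}"
  define w where "w = (\<lambda>x. u x - v x - k')"
  have S: "open ?S" by (intro open_Collect_conj open_Collect_less continuous_intros)
  have wc: "continuous_on ?C w" unfolding w_def using uc vc by (intro continuous_intros)
  have cC: "compact ?C"
  proof -
    have "closed ?C" by (intro closed_Collect_conj closed_Collect_le continuous_intros)
    moreover have "bounded ?C" unfolding bounded_iff by auto
    ultimately show ?thesis by (simp add: compact_eq_bounded_closed)
  qed
  define K where "K = {x\<in>?C. w x \<ge> 0}"
  have cK: "compact K"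
  proof -
    have "K = ?C \<inter> w -` {0..}" unfolding K_def by auto
    then have "closed K" using continuous_closed_preimage[OF wc compact_imp_closed[OF cC] closed_atLeast] by simp
    then show ?thesis using compact_Int_closed[OF cC, of K] unfolding K_def by (simp add: Int_absorb1 Collect_mono_iff)
  qed
  have wb: "w x < 0" if "norm x = R1 \<or> norm x = R2" for x using bd[OF that] \<epsilon> unfolding w_def k'_def by linarith
  have KS: "K \<subseteq> ?S" using wb unfolding K_def by (force simp: less_le)
  define \<eta> where "\<eta> = (\<lambda>x. if x \<in> ?S then max 0 (w x) powr 2 else 0)"
  define D where "D = (\<lambda>x. if x \<in> ?S then (2 * max 0 (w x) powr (2 - 1)) *\<^sub>R (G x - H x) else 0)"
  have wS: "continuous_on ?S w" using wc by (rule continuous_on_subset) auto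
  have C: "C1c ?S \<eta> D" unfolding \<eta>_def D_def
  proof (rule C1c_glue[OF S cK KS])
    show "max 0 (w x) powr 2 = 0" if "x \<in> ?S" "x \<notin> K" for x using that unfolding K_def by auto
    show "((\<lambda>x. max 0 (w x) powr 2) has_derivative (\<bullet>) ((2 * max 0 (w x) powr (2 - 1)) *\<^sub>R (G x - H x))) (at x)"
      if "x \<in> ?S" for x
    proof -
      have wd: "(w has_derivative (\<lambda>h. (G x - H x) \<bullet> h)) (at x)"
        unfolding w_def using ud[of x] vd[of x] that
        by (auto intro!: derivative_eq_intros simp: inner_diff_left)
      show ?thesis
        by (rule has_derivative_eq_rhs[OF has_derivative_compose[OF wd
              pos_part_powr_deriv[of 2 "w x", unfolded has_field_derivative_def]]]) auto
    qed
    have "continuous_on ?S (\<lambda>x. max 0 (w x) powr (2 - 1))"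
      using wS by (intro continuous_on_powr' continuous_intros) auto
    then show "continuous_on ?S (\<lambda>x. (2 * max 0 (w x) powr (2 - 1)) *\<^sub>R (G x - H x))"
      using Gc Hc by (intro continuous_on_scaleR continuous_on_mult continuous_on_const continuous_on_diff)
  qed
  have fc: "continuous_on ?S (\<lambda>x. flux p A (g x))" if "continuous_on ?S g" for g :: "'a \<Rightarrow> 'a"
    by (rule continuous_on_compose2[OF _ that, of UNIV])
      (auto intro!: continuous_at_imp_continuous_on continuous_flux[OF p A_cont A0])
  define q where "q = (\<lambda>x. (flux p A (G x) - flux p A (H x)) \<bullet> D x)"
  have q0: "q x \<ge> 0" for x
    unfolding q_def D_def using flux_monotone(1)[of "G x" "H x"] by auto
  have qi: "integrable lborel q"
    unfolding q_def inner_diff_left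
    using C1c_integrable_flux[OF C fc[OF Gc]] C1c_integrable_flux[OF C fc[OF Hc]] by simp
  have qn: "(\<integral>x. q x \<partial>lborel) \<le> 0"
  proof -
    have "(\<integral>x. q x \<partial>lborel) = (\<integral>x. flux p A (G x) \<bullet> D x \<partial>lborel) - (\<integral>x. flux p A (H x) \<bullet> D x \<partial>lborel)"
      unfolding q_def inner_diff_left
      using C1c_integrable_flux[OF C fc[OF Gc]] C1c_integrable_flux[OF C fc[OF Hc]] by simp
    then show ?thesis using le[OF C] unfolding \<eta>_def by simp
  qed
  have qc: "continuous_on ?S q"
    unfolding q_def using fc[OF Gc] fc[OF Hc] continuous_on_subset[OF C1c_continuous(2)[OF C] subset_UNIV]
    by (intro continuous_on_inner continuous_on_diff)
  have D0: "D x = 0" for x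
  proof (cases "x \<in> ?S \<and> w x > 0")
    case True
    have "q x = 0" using continuous_nonneg_integral_0[OF S qc q0 qi qn, of x] True by blast
    then have "2 * w x * ((flux p A (G x) - flux p A (H x)) \<bullet> (G x - H x)) = 0"
      using True unfolding q_def D_def by simp
    then have "G x = H x" using True flux_monotone(2) by simp
    then show ?thesis unfolding D_def by simp
  qed (auto simp: D_def)
  have "\<exists>c. \<forall>x\<in>UNIV. \<eta> x = c"
  proof (rule has_derivative_zero_constant[of UNIV \<eta>])
    show "(\<eta> has_derivative (\<lambda>h. 0)) (at x within UNIV)" for x
    proof -
      have "(\<eta> has_derivative (\<lambda>h. D x \<bullet> h)) (at x)" using C unfolding C1c_def by blast
      then show ?thesis using D0[of x] by simp
    qed
  qed simp
  then obtain c where c: "\<And>x. \<eta> x = c" by blast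
  have "\<eta> 0 = 0" unfolding \<eta>_def using R by simp
  then have \<eta>0: "\<eta> x = 0" for x using c by metis
  have "w x \<le> 0"
  proof (cases "x \<in> ?S")
    case True
    then show ?thesis using \<eta>0[of x] unfolding \<eta>_def by (auto simp: max_def split: if_splits)
  next
    case False
    then have "norm x = R1 \<or> norm x = R2" using x by auto
    then show ?thesis using wb[of x] by simp
  qed
  then show "u x \<le> v x + k + \<epsilon>" unfolding w_def k'_def by simp
qed

end

subsection \<open>Solutions in an exterior domain\<close>

lemma open_exterior: "open {x::'a::real_normed_vector. norm x > r}"
  by (intro open_Collect_less continuous_intros)

lemma power_primitive:
  assumes "b > 0" "r > 0"
  shows "((\<lambda>r. - (M / b) * r powr (- b)) has_real_derivative M * r powr (- 1 - b)) (at r)"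
proof -
  have "((\<lambda>r. - (M / b) * r powr (- b)) has_real_derivative - (M / b) * (- b * r powr (- b - 1))) (at r)"
    by (intro DERIV_cmult has_real_derivative_powr assms)
  moreover have "- (M / b) * (- b * r powr (- b - 1)) = M * r powr (- 1 - b)"
  proof -
    have "r powr (- b - 1) = r powr (- 1 - b)" by (rule arg_cong[of _ _ "\<lambda>q. r powr q"]) simp
    then show ?thesis using assms by simp
  qed
  ultimately show ?thesis by simp
qed

lemma derivative_le_imp_le:
  fixes V W :: "real \<Rightarrow> real"
  assumes "R \<le> r" "\<And>s. R \<le> s \<Longrightarrow> s \<le> r \<Longrightarrow> (V has_real_derivative V' s) (at s)"
    "\<And>s. R \<le> s \<Longrightarrow> s \<le> r \<Longrightarrow> (W has_real_derivative W' s) (at s)"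
    "\<And>s. R \<le> s \<Longrightarrow> s \<le> r \<Longrightarrow> V' s \<le> W' s"
  shows "V r - V R \<le> W r - W R"
proof -
  have "(\<lambda>s. W s - V s) R \<le> (\<lambda>s. W s - V s) r"
  proof (rule DERIV_nonneg_imp_nondecreasing[OF assms(1)])
    fix s assume "R \<le> s" "s \<le> r"
    then show "\<exists>y. ((\<lambda>s. W s - V s) has_real_derivative y) (at s) \<and> 0 \<le> y"
      using assms by (intro exI[of _ "W' s - V' s"]) (auto intro!: derivative_eq_intros)
  qed
  then show ?thesis by simp
qed

locale exterior_solution = p_structure +
  fixes f u :: "'a::euclidean_space \<Rightarrow> real" and G :: "'a \<Rightarrow> 'a"
  assumes f_loc: "loc_integrable_on {x. norm x \<ge> 1} f"
    and u_C1: "C1_grad_on {x. norm x \<ge> 1} u G"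
    and weak: "weak_solution p A G f {x. norm x > 1}"
begin

text \<open>The flux is odd, so every one-sided statement about solutions also yields its mirror
  image.\<close>

lemma exterior_uminus: "exterior_solution p \<delta> L A (\<lambda>x. - f x) (\<lambda>x. - u x) (\<lambda>x. - G x)"
proof (unfold_locales)
  show "loc_integrable_on {x. norm x \<ge> 1} (\<lambda>x. - f x)"
    using f_loc unfolding loc_integrable_on_def set_integrable_def by auto
  show "C1_grad_on {x. norm x \<ge> 1} (\<lambda>x. - u x) (\<lambda>x. - G x)"
    using u_C1 unfolding C1_grad_on_def by (auto intro!: continuous_intros derivative_eq_intros)
  show "weak_solution p A (\<lambda>x. - G x) (\<lambda>x. - f x) {x. norm x > 1}"
    using weak unfolding weak_solution_def by simp
qed

lemma u_deriv:
  assumes "norm x > 1" shows "(u has_derivative (\<lambda>h. G x \<bullet> h)) (at x)"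
proof -
  have "{x::'a. norm x > 1} \<subseteq> interior {x. norm x \<ge> 1}"
    by (rule interior_maximal) (auto simp: open_exterior)
  then have "at x within {x. norm x \<ge> 1} = at x" using assms by (intro at_within_interior) auto
  moreover have "(u has_derivative (\<lambda>h. G x \<bullet> h)) (at x within {x. norm x \<ge> 1})"
    using u_C1 assms unfolding C1_grad_on_def by auto
  ultimately show ?thesis by simp
qed

lemma u_cont: "continuous_on {x. norm x \<ge> 1} u"
  unfolding continuous_on_eq_continuous_within
  using u_C1 has_derivative_continuous unfolding C1_grad_on_def by blast

lemma G_cont: "continuous_on {x. norm x \<ge> 1} G"
  using u_C1 unfolding C1_grad_on_def by blast

lemma f_int:
  assumes "compact K" "K \<subseteq> {x. norm x > 1}" shows "set_integrable lebesgue K f"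
  using f_loc assms unfolding loc_integrable_on_def by force

lemma weak_C1c:
  assumes "C1c S \<eta> D" "S \<subseteq> {x. norm x > 1}"
  shows "(\<integral>x. flux p A (G x) \<bullet> D x \<partial>lborel) = (\<integral>x. f x * \<eta> x \<partial>lebesgue)"
  by (rule weak_solution_C1c[OF p A_cont A0 open_exterior continuous_on_subset[OF G_cont] f_int weak
        C1c_mono[OF assms]]) auto

lemma DGsol_exterior:
  assumes "S \<subseteq> {x. norm x > 1}" "open S" "N \<ge> 0"
    "\<And>E. open E \<Longrightarrow> bounded E \<Longrightarrow> E \<subseteq> S \<Longrightarrow> (\<integral>x. indicator E x * \<bar>f x\<bar> \<partial>lebesgue) \<le> N * measure lborel E powr e"
  shows "DGsol p \<delta> L e N S u G (\<lambda>x. flux p A (G x))"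
  by (rule DGsol_of_weak_solution[OF p A_cont \<delta> A_bounds open_exterior continuous_on_subset[OF G_cont]
        u_deriv f_int weak assms(2,1,3,4)]) auto

text \<open>For a bounded right-hand side the exponent is e = 1, which gives the scaling exponent
  \<gamma> = p.\<close>

lemma DGsol_decay:
  assumes f: "\<And>x. norm x \<ge> R0 \<Longrightarrow> \<bar>f x\<bar> \<le> Cf * norm x powr (- q)" and C: "Cf > 0" and q: "q > 0"
    and r: "r \<ge> R0" "r \<ge> 1" and S: "open S" "S \<subseteq> {x. norm x > r}"
  shows "DGsol p \<delta> L 1 (Cf * r powr (- q)) S u G (\<lambda>x. flux p A (G x))"
proof (rule DGsol_exterior)
  show "S \<subseteq> {x. norm x > 1}" using S r by force
  show "open S" by fact
  show "Cf * r powr (- q) \<ge> 0" using C by simp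
  fix E :: "'a set" assume E: "open E" "bounded E" "E \<subseteq> S"
  have fE: "emeasure lborel E < \<infinity>" using emeasure_bounded_finite[OF E(2)] .
  have rhs: "(\<integral>x. (Cf * r powr (- q)) * indicator E x \<partial>lebesgue) = Cf * r powr (- q) * measure lborel E"
    using E(1) by simp
  have iE: "integrable lebesgue (indicator E :: 'a \<Rightarrow> real)"
    using E(1) fE by simp
  have "(\<integral>x. indicator E x * \<bar>f x\<bar> \<partial>lebesgue) \<le> (\<integral>x. (Cf * r powr (- q)) * indicator E x \<partial>lebesgue)"
  proof (rule integral_mono')
    show "integrable lebesgue (\<lambda>x. (Cf * r powr (- q)) * indicator E x)" using iE by simp
    show "indicator E x * \<bar>f x\<bar> \<le> (Cf * r powr (- q)) * indicator E x" for x
    proof (cases "x \<in> E")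
      case True
      then have n: "norm x > r" using E S by auto
      have "\<bar>f x\<bar> \<le> Cf * norm x powr (- q)" using f[of x] n r by simp
      also have "\<dots> \<le> Cf * r powr (- q)" using C n r q by (intro mult_left_mono powr_mono2') auto
      finally show ?thesis using True by simp
    qed simp
    show "0 \<le> (Cf * r powr (- q)) * indicator E x" for x using C by simp
  qed
  then show "(\<integral>x. indicator E x * \<bar>f x\<bar> \<partial>lebesgue) \<le> Cf * r powr (- q) * measure lborel E powr 1"
    unfolding rhs by simp
qed

subsection \<open>Radial barriers\<close>

text \<open>The first part of the prescribed flux is divergence free, and the coefficient Cf/(q - n)
  of the second makes minus its divergence equal to Cf |x|^(-q) \<ge> f. Thus V(|x|) is a
  supersolution for either sign of q - n.\<close>

lemma barrier_comparison:
  assumes f: "\<And>x. norm x \<ge> R0 \<Longrightarrow> \<bar>f x\<bar> \<le> Cf * norm x powr (- q)" and C: "Cf > 0" and qn: "q \<noteq> DIM('a)"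
    and R: "R0 > 1" "R0 \<le> R1" "R1 < R2" and c: "c \<ge> 0"
    and V: "\<And>r. r > R1 / 2 \<Longrightarrow> (V has_real_derivative
        irflux (c * r powr (1 - real DIM('a)) + Cf / (q - DIM('a)) * r powr (1 - q))) (at r)"
    and bd: "\<And>x. norm x = R1 \<or> norm x = R2 \<Longrightarrow> u x \<le> V (norm x) + k"
    and x: "R1 \<le> norm x" "norm x \<le> R2"
  shows "u x \<le> V (norm x) + k"
proof -
  let ?n = "real DIM('a)"
  define \<kappa> where "\<kappa> = Cf / (q - ?n)"
  define h where "h = (\<lambda>r. c * r powr (1 - ?n) + \<kappa> * r powr (1 - q))"
  define H where "H = (\<lambda>x::'a. (irflux (h (norm x)) / norm x) *\<^sub>R x)"
  let ?S = "{x::'a. R1 < norm x \<and> norm x < R2}"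
  have R1: "R1 > 1" using R by simp
  have Sx: "?S \<subseteq> {x. norm x > 1}" using R1 by auto
  have S0: "0 \<notin> ?S" using R1 by auto
  have S: "open ?S" by (intro open_Collect_conj open_Collect_less continuous_intros)
  have V': "(V has_real_derivative irflux (h r)) (at r)" if "r > R1 / 2" for r
    using V[OF that] unfolding h_def \<kappa>_def .
  have Vd: "((\<lambda>x::'a. V (norm x)) has_derivative (\<lambda>k. H x \<bullet> k)) (at x)" if "norm x > R1 / 2" for x
    unfolding H_def
  proof (rule radial_gradient(1)[OF V'[OF that]])
    show "x \<noteq> 0" using that R1 by auto
  qed
  have Hflux: "flux p A (H x) = c *\<^sub>R (norm x powr (- ?n) *\<^sub>R x) + \<kappa> *\<^sub>R (norm x powr (- q) *\<^sub>R x)"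
    if "norm x > R1" for x
  proof -
    have nx: "norm x > 0" using that R1 by linarith
    have "flux p A (H x) = (h (norm x) / norm x) *\<^sub>R x"
      unfolding H_def
    proof (rule radial_gradient(2))
      show "(V has_real_derivative irflux (h (norm x))) (at (norm x))" using V' that R1 by simp
      show "x \<noteq> 0" using nx by auto
    qed
    moreover have "h (norm x) / norm x = c * norm x powr (- ?n) + \<kappa> * norm x powr (- q)"
      unfolding h_def using nx by (simp add: powr_diff powr_minus field_simps)
    ultimately show ?thesis by (simp add: scaleR_add_left)
  qed
  have hc: "continuous_on {0<..} h" unfolding h_def by (intro continuous_intros) auto
  have Hc: "continuous_on {x. norm x > 1} H"
  proof -
    have "continuous_on {x::'a. norm x > 1} (\<lambda>x. irflux (h (norm x)))"
    proof (rule continuous_on_compose2[of UNIV irflux])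
      show "continuous_on UNIV irflux" by (auto intro!: continuous_at_imp_continuous_on isCont_irflux)
      show "continuous_on {x::'a. norm x > 1} (\<lambda>x. h (norm x))"
        by (rule continuous_on_compose2[OF hc]) (auto intro!: continuous_intros)
    qed auto
    then show ?thesis unfolding H_def by (intro continuous_intros) auto
  qed
  show ?thesis
  proof (rule comparison[of R1 R2 u "\<lambda>x. V (norm x)" G H k])
    show "0 < R1" "R1 < R2" using R R1 by auto
    show "continuous_on {x. R1 \<le> norm x \<and> norm x \<le> R2} u"
      using u_cont by (rule continuous_on_subset) (use R1 in auto)
    show "continuous_on {x::'a. R1 \<le> norm x \<and> norm x \<le> R2} (\<lambda>x. V (norm x))"
      by (intro continuous_at_imp_continuous_on ballI has_derivative_continuous[OF Vd]) (use R1 in auto)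
    show "(u has_derivative (\<bullet>) (G x)) (at x)" if "R1 < norm x" for x using u_deriv[of x] that R1 by simp
    show "((\<lambda>x. V (norm x)) has_derivative (\<bullet>) (H x)) (at x)" if "R1 < norm x" for x
      using Vd[of x] that R1 by simp
    show "continuous_on ?S G" using G_cont by (rule continuous_on_subset) (use R1 in auto)
    show "continuous_on ?S H" using Hc Sx by (rule continuous_on_subset)
    show "u x \<le> V (norm x) + k" if "norm x = R1 \<or> norm x = R2" for x by (rule bd[OF that])
    show "R1 \<le> norm x" "norm x \<le> R2" by fact+
    fix \<eta> D assume \<eta>: "C1c ?S \<eta> D" and \<eta>0: "\<And>x. \<eta> x \<ge> 0"
    obtain K where K: "compact K" "K \<subseteq> ?S" "\<And>x. x \<notin> K \<Longrightarrow> \<eta> x = 0" using \<eta> unfolding C1c_def by blast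
    have Dz: "D x = 0" if "x \<notin> ?S" for x using C1c_deriv_zero[OF \<eta> K(1,3)] K(2) that by blast
    note r1 = radial_power_divergence[OF S S0 \<eta>, of ?n] and r2 = radial_power_divergence[OF S S0 \<eta>, of q]
    have "(\<integral>x. flux p A (H x) \<bullet> D x \<partial>lborel)
      = (\<integral>x. c * ((norm x powr (- ?n) *\<^sub>R x) \<bullet> D x) + \<kappa> * ((norm x powr (- q) *\<^sub>R x) \<bullet> D x) \<partial>lborel)"
    proof (rule Bochner_Integration.integral_cong[OF refl])
      fix x show "flux p A (H x) \<bullet> D x = c * ((norm x powr (- ?n) *\<^sub>R x) \<bullet> D x) + \<kappa> * ((norm x powr (- q) *\<^sub>R x) \<bullet> D x)"
        by (cases "x \<in> ?S") (auto simp: Hflux inner_add_left Dz)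
    qed
    also have "\<dots> = c * (\<integral>x. (norm x powr (- ?n) *\<^sub>R x) \<bullet> D x \<partial>lborel) + \<kappa> * (\<integral>x. (norm x powr (- q) *\<^sub>R x) \<bullet> D x \<partial>lborel)"
      using r1(3) r2(3) by (subst Bochner_Integration.integral_add) auto
    also have "\<dots> = Cf * (\<integral>x. norm x powr (- q) * \<eta> x \<partial>lborel)"
      unfolding r1(1) r2(1) \<kappa>_def using qn by (simp add: field_simps)
    also have "\<dots> = (\<integral>x. Cf * (norm x powr (- q) * \<eta> x) \<partial>lborel)" by simp
    also have "\<dots> = (\<integral>x. Cf * (norm x powr (- q) * \<eta> x) \<partial>lebesgue)"
      using borel_measurable_integrable[OF r2(2)] by (intro integral_completion[symmetric]) simp
    finally have eq: "(\<integral>x. flux p A (H x) \<bullet> D x \<partial>lborel) = (\<integral>x. Cf * (norm x powr (- q) * \<eta> x) \<partial>lebesgue)" .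
    have "(\<integral>x. flux p A (G x) \<bullet> D x \<partial>lborel) = (\<integral>x. f x * \<eta> x \<partial>lebesgue)" by (rule weak_C1c[OF \<eta> Sx])
    also have "\<dots> \<le> (\<integral>x. Cf * (norm x powr (- q) * \<eta> x) \<partial>lebesgue)"
    proof (rule integral_mono')
      have "integrable lborel (\<lambda>x. Cf * (norm x powr (- q) * \<eta> x))" using r2(2) by simp
      then show "integrable lebesgue (\<lambda>x. Cf * (norm x powr (- q) * \<eta> x))"
        by (subst integrable_completion) (auto dest: borel_measurable_integrable)
      show "f x * \<eta> x \<le> Cf * (norm x powr (- q) * \<eta> x)" for x
      proof (cases "x \<in> ?S")
        case True
        then have "f x \<le> Cf * norm x powr (- q)" using f[of x] R by auto
        then have "f x * \<eta> x \<le> (Cf * norm x powr (- q)) * \<eta> x" using \<eta>0 by (rule mult_right_mono)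
        then show ?thesis by (simp add: mult.assoc)
      next
        case False
        then show ?thesis using K(2,3) by (metis mult_zero_right order_refl subsetD)
      qed
      show "0 \<le> Cf * (norm x powr (- q) * \<eta> x)" for x using C \<eta>0 by simp
    qed
    finally show "(\<integral>x. flux p A (G x) \<bullet> D x \<partial>lborel) \<le> (\<integral>x. flux p A (H x) \<bullet> D x \<partial>lborel)" unfolding eq .
  qed
qed

text \<open>The decay rate of the barriers: inverting a radial flux of order r^(1-q) gives a slope
  of order r^((1-q)/(p-1)) = r^(-1-\<beta>), which integrates to r^(-\<beta>).\<close>

definition beta :: "real \<Rightarrow> real" where "beta q = (q - p) / (p - 1)"

lemma beta_pos: "q > p \<Longrightarrow> beta q > 0" unfolding beta_def using p by simp

lemma beta_exponent: "r > 0 \<Longrightarrow> (a * r powr (1 - q)) powr (1 / (p - 1)) = a powr (1 / (p - 1)) * r powr (- 1 - beta q)"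
proof -
  assume r: "r > 0"
  have "(1 - q) / (p - 1) = - 1 - beta q" unfolding beta_def using p by (simp add: field_simps)
  then show ?thesis using r by (simp add: powr_mult powr_powr)
qed

text \<open>For c = 0 the barrier varies by at most \<open>E\<close> on all of [R1, \<infinity>),
  whatever R2 is. It is decreasing when q < n, so its absolute value is estimated, and
  \<open>E\<close> is paid twice: on the boundary and at x.\<close>

lemma max_principle_decay:
  assumes f: "\<And>x. norm x \<ge> R0 \<Longrightarrow> \<bar>f x\<bar> \<le> Cf * norm x powr (- q)" and C: "Cf > 0" and qn: "q \<noteq> DIM('a)"
    and q: "q > p" and R0: "R0 > 1"
  obtains B where "B > 0" "\<And>R1 R2 k x. \<lbrakk>R0 \<le> R1; R1 < R2; \<forall>y. norm y = R1 \<or> norm y = R2 \<longrightarrow> u y \<le> k;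
     R1 \<le> norm x; norm x \<le> R2\<rbrakk> \<Longrightarrow> u x \<le> k + B * R1 powr (- beta q)"
proof -
  let ?n = "real DIM('a)"
  define \<kappa> where "\<kappa> = Cf / (q - ?n)"
  define M where "M = (\<bar>\<kappa>\<bar> / \<delta>) powr (1 / (p - 1))"
  have M: "M > 0" unfolding M_def \<kappa>_def using C qn \<delta> by simp
  note b = beta_pos[OF q]
  show thesis
  proof (rule that[of "2 * (M / beta q)"])
    show "2 * (M / beta q) > 0" using M b by simp
    fix R1 R2 k x assume R: "R0 \<le> R1" "R1 < R2" and bd: "\<forall>y. norm y = R1 \<or> norm y = R2 \<longrightarrow> u y \<le> k"
      and x: "R1 \<le> norm (x::'a)" "norm x \<le> R2"
    have R1: "R1 > 0" using R R0 by simp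
    obtain V where V0: "V R1 = 0" and V: "\<And>r. r > R1 / 2 \<Longrightarrow>
       (V has_real_derivative irflux (0 * r powr (1 - ?n) + \<kappa> * r powr (1 - q))) (at r)"
    proof (rule radial_profile[OF R1])
      show "continuous_on {0<..} (\<lambda>r. 0 * r powr (1 - ?n) + \<kappa> * r powr (1 - q))"
        by (intro continuous_intros) auto
    qed (rule that)
    define E where "E = M / beta q * R1 powr (- beta q)"
    have Vb: "\<bar>V r\<bar> \<le> E" if r: "R1 \<le> r" for r
    proof -
      have db: "\<bar>irflux (0 * s powr (1 - ?n) + \<kappa> * s powr (1 - q))\<bar> \<le> M * s powr (- 1 - beta q)" if "R1 \<le> s" for s
      proof -
        have s: "s > 0" using that R1 by simp
        have "\<bar>irflux (0 * s powr (1 - ?n) + \<kappa> * s powr (1 - q))\<bar> \<le> (\<bar>\<kappa>\<bar> / \<delta> * s powr (1 - q)) powr (1 / (p - 1))"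
          using irflux_abs[of "\<kappa> * s powr (1 - q)"] by (simp add: abs_mult)
        then show ?thesis unfolding beta_exponent[OF s] M_def .
      qed
      let ?W = "\<lambda>r. - (M / beta q) * r powr (- beta q)"
      have W: "(?W has_real_derivative M * s powr (- 1 - beta q)) (at s)" if "R1 \<le> s" for s
        using power_primitive[OF b] that R1 by simp
      have Vd: "(V has_real_derivative irflux (0 * s powr (1 - ?n) + \<kappa> * s powr (1 - q))) (at s)" if "R1 \<le> s" for s
        using V[of s] that R1 by simp
      have "V r - V R1 \<le> ?W r - ?W R1"
        by (rule derivative_le_imp_le[OF r Vd W]) (use db in \<open>auto dest: abs_le_D1\<close>)
      moreover have "(\<lambda>s. - V s) r - (\<lambda>s. - V s) R1 \<le> ?W r - ?W R1"
        by (rule derivative_le_imp_le[OF r DERIV_minus[OF Vd] W]) (use db in \<open>auto dest: abs_le_D2\<close>)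
      moreover have "?W r - ?W R1 \<le> E" unfolding E_def using M b by simp
      ultimately show ?thesis using V0 by simp
    qed
    have "u x \<le> V (norm x) + (k + E)"
    proof (rule barrier_comparison[OF f C qn R0 R order_refl V[unfolded \<kappa>_def] _ x])
      fix y :: 'a assume y: "norm y = R1 \<or> norm y = R2"
      then have "u y \<le> k" using bd by blast
      moreover have "\<bar>V (norm y)\<bar> \<le> E" using Vb y R by auto
      ultimately show "u y \<le> V (norm y) + (k + E)" by linarith
    qed
    moreover have "\<bar>V (norm x)\<bar> \<le> E" using Vb x by simp
    ultimately show "u x \<le> k + 2 * (M / beta q) * R1 powr (- beta q)" unfolding E_def by linarith
  qed
qed

text \<open>For \<open>p \<ge> n\<close> the primitive \<open>P\<close> below is unbounded; comparing with small multiples of it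
  removes the condition on the outer sphere.\<close>

lemma max_principle_growth:
  assumes f: "\<And>x. norm x \<ge> R0 \<Longrightarrow> \<bar>f x\<bar> \<le> Cf * norm x powr (- q)" and C: "Cf > 0" and qn: "q > DIM('a)"
    and q: "q > p" and R0: "R0 > 1"
    and P: "\<And>r. r > 0 \<Longrightarrow> (P has_real_derivative r powr (- (real DIM('a) - 1) / (p - 1))) (at r)"
    and P_top: "filterlim P at_top at_top"
    and growth: "\<And>\<epsilon>. \<epsilon> > 0 \<Longrightarrow> eventually (\<lambda>x. u x \<le> \<epsilon> * P (norm x)) at_infinity"
  obtains B where "B > 0" "\<And>R1 k x. \<lbrakk>R0 \<le> R1; \<forall>y. norm y = R1 \<longrightarrow> u y \<le> k; R1 \<le> norm x\<rbrakk>
     \<Longrightarrow> u x \<le> k + B * R1 powr (- beta q)"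
proof -
  let ?n = "real DIM('a)"
  define s where "s = 1 / (p - 1)"
  have s: "s > 0" unfolding s_def using p by simp
  define \<kappa> where "\<kappa> = Cf / (q - ?n)"
  have \<kappa>: "\<kappa> > 0" unfolding \<kappa>_def using C qn by simp
  define M where "M = 2 powr s * (\<kappa> / \<delta>) powr s"
  have M: "M > 0" unfolding M_def using \<kappa> \<delta> by simp
  note b = beta_pos[OF q]
  show thesis
  proof (rule that[of "M / beta q"])
    show "M / beta q > 0" using M b by simp
    fix R1 k x assume R: "R0 \<le> R1" and bd: "\<forall>y. norm y = R1 \<longrightarrow> u y \<le> k" and x: "R1 \<le> norm (x::'a)"
    have R1: "R1 > 0" using R R0 by simp
    define E where "E = M / beta q * R1 powr (- beta q)"
    have main: "u x \<le> k + (E + t * (P (norm x) - P R1))" if t: "t > 0" for t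
    proof -
      \<comment> \<open>Solves \<open>2 powr s * (c / \<delta>) powr s = t\<close>, so that t is
        exactly the coefficient of P in the upper bound for the barrier.\<close>
      define c where "c = \<delta> * (t / 2 powr s) powr (p - 1)"
      have c: "c > 0" unfolding c_def using \<delta> t by simp
      have ct: "2 powr s * (c / \<delta>) powr s = t"
        unfolding c_def s_def using \<delta> t p by (simp add: powr_powr)
      obtain V where V0: "V R1 = 0" and V: "\<And>r. r > R1 / 2 \<Longrightarrow>
         (V has_real_derivative irflux (c * r powr (1 - ?n) + \<kappa> * r powr (1 - q))) (at r)"
      proof (rule radial_profile[OF R1])
        show "continuous_on {0<..} (\<lambda>r. c * r powr (1 - ?n) + \<kappa> * r powr (1 - q))"
          by (intro continuous_intros) auto
      qed (rule that)
      have Vd: "(V has_real_derivative irflux (c * r powr (1 - ?n) + \<kappa> * r powr (1 - q))) (at r)" if "R1 \<le> r" for r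
        using V[of r] that R1 by simp
      have pe: "(r powr (1 - ?n)) powr s = r powr (- (?n - 1) / (p - 1))" if "r > 0" for r
        unfolding s_def powr_powr by (simp add: field_simps)
      have up: "irflux (c * r powr (1 - ?n) + \<kappa> * r powr (1 - q))
         \<le> t * r powr (- (?n - 1) / (p - 1)) + M * r powr (- 1 - beta q)" if "R1 \<le> r" for r
      proof -
        have r: "r > 0" using that R1 by simp
        let ?a = "c / \<delta> * r powr (1 - ?n)" and ?b = "\<kappa> / \<delta> * r powr (1 - q)"
        have ab: "?a \<ge> 0" "?b \<ge> 0" using c \<kappa> \<delta> by auto
        have "irflux (c * r powr (1 - ?n) + \<kappa> * r powr (1 - q)) \<le> (?a + ?b) powr s"
          using irflux_bounds(2)[of "c * r powr (1 - ?n) + \<kappa> * r powr (1 - q)"] c \<kappa> unfolding s_def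
          by (simp add: add_divide_distrib)
        also have "\<dots> \<le> (2 * max ?a ?b) powr s"
        proof (rule powr_mono2)
          show "?a + ?b \<le> 2 * max ?a ?b" by (smt (verit) max.cobounded1 max.cobounded2)
        qed (use ab s in auto)
        also have "\<dots> = 2 powr s * (max ?a ?b) powr s" using ab by (simp add: powr_mult)
        also have "(max ?a ?b) powr s \<le> ?a powr s + ?b powr s" by (auto simp: max_def)
        also have "2 powr s * (?a powr s + ?b powr s) = t * r powr (- (?n - 1) / (p - 1)) + M * r powr (- 1 - beta q)"
        proof -
          have "?a powr s = (c / \<delta>) powr s * r powr (- (?n - 1) / (p - 1))"
            using pe[OF r] by (simp only: powr_mult)
          moreover have "?b powr s = (\<kappa> / \<delta>) powr s * r powr (- 1 - beta q)"
            unfolding s_def by (rule beta_exponent[OF r])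
          ultimately show ?thesis unfolding M_def ct[symmetric] by (simp only: distrib_left mult.assoc)
        qed
        finally show ?thesis by simp
      qed
      have lo: "(c / L) powr s * r powr (- (?n - 1) / (p - 1)) \<le> irflux (c * r powr (1 - ?n) + \<kappa> * r powr (1 - q))" if "R1 \<le> r" for r
      proof -
        have r: "r > 0" using that R1 by simp
        have "(c / L) powr s * r powr (- (?n - 1) / (p - 1)) = (c / L * r powr (1 - ?n)) powr s"
          using pe[OF r] by (simp only: powr_mult)
        also have "\<dots> \<le> ((c * r powr (1 - ?n) + \<kappa> * r powr (1 - q)) / L) powr s"
          using c \<kappa> L s by (intro powr_mono2) (auto simp: field_simps)
        also have "\<dots> \<le> irflux (c * r powr (1 - ?n) + \<kappa> * r powr (1 - q))"
          unfolding s_def using c \<kappa> by (intro irflux_bounds(1)) auto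
        finally show ?thesis .
      qed
      have Vup: "V r \<le> t * (P r - P R1) + E" if r: "R1 \<le> r" for r
      proof -
        let ?W = "\<lambda>r. t * P r + - (M / beta q) * r powr (- beta q)"
        have W: "(?W has_real_derivative t * v powr (- (?n - 1) / (p - 1)) + M * v powr (- 1 - beta q)) (at v)" if "R1 \<le> v" for v
          using power_primitive[OF b, of v M] P[of v] that R1 by (intro DERIV_add DERIV_cmult) auto
        have "V r - V R1 \<le> ?W r - ?W R1"
          by (rule derivative_le_imp_le[OF r Vd W up])
        also have "\<dots> \<le> t * (P r - P R1) + E" unfolding E_def using M b by (simp add: algebra_simps)
        finally show ?thesis using V0 by simp
      qed
      define a where "a = (c / L) powr s"
      have a: "a > 0" unfolding a_def using c L by simp
      have Vlo: "a * (P r - P R1) \<le> V r" if r: "R1 \<le> r" for r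
      proof -
        have W: "((\<lambda>r. a * P r) has_real_derivative a * v powr (- (?n - 1) / (p - 1))) (at v)" if "R1 \<le> v" for v
          using P[of v] that R1 by (intro DERIV_cmult) auto
        have "a * P r - a * P R1 \<le> V r - V R1"
          by (rule derivative_le_imp_le[OF r W Vd]) (use lo in \<open>auto simp: a_def\<close>)
        then show ?thesis using V0 by (simp add: algebra_simps)
      qed
      obtain r0 where r0: "\<And>y. norm y \<ge> r0 \<Longrightarrow> u y \<le> a / 2 * P (norm y)"
        using growth[of "a / 2"] a unfolding eventually_at_infinity by auto
      have "eventually (\<lambda>r. P r \<ge> 2 / a * (a * P R1 - k)) at_top"
        using P_top unfolding filterlim_at_top by blast
      then obtain r1 where r1: "\<And>r. r \<ge> r1 \<Longrightarrow> P r \<ge> 2 / a * (a * P R1 - k)"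
        unfolding eventually_at_top_linorder by blast
      \<comment> \<open>On this sphere u is at most (a/2) P while the barrier is at least a (P -
        P(R1)); beyond \<open>r1\<close> the remaining (a/2) P absorbs the constant a P(R1) -
        k.\<close>
      define R2 where "R2 = max (norm x) (max r0 r1) + 1"
      have R2: "R2 > norm x" "R2 \<ge> r0" "R2 \<ge> r1" unfolding R2_def by auto
      have "u x \<le> V (norm x) + k"
      proof (rule barrier_comparison[OF f C _ R0 R _ less_imp_le[OF c] V[unfolded \<kappa>_def] _ x less_imp_le[OF R2(1)]])
        show "q \<noteq> DIM('a)" using qn by simp
        show "R1 < R2" using x R2 by simp
        fix y :: 'a assume "norm y = R1 \<or> norm y = R2"
        then show "u y \<le> V (norm y) + k"
        proof
          assume "norm y = R1" then show ?thesis using bd V0 by simp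
        next
          assume y: "norm y = R2"
          have "u y \<le> a / 2 * P R2" using r0[of y] y R2 by simp
          moreover have "a * P R1 - k \<le> a / 2 * P R2" using r1[OF R2(3)] a by (simp add: field_simps)
          moreover have "a * (P R2 - P R1) \<le> V R2" using Vlo[of R2] x R2 by simp
          ultimately show ?thesis using y by (simp add: algebra_simps)
        qed
      qed
      also have "V (norm x) \<le> t * (P (norm x) - P R1) + E" by (rule Vup[OF x])
      finally show ?thesis by simp
    qed
    \<comment> \<open>R2 has disappeared from the estimate, so t may tend to 0 with x fixed.\<close>
    have "u x \<le> k + E"
    proof (rule field_le_epsilon)
      fix e :: real assume e: "e > 0"
      define t where "t = e / (\<bar>P (norm x) - P R1\<bar> + 1)"
      have t: "t > 0" unfolding t_def using e by simp
      have "t * (P (norm x) - P R1) \<le> t * (\<bar>P (norm x) - P R1\<bar> + 1)" using t by (intro mult_left_mono) auto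
      also have "\<dots> = e" unfolding t_def by simp
      finally show "u x \<le> k + E + e" using main[OF t] by simp
    qed
    then show "u x \<le> k + M / beta q * R1 powr (- beta q)" unfolding E_def .
  qed
qed

end

subsection \<open>Maximum principle for integrable right-hand sides\<close>

lemma DGsol_mono_N:
  assumes "DGsol p \<delta> L e N S u G F" "N \<le> N'"
  shows "DGsol p \<delta> L e N' S u G F"
  unfolding DGsol_def
proof (intro conjI allI impI)
  fix \<eta> D B assume \<eta>: "C1c S \<eta> D" "\<forall>x. \<bar>\<eta> x\<bar> \<le> B"
  have "B \<ge> 0" using \<eta>(2)[rule_format, of undefined] by simp
  have "\<bar>\<integral>x. F x \<bullet> D x \<partial>lborel\<bar> \<le> B * N * measure lborel {x. \<eta> x \<noteq> 0} powr e"
    using DGsolD(8)[OF assms(1) \<eta>(1)] \<eta>(2) by blast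
  also have "\<dots> \<le> B * N' * measure lborel {x. \<eta> x \<noteq> 0} powr e"
    using assms(2) \<open>B \<ge> 0\<close> by (intro mult_right_mono mult_left_mono) auto
  finally show "\<bar>\<integral>x. F x \<bullet> D x \<partial>lborel\<bar> \<le> B * N' * measure lborel {x. \<eta> x \<noteq> 0} powr e" .
qed (use assms in \<open>auto simp: DGsol_def\<close>)

text \<open>Two exponents, one on either side of the critical one, allow the super-level sets to be
  controlled independently of the size of the domain: the first bounds their measure at half of
  the maximal height, the second drives it to zero.\<close>

lemma stampacchia:
  fixes TA :: "'a::euclidean_space itself" and p \<delta> L e1 e2 :: real
  assumes p: "p > 1" and \<delta>: "\<delta> > 0" and L: "L > 0"
    and e1: "0 \<le> e1" "e1 < 1 - p / DIM('a)" and e2: "e2 > 1 - p / DIM('a)"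
  obtains c a b where "c > 0" "a > 0" "b > 0"
    "\<And>N1 N2 S C (u::'a \<Rightarrow> real) G F k0 s. \<lbrakk>DGsol p \<delta> L e1 N1 S u G F; DGsol p \<delta> L e2 N2 S u G F;
      N1 > 0; N2 > 0; compact C; S \<subseteq> C; continuous_on C u; \<forall>x\<in>C - S. u x \<le> k0; s > 0;
      \<forall>x\<in>S. u x \<le> k0 + s; \<exists>x\<in>S. u x = k0 + s\<rbrakk> \<Longrightarrow>
      c \<le> (N1 * s powr (1 - p)) powr a * (N2 * s powr (1 - p)) powr b"
proof -
  let ?n = "real DIM('a)"
  define E where "E = energy_const TYPE('a) p \<delta> L"
  have E: "E > 0" unfolding E_def by (rule energy_const_pos[OF L \<delta>])
  define \<alpha> where "\<alpha> = (\<lambda>e::real. 1 / ?n - (1 - e) / p)"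
  define \<beta> where "\<beta> = 1 + \<alpha> e1"
  have \<alpha>1: "\<alpha> e1 < 0"
  proof -
    have "(p / ?n) / p < (1 - e1) / p" using e1 p by (intro divide_strict_right_mono) auto
    then show ?thesis unfolding \<alpha>_def using p by simp
  qed
  have \<alpha>2: "\<alpha> e2 > 0"
  proof -
    have "(1 - e2) / p < (p / ?n) / p" using e2 p by (intro divide_strict_right_mono) auto
    then show ?thesis unfolding \<alpha>_def using p by simp
  qed
  have \<beta>: "0 < \<beta>" "\<beta> < 1"
  proof -
    have "(1 - e1) / p \<le> 1 / p" using e1 p by (intro divide_right_mono) auto
    moreover have "1 / p < 1" using p by simp
    moreover have "1 / ?n > 0" by simp
    ultimately show "0 < \<beta>" unfolding \<beta>_def \<alpha>_def by linarith
    show "\<beta> < 1" unfolding \<beta>_def using \<alpha>1 by simp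
  qed
  \<comment> \<open>The solution of m = 2 + m \<beta>, where 2 is the power of the level difference
    lost in one step.\<close>
  define m where "m = 2 / (1 - \<beta>)"
  have m: "m > 0" unfolding m_def using \<beta> by simp
  define c1 where "c1 = 4 * E * 2 powr (m * \<beta>)"
  have c1: "c1 > 0" unfolding c1_def using E by simp
  define c2 where "c2 = 64 * E"
  have c2: "c2 > 0" unfolding c2_def using E by simp
  define a where "a = 1 / (1 - \<beta>)"
  define b where "b = 1 / \<alpha> e2"
  have ab: "a > 0" "b > 0" unfolding a_def b_def using \<beta> \<alpha>2 by auto
  define c where "c = 4 powr (- 1 / (\<alpha> e2)\<^sup>2) * 2 powr (- m) * c1 powr (- a) * c2 powr (- b)"
  have c: "c > 0" unfolding c_def using c1 c2 by simp
  show thesis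
  proof (rule that[of c "a / p" "b / p"])
    show "c > 0" "a / p > 0" "b / p > 0" using c ab p by auto
    fix N1 N2 S C and u :: "'a \<Rightarrow> real" and G F k0 s
    assume sol1: "DGsol p \<delta> L e1 N1 S u G F" and sol2: "DGsol p \<delta> L e2 N2 S u G F"
      and N: "N1 > 0" "N2 > 0" and C: "compact C" "S \<subseteq> C" and uc: "continuous_on C u"
      and out: "\<forall>x\<in>C - S. u x \<le> k0" and s: "s > 0" and us: "\<forall>x\<in>S. u x \<le> k0 + s"
      and top: "\<exists>x\<in>S. u x = k0 + s"
    have S: "open S" by (rule DGsolD(1)[OF sol1])
    define X where "X = (\<lambda>t. {x\<in>S. u x > k0 + t * s})"
    define y where "y = (\<lambda>t. measure lborel (X t))"
    have oX: "open (X t)" for t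
      unfolding X_def by (rule open_superlevel[OF S DGsolD(9)[OF sol1]])
    have bX: "bounded (X t)" for t
      using bounded_subset[OF compact_imp_bounded[OF C(1)]] C(2) unfolding X_def by (metis (no_types, lifting) mem_Collect_eq subset_eq)
    have fX: "emeasure lborel (X t) < \<infinity>" for t using emeasure_bounded_finite[OF bX] .
    have yX: "measure lborel (X t) = y t" for t unfolding y_def ..
    have y0: "y t \<ge> 0" for t unfolding y_def by simp
    have ymono: "y t' \<le> y t" if "t \<le> t'" for t t'
    proof -
      have "t * s \<le> t' * s" using that s by (intro mult_right_mono) auto
      then have "X t' \<subseteq> X t" unfolding X_def by force
      then show ?thesis unfolding y_def using fX oX by (intro measure_mono_fmeasurable) (auto simp: fmeasurable_def)
    qed
    have yt: "y t > 0" if "t < 1" for t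
    proof -
      have "t * s < 1 * s" using that s by (intro mult_strict_right_mono) auto
      then have "X t \<noteq> {}" using top unfolding X_def by force
      then show ?thesis unfolding y_def by (rule measure_open_pos[OF oX _ fX])
    qed
    define Bf where "Bf = (\<lambda>N. (N * s powr (1 - p)) powr (1 / p))"
    have step: "y t' * (t' - t)\<^sup>2 \<le> E * Bf N * y t powr (1 + \<alpha> e)"
      if sol: "DGsol p \<delta> L e N S u G F" and NN: "N > 0" and t: "0 < t" "t < t'" "t' < 1" for e N t t'
    proof -
      define T where "T = (N * s powr (p + 1) * y t powr (e - 1)) powr (1 / p)"
      have yp: "y t > 0" using yt t by simp
      have T: "T > 0" unfolding T_def using NN s yp by simp
      define K where "K = {x\<in>C. u x \<ge> k0 + t * s}"
      have K: "compact K"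
      proof -
        have "K = C \<inter> u -` {k0 + t * s..}" unfolding K_def by auto
        then have "closed K" using continuous_closed_preimage[OF uc compact_imp_closed[OF C(1)] closed_atLeast] by simp
        then have "compact (C \<inter> K)" by (rule compact_Int_closed[OF C(1)])
        moreover have "C \<inter> K = K" unfolding K_def by auto
        ultimately show ?thesis by simp
      qed
      have KS: "K \<subseteq> S"
      proof
        fix x assume "x \<in> K"
        then have "x \<in> C" "u x \<ge> k0 + t * s" unfolding K_def by auto
        moreover have "t * s > 0" using t s by simp
        ultimately show "x \<in> S" using out by force
      qed
      have Xeq: "{x\<in>S. (1::real) > 0 \<and> u x > k0 + t * s} = X t" unfolding X_def by auto
      have "measure lborel (X t') * (1 * ((t' - t) * s)\<^sup>2)
        \<le> energy_const TYPE('a) p \<delta> L * measure lborel {x\<in>S. (1::real) > 0 \<and> u x > k0 + t * s} powr (1 / DIM('a))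
            * measure lborel {x\<in>S. (1::real) > 0 \<and> u x > k0 + t * s} * T"
      \<comment> \<open>The cut-off is the constant 1: super-level sets above the boundary values
        are compactly contained in \<open>S\<close>.\<close>
      proof (rule energy_step[OF p \<delta> L sol, of "\<lambda>_. 1" "\<lambda>_. 0" 0 K "k0 + t * s" s])
        show "compact K" "K \<subseteq> S" by fact+
        show "(1::real) = 0 \<or> u x \<le> k0 + t * s" if "x \<in> S" "x \<notin> K" for x
          using that C(2) unfolding K_def by auto
        show "u x - (k0 + t * s) \<le> s" if "x \<in> S" for x
        proof -
          have "t * s > 0" using t s by simp
          moreover have "u x \<le> k0 + s" using us that by blast
          ultimately show ?thesis by linarith
        qed
        show "N * s powr (p + 1) * measure lborel {x\<in>S. (1::real) > 0 \<and> u x > k0 + t * s} powr (e - 1) \<le> T powr p"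
          unfolding Xeq yX T_def using p NN s by (simp add: powr_powr)
        show "X t' \<in> sets borel" using oX by simp
        show "x \<in> S \<and> (1::real) \<ge> 1 \<and> u x \<ge> k0 + t * s + (t' - t) * s" if "x \<in> X t'" for x
          using that unfolding X_def by (auto simp: algebra_simps)
      qed (use s t T in auto)
      then have "(y t' * (t' - t)\<^sup>2) * s\<^sup>2 \<le> E * (y t powr (1 / ?n) * y t * T)"
        unfolding Xeq yX E_def by (simp add: power_mult_distrib mult_ac)
      also have "y t powr (1 / ?n) * y t * T = s\<^sup>2 * (Bf N * y t powr (1 + \<alpha> e))"
      proof -
        have T1: "T = N powr (1 / p) * s powr ((p + 1) / p) * y t powr ((e - 1) / p)"
          unfolding T_def by (simp add: powr_mult powr_powr)
        have B1: "Bf N = N powr (1 / p) * s powr ((1 - p) / p)"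
          unfolding Bf_def by (simp add: powr_mult powr_powr)
        have s1: "s powr ((p + 1) / p) = s\<^sup>2 * s powr ((1 - p) / p)"
        proof -
          have "(p + 1) / p = 2 + (1 - p) / p" using p by (simp add: field_simps)
          then show ?thesis using s by (simp add: powr_add powr_numeral)
        qed
        have "1 + \<alpha> e = 1 / ?n + 1 + (e - 1) / p" unfolding \<alpha>_def using p by (simp add: field_simps)
        then have y1: "y t powr (1 + \<alpha> e) = y t powr (1 / ?n) * y t * y t powr ((e - 1) / p)"
          using yp by (simp add: powr_add)
        show ?thesis unfolding T1 B1 s1 y1 by (simp only: mult_ac)
      qed
      finally have "(y t' * (t' - t)\<^sup>2) * s\<^sup>2 \<le> (E * Bf N * y t powr (1 + \<alpha> e)) * s\<^sup>2" by (simp add: mult_ac)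
      then show ?thesis using s by simp
    qed
    have Bp: "Bf N1 > 0" "Bf N2 > 0" unfolding Bf_def using N s by auto
    text \<open>The weight \<open>t powr m\<close> is chosen such that the recursion for \<open>y\<close> becomes autonomous.\<close>
    define Z where "Z = (\<lambda>t. y t * t powr m)"
    define Q where "Q = (SUP t\<in>{0<..1/2}. Z t)"
    have bdd: "bdd_above (Z ` {0<..1/2})"
    proof (rule bdd_aboveI2)
      fix t :: real assume t: "t \<in> {0<..1/2}"
      have "y t \<le> y 0" using ymono t by simp
      moreover have "t powr m \<le> 1" using t m by (intro powr_le1) auto
      ultimately show "Z t \<le> y 0 * 1" unfolding Z_def using y0 by (intro mult_mono) auto
    qed
    have ZQ: "Z t \<le> Q" if "t \<in> {0<..1/2}" for t unfolding Q_def by (rule cSUP_upper[OF that bdd])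
    have "Z (1/2) > 0" unfolding Z_def using yt[of "1/2"] by simp
    then have Qpos: "Q > 0" using ZQ[of "1/2"] by simp
    \<comment> \<open>Since \<open>\<beta> < 1\<close>, a self-bound of this kind limits the finite
      number Q by \<open>c1\<close> and \<open>Bf N1\<close> alone, whatever the measure of
      \<open>S\<close>.\<close>
    have "Q \<le> c1 * Bf N1 * Q powr \<beta>" unfolding Q_def
    proof (rule cSUP_least)
      fix t :: real assume t: "t \<in> {0<..1/2}"
      then have t2: "0 < t" "0 < t / 2" "t / 2 < t" "t < 1" "t / 2 \<in> {0<..1/2}" by auto
      have "y t * (t - t / 2)\<^sup>2 \<le> E * Bf N1 * y (t / 2) powr (1 + \<alpha> e1)"
        by (rule step[OF sol1 N(1) t2(2,3,4)])
      then have "y t * t\<^sup>2 \<le> 4 * E * Bf N1 * y (t / 2) powr \<beta>"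
        unfolding \<beta>_def by (simp add: power2_eq_square)
      also have "\<dots> \<le> 4 * E * Bf N1 * (Q powr \<beta> * (2 powr (m * \<beta>) * t powr (- m * \<beta>)))"
      proof -
        have "y (t / 2) * (t / 2) powr m \<le> Q" using ZQ[OF t2(5)] unfolding Z_def .
        then have "y (t / 2) \<le> Q * (t / 2) powr (- m)" using t2 by (simp add: powr_minus field_simps)
        then have "y (t / 2) powr \<beta> \<le> (Q * (t / 2) powr (- m)) powr \<beta>" using \<beta> y0 by (intro powr_mono2) auto
        also have "\<dots> = Q powr \<beta> * (t / 2) powr (- m * \<beta>)" using Qpos by (simp add: powr_mult powr_powr)
        also have "(t / 2) powr (- m * \<beta>) = 2 powr (m * \<beta>) * t powr (- m * \<beta>)"
          using t2 by (simp add: powr_divide powr_minus field_simps)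
        finally show ?thesis using E Bp by (intro mult_left_mono) auto
      qed
      finally have "y t * t\<^sup>2 * t powr (m * \<beta>) \<le> 4 * E * Bf N1 * (Q powr \<beta> * (2 powr (m * \<beta>) * t powr (- m * \<beta>))) * t powr (m * \<beta>)"
        by (rule mult_right_mono) simp
      also have "\<dots> = c1 * Bf N1 * Q powr \<beta>" unfolding c1_def using t2 by (simp add: powr_minus field_simps)
      also have "y t * t\<^sup>2 * t powr (m * \<beta>) = Z t"
      proof -
        have "m = 2 + m * \<beta>" unfolding m_def using \<beta> by (simp add: field_simps)
        then have "t powr m = t powr 2 * t powr (m * \<beta>)" by (metis powr_add)
        then show ?thesis unfolding Z_def using t2 by (simp add: powr_numeral)
      qed
      finally show "Z t \<le> c1 * Bf N1 * (SUP t\<in>{0<..1/2}. Z t) powr \<beta>" unfolding Q_def .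
    qed simp
    then have "Q powr (1 - \<beta>) \<le> c1 * Bf N1" using Qpos by (simp add: powr_diff field_simps)
    then have "(Q powr (1 - \<beta>)) powr a \<le> (c1 * Bf N1) powr a" using ab by (intro powr_mono2) auto
    then have QB: "Q \<le> c1 powr a * Bf N1 powr a"
      unfolding a_def using \<beta> Qpos c1 Bp by (simp add: powr_powr powr_mult)
    have half: "y (1/2) \<le> 2 powr m * (c1 powr a * Bf N1 powr a)"
    proof -
      have "y (1/2) * (1/2) powr m \<le> Q" using ZQ[of "1/2"] unfolding Z_def by simp
      then have "y (1/2) \<le> 2 powr m * Q" by (simp add: powr_divide field_simps)
      also have "\<dots> \<le> 2 powr m * (c1 powr a * Bf N1 powr a)" using QB by (intro mult_left_mono) auto
      finally show ?thesis .
    qed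
    \<comment> \<open>Were y(1/2) below the threshold of fast decay, the measures at levels rising
      from 1/2 to 3/4 would tend to 0, contradicting that the maximum k0 + s is attained and u is
      continuous.\<close>
    have big: "y (1/2) > (c2 * Bf N2) powr (- 1 / \<alpha> e2) * 4 powr (- 1 / (\<alpha> e2)\<^sup>2)"
    proof (rule ccontr)
      assume ns: "\<not> ?thesis"
      define t where "t = (\<lambda>j::nat. 3 / 4 - (1 / 4) * (1/2::real) ^ j)"
      have tj: "0 < t j" "t j < t (Suc j)" "t j < 1" "t j \<le> 3/4" "t (Suc j) - t j = (1/2) ^ j / 8" for j
      proof -
        define z where "z = (1/2::real) ^ j"
        have "0 < z" "z \<le> 1" unfolding z_def by (auto simp: power_le_one)
        moreover have "t j = 3 / 4 - z / 4" "t (Suc j) = 3 / 4 - z / 8" unfolding t_def z_def by auto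
        ultimately show "0 < t j" "t j < t (Suc j)" "t j < 1" "t j \<le> 3/4" "t (Suc j) - t j = (1/2) ^ j / 8"
          unfolding z_def[symmetric] by linarith+
      qed
      have "(\<lambda>j. y (t j)) \<longlonglongrightarrow> 0"
      proof (rule fast_geometric_decay[of "c2 * Bf N2" 4 "\<alpha> e2"])
        show "c2 * Bf N2 > 0" using c2 Bp by simp
        show "\<alpha> e2 > 0" by fact
        show "y (t j) \<ge> 0" for j by (rule y0)
        show "y (t (Suc j)) \<le> c2 * Bf N2 * 4 powr (real j) * y (t j) powr (1 + \<alpha> e2)" for j
        proof -
          have "y (t (Suc j)) * ((1/2) ^ j / 8)\<^sup>2 \<le> E * Bf N2 * y (t j) powr (1 + \<alpha> e2)"
            using step[OF sol2 N(2) tj(1)[of j] tj(2)[of j] tj(3)[of "Suc j"]] unfolding tj(5) .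
          moreover have "((1/2::real) ^ j / 8)\<^sup>2 = 1 / (64 * 4 powr (real j))"
            by (simp add: powr_realpow power_divide power_one_over power_mult[symmetric] mult.commute[of j] power_mult)
          ultimately have "y (t (Suc j)) / (64 * 4 powr (real j)) \<le> E * Bf N2 * y (t j) powr (1 + \<alpha> e2)" by simp
          then show ?thesis unfolding c2_def by (subst (asm) pos_divide_le_eq) (auto simp: mult_ac)
        qed
        show "y (t 0) \<le> (c2 * Bf N2) powr (- 1 / \<alpha> e2) * 4 powr (- 1 / (\<alpha> e2)\<^sup>2)"
          using ns unfolding t_def by simp
      qed simp
      then have "y (3/4) \<le> 0" using ymono[OF tj(4)] by (intro LIMSEQ_le_const) auto
      then show False using yt[of "3/4"] by simp
    qed
    \<comment> \<open>Comparing the upper bound for y(1/2) obtained from \<open>e1\<close> with the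
      lower bound obtained from \<open>e2\<close> eliminates y(1/2).\<close>
    define W where "W = Bf N1 powr a * Bf N2 powr b"
    have "(c2 * Bf N2) powr (- b) * 4 powr (- 1 / (\<alpha> e2)\<^sup>2) \<le> 2 powr m * (c1 powr a * Bf N1 powr a)"
      using big half unfolding b_def by simp
    then have "((c2 * Bf N2) powr (- b) * 4 powr (- 1 / (\<alpha> e2)\<^sup>2)) * (2 powr (- m) * c1 powr (- a) * Bf N2 powr b)
        \<le> (2 powr m * (c1 powr a * Bf N1 powr a)) * (2 powr (- m) * c1 powr (- a) * Bf N2 powr b)"
      by (rule mult_right_mono) simp
    also have "(2 powr m * (c1 powr a * Bf N1 powr a)) * (2 powr (- m) * c1 powr (- a) * Bf N2 powr b) = W"
      unfolding W_def using c1 by (simp add: powr_minus field_simps)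
    also have "((c2 * Bf N2) powr (- b) * 4 powr (- 1 / (\<alpha> e2)\<^sup>2)) * (2 powr (- m) * c1 powr (- a) * Bf N2 powr b) = c"
    proof -
      have "Bf N2 powr (- b) * Bf N2 powr b = 1" using Bp by (simp add: powr_minus)
      moreover have "(c2 * Bf N2) powr (- b) = c2 powr (- b) * Bf N2 powr (- b)" by (rule powr_mult)
      ultimately show ?thesis unfolding c_def by (simp add: mult_ac)
    qed
    also have "W = (N1 * s powr (1 - p)) powr (a / p) * (N2 * s powr (1 - p)) powr (b / p)"
      unfolding W_def Bf_def by (simp add: powr_powr)
    finally show "c \<le> (N1 * s powr (1 - p)) powr (a / p) * (N2 * s powr (1 - p)) powr (b / p)" .
  qed
qed

section \<open>Limits at infinity and their rate\<close>

subsection \<open>Behaviour at infinity from Harnack's inequality and the maximum principle\<close>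

text \<open>Harnack's inequality and the maximum principle are abstract hypotheses, so that
  pointwise decay and integrability of the right-hand side share the argument. \<open>m\<close> is
  the limit inferior, written as the supremum of the eventual lower bounds; it is finite as soon as
  u does not tend to +\<infinity>. \<open>R0\<close> must not depend on \<open>R2\<close>, since the
  outer sphere is chosen after x.\<close>

lemma limit_or_top:
  fixes u :: "'a::euclidean_space \<Rightarrow> real"
  assumes C: "C \<ge> 1"
    and harnack: "\<And>R c x y. \<lbrakk>R \<ge> Rh; \<forall>x. norm x > R / 3 \<longrightarrow> u x + c \<ge> 0; norm x = R; norm y = R\<rbrakk>
       \<Longrightarrow> u x + c \<le> C * (u y + c + \<kappa> R)"
    and \<kappa>: "(\<kappa> \<longlongrightarrow> 0) at_top"
    and mp: "\<And>\<epsilon>. \<epsilon> > 0 \<Longrightarrow> \<exists>R0. \<forall>R1 R2 k x. R0 \<le> R1 \<longrightarrow> R1 < R2 \<longrightarrow>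
       (\<forall>y. norm y = R1 \<or> norm y = R2 \<longrightarrow> u y \<le> k) \<longrightarrow> R1 \<le> norm x \<longrightarrow> norm x \<le> R2 \<longrightarrow> u x \<le> k + \<epsilon>"
    and lower: "eventually (\<lambda>x. M \<le> u x) at_infinity"
  shows "(\<exists>l. (u \<longlongrightarrow> l) at_infinity) \<or> filterlim u at_top at_infinity"
proof (cases "filterlim u at_top at_infinity")
  case False
  then obtain Z where Z: "\<not> eventually (\<lambda>x. Z \<le> u x) at_infinity"
    unfolding filterlim_at_top by blast
  define m where "m = Sup {a. eventually (\<lambda>x. a \<le> u x) at_infinity}"
  let ?A = "{a. eventually (\<lambda>x. a \<le> u x) at_infinity}"
  have ne: "?A \<noteq> {}" using lower by blast
  have bdd: "bdd_above ?A"
  proof (rule bdd_aboveI[of _ Z])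
    fix a assume "a \<in> ?A"
    then have ev: "eventually (\<lambda>x. a \<le> u x) at_infinity" by simp
    show "a \<le> Z"
    proof (rule ccontr)
      assume "\<not> a \<le> Z"
      then have "eventually (\<lambda>x. Z \<le> u x) at_infinity" by (intro eventually_mono[OF ev]) simp
      then show False using Z by simp
    qed
  qed
  have low: "eventually (\<lambda>x. m - \<epsilon> \<le> u x) at_infinity" if \<epsilon>: "\<epsilon> > 0" for \<epsilon>
  proof -
    have "m - \<epsilon> < Sup ?A" using \<epsilon> unfolding m_def by simp
    then obtain a where "a \<in> ?A" "m - \<epsilon> < a"
      using less_cSup_iff[OF ne bdd, of "m - \<epsilon>"] by blast
    then show ?thesis by (auto elim!: eventually_mono)
  qed
  have freq: "\<exists>x. norm x \<ge> R \<and> u x < m + \<epsilon>" if "\<epsilon> > 0" for \<epsilon> R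
  proof (rule ccontr)
    assume "\<not> ?thesis"
    then have "eventually (\<lambda>x. m + \<epsilon> \<le> u x) at_infinity"
      unfolding eventually_at_infinity by (force simp: not_less)
    then have "m + \<epsilon> \<le> m" unfolding m_def using bdd by (intro cSup_upper) auto
    then show False using that by simp
  qed
  have "(u \<longlongrightarrow> m) at_infinity"
  proof (rule tendstoI)
    fix e :: real assume e: "e > 0"
    define \<epsilon> where "\<epsilon> = e / (4 * C)"
    have \<epsilon>: "\<epsilon> > 0" unfolding \<epsilon>_def using e C by simp
    have Ce: "3 * C * \<epsilon> < e" unfolding \<epsilon>_def using e C by simp
    obtain b where b: "\<And>x. norm x \<ge> b \<Longrightarrow> m - \<epsilon> \<le> u x"
      using low[OF \<epsilon>] unfolding eventually_at_infinity by blast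
    have "eventually (\<lambda>R. dist (\<kappa> R) 0 < \<epsilon>) at_top" using \<kappa> \<epsilon> by (rule tendstoD)
    then obtain b1 where b1: "\<And>R. R \<ge> b1 \<Longrightarrow> \<bar>\<kappa> R\<bar> < \<epsilon>"
      unfolding eventually_at_top_linorder by auto
    obtain R0 where R0: "\<And>R1 R2 k x. R0 \<le> R1 \<Longrightarrow> R1 < R2 \<Longrightarrow>
       (\<forall>y. norm y = R1 \<or> norm y = R2 \<longrightarrow> u y \<le> k) \<Longrightarrow> R1 \<le> norm x \<Longrightarrow> norm x \<le> R2 \<Longrightarrow> u x \<le> k + \<epsilon>"
      using mp[OF \<epsilon>] by blast
    \<comment> \<open>Harnack's inequality is applied to u - (m - \<epsilon>) on a sphere through a
      point where this function is below 2\<epsilon>; the error \<kappa> adds a third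
      \<epsilon>.\<close>
    define k where "k = m - \<epsilon> + C * (3 * \<epsilon>)"
    have sphere: "u y \<le> k" if "norm x \<ge> 3 * b" "norm x \<ge> b1" "norm x \<ge> Rh" "u x < m + \<epsilon>" "norm y = norm x" for x y
    proof -
      have "\<forall>x'. norm x' > norm x / 3 \<longrightarrow> u x' + (- (m - \<epsilon>)) \<ge> 0"
      proof (intro allI impI)
        fix x' :: 'a assume "norm x' > norm x / 3"
        then have "norm x' \<ge> b" using that(1) by linarith
        then show "u x' + (- (m - \<epsilon>)) \<ge> 0" using b[of x'] by simp
      qed
      from harnack[OF that(3) this that(5) refl]
      have "u y + (- (m - \<epsilon>)) \<le> C * (u x + (- (m - \<epsilon>)) + \<kappa> (norm x))" .
      also have "\<dots> \<le> C * (3 * \<epsilon>)"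
        using b1[OF that(2)] that(4) C by (intro mult_left_mono) auto
      finally show ?thesis unfolding k_def by simp
    qed
    define r where "r = max (max (3 * b) b1) (max Rh R0)"
    obtain x1 where x1: "norm x1 \<ge> r" "u x1 < m + \<epsilon>" using freq[OF \<epsilon>] by blast
    have up: "u x \<le> k + \<epsilon>" if x: "norm x \<ge> norm x1" for x
    proof -
      obtain x2 where x2: "norm x2 \<ge> norm x + 1" "u x2 < m + \<epsilon>" using freq[OF \<epsilon>] by blast
      show ?thesis
      proof (rule R0[of "norm x1" "norm x2"])
        show "R0 \<le> norm x1" using x1 unfolding r_def by simp
        show "norm x1 < norm x2" "norm x \<le> norm x2" "norm x1 \<le> norm x" using x x2 by auto
        show "\<forall>y. norm y = norm x1 \<or> norm y = norm x2 \<longrightarrow> u y \<le> k"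
          using sphere[of x1] sphere[of x2] x1 x2 x unfolding r_def by auto
      qed
    qed
    show "eventually (\<lambda>x. dist (u x) m < e) at_infinity"
      unfolding eventually_at_infinity
    proof (intro exI allI impI)
      fix x :: 'a assume x: "max (norm x1) b \<le> norm x"
      have "u x \<le> m + 3 * C * \<epsilon>" using up[of x] x unfolding k_def by (simp add: algebra_simps)
      moreover have "m - \<epsilon> \<le> u x" using b x by simp
      moreover have "1 * \<epsilon> \<le> 3 * C * \<epsilon>" using C \<epsilon> by (intro mult_right_mono) auto
      ultimately show "dist (u x) m < e" using Ce by (simp add: dist_real_def abs_less_iff)
    qed
  qed
  then show ?thesis by blast
qed simp

text \<open>Applying Harnack's inequality to the distances of \<open>u\<close> from its infimum and from its supremum
  shows that the oscillation contracts when the radius is tripled.\<close>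

lemma oscillation_contraction:
  fixes u :: "'a::euclidean_space \<Rightarrow> real"
  assumes C: "C \<ge> 1"
    and H: "\<And>c x y. \<lbrakk>\<forall>x. norm x > R / 3 \<longrightarrow> u x + c \<ge> 0; norm x = R; norm y = R\<rbrakk> \<Longrightarrow> u x + c \<le> C * (u y + c + \<kappa>)"
    and H': "\<And>c x y. \<lbrakk>\<forall>x. norm x > R / 3 \<longrightarrow> - u x + c \<ge> 0; norm x = R; norm y = R\<rbrakk> \<Longrightarrow> - u x + c \<le> C * (- u y + c + \<kappa>)"
    and M: "\<And>k x. \<lbrakk>\<forall>y. norm y = R \<longrightarrow> u y \<le> k; R \<le> norm x\<rbrakk> \<Longrightarrow> u x \<le> k + \<kappa>"
    and M': "\<And>k x. \<lbrakk>\<forall>y. norm y = R \<longrightarrow> - u y \<le> k; R \<le> norm x\<rbrakk> \<Longrightarrow> - u x \<le> k + \<kappa>"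
    and \<kappa>: "\<kappa> \<ge> 0" and R: "R > 0"
    and w: "\<forall>x y. norm x \<ge> R / 3 \<longrightarrow> norm y \<ge> R / 3 \<longrightarrow> u x - u y \<le> w"
    and x: "norm x \<ge> R" and y: "norm y \<ge> R"
  shows "u x - u y \<le> (C - 1) / (C + 1) * w + 4 * \<kappa>"
proof -
  let ?U = "u ` {x. norm x \<ge> R / 3}"
  define m where "m = Inf ?U"
  define M0 where "M0 = Sup ?U"
  have ne: "?U \<noteq> {}" using x R by (auto intro!: exI[of _ x])
  have bb: "bdd_below ?U" 
    by (rule bdd_belowI[of _ "u x - w"]) (use w x R in \<open>auto simp: algebra_simps\<close>)
  have ba: "bdd_above ?U"
    by (rule bdd_aboveI[of _ "u x + w"]) (use w x R in \<open>auto simp: algebra_simps\<close>)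
  have mle: "m \<le> u z" and leM: "u z \<le> M0" if "norm z \<ge> R / 3" for z
    unfolding m_def M0_def using bb ba that by (auto intro: cInf_lower cSup_upper)
  have "M0 \<le> m + w"
    unfolding M0_def
  proof (rule cSup_least[OF ne])
    fix a assume "a \<in> ?U"
    then obtain z where z: "a = u z" "norm z \<ge> R / 3" by auto
    have "a - w \<le> m" unfolding m_def
      by (rule cInf_greatest[OF ne]) (use w z in \<open>auto simp: algebra_simps\<close>)
    then show "a \<le> m + w" by simp
  qed
  then have Mm: "M0 - m \<le> w" by simp
  let ?\<theta> = "(C - 1) / (C + 1)"
  have sph: "u a - u b \<le> ?\<theta> * w + 2 * \<kappa>" if "norm a = R" "norm b = R" for a b
  proof -
    have "u a + (- m) \<le> C * (u b + (- m) + \<kappa>)" using mle that by (intro H) auto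
    moreover have "- u b + M0 \<le> C * (- u a + M0 + \<kappa>)" using leM that by (intro H') auto
    \<comment> \<open>Adding the two inequalities puts the oscillation on the sphere on the left
      with factor C + 1. Passing from the sphere to its exterior later costs one further \<kappa>
      for each of the two points.\<close>
    ultimately have "(C + 1) * (u a - u b) \<le> (C - 1) * (M0 - m) + 2 * C * \<kappa>"
      by (simp add: algebra_simps)
    also have "\<dots> \<le> (C - 1) * w + 2 * (C + 1) * \<kappa>"
      using Mm C \<kappa> by (intro add_mono mult_left_mono mult_right_mono) auto
    finally have "u a - u b \<le> ((C - 1) * w + 2 * (C + 1) * \<kappa>) / (C + 1)"
      using C by (simp add: field_simps)
    also have "\<dots> = ?\<theta> * w + 2 * \<kappa>" using C by (simp add: field_simps)
    finally show ?thesis .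
  qed
  have 1: "u x \<le> u b + ?\<theta> * w + 3 * \<kappa>" if "norm b = R" for b
  proof -
    have "\<forall>a. norm a = R \<longrightarrow> u a \<le> u b + ?\<theta> * w + 2 * \<kappa>" using sph that by (force simp: algebra_simps)
    from M[OF this x] show ?thesis by simp
  qed
  have "\<forall>b. norm b = R \<longrightarrow> - u b \<le> - u x + ?\<theta> * w + 3 * \<kappa>" using 1 by force
  from M'[OF this y] show ?thesis by simp
qed

text \<open>The contraction is iterated over the radii 3^j R0. The ratio \<sigma> lies strictly
  above the contraction factor \<theta> to leave room for the error, and it is at least 3^(-b) so
  that the error, of order 3^(-bj), decays no more slowly than \<sigma>^j.\<close>

lemma oscillation_rate:
  fixes u :: "'a::euclidean_space \<Rightarrow> real"
  assumes C: "C \<ge> 1" and R0: "R0 > 0" and b: "b > 0" and B: "B \<ge> 0"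
    and H: "\<And>R c x y. \<lbrakk>R \<ge> 3 * R0; \<forall>x. norm x > R / 3 \<longrightarrow> u x + c \<ge> 0; norm x = R; norm y = R\<rbrakk>
        \<Longrightarrow> u x + c \<le> C * (u y + c + B * R powr (- b))"
    and H': "\<And>R c x y. \<lbrakk>R \<ge> 3 * R0; \<forall>x. norm x > R / 3 \<longrightarrow> - u x + c \<ge> 0; norm x = R; norm y = R\<rbrakk>
        \<Longrightarrow> - u x + c \<le> C * (- u y + c + B * R powr (- b))"
    and M: "\<And>R k x. \<lbrakk>R \<ge> R0; \<forall>y. norm y = R \<longrightarrow> u y \<le> k; R \<le> norm x\<rbrakk> \<Longrightarrow> u x \<le> k + B * R powr (- b)"
    and M': "\<And>R k x. \<lbrakk>R \<ge> R0; \<forall>y. norm y = R \<longrightarrow> - u y \<le> k; R \<le> norm x\<rbrakk> \<Longrightarrow> - u x \<le> k + B * R powr (- b)"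
    and bdd: "\<And>x. norm x \<ge> R0 \<Longrightarrow> \<bar>u x\<bar> \<le> M0"
    and l: "(u \<longlongrightarrow> l) at_infinity"
  shows "\<exists>C \<beta>. C > 0 \<and> \<beta> > 0 \<and> (\<forall>\<^sub>F x in at_infinity. \<bar>l - u x\<bar> < C * norm x powr (- \<beta>))"
proof -
  define \<theta> where "\<theta> = (C - 1) / (C + 1)"
  have \<theta>: "0 \<le> \<theta>" "\<theta> < 1" unfolding \<theta>_def using C by auto
  define \<sigma> where "\<sigma> = max ((1 + \<theta>) / 2) (3 powr (- b))"
  have \<sigma>: "0 < \<sigma>" "\<sigma> < 1" "\<theta> < \<sigma>" "3 powr (- b) \<le> \<sigma>"
  proof -
    show "\<theta> < \<sigma>" "3 powr (- b) \<le> \<sigma>" unfolding \<sigma>_def using \<theta> by (auto simp: less_max_iff_disj)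
    then show "0 < \<sigma>" using \<theta> by simp
    have "3 powr (- b) < (1::real)" using b by (intro powr_less_one) auto
    then show "\<sigma> < 1" unfolding \<sigma>_def using \<theta> by simp
  qed
  define B' where "B' = 4 * B * R0 powr (- b)"
  have B': "B' \<ge> 0" unfolding B'_def using B by simp
  \<comment> \<open>The condition W (\<sigma> - \<theta>) \<ge> B' closes the induction: \<theta> W
    \<sigma>^j + B' \<sigma>^j \<le> W \<sigma>^(j+1). The term 2|M0| serves its start.\<close>
  define W where "W = 2 * \<bar>M0\<bar> + B' / (\<sigma> - \<theta>) + 1"
  have W: "W > 0" "W \<ge> 2 * \<bar>M0\<bar>" "W * (\<sigma> - \<theta>) \<ge> B'"
  proof -
    have q: "B' / (\<sigma> - \<theta>) \<ge> 0" using B' \<sigma> by simp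
    then show "W > 0" "W \<ge> 2 * \<bar>M0\<bar>" unfolding W_def by auto
    have "W \<ge> B' / (\<sigma> - \<theta>)" unfolding W_def by simp
    then show "W * (\<sigma> - \<theta>) \<ge> B'" using \<sigma> by (simp add: field_simps)
  qed
  have osc: "\<forall>x y. norm x \<ge> 3 ^ j * R0 \<longrightarrow> norm y \<ge> 3 ^ j * R0 \<longrightarrow> u x - u y \<le> W * \<sigma> ^ j" for j
  proof (induction j)
    case 0
    show ?case
    proof (intro allI impI)
      fix x y :: 'a assume "norm x \<ge> 3 ^ 0 * R0" "norm y \<ge> 3 ^ 0 * R0"
      then have "\<bar>u x\<bar> \<le> M0" "\<bar>u y\<bar> \<le> M0" using bdd by auto
      then show "u x - u y \<le> W * \<sigma> ^ 0" using W(2) by simp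
    qed
  next
    case (Suc j)
    define R where "R = 3 ^ Suc j * R0"
    have RR: "R > 0" "R \<ge> 3 * R0" "R \<ge> R0" "R / 3 = 3 ^ j * R0"
    proof -
      have "1 * R0 \<le> 3 ^ j * R0" using R0 by (intro mult_right_mono) auto
      moreover have "R = 3 * (3 ^ j * R0)" unfolding R_def by simp
      ultimately show "R > 0" "R \<ge> 3 * R0" "R \<ge> R0" "R / 3 = 3 ^ j * R0" using R0 by linarith+
    qed
    have \<kappa>b: "4 * (B * R powr (- b)) \<le> B' * \<sigma> ^ j"
    proof -
      have "R powr (- b) = (3 powr (- b)) ^ Suc j * R0 powr (- b)"
      proof -
        have 1: "(3::real) ^ Suc j = 3 powr real (Suc j)" by (rule powr_realpow[symmetric]) simp
        have 2: "(3 powr (- b)) ^ Suc j = (3 powr (- b)) powr real (Suc j)" by (rule powr_realpow[symmetric]) simp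
        show ?thesis unfolding R_def powr_mult 1 2 powr_powr by (simp only: mult.commute)
      qed
      also have "(3 powr (- b)) ^ Suc j \<le> \<sigma> ^ Suc j" using \<sigma> by (intro power_mono) auto
      also have "\<sigma> ^ Suc j \<le> \<sigma> ^ j" using \<sigma> by (intro power_decreasing) auto
      finally have "R powr (- b) \<le> \<sigma> ^ j * R0 powr (- b)" by (simp add: mult_right_mono)
      then have "4 * (B * R powr (- b)) \<le> 4 * (B * (\<sigma> ^ j * R0 powr (- b)))" using B by (intro mult_left_mono) auto
      then show ?thesis unfolding B'_def by (simp add: mult_ac)
    qed
    show ?case
    proof (intro allI impI)
      fix x y :: 'a assume xy: "norm x \<ge> 3 ^ Suc j * R0" "norm y \<ge> 3 ^ Suc j * R0"
      have "u x - u y \<le> (C - 1) / (C + 1) * (W * \<sigma> ^ j) + 4 * (B * R powr (- b))"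
        by (rule oscillation_contraction[OF C H[OF RR(2)] H'[OF RR(2)] M[OF RR(3)] M'[OF RR(3)] _ RR(1)])
          (use B Suc.IH RR xy in \<open>auto simp: R_def\<close>)
      also have "\<dots> \<le> \<theta> * (W * \<sigma> ^ j) + (W * (\<sigma> - \<theta>)) * \<sigma> ^ j"
      proof -
        have "B' * \<sigma> ^ j \<le> (W * (\<sigma> - \<theta>)) * \<sigma> ^ j" using W(3) \<sigma> by (intro mult_right_mono) auto
        then show ?thesis unfolding \<theta>_def[symmetric] using \<kappa>b by linarith
      qed
      also have "\<dots> = W * \<sigma> ^ Suc j" by (simp add: algebra_simps)
      finally show "u x - u y \<le> W * \<sigma> ^ Suc j" .
    qed
  qed
  \<comment> \<open>Chosen with \<sigma> = 3^(-\<beta>), which translates \<sigma>^j into a power of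
    the radius 3^j R0.\<close>
  define \<beta> where "\<beta> = - ln \<sigma> / ln 3"
  have \<beta>: "\<beta> > 0" unfolding \<beta>_def using \<sigma> by (simp add: divide_neg_pos)
  have \<sigma>\<beta>: "\<sigma> = 3 powr (- \<beta>)" unfolding \<beta>_def powr_def using \<sigma> by simp
  have "\<forall>\<^sub>F x in at_infinity. \<bar>l - u x\<bar> < (W * (3 * R0) powr \<beta> + 1) * norm x powr (- \<beta>)"
    unfolding eventually_at_infinity
  proof (intro exI allI impI)
    fix x :: 'a assume x: "R0 \<le> norm x"
    define j where "j = nat \<lfloor>log 3 (norm x / R0)\<rfloor>"
    have x1: "norm x / R0 \<ge> 1" using x R0 by simp
    then have lg: "log 3 (norm x / R0) \<ge> 0" by simp
    have j1: "real j \<le> log 3 (norm x / R0)" "log 3 (norm x / R0) < real j + 1"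
      unfolding j_def using lg by linarith+
    have "3 powr (real j) \<le> norm x / R0" using j1(1) x1 by (simp add: le_log_iff)
    then have jx: "3 ^ j * R0 \<le> norm x" using R0 by (simp add: powr_realpow field_simps)
    have "norm x / R0 < 3 powr (real j + 1)" using j1(2) x1 by (simp add: log_less_iff)
    then have jx': "norm x / (3 * R0) \<le> 3 powr (real j)" using R0 by (simp add: powr_add field_simps)
    have np: "norm x > 0" using x R0 by linarith
    have "\<bar>l - u x\<bar> \<le> W * \<sigma> ^ j"
    proof -
      have "eventually (\<lambda>y. norm y \<ge> 3 ^ j * R0) at_infinity" unfolding eventually_at_infinity by blast
      then have e: "eventually (\<lambda>y. \<bar>u y - u x\<bar> \<le> W * \<sigma> ^ j) at_infinity"
        by (rule eventually_mono) (use osc[of j] jx in \<open>auto simp: abs_le_iff\<close>)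
      have "((\<lambda>y. \<bar>u y - u x\<bar>) \<longlongrightarrow> \<bar>l - u x\<bar>) at_infinity" using l by (intro tendsto_intros)
      then show ?thesis using e by (rule tendsto_upperbound) (rule trivial_limit_at_infinity)
    qed
    also have "\<sigma> ^ j = (3 powr (real j)) powr (- \<beta>)"
      unfolding \<sigma>\<beta> by (simp add: powr_realpow[symmetric] powr_powr mult.commute)
    also have "\<dots> \<le> (norm x / (3 * R0)) powr (- \<beta>)"
      using jx' np R0 \<beta> by (intro powr_mono2') auto
    also have "\<dots> = (3 * R0) powr \<beta> * norm x powr (- \<beta>)"
      using np R0 by (simp add: powr_divide powr_minus field_simps)
    finally have "\<bar>l - u x\<bar> \<le> (W * (3 * R0) powr \<beta>) * norm x powr (- \<beta>)" using W by (simp add: mult.assoc mult_left_mono)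
    also have "\<dots> < (W * (3 * R0) powr \<beta> + 1) * norm x powr (- \<beta>)"
      using np by (intro mult_strict_right_mono) auto
    finally show "\<bar>l - u x\<bar> < (W * (3 * R0) powr \<beta> + 1) * norm x powr (- \<beta>)" .
  qed
  moreover have "W * (3 * R0) powr \<beta> + 1 > 0" using W by (intro add_nonneg_pos) auto
  ultimately show ?thesis using \<beta> by blast
qed

lemma max_principle_eventually:
  fixes u :: "'a::euclidean_space \<Rightarrow> real"
  assumes B: "\<And>R1 R2 k x. \<lbrakk>R0 \<le> R1; R1 < R2; \<forall>y. norm y = R1 \<or> norm y = R2 \<longrightarrow> u y \<le> k;
     R1 \<le> norm x; norm x \<le> R2\<rbrakk> \<Longrightarrow> u x \<le> k + B * R1 powr (- b)" and b: "b > 0" and \<epsilon>: "\<epsilon> > 0"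
  shows "\<exists>R0. \<forall>R1 R2 k x. R0 \<le> R1 \<longrightarrow> R1 < R2 \<longrightarrow>
       (\<forall>y. norm y = R1 \<or> norm y = R2 \<longrightarrow> u y \<le> k) \<longrightarrow> R1 \<le> norm x \<longrightarrow> norm x \<le> R2 \<longrightarrow> u x \<le> k + \<epsilon>"
proof -
  have "((\<lambda>R. B * R powr (- b)) \<longlongrightarrow> B * 0) at_top"
    using b by (intro tendsto_mult tendsto_const tendsto_neg_powr filterlim_ident) auto
  then have "eventually (\<lambda>R. B * R powr (- b) < \<epsilon>) at_top" using \<epsilon> by (intro order_tendstoD(2)) auto
  then obtain R' where R': "\<And>R. R \<ge> R' \<Longrightarrow> B * R powr (- b) < \<epsilon>"
    unfolding eventually_at_top_linorder by blast
  show ?thesis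
  proof (intro exI[of _ "max R0 R'"] allI impI)
    fix R1 R2 k and x :: 'a assume h: "max R0 R' \<le> R1" "R1 < R2" "\<forall>y. norm y = R1 \<or> norm y = R2 \<longrightarrow> u y \<le> k"
      "R1 \<le> norm x" "norm x \<le> R2"
    have "u x \<le> k + B * R1 powr (- b)" using h by (intro B) auto
    moreover have "B * R1 powr (- b) < \<epsilon>" using R' h by simp
    ultimately show "u x \<le> k + \<epsilon>" by linarith
  qed
qed

subsection \<open>Right-hand sides with pointwise decay\<close>

lemma Lp_norm_on_nonneg: "Lp_norm_on s S g \<ge> 0"
  unfolding Lp_norm_on_def by simp

lemma decay_D_uminus: "decay_D p (\<lambda>x. - f x) = decay_D p f"
  unfolding decay_D_def by simp

context exterior_solution
begin

text \<open>Halving \<epsilon> in the case p + \<epsilon> = n avoids the resonant exponent q = n,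
  for which the barrier's coefficient Cf/(q - n) makes no sense; outside the unit ball the weaker
  decay is implied.\<close>

lemma decay_D_obtain:
  assumes "decay_D p f"
  obtains Cf q R0 where "Cf > 0" "q > p" "q \<noteq> DIM('a)" "R0 > 1"
    "\<And>x. norm x \<ge> R0 \<Longrightarrow> \<bar>f x\<bar> \<le> Cf * norm x powr (- q)"
proof -
  obtain Cf \<epsilon> R where D: "Cf > 0" "\<epsilon> > 0" "\<And>x. norm x \<ge> R \<Longrightarrow> \<bar>f x\<bar> \<le> Cf * norm x powr (- (p + \<epsilon>))"
    using assms unfolding decay_D_def by blast
  define \<epsilon>' where "\<epsilon>' = (if p + \<epsilon> = real DIM('a) then \<epsilon> / 2 else \<epsilon>)"
  have \<epsilon>': "0 < \<epsilon>'" "\<epsilon>' \<le> \<epsilon>" "p + \<epsilon>' \<noteq> real DIM('a)" unfolding \<epsilon>'_def using D(2) by auto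
  show thesis
  proof (rule that[of Cf "p + \<epsilon>'" "max R 2"])
    fix x :: 'a assume x: "norm x \<ge> max R 2"
    have "\<bar>f x\<bar> \<le> Cf * norm x powr (- (p + \<epsilon>))" using D(3) x by simp
    also have "\<dots> \<le> Cf * norm x powr (- (p + \<epsilon>'))"
      using x \<epsilon>' D(1) by (intro mult_left_mono powr_mono) auto
    finally show "\<bar>f x\<bar> \<le> Cf * norm x powr (- (p + \<epsilon>'))" .
  qed (use D \<epsilon>' in auto)
qed

lemma harnack_decay:
  assumes dim: "DIM('a) \<ge> 2" and Cf: "Cf > 0" and q: "q > p" and R0: "R0 > 1"
    and f: "\<And>x. norm x \<ge> R0 \<Longrightarrow> \<bar>f x\<bar> \<le> Cf * norm x powr (- q)"
  obtains C B where "C \<ge> 1" "B > 0"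
    "\<And>R c x y. \<lbrakk>R \<ge> 3 * R0; \<forall>x. norm x > R / 3 \<longrightarrow> u x + c \<ge> 0; norm x = R; norm y = R\<rbrakk>
        \<Longrightarrow> u x + c \<le> C * (u y + c + B * R powr (- beta q))"
proof -
  interpret D: DG_exponents "TYPE('a)" p \<delta> L 1 "real DIM('a)" "ubvol TYPE('a)"
    using p \<delta> L by unfold_locales auto
  have \<gamma>: "D.\<gamma> = p" unfolding D.\<gamma>_def by simp
  obtain C where C: "C \<ge> 1" and H: "\<And>N (u::'a \<Rightarrow> real) G F R x y.
    \<lbrakk>DGsol p \<delta> L 1 N {x. norm x > R / 3} u G F; R > 0; \<forall>x. norm x > R / 3 \<longrightarrow> u x \<ge> 0;
     norm x = R; norm y = R\<rbrakk> \<Longrightarrow> u x \<le> C * (u y + (N * R powr D.\<gamma>) powr (1 / (p - 1)))"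
    by (rule D.harnack_sphere[OF dim]) (rule that)
  define B where "B = (Cf * 3 powr q) powr (1 / (p - 1))"
  have B: "B > 0" unfolding B_def using Cf by simp
  show thesis
  proof (rule that[OF C B])
    fix R c and x y :: 'a
    assume R: "R \<ge> 3 * R0" and nn: "\<forall>x. norm x > R / 3 \<longrightarrow> u x + c \<ge> 0" and xy: "norm x = R" "norm y = R"
    have Rp: "R > 0" using R R0 by simp
    have sol: "DGsol p \<delta> L 1 (Cf * (R / 3) powr (- q)) {x. norm x > R / 3} u G (\<lambda>x. flux p A (G x))"
      by (rule DGsol_decay[OF _ Cf _ _ _ open_exterior order_refl]) (use q p R R0 f in auto)
    \<comment> \<open>The scaled right-hand side is a multiple of R^(p-q), and p - q = 1 - (q - p +
      1) is the form required by \<open>beta_exponent\<close>; the outcome is the same exponent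
      \<beta> as for the barriers.\<close>
    have e: "Cf * (R / 3) powr (- q) * R powr p = Cf * 3 powr q * R powr (1 - (q - p + 1))"
      using Rp by (simp add: powr_divide powr_minus powr_diff field_simps)
    have "(Cf * (R / 3) powr (- q) * R powr p) powr (1 / (p - 1)) = B * R powr (- 1 - beta (q - p + 1))"
      unfolding B_def e by (rule beta_exponent[OF Rp])
    also have "- 1 - beta (q - p + 1) = - beta q" unfolding beta_def using p by (simp add: field_simps)
    finally show "u x + c \<le> C * (u y + c + B * R powr (- beta q))"
      using H[OF DGsol_add[OF sol, of c] Rp nn xy] unfolding \<gamma> by simp
  qed
qed

lemma limit_or_top_decay:
  assumes dim: "DIM('a) \<ge> 2" and D: "decay_D p f" and lower: "eventually (\<lambda>x. M \<le> u x) at_infinity"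
  shows "(\<exists>l. (u \<longlongrightarrow> l) at_infinity) \<or> filterlim u at_top at_infinity"
proof -
  obtain Cf q R0 where Q: "Cf > 0" "q > p" "q \<noteq> DIM('a)" "R0 > 1"
    "\<And>x. norm x \<ge> R0 \<Longrightarrow> \<bar>f x\<bar> \<le> Cf * norm x powr (- q)"
    by (rule decay_D_obtain[OF D]) (rule that)
  obtain C B where C: "C \<ge> 1" and B: "B > 0" and H: "\<And>R c x y. \<lbrakk>R \<ge> 3 * R0; \<forall>x. norm x > R / 3 \<longrightarrow> u x + c \<ge> 0; norm x = R; norm y = R\<rbrakk>
        \<Longrightarrow> u x + c \<le> C * (u y + c + B * R powr (- beta q))"
    by (rule harnack_decay[OF dim Q(1,2,4,5)]; (assumption | rule that))
  obtain B2 where B2: "B2 > 0" and MP: "\<And>R1 R2 k x. \<lbrakk>R0 \<le> R1; R1 < R2; \<forall>y. norm y = R1 \<or> norm y = R2 \<longrightarrow> u y \<le> k;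
     R1 \<le> norm x; norm x \<le> R2\<rbrakk> \<Longrightarrow> u x \<le> k + B2 * R1 powr (- beta q)"
    by (rule max_principle_decay[OF Q(5,1,3,2,4)]; (assumption | rule that))
  note b = beta_pos[OF Q(2)]
  have \<kappa>: "((\<lambda>R. B * R powr (- beta q)) \<longlongrightarrow> 0) at_top"
  proof -
    have "((\<lambda>R. B * R powr (- beta q)) \<longlongrightarrow> B * 0) at_top"
      using b by (intro tendsto_mult tendsto_const tendsto_neg_powr filterlim_ident) auto
    then show ?thesis by simp
  qed
  show ?thesis
    by (rule limit_or_top[OF C H \<kappa> max_principle_eventually[OF MP b] lower])
qed

text \<open>The growth condition gives boundedness through the maximum principle outside the sphere
  |x| = R0, and boundedness gives a limit. The same maximum principle, having no outer sphere,
  supplies the passage from spheres to their exteriors in the oscillation argument. Solutions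
  bounded from the start are covered because P is unbounded.\<close>

lemma rate_from_growth:
  assumes dim: "DIM('a) \<ge> 2" and D: "decay_D p f" and pn: "p \<ge> DIM('a)"
    and P: "\<And>r. r > 0 \<Longrightarrow> (P has_real_derivative r powr (- (real DIM('a) - 1) / (p - 1))) (at r)"
    and P_top: "filterlim P at_top at_top"
    and growth: "\<And>\<epsilon>. \<epsilon> > 0 \<Longrightarrow> eventually (\<lambda>x. \<bar>u x\<bar> \<le> \<epsilon> * P (norm x)) at_infinity"
  shows "\<exists>l. (u \<longlongrightarrow> l) at_infinity \<and>
    (\<exists>C \<beta>. C > 0 \<and> \<beta> > 0 \<and> (\<forall>\<^sub>F x in at_infinity. \<bar>l - u x\<bar> < C * norm x powr (- \<beta>)))"
proof -
  interpret U: exterior_solution p \<delta> L A "\<lambda>x. - f x" "\<lambda>x. - u x" "\<lambda>x. - G x" by (rule exterior_uminus)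
  obtain Cf q R0 where Q: "Cf > 0" "q > p" "q \<noteq> DIM('a)" "R0 > 1"
    "\<And>x. norm x \<ge> R0 \<Longrightarrow> \<bar>f x\<bar> \<le> Cf * norm x powr (- q)"
    by (rule decay_D_obtain[OF D]) (rule that)
  have Q': "\<bar>- f x\<bar> \<le> Cf * norm x powr (- q)" if "norm x \<ge> R0" for x using Q(5)[OF that] by simp
  have qn: "q > DIM('a)" using Q(2) pn by simp
  note b = beta_pos[OF Q(2)]
  obtain C1 B1 where C1: "C1 \<ge> 1" "B1 > 0" and H1: "\<And>R c x y. \<lbrakk>R \<ge> 3 * R0; \<forall>x. norm x > R / 3 \<longrightarrow> u x + c \<ge> 0; norm x = R; norm y = R\<rbrakk>
        \<Longrightarrow> u x + c \<le> C1 * (u y + c + B1 * R powr (- beta q))"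
    by (rule harnack_decay[OF dim Q(1,2,4,5)]; (assumption | rule that))
  obtain C2 B2 where C2: "C2 \<ge> 1" "B2 > 0" and H2: "\<And>R c x y. \<lbrakk>R \<ge> 3 * R0; \<forall>x. norm x > R / 3 \<longrightarrow> - u x + c \<ge> 0; norm x = R; norm y = R\<rbrakk>
        \<Longrightarrow> - u x + c \<le> C2 * (- u y + c + B2 * R powr (- beta q))"
    by (rule U.harnack_decay[OF dim Q(1,2,4) Q']; (assumption | rule that))
  have g1: "eventually (\<lambda>x. u x \<le> \<epsilon> * P (norm x)) at_infinity" if "\<epsilon> > 0" for \<epsilon>
    using growth[OF that] by (rule eventually_mono) auto
  have g2: "eventually (\<lambda>x. - u x \<le> \<epsilon> * P (norm x)) at_infinity" if "\<epsilon> > 0" for \<epsilon>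
    using growth[OF that] by (rule eventually_mono) auto
  obtain B3 where B3: "B3 > 0" and M1: "\<And>R1 k x. \<lbrakk>R0 \<le> R1; \<forall>y. norm y = R1 \<longrightarrow> u y \<le> k; R1 \<le> norm x\<rbrakk>
     \<Longrightarrow> u x \<le> k + B3 * R1 powr (- beta q)"
    by (rule max_principle_growth[OF Q(5,1) qn Q(2,4) P P_top g1]; (assumption | rule that))
  obtain B4 where B4: "B4 > 0" and M2: "\<And>R1 k x. \<lbrakk>R0 \<le> R1; \<forall>y. norm y = R1 \<longrightarrow> - u y \<le> k; R1 \<le> norm x\<rbrakk>
     \<Longrightarrow> - u x \<le> k + B4 * R1 powr (- beta q)"
    by (rule U.max_principle_growth[OF Q' Q(1) qn Q(2,4) P P_top g2]; (assumption | rule that))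
  have "compact (u ` sphere 0 R0)"
    by (rule compact_continuous_image[OF continuous_on_subset[OF u_cont]]) (use Q(4) in auto)
  then have "bounded (u ` sphere 0 R0)" by (rule compact_imp_bounded)
  then obtain m where "\<forall>y\<in>sphere 0 R0. \<bar>u y\<bar> \<le> m" unfolding bounded_iff by auto
  then have m: "\<And>y. norm y = R0 \<Longrightarrow> \<bar>u y\<bar> \<le> m" by simp
  define M0 where "M0 = m + max B3 B4 * R0 powr (- beta q)"
  have bdd: "\<bar>u x\<bar> \<le> M0" if "norm x \<ge> R0" for x
  proof -
    have "u x \<le> m + B3 * R0 powr (- beta q)" using m that by (intro M1) (auto simp: abs_le_iff)
    moreover have "- u x \<le> m + B4 * R0 powr (- beta q)" using m that by (intro M2) (auto simp: abs_le_iff)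
    moreover have "B3 * R0 powr (- beta q) \<le> max B3 B4 * R0 powr (- beta q)"
      "B4 * R0 powr (- beta q) \<le> max B3 B4 * R0 powr (- beta q)" by (auto intro: mult_right_mono)
    ultimately show ?thesis unfolding M0_def by linarith
  qed
  have ev: "eventually (\<lambda>x. - M0 \<le> u x) at_infinity" "eventually (\<lambda>x. u x \<le> M0) at_infinity"
    unfolding eventually_at_infinity using bdd by (force simp: abs_le_iff)+
  have "\<not> filterlim u at_top (at_infinity :: 'a filter)"
  proof
    assume "filterlim u at_top (at_infinity :: 'a filter)"
    then have "eventually (\<lambda>x. M0 + 1 \<le> u x) at_infinity" unfolding filterlim_at_top by blast
    then have "eventually (\<lambda>x::'a. False) at_infinity"
      using ev(2) by eventually_elim simp
    then show False by (simp add: eventually_False trivial_limit_at_infinity)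
  qed
  then obtain l where l: "(u \<longlongrightarrow> l) at_infinity" using limit_or_top_decay[OF dim D ev(1)] by blast
  define B where "B = max (max B1 B2) (max B3 B4)"
  define C where "C = max C1 C2"
  have B: "B \<ge> 0" "B1 \<le> B" "B2 \<le> B" "B3 \<le> B" "B4 \<le> B" unfolding B_def using B3 by auto
  have C: "C \<ge> 1" "C1 \<le> C" "C2 \<le> C" unfolding C_def using C1 by auto
  have widen: "C' * (a + B' * R powr (- beta q)) \<le> C * (a + B * R powr (- beta q))"
    if "0 \<le> a" "0 \<le> C'" "0 \<le> B'" "C' \<le> C" "B' \<le> B" for C' B' a R
    using that by (intro mult_mono add_mono mult_right_mono) (auto intro!: add_nonneg_nonneg)
  have "\<exists>C \<beta>. C > 0 \<and> \<beta> > 0 \<and> (\<forall>\<^sub>F x in at_infinity. \<bar>l - u x\<bar> < C * norm x powr (- \<beta>))"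
  proof (rule oscillation_rate[OF C(1) _ b B(1) _ _ _ _ bdd l])
    show "R0 > 0" using Q(4) by simp
    fix R c and x y :: 'a assume h: "R \<ge> 3 * R0" "norm x = R" "norm y = R"
    have R: "R > 0" using h Q(4) by simp
    { assume nn: "\<forall>x. norm x > R / 3 \<longrightarrow> u x + c \<ge> 0"
      have "u y + c \<ge> 0" using nn h R by simp
      then show "u x + c \<le> C * (u y + c + B * R powr (- beta q))"
        using order_trans[OF H1[OF h(1) nn h(2,3)] widen[of "u y + c" C1 B1]] C1 C B by simp }
    { assume nn: "\<forall>x. norm x > R / 3 \<longrightarrow> - u x + c \<ge> 0"
      have "- u y + c \<ge> 0" using nn h R by simp
      then show "- u x + c \<le> C * (- u y + c + B * R powr (- beta q))"
        using order_trans[OF H2[OF h(1) nn h(2,3)] widen[of "- u y + c" C2 B2]] C2 C B by simp }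
  next
    fix R k and x :: 'a assume h: "R \<ge> R0" "R \<le> norm x"
    have le: "k + B' * R powr (- beta q) \<le> k + B * R powr (- beta q)" if "B' \<le> B" for B'
      using that by (intro add_left_mono mult_right_mono) auto
    { assume "\<forall>y. norm y = R \<longrightarrow> u y \<le> k"
      then show "u x \<le> k + B * R powr (- beta q)" using order_trans[OF M1[OF h(1) _ h(2)] le[OF B(4)]] by blast }
    { assume "\<forall>y. norm y = R \<longrightarrow> - u y \<le> k"
      then show "- u x \<le> k + B * R powr (- beta q)" using order_trans[OF M2[OF h(1) _ h(2)] le[OF B(5)]] by blast }
  qed
  then show ?thesis using l by blast
qed

subsection \<open>Integrable right-hand sides\<close>

text \<open>Hoelder's inequality with constant 2, obtained by splitting |f| at the level T =
  (J/m)^(1/s) that balances the two parts; J is the integral of |f|^s and m the measure of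
  \<open>E\<close>. For J = 0 the level is sent to 0 instead.\<close>

lemma Lp_local_bound:
  assumes Lp: "Lp_on s {x. norm x \<ge> 1} f" and s: "s \<ge> 1" and \<rho>: "\<rho> \<ge> 1"
    and E: "open E" "bounded E" "E \<subseteq> {x. norm x > \<rho>}"
  shows "(\<integral>x. indicator E x * \<bar>f x\<bar> \<partial>lebesgue)
    \<le> 2 * Lp_norm_on s {x. norm x \<ge> \<rho>} f * measure lborel E powr (1 - 1 / s)"
proof (cases "E = {}")
  case True then show ?thesis by simp
next
  case False
  let ?A = "{x::'a. norm x \<ge> \<rho>}"
  have closed: "closed {x::'a. norm x \<ge> r}" for r by (intro closed_Collect_le continuous_intros)
  then have Am: "{x::'a. norm x \<ge> r} \<inter> space lebesgue \<in> sets lebesgue" for r by simp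
  have fE: "emeasure lborel E < \<infinity>" using emeasure_bounded_finite[OF E(2)] .
  define m where "m = measure lborel E"
  have m: "m > 0" unfolding m_def by (rule measure_open_pos[OF E(1) False fE])
  define J where "J = (\<integral>x. indicator ?A x * \<bar>f x\<bar> powr s \<partial>lebesgue)"
  have J0: "J \<ge> 0" unfolding J_def by (intro integral_nonneg_AE) auto
  have norm: "Lp_norm_on s ?A f = J powr (1 / s)"
    unfolding Lp_norm_on_def J_def using integral_restrict_space[OF Am, of \<rho> "\<lambda>x. \<bar>f x\<bar> powr s"] by simp
  have "integrable lebesgue (\<lambda>x. indicator {x. norm x \<ge> 1} x *\<^sub>R \<bar>f x\<bar> powr s)"
    using Lp integrable_restrict_space[OF Am, of 1 "\<lambda>x. \<bar>f x\<bar> powr s"] unfolding Lp_on_def by blast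
  then have "integrable lebesgue (\<lambda>x. indicator ?A x *\<^sub>R (indicator {x. norm x \<ge> 1} x *\<^sub>R \<bar>f x\<bar> powr s))"
    by (rule integrable_mult_indicator[rotated]) (use closed in auto)
  moreover have "(\<lambda>x. indicator ?A x *\<^sub>R (indicator {x. norm x \<ge> 1} x *\<^sub>R \<bar>f x\<bar> powr s)) = (\<lambda>x. indicator ?A x * \<bar>f x\<bar> powr s)"
    using \<rho> by (auto simp: indicator_def fun_eq_iff)
  ultimately have Ji: "integrable lebesgue (\<lambda>x. indicator ?A x * \<bar>f x\<bar> powr s)" by simp
  have Ei: "integrable lebesgue (indicator E :: 'a \<Rightarrow> real)" using E(1) fE by simp
  have EA: "x \<in> ?A" if "x \<in> E" for x using E(3) that by auto
  show ?thesis
  proof (cases "s = 1")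
    case True
    have "(\<integral>x. indicator E x * \<bar>f x\<bar> \<partial>lebesgue) \<le> J"
      unfolding J_def
    proof (rule integral_mono'[OF Ji])
      show "indicator E x * \<bar>f x\<bar> \<le> indicator ?A x * \<bar>f x\<bar> powr s" for x
        using EA[of x] True by (cases "x \<in> E") auto
    qed simp
    also have "\<dots> \<le> 2 * J" using J0 by simp
    finally show ?thesis unfolding norm m_def[symmetric] using True J0 m by simp
  next
    case False
    then have s1: "s > 1" using s by simp
    have split: "(\<integral>x. indicator E x * \<bar>f x\<bar> \<partial>lebesgue) \<le> T powr (1 - s) * J + T * m" if T: "T > 0" for T
    proof -
      have "(\<integral>x. indicator E x * \<bar>f x\<bar> \<partial>lebesgue)
        \<le> (\<integral>x. T powr (1 - s) * (indicator ?A x * \<bar>f x\<bar> powr s) + T * indicator E x \<partial>lebesgue)"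
      proof (rule integral_mono')
        show "integrable lebesgue (\<lambda>x. T powr (1 - s) * (indicator ?A x * \<bar>f x\<bar> powr s) + T * indicator E x)"
          using Ji Ei by simp
        show "indicator E x * \<bar>f x\<bar> \<le> T powr (1 - s) * (indicator ?A x * \<bar>f x\<bar> powr s) + T * indicator E x" for x
        proof (cases "x \<in> E")
          case True
          then show ?thesis using EA le_powr_split[of "\<bar>f x\<bar>" T s] T s1 by auto
        next
          case False
          then show ?thesis by simp
        qed
        show "0 \<le> T powr (1 - s) * (indicator ?A x * \<bar>f x\<bar> powr s) + T * indicator E x" for x
          using T by (intro add_nonneg_nonneg mult_nonneg_nonneg) auto
      qed
      also have "\<dots> = T powr (1 - s) * J + T * m"
        using Ji Ei E(1) unfolding J_def m_def by (subst Bochner_Integration.integral_add) auto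
      finally show ?thesis .
    qed
    show ?thesis
    proof (cases "J = 0")
      case True
      have "(\<integral>x. indicator E x * \<bar>f x\<bar> \<partial>lebesgue) \<le> 0"
      proof (rule field_le_epsilon)
        fix e :: real assume "e > 0"
        then show "(\<integral>x. indicator E x * \<bar>f x\<bar> \<partial>lebesgue) \<le> 0 + e" using split[of "e / m"] m True by simp
      qed
      then show ?thesis unfolding norm True by simp
    next
      case False
      then have Jp: "J > 0" using J0 by simp
      define T where "T = (J / m) powr (1 / s)"
      have T: "T > 0" unfolding T_def using Jp m by simp
      have "T powr (1 - s) * J = T * m"
      proof -
        have "T powr s = J / m" unfolding T_def using s1 Jp m by (simp add: powr_powr)
        then show ?thesis using T Jp m by (simp add: powr_diff)
      qed
      then have "(\<integral>x. indicator E x * \<bar>f x\<bar> \<partial>lebesgue) \<le> 2 * (T * m)" using split[OF T] by simp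
      also have "T * m = J powr (1 / s) * m powr (1 - 1 / s)"
        unfolding T_def using Jp m by (simp add: powr_divide powr_diff)
      finally show ?thesis unfolding norm m_def by simp
    qed
  qed
qed

lemma DGsol_Lp:
  assumes Lp: "Lp_on s {x. norm x \<ge> 1} f" and s: "s \<ge> 1" and \<rho>: "\<rho> \<ge> 1"
    and S: "open S" "S \<subseteq> {x. norm x > \<rho>}"
  shows "DGsol p \<delta> L (1 - 1 / s) (2 * Lp_norm_on s {x. norm x \<ge> \<rho>} f) S u G (\<lambda>x. flux p A (G x))"
proof (rule DGsol_exterior)
  show "S \<subseteq> {x. norm x > 1}" using S \<rho> by force
  show "(\<integral>x. indicator E x * \<bar>f x\<bar> \<partial>lebesgue) \<le> 2 * Lp_norm_on s {x. norm x \<ge> \<rho>} f * measure lborel E powr (1 - 1 / s)"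
    if "open E" "bounded E" "E \<subseteq> S" for E
    using Lp_local_bound[OF Lp s \<rho> that(1,2)] that(3) S(2) by blast
qed (use S Lp_norm_on_nonneg in auto)

text \<open>For the Lebesgue exponent n/(p - \<theta>) the scaling exponent \<gamma> equals
  \<theta>, so the weighted norm condition is what makes Harnack's error term tend to 0. The numbers
  \<open>e1\<close> and \<open>e2\<close>, belonging to r and n/(p - \<theta>), lie on either side
  of 1 - p/n, as the level-set method requires.\<close>

lemma limit_or_top_Lp:
  assumes dim: "DIM('a) \<ge> 2" and pn: "p < DIM('a)"
    and r: "1 \<le> r" "r < DIM('a) / p" and fr: "Lp_on r {x. norm x \<ge> 1} f"
    and \<theta>: "0 < \<theta>" "\<theta> < 1" and f\<theta>: "Lp_on (DIM('a) / (p - \<theta>)) {x. norm x \<ge> 1} f"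
    and lim: "((\<lambda>R. R powr \<theta> * Lp_norm_on (DIM('a) / (p - \<theta>)) {x. norm x \<ge> R} f) \<longlongrightarrow> 0) at_top"
    and lower: "eventually (\<lambda>x. M \<le> u x) at_infinity"
  shows "(\<exists>l. (u \<longlongrightarrow> l) at_infinity) \<or> filterlim u at_top at_infinity"
proof -
  let ?n = "real DIM('a)"
  let ?q = "?n / (p - \<theta>)"
  define e1 where "e1 = 1 - 1 / r"
  define e2 where "e2 = 1 - 1 / ?q"
  have p\<theta>: "p - \<theta> > 0" using p \<theta> by simp
  have q1: "?q \<ge> 1" using p\<theta> pn \<theta> by simp
  have e2': "e2 = 1 - (p - \<theta>) / ?n" unfolding e2_def by simp
  have e2: "0 \<le> e2" "e2 \<le> 1" "e2 > 1 - p / ?n"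
  proof -
    show "0 \<le> e2" unfolding e2' using pn \<theta> by simp
    show "e2 \<le> 1" unfolding e2' using p\<theta> by simp
    show "e2 > 1 - p / ?n" unfolding e2' using \<theta> by (simp add: divide_strict_right_mono)
  qed
  have e1: "0 \<le> e1" "e1 < 1 - p / ?n"
  proof -
    show "0 \<le> e1" unfolding e1_def using r by simp
    have "p * r < ?n" using r(2) p by (simp add: field_simps)
    then show "e1 < 1 - p / ?n" unfolding e1_def using r(1) by (simp add: field_simps)
  qed
  define N where "N = (\<lambda>\<rho>. 2 * Lp_norm_on ?q {x. norm x \<ge> \<rho>} f)"
  have N0: "N \<rho> \<ge> 0" for \<rho> unfolding N_def using Lp_norm_on_nonneg by simp
  have Nlim: "((\<lambda>\<rho>. \<rho> powr \<theta> * N \<rho>) \<longlongrightarrow> 0) at_top"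
    using tendsto_mult[OF tendsto_const[of 2] lim] unfolding N_def by (simp add: mult_ac)
  interpret D: DG_exponents "TYPE('a)" p \<delta> L e2 ?n "ubvol TYPE('a)"
    using p \<delta> L e2 by unfold_locales auto
  have "D.\<gamma> = p - ?n + ?n * e2" by (rule D.\<gamma>_def)
  also have "\<dots> = \<theta>" unfolding e2' by (simp add: field_simps)
  finally have \<gamma>: "D.\<gamma> = \<theta>" .
  obtain C where C: "C \<ge> 1" and H: "\<And>N (u::'a \<Rightarrow> real) G F R x y.
    \<lbrakk>DGsol p \<delta> L e2 N {x. norm x > R / 3} u G F; R > 0; \<forall>x. norm x > R / 3 \<longrightarrow> u x \<ge> 0;
     norm x = R; norm y = R\<rbrakk> \<Longrightarrow> u x \<le> C * (u y + (N * R powr D.\<gamma>) powr (1 / (p - 1)))"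
    by (rule D.harnack_sphere[OF dim]) (rule that)
  define \<kappa> where "\<kappa> = (\<lambda>R. (N (R / 3) * R powr \<theta>) powr (1 / (p - 1)))"
  have harnack: "u x + c \<le> C * (u y + c + \<kappa> R)"
    if R: "R \<ge> 3" and nn: "\<forall>x. norm x > R / 3 \<longrightarrow> u x + c \<ge> 0" and xy: "norm x = R" "norm y = R" for R c x y
  proof -
    have "DGsol p \<delta> L e2 (N (R / 3)) {x. norm x > R / 3} u G (\<lambda>x. flux p A (G x))"
      unfolding e2_def N_def by (rule DGsol_Lp[OF f\<theta> q1 _ open_exterior order_refl]) (use R in simp)
    then show ?thesis using H[OF DGsol_add _ nn xy] R unfolding \<gamma> \<kappa>_def by simp
  qed
  have \<kappa>lim: "(\<kappa> \<longlongrightarrow> 0) at_top"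
  proof -
    have "filterlim (\<lambda>R::real. R / 3) at_top at_top"
      using filterlim_tendsto_pos_mult_at_top[OF tendsto_const[of "1/3"] _ filterlim_ident[of at_top]] by simp
    from filterlim_compose[OF Nlim this]
    have "((\<lambda>R. 3 powr \<theta> * ((R / 3) powr \<theta> * N (R / 3))) \<longlongrightarrow> 3 powr \<theta> * 0) at_top"
      by (intro tendsto_mult tendsto_const)
    moreover have "eventually (\<lambda>R. 3 powr \<theta> * ((R / 3) powr \<theta> * N (R / 3)) = N (R / 3) * R powr \<theta>) at_top"
      using eventually_gt_at_top[of 0] by eventually_elim (simp add: powr_divide)
    ultimately have "((\<lambda>R. N (R / 3) * R powr \<theta>) \<longlongrightarrow> 0) at_top"
      by (simp add: tendsto_cong)
    then have "(\<kappa> \<longlongrightarrow> 0 powr (1 / (p - 1))) at_top"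
      unfolding \<kappa>_def using p N0 by (intro tendsto_powr' tendsto_const) (auto intro!: always_eventually)
    then show ?thesis by simp
  qed
  obtain c a b where cab: "c > 0" "a > 0" "b > 0" and ST:
    "\<And>N1 N2 S C (u::'a \<Rightarrow> real) G F k0 s. \<lbrakk>DGsol p \<delta> L e1 N1 S u G F; DGsol p \<delta> L e2 N2 S u G F;
      N1 > 0; N2 > 0; compact C; S \<subseteq> C; continuous_on C u; \<forall>x\<in>C - S. u x \<le> k0; s > 0;
      \<forall>x\<in>S. u x \<le> k0 + s; \<exists>x\<in>S. u x = k0 + s\<rbrakk> \<Longrightarrow>
      c \<le> (N1 * s powr (1 - p)) powr a * (N2 * s powr (1 - p)) powr b"
    by (rule stampacchia[OF p \<delta> L e1 e2(3)]) (rule that)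
  \<comment> \<open>The level-set estimate asks for positive bounds; adding 1 here and 1/\<rho>
    below ensures this, while \<open>N2\<close> still tends to 0.\<close>
  define N1 where "N1 = 2 * Lp_norm_on r {x. norm x \<ge> 1} f + 1"
  have N1: "N1 > 0" unfolding N1_def using Lp_norm_on_nonneg[of r "{x. norm x \<ge> 1}" f] by simp
  define N2 where "N2 = (\<lambda>\<rho>. N \<rho> + inverse \<rho>)"
  have N2lim: "(N2 \<longlongrightarrow> 0) at_top"
  proof -
    have "(N \<longlongrightarrow> 0) at_top"
    proof (rule Lim_null_comparison[OF _ Nlim])
      show "\<forall>\<^sub>F \<rho> in at_top. norm (N \<rho>) \<le> \<rho> powr \<theta> * N \<rho>"
        using eventually_ge_at_top[of 1]
      proof eventually_elim
        case (elim \<rho>)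
        then have "1 \<le> \<rho> powr \<theta>" using \<theta> by (intro ge_one_powr_ge_zero) auto
        then show ?case using N0[of \<rho>] mult_right_mono[of 1 "\<rho> powr \<theta>" "N \<rho>"] by simp
      qed
    qed
    moreover have "(inverse \<longlongrightarrow> (0::real)) at_top" by (rule tendsto_inverse_0_at_top[OF filterlim_ident])
    ultimately show ?thesis unfolding N2_def using tendsto_add[of N 0 at_top inverse 0] by simp
  qed
  have mp: "\<exists>R0. \<forall>R1 R2 k x. R0 \<le> R1 \<longrightarrow> R1 < R2 \<longrightarrow>
       (\<forall>y. norm y = R1 \<or> norm y = R2 \<longrightarrow> u y \<le> k) \<longrightarrow> R1 \<le> norm x \<longrightarrow> norm x \<le> R2 \<longrightarrow> u x \<le> k + \<epsilon>"
    if \<epsilon>: "\<epsilon> > 0" for \<epsilon>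
  proof -
    \<comment> \<open>\<open>N1\<close> stays fixed; since \<open>N2\<close> tends to 0, the product
      falls below the lower bound \<open>c\<close> for all annuli far out, whatever their
      width.\<close>
    have "((\<lambda>\<rho>. (N1 * \<epsilon> powr (1 - p)) powr a * (N2 \<rho> * \<epsilon> powr (1 - p)) powr b) \<longlongrightarrow>
        (N1 * \<epsilon> powr (1 - p)) powr a * (0 * \<epsilon> powr (1 - p)) powr b) at_top"
    proof (intro tendsto_mult tendsto_const tendsto_powr' N2lim)
      have "\<forall>\<^sub>F \<rho> in at_top. 0 \<le> N2 \<rho> * \<epsilon> powr (1 - p)"
        using eventually_ge_at_top[of 1]
      proof eventually_elim
        case (elim \<rho>)
        then show ?case unfolding N2_def using N0[of \<rho>] by simp
      qed
      then show "0 * \<epsilon> powr (1 - p) \<noteq> 0 \<or> 0 < b \<and> (\<forall>\<^sub>F \<rho> in at_top. 0 \<le> N2 \<rho> * \<epsilon> powr (1 - p))"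
        using cab by simp
    qed
    then have "eventually (\<lambda>\<rho>. (N1 * \<epsilon> powr (1 - p)) powr a * (N2 \<rho> * \<epsilon> powr (1 - p)) powr b < c) at_top"
      using cab by (intro order_tendstoD(2)) auto
    then obtain R' where R': "\<And>\<rho>. \<rho> \<ge> R' \<Longrightarrow> (N1 * \<epsilon> powr (1 - p)) powr a * (N2 \<rho> * \<epsilon> powr (1 - p)) powr b < c"
      unfolding eventually_at_top_linorder by blast
    show ?thesis
    proof (intro exI[of _ "max R' 1"] allI impI)
      fix R1 R2 k and x :: 'a
      assume R: "max R' 1 \<le> R1" "R1 < R2" and bd: "\<forall>y. norm y = R1 \<or> norm y = R2 \<longrightarrow> u y \<le> k"
        and x: "R1 \<le> norm x" "norm x \<le> R2"
      have R1: "R1 \<ge> 1" using R by simp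
      let ?S = "{x::'a. R1 < norm x \<and> norm x < R2}"
      let ?C = "{x::'a. R1 \<le> norm x \<and> norm x \<le> R2}"
      have cC: "compact ?C"
      proof -
        have "closed ?C" by (intro closed_Collect_conj closed_Collect_le continuous_intros)
        moreover have "bounded ?C" unfolding bounded_iff by auto
        ultimately show ?thesis by (simp add: compact_eq_bounded_closed)
      qed
      have S: "open ?S" by (intro open_Collect_conj open_Collect_less continuous_intros)
      have uc: "continuous_on ?C u" using u_cont by (rule continuous_on_subset) (use R1 in auto)
      obtain y where y: "y \<in> ?C" and ymax: "\<And>z. z \<in> ?C \<Longrightarrow> u z \<le> u y"
        using continuous_attains_sup[OF cC _ uc] x by blast
      show "u x \<le> k + \<epsilon>"
      proof (rule ccontr)
        assume "\<not> u x \<le> k + \<epsilon>"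
        then have uy: "u y > k + \<epsilon>" using ymax[of x] x by simp
        define s where "s = u y - k"
        have s: "s > \<epsilon>" unfolding s_def using uy by simp
        have yS: "y \<in> ?S"
        proof (rule ccontr)
          assume "y \<notin> ?S"
          then have "norm y = R1 \<or> norm y = R2" using y by auto
          then show False using bd uy \<epsilon> by force
        qed
        have N2p: "N2 R1 > 0" unfolding N2_def using N0[of R1] R1 by (simp add: add_nonneg_pos)
        have "c \<le> (N1 * s powr (1 - p)) powr a * (N2 R1 * s powr (1 - p)) powr b"
        proof (rule ST[OF _ _ N1 N2p cC _ uc])
          have "DGsol p \<delta> L e1 (2 * Lp_norm_on r {x. norm x \<ge> 1} f) ?S u G (\<lambda>x. flux p A (G x))"
            unfolding e1_def using R1 by (intro DGsol_Lp[OF fr r(1)] S) auto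
          then show "DGsol p \<delta> L e1 N1 ?S u G (\<lambda>x. flux p A (G x))"
            by (rule DGsol_mono_N) (simp add: N1_def)
          have "DGsol p \<delta> L e2 (N R1) ?S u G (\<lambda>x. flux p A (G x))"
            unfolding e2_def N_def using R1 by (intro DGsol_Lp[OF f\<theta> q1] S) auto
          then show "DGsol p \<delta> L e2 (N2 R1) ?S u G (\<lambda>x. flux p A (G x))"
            by (rule DGsol_mono_N) (use R1 in \<open>simp add: N2_def\<close>)
          show "?S \<subseteq> ?C" by auto
          show "\<forall>x\<in>?C - ?S. u x \<le> k"
          proof
            fix z assume "z \<in> ?C - ?S"
            then have "norm z = R1 \<or> norm z = R2" by auto
            then show "u z \<le> k" using bd by blast
          qed
          show "s > 0" using s \<epsilon> by simp
          show "\<forall>x\<in>?S. u x \<le> k + s" unfolding s_def using ymax by auto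
          show "\<exists>x\<in>?S. u x = k + s" unfolding s_def using yS by (intro bexI[of _ y]) auto
        qed
        \<comment> \<open>The excess s over the boundary values is larger than \<epsilon>, and the
          exponent 1 - p is negative.\<close>
        also have "\<dots> \<le> (N1 * \<epsilon> powr (1 - p)) powr a * (N2 R1 * \<epsilon> powr (1 - p)) powr b"
        proof -
          have "s powr (1 - p) \<le> \<epsilon> powr (1 - p)" using s \<epsilon> p by (intro powr_mono2') auto
          then have "N1 * s powr (1 - p) \<le> N1 * \<epsilon> powr (1 - p)" "N2 R1 * s powr (1 - p) \<le> N2 R1 * \<epsilon> powr (1 - p)"
            using N1 N2p by (auto intro: mult_left_mono)
          then have "(N1 * s powr (1 - p)) powr a \<le> (N1 * \<epsilon> powr (1 - p)) powr a"
            "(N2 R1 * s powr (1 - p)) powr b \<le> (N2 R1 * \<epsilon> powr (1 - p)) powr b"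
            using N1 N2p cab by (auto intro!: powr_mono2)
          then show ?thesis by (intro mult_mono) auto
        qed
        also have "\<dots> < c" using R' R by simp
        finally show False by simp
      qed
    qed
  qed
  show ?thesis by (rule limit_or_top[OF C harnack \<kappa>lim mp lower])
qed

end

section \<open>Combination of the bounded, one-sidedly bounded and slowly growing cases\<close>

lemma not_filterlim_at_top_bounded:
  fixes u :: "'a::euclidean_space \<Rightarrow> real"
  assumes "\<forall>x. norm x \<ge> 1 \<longrightarrow> \<bar>u x\<bar> \<le> M"
  shows "\<not> filterlim u at_top at_infinity"
proof
  assume "filterlim u at_top at_infinity"
  then have "eventually (\<lambda>x. M + 1 \<le> u x) at_infinity" unfolding filterlim_at_top by blast
  moreover have "eventually (\<lambda>x::'a. norm x \<ge> 1) at_infinity" unfolding eventually_at_infinity by blast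
  ultimately have "eventually (\<lambda>x::'a. False) at_infinity"
    by eventually_elim (use assms in force)
  then show False by (simp add: eventually_False trivial_limit_at_infinity)
qed

lemma eventually_norm_ge_1:
  assumes "\<forall>x. norm x \<ge> 1 \<longrightarrow> P x" shows "eventually P at_infinity"
  unfolding eventually_at_infinity using assms by blast

lemma powr_at_top:
  fixes a :: real
  assumes "a > 0" shows "filterlim (\<lambda>r::real. r powr a) at_top at_top"
  unfolding filterlim_at_top
proof
  fix Z :: real
  show "eventually (\<lambda>r. Z \<le> r powr a) at_top"
    using eventually_ge_at_top[of "(\<bar>Z\<bar> + 1) powr (1 / a)"]
  proof eventually_elim
    case (elim r)
    then have "((\<bar>Z\<bar> + 1) powr (1 / a)) powr a \<le> r powr a" using assms by (intro powr_mono2) auto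
    moreover have "((\<bar>Z\<bar> + 1) powr (1 / a)) powr a = \<bar>Z\<bar> + 1" using assms by (simp add: powr_powr)
    ultimately show ?case by linarith
  qed
qed

theorem theorem2:
  fixes p \<delta> L :: real and A :: "real \<Rightarrow> real"
    and f u :: "'a::euclidean_space \<Rightarrow> real" and G :: "'a \<Rightarrow> 'a"
  assumes dim: "DIM('a) \<ge> 2"
    and p: "p > 1"
    and A_cont: "continuous_on {0..} A"
    and \<delta>L: "\<delta> > 0" "L > 0" "\<And>t. t \<ge> 0 \<Longrightarrow> \<delta> \<le> A t \<and> A t \<le> L"
    and A_mono: "strict_mono_on {0<..} (\<lambda>t. t powr (p - 1) * A t)"
    and f_loc: "loc_integrable_on {x. norm x \<ge> 1} f"
    and u_C1: "C1_grad_on {x. norm x \<ge> 1} u G"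
    and weak: "weak_solution p A G f {x. norm x > 1}"
  shows
   \<comment> \<open>(a)\<close>
   "(decay_D p f \<and> (\<exists>M. \<forall>x. norm x \<ge> 1 \<longrightarrow> \<bar>u x\<bar> \<le> M)
       \<longrightarrow> (\<exists>l. (u \<longlongrightarrow> l) at_infinity))
  \<and> (decay_D p f \<and> (\<exists>M. \<forall>x. norm x \<ge> 1 \<longrightarrow> u x \<le> M)
       \<longrightarrow> (\<exists>l. (u \<longlongrightarrow> l) at_infinity) \<or> filterlim u at_bot at_infinity)
  \<and> (decay_D p f \<and> (\<exists>M. \<forall>x. norm x \<ge> 1 \<longrightarrow> M \<le> u x)
       \<longrightarrow> (\<exists>l. (u \<longlongrightarrow> l) at_infinity) \<or> filterlim u at_top at_infinity)
   \<comment> \<open>(b)\<close>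
  \<and> (p < real DIM('a) \<and> (\<exists>M. \<forall>x. norm x \<ge> 1 \<longrightarrow> \<bar>u x\<bar> \<le> M)
       \<and> (\<exists>r. 1 \<le> r \<and> r < real DIM('a) / p \<and> Lp_on r {x. norm x \<ge> 1} f)
       \<and> (\<exists>\<theta>. 0 < \<theta> \<and> \<theta> < 1 \<and> Lp_on (real DIM('a) / (p - \<theta>)) {x. norm x \<ge> 1} f
             \<and> ((\<lambda>R. R powr \<theta> * Lp_norm_on (real DIM('a) / (p - \<theta>)) {x. norm x \<ge> R} f)
                   \<longlongrightarrow> 0) at_top)
       \<longrightarrow> (\<exists>l. (u \<longlongrightarrow> l) at_infinity))
   \<comment> \<open>(c)\<close>
  \<and> (p > real DIM('a) \<and> decay_D p f \<and> (\<exists>M. \<forall>x. norm x \<ge> 1 \<longrightarrow> \<bar>u x\<bar> \<le> M)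
       \<longrightarrow> (\<exists>l. (u \<longlongrightarrow> l) at_infinity \<and>
              (\<exists>C \<beta>. C > 0 \<and> \<beta> > 0 \<and>
                 (\<forall>\<^sub>F x in at_infinity. \<bar>l - u x\<bar> < C * norm x powr (-\<beta>)))))
   \<comment> \<open>unbounded solutions, p > n\<close>
  \<and> (p > real DIM('a) \<and> decay_D p f
       \<and> ((\<lambda>x. \<bar>u x\<bar> / norm x powr ((p - real DIM('a)) / (p - 1))) \<longlongrightarrow> 0) at_infinity
       \<longrightarrow> (\<exists>l. (u \<longlongrightarrow> l) at_infinity \<and>
              (\<exists>C \<beta>. C > 0 \<and> \<beta> > 0 \<and>
                 (\<forall>\<^sub>F x in at_infinity. \<bar>l - u x\<bar> < C * norm x powr (-\<beta>)))))
   \<comment> \<open>unbounded solutions, p = n\<close>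
  \<and> (p = real DIM('a) \<and> decay_D p f
       \<and> ((\<lambda>x. \<bar>u x\<bar> / ln (norm x)) \<longlongrightarrow> 0) at_infinity
       \<longrightarrow> (\<exists>l. (u \<longlongrightarrow> l) at_infinity))"
proof -
  interpret X: exterior_solution p \<delta> L A f u G
    by unfold_locales (use assms in auto)
  interpret Y: exterior_solution p \<delta> L A "\<lambda>x. - f x" "\<lambda>x. - u x" "\<lambda>x. - G x"
    by (rule X.exterior_uminus)
  let ?n = "real DIM('a)"
  have below: "(\<exists>l. (u \<longlongrightarrow> l) at_infinity) \<or> filterlim u at_top at_infinity"
    if "decay_D p f" "\<forall>x. norm x \<ge> 1 \<longrightarrow> M \<le> u x" for M
    using X.limit_or_top_decay[OF dim that(1) eventually_norm_ge_1[OF that(2)]] .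
  have above: "(\<exists>l. (u \<longlongrightarrow> l) at_infinity) \<or> filterlim u at_bot at_infinity"
    if D: "decay_D p f" and M: "\<forall>x. norm x \<ge> 1 \<longrightarrow> u x \<le> M" for M
  proof -
    have D': "decay_D p (\<lambda>x. - f x)" using D unfolding decay_D_uminus .
    have M': "\<forall>x. norm x \<ge> 1 \<longrightarrow> - M \<le> - u x" using M by simp
    from Y.limit_or_top_decay[OF dim D' eventually_norm_ge_1[OF M']] show ?thesis
    proof
      assume "\<exists>l. ((\<lambda>x. - u x) \<longlongrightarrow> l) at_infinity"
      then obtain l where "((\<lambda>x. - u x) \<longlongrightarrow> l) at_infinity" by blast
      then have "(u \<longlongrightarrow> - l) at_infinity" using tendsto_minus by fastforce
      then show ?thesis by blast
    next
      assume "filterlim (\<lambda>x. - u x) at_top at_infinity"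
      then show ?thesis by (simp add: filterlim_uminus_at_bot)
    qed
  qed
  have bounded: "\<exists>l. (u \<longlongrightarrow> l) at_infinity"
    if "decay_D p f" and M: "\<forall>x. norm x \<ge> 1 \<longrightarrow> \<bar>u x\<bar> \<le> M" for M
  proof -
    have "\<forall>x. norm x \<ge> 1 \<longrightarrow> - M \<le> u x" using M by (force simp: abs_le_iff)
    from below[OF that(1) this] not_filterlim_at_top_bounded[OF M] show ?thesis by blast
  qed
  have b: "\<exists>l. (u \<longlongrightarrow> l) at_infinity"
    if pn: "p < ?n" and M: "\<forall>x. norm x \<ge> 1 \<longrightarrow> \<bar>u x\<bar> \<le> M"
      and r: "1 \<le> r" "r < ?n / p" "Lp_on r {x. norm x \<ge> 1} f"
      and \<theta>: "0 < \<theta>" "\<theta> < 1" "Lp_on (?n / (p - \<theta>)) {x. norm x \<ge> 1} f"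
        "((\<lambda>R. R powr \<theta> * Lp_norm_on (?n / (p - \<theta>)) {x. norm x \<ge> R} f) \<longlongrightarrow> 0) at_top" for M r \<theta>
  proof -
    have "\<forall>x. norm x \<ge> 1 \<longrightarrow> - M \<le> u x" using M by (force simp: abs_le_iff)
    from X.limit_or_top_Lp[OF dim pn r \<theta> eventually_norm_ge_1[OF this]] not_filterlim_at_top_bounded[OF M]
    show ?thesis by blast
  qed
  let ?\<alpha> = "(p - ?n) / (p - 1)"
  \<comment> \<open>A radial solution of the homogeneous p-Laplace equation, normalized to have
    derivative r^(-(n-1)/(p-1)); it is a multiple of the critical growth r^\<alpha>.\<close>
  let ?P = "\<lambda>r. r powr ?\<alpha> / ?\<alpha>"
  have P_deriv: "(?P has_real_derivative r powr (- (?n - 1) / (p - 1))) (at r)" if "p > ?n" "r > 0" for r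
  proof -
    have a: "?\<alpha> \<noteq> 0" "?\<alpha> - 1 = - (?n - 1) / (p - 1)" using that p by (auto simp: field_simps)
    have "(?P has_real_derivative (?\<alpha> * r powr (?\<alpha> - 1)) / ?\<alpha>) (at r)"
      by (intro DERIV_cdivide has_real_derivative_powr that)
    then show ?thesis using a by simp
  qed
  have P_top: "filterlim ?P at_top at_top" if "p > ?n"
  proof -
    have a: "?\<alpha> > 0" using that p by simp
    have "filterlim (\<lambda>r::real. (1 / a) * r powr a) at_top at_top" if "a > 0" for a
      by (rule filterlim_tendsto_pos_mult_at_top[OF tendsto_const _ powr_at_top[OF that]]) (use that in simp)
    from this[OF a] show ?thesis by (simp only: mult_1 times_divide_eq_left)
  qed
  have growth: "\<exists>l. (u \<longlongrightarrow> l) at_infinity \<and>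
      (\<exists>C \<beta>. C > 0 \<and> \<beta> > 0 \<and> (\<forall>\<^sub>F x in at_infinity. \<bar>l - u x\<bar> < C * norm x powr (- \<beta>)))"
    if pn: "p > ?n" and D: "decay_D p f"
      and g: "\<And>\<epsilon>. \<epsilon> > 0 \<Longrightarrow> eventually (\<lambda>x. \<bar>u x\<bar> \<le> \<epsilon> * ?P (norm x)) at_infinity"
    by (rule X.rate_from_growth[OF dim D less_imp_le[OF pn] P_deriv[OF pn] P_top[OF pn] g])
  \<comment> \<open>For p > n the function \<open>?P\<close> tends to infinity, so bounded solutions
    satisfy the growth condition.\<close>
  have c: "\<exists>l. (u \<longlongrightarrow> l) at_infinity \<and>
      (\<exists>C \<beta>. C > 0 \<and> \<beta> > 0 \<and> (\<forall>\<^sub>F x in at_infinity. \<bar>l - u x\<bar> < C * norm x powr (- \<beta>)))"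
    if pn: "p > ?n" and D: "decay_D p f" and M: "\<forall>x. norm x \<ge> 1 \<longrightarrow> \<bar>u x\<bar> \<le> M" for M
  proof (rule growth[OF pn D])
    fix \<epsilon> :: real assume \<epsilon>: "\<epsilon> > 0"
    have "filterlim (\<lambda>x::'a. ?P (norm x)) at_top at_infinity"
      by (rule filterlim_compose[OF P_top[OF pn] filterlim_norm_at_top])
    then have "eventually (\<lambda>x::'a. M / \<epsilon> \<le> ?P (norm x)) at_infinity" unfolding filterlim_at_top by blast
    moreover have "eventually (\<lambda>x. \<bar>u x\<bar> \<le> M) at_infinity" by (rule eventually_norm_ge_1[OF M])
    ultimately show "eventually (\<lambda>x. \<bar>u x\<bar> \<le> \<epsilon> * ?P (norm x)) at_infinity"
    proof eventually_elim
      case (elim x)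
      have "M = \<epsilon> * (M / \<epsilon>)" using \<epsilon> by simp
      also have "\<dots> \<le> \<epsilon> * ?P (norm x)" using elim(1) \<epsilon> by (intro mult_left_mono) auto
      finally show ?case using elim(2) by linarith
    qed
  qed
  have unbounded: "\<exists>l. (u \<longlongrightarrow> l) at_infinity \<and>
      (\<exists>C \<beta>. C > 0 \<and> \<beta> > 0 \<and> (\<forall>\<^sub>F x in at_infinity. \<bar>l - u x\<bar> < C * norm x powr (- \<beta>)))"
    if pn: "p > ?n" and D: "decay_D p f"
      and lim: "((\<lambda>x. \<bar>u x\<bar> / norm x powr ?\<alpha>) \<longlongrightarrow> 0) at_infinity"
  proof (rule growth[OF pn D])
    fix \<epsilon> :: real assume \<epsilon>: "\<epsilon> > 0"
    have "\<epsilon> / ?\<alpha> > 0" using \<epsilon> pn p by simp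
    then have "eventually (\<lambda>x. \<bar>u x\<bar> / norm x powr ?\<alpha> < \<epsilon> / ?\<alpha>) at_infinity" using lim by (intro order_tendstoD(2)) auto
    moreover have "eventually (\<lambda>x::'a. norm x \<ge> 1) at_infinity" unfolding eventually_at_infinity by blast
    ultimately show "eventually (\<lambda>x. \<bar>u x\<bar> \<le> \<epsilon> * ?P (norm x)) at_infinity"
    proof eventually_elim
      case (elim x)
      have "norm x > 0" using elim(2) by linarith
      then have "norm x powr ?\<alpha> > 0" by simp
      then have "\<bar>u x\<bar> \<le> \<epsilon> / ?\<alpha> * norm x powr ?\<alpha>"
        using elim(1) by (subst (asm) pos_divide_less_eq) auto
      then show ?case by (simp only: times_divide_eq_left times_divide_eq_right)
    qed
  qed
  have critical: "\<exists>l. (u \<longlongrightarrow> l) at_infinity"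
    if pn: "p = ?n" and D: "decay_D p f" and lim: "((\<lambda>x. \<bar>u x\<bar> / ln (norm x)) \<longlongrightarrow> 0) at_infinity"
  proof -
    have "\<exists>l. (u \<longlongrightarrow> l) at_infinity \<and>
      (\<exists>C \<beta>. C > 0 \<and> \<beta> > 0 \<and> (\<forall>\<^sub>F x in at_infinity. \<bar>l - u x\<bar> < C * norm x powr (- \<beta>)))"
    \<comment> \<open>For p = n the derivative r^(-(n-1)/(p-1)) is 1/r, and the logarithm takes the
      place of \<open>?P\<close>.\<close>
    proof (rule X.rate_from_growth[OF dim D _ _ ln_at_top])
      show "p \<ge> ?n" using pn by simp
      show "(ln has_real_derivative r powr (- (?n - 1) / (p - 1))) (at r)" if "r > 0" for r
      proof -
        have "- (?n - 1) / (p - 1) = - 1" unfolding pn[symmetric] using p by (simp add: field_simps)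
        then have "r powr (- (?n - 1) / (p - 1)) = 1 / r" using that by (simp add: powr_minus_divide)
        then show ?thesis using DERIV_ln_divide[OF that] by simp
      qed
      fix \<epsilon> :: real assume "\<epsilon> > 0"
      then have "eventually (\<lambda>x. \<bar>u x\<bar> / ln (norm x) < \<epsilon>) at_infinity" using lim by (intro order_tendstoD(2)) auto
      moreover have "eventually (\<lambda>x::'a. norm x \<ge> 2) at_infinity" unfolding eventually_at_infinity by blast
      ultimately show "eventually (\<lambda>x. \<bar>u x\<bar> \<le> \<epsilon> * ln (norm x)) at_infinity"
      proof eventually_elim
        case (elim x)
        then have "ln (norm x) > 0" by (intro ln_gt_zero) linarith
        then show ?case using elim(1) by (subst (asm) pos_divide_less_eq) auto
      qed
    qed
    then show ?thesis by blast
  qed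
  show ?thesis
    using below above bounded b c unbounded critical by (intro conjI impI) (elim conjE exE; blast)+
qed

end
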